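(* Let $\varepsilon>0$ be fixed. For $x$ large, let $a_1<a_2<\cdots$ be the $x^{\varepsilon}$-smooth numbers in increasing order. Then $$\sum_{a_n\le x}(a_{n+1}-a_n)^{2}\ll_{\varepsilon} x^{7/6+\varepsilon}.$$
   Context: For a positive real number $y$, a positive integer $n$ is called $y$-smooth if all prime factors $p\mid n$ satisfy $p\le y$ (so $1$ is $y$-smooth). The sequence $(a_n)$ is the infinite sequence of all $x^{\varepsilon}$-smooth positive integers, and depends on $x$ and $\varepsilon$. The notation $A\ll_{\varepsilon}B$ means that there are constants $C(\varepsilon)>0$ and $x_0(\varepsilon)$, depending only on $\varepsilon$, such that $|A|\le C(\varepsilon)B$ for all real $x\ge x_0(\varepsilon)$. *)

theory Defs
  imports Complex_Main "HOL-Library.Infinite_Set" "HOL-Computational_Algebra.Primes"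
begin

definition smooth :: "real \<Rightarrow> nat \<Rightarrow> bool" where
  "smooth y n \<longleftrightarrow> n > 0 \<and> (\<forall>p. prime p \<and> p dvd n \<longrightarrow> real p \<le> y)"

text \<open>The numbering is zero-based: \<open>smooth_seq y n\<close> is the term usually written with index
  \<open>n + 1\<close>, so \<open>smooth_seq y 0 = 1\<close>. For \<open>y < 2\<close> the only \<open>y\<close>-smooth number is \<open>1\<close> and the later
  values of the sequence carry no meaning; for \<open>y \<ge> 2\<close> there are infinitely many.\<close>

definition smooth_seq :: "real \<Rightarrow> nat \<Rightarrow> nat" where
  "smooth_seq y = enumerate {n. smooth y n}"

end

theory Submission
  imports Defs "HOL-Analysis.Analysis" "HOL-Real_Asymp.Real_Asymp"
begin

text \<open>
  Fix a large integer \<open>k\<close> in terms of \<open>\<epsilon>\<close>, and let \<open>Y\<close> be about \<open>P ^ (k + 1)\<close>, so that \<open>9 * P\<close> is far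
  below \<open>Y powr \<epsilon>\<close>. After a dyadic decomposition it is enough to bound the number \<open>R\<close> of
  \<open>H\<close>-separated points \<open>y\<close> in \<open>[Y, 2 * Y]\<close> without a smooth number within \<open>H\<close>, by
  \<open>R * H\<^sup>2 \<le> Y powr (7/6 + \<epsilon>)\<close>; only \<open>H \<ge> Y powr (1/6)\<close> needs work, since \<open>R * H\<close> is trivially
  of order at most \<open>Y\<close>.

  All products \<open>a1 * \<dots> * ak * p\<close>, with \<open>ai\<close> slightly above \<open>P\<close> and \<open>P < p \<le> 9 * P\<close>, are smooth, so
  none of them is near an exceptional \<open>y\<close>. On the logarithmic scale \<open>y\<close> excludes an interval of length
  about \<open>1 / T\<close> with \<open>T = 3 * Y / H\<close>. A high power of the Fejer kernel, which involves integer frequencies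
  \<open>t\<close> only, detects the missing products (\<open>detection\<close>): if \<open>p\<close> is replaced by an average over a
  much finer grid, the expected number of products does appear, and the difference between the
  two counts is large. Its Fourier expansion is a sum over \<open>\<bar>t\<bar>\<close> at most about \<open>T\<close> of the product of \<open>\<bar>A(t)\<bar> ^ k\<close>,
  of \<open>\<bar>B(t)\<bar>\<close> and of \<open>\<bar>Z(t)\<bar>\<close>, where \<open>A\<close> is the Dirichlet polynomial over the factors \<open>ai\<close>, \<open>B\<close> is the one over \<open>p\<close>
  minus its grid average, and \<open>Z(t)\<close> is the sum of \<open>y\<close> to the power \<open>\<i> * t\<close> over the exceptional points. The
  factor \<open>B\<close> saves a fixed power \<open>P powr c\<close> for every \<open>t\<close> (\<open>balanced_bound\<close>, by van der Corput's
  method). This small saving pays for all divisor functions, logarithms and constants, so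
  that the rest of the argument is about exponents only.

  Cut the frequencies into level sets \<open>S\<close> on which \<open>\<bar>A(t)\<bar>\<close> is about \<open>card A * P powr (- u)\<close>. On one of them
  the sum of \<open>\<bar>Z(t)\<bar>\<close> must be at least about \<open>R * P powr (k * u)\<close>. This sum is bounded
  above in three ways: trivially by \<open>R * card S\<close>, by the large sieve over the \<open>1 / T\<close>-separated points \<open>ln y\<close>, and by
  the fourth power version of the large sieve, which involves the additive energy of
  \<open>S\<close>. In turn \<open>card S\<close> and the energy of \<open>S\<close> are bounded because powers \<open>A(t) ^ i\<close> are large on \<open>S\<close>:
  by the mean value theorem for Dirichlet polynomials, by the method of Halasz, and by a bound for
  the energy in terms of sums over ratios of integers (\<open>energy_large_values\<close>). As
  \<open>k\<close> is large, \<open>i\<close> may be treated as a continuous parameter and optimised.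

  Suppose that \<open>R * H\<^sup>2\<close> exceeds \<open>Y powr (7/6 + \<epsilon>)\<close>, write \<open>v = 2 * u\<close> and compare exponents. After
  elimination of the exponents of \<open>T\<close>, of \<open>R\<close> and of \<open>card S\<close> there remain, up to terms that favour the
  contradiction, the inequalities \<open>v * (v - 1/2) * (v - 1/3) < 0\<close> for \<open>v \<ge> 1/2\<close> and
  \<open>v * (v - 1/2) * (v + 2/3) > 0\<close> for \<open>v \<le> 1/2\<close> (\<open>exponent_contradiction_large\<close>,
  \<open>exponent_contradiction_small\<close>). Both are impossible. Both expressions vanish at \<open>v = 1/2\<close>, where \<open>T\<close> is
  about \<open>Y powr (2/3)\<close>: gaps of length about \<open>Y powr (1/3)\<close> are the critical case and determine \<open>7/6\<close>.
\<close>

section \<open>The Kusmin--Landau inequality and the second difference test\<close>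

lemma sin_ge_half:
  fixes x :: real
  assumes "0 \<le> x" "x \<le> 8/5"
  shows "sin x \<ge> x / 2"
proof -
  have "\<bar>sin x - (\<Sum>m<3. sin_coeff m * x ^ m)\<bar> \<le> inverse (fact 3) * \<bar>x\<bar> ^ 3"
    by (rule Maclaurin_sin_bound)
  hence "\<bar>sin x - x\<bar> \<le> x ^ 3 / 6"
    using assms by (simp add: sin_coeff_def lessThan_nat_numeral eval_nat_numeral fact_numeral field_simps)
  hence "sin x \<ge> x - x ^ 3 / 6"
    by linarith
  moreover have "x\<^sup>2 \<le> (8/5)\<^sup>2" using assms by (intro power_mono) auto
  hence "x * x\<^sup>2 \<le> x * 3" using assms by (intro mult_left_mono) (auto simp: power2_eq_square)
  hence "x ^ 3 \<le> 3 * x" by (simp add: power3_eq_cube power2_eq_square)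
  ultimately show ?thesis by simp
qed

lemma pi_half_le: "pi / 2 \<le> 8 / 5"
  using pi_approx by simp

lemma sin_ge_of_bounds:
  fixes x \<theta> :: real
  assumes "0 < \<theta>" "\<theta> / 2 \<le> x" "x \<le> pi - \<theta> / 2"
  shows "sin x \<ge> \<theta> / 4"
proof (cases "x \<le> pi / 2")
  case True
  then show ?thesis using sin_ge_half[of x] assms pi_half_le by simp
next
  case False
  then have "sin (pi - x) \<ge> (pi - x) / 2"
    using assms pi_half_le by (intro sin_ge_half) auto
  then show ?thesis using assms by simp
qed

lemma cis_minus_one: "cis d - 1 = 2 * \<i> * sin (d/2) * cis (d/2)"
proof -
  have "cos d = 1 - 2 * (sin (d/2))\<^sup>2" using cos_double_sin[of "d/2"] by simp
  moreover have "sin d = 2 * sin (d/2) * cos (d/2)" using sin_double[of "d/2"] by simp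
  ultimately show ?thesis
    by (simp add: complex_eq_iff power2_eq_square)
qed

lemma norm_cis_minus_one: "norm (cis d - 1) = 2 * \<bar>sin (d/2)\<bar>"
  by (simp add: cis_minus_one norm_mult)

lemma inverse_cis_minus_one:
  assumes "sin (d/2) \<noteq> 0"
  shows "inverse (cis d - 1) = Complex (-1/2) (- cot (d/2) / 2)"
proof -
  have "(cis d - 1) * Complex (-1/2) (- cot (d/2) / 2) = 1"
  proof -
    have c: "cos d = 1 - 2 * (sin (d/2))\<^sup>2" using cos_double_sin[of "d/2"] by simp
    have s: "sin d = 2 * sin (d/2) * cos (d/2)" using sin_double[of "d/2"] by simp
    have p: "(sin (d/2))\<^sup>2 + (cos (d/2))\<^sup>2 = 1" by simp
    have "(cis d - 1) * Complex (-1/2) (- cot (d/2) / 2)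
       = Complex (((cos d - 1) * (-1/2)) + sin d * cot (d/2) / 2) (- (cos d - 1) * cot (d/2) / 2 - sin d / 2)"
      by (simp add: complex_eq_iff field_simps)
    also have "\<dots> = Complex ((sin (d/2))\<^sup>2 + (cos (d/2))\<^sup>2) 0"
      using assms by (simp add: c s cot_def field_simps power2_eq_square)
    also have "\<dots> = 1" by (simp add: p complex_eq_iff)
    finally show ?thesis .
  qed
  then show ?thesis by (metis inverse_unique)
qed

lemma cot_diff:
  assumes "sin a \<noteq> 0" "sin (b::real) \<noteq> 0"
  shows "cot a - cot b = sin (b - a) / (sin a * sin b)"
  using assms by (simp add: cot_def sin_diff field_simps)

text \<open>With \<open>g n = 1 / (cis (\<phi> (Suc n) - \<phi> n) - 1)\<close> the summand \<open>cis (\<phi> n)\<close> equals \<open>g n\<close> times the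
difference \<open>cis (\<phi> (Suc n)) - cis (\<phi> n)\<close>, which invites summation by parts. The real part of \<open>g\<close> is
constantly \<open>-1/2\<close>, and its imaginary part is minus half a cotangent, monotone in \<open>n\<close>; so the total
variation of \<open>g\<close> telescopes.\<close>

lemma Kusmin_Landau_aux:
  fixes \<phi> :: "nat \<Rightarrow> real"
  assumes "a < b" "0 < \<theta>"
    and mono: "\<And>n. a \<le> n \<Longrightarrow> Suc n < b \<Longrightarrow> \<phi> (Suc n) - \<phi> n \<le> \<phi> (Suc (Suc n)) - \<phi> (Suc n)"
    and lo: "\<And>n. a \<le> n \<Longrightarrow> n < b \<Longrightarrow> \<theta> \<le> \<phi> (Suc n) - \<phi> n"
    and hi: "\<And>n. a \<le> n \<Longrightarrow> n < b \<Longrightarrow> \<phi> (Suc n) - \<phi> n \<le> 2 * pi - \<theta>"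
  shows "norm (\<Sum>n=a..<b. cis (\<phi> n)) \<le> 8 / \<theta>"
proof -
  define \<delta> where "\<delta> n = \<phi> (Suc n) - \<phi> n" for n
  define g where "g n = inverse (cis (\<delta> n) - 1)" for n
  have s: "sin (\<delta> n / 2) \<ge> \<theta> / 4" if "a \<le> n" "n < b" for n
    using lo[OF that] hi[OF that] assms(2) by (intro sin_ge_of_bounds) (auto simp: \<delta>_def)
  have s0: "sin (\<delta> n / 2) > 0" if "a \<le> n" "n < b" for n
    using s[OF that] assms(2) by linarith
  have gn: "norm (g n) \<le> 2 / \<theta>" if "a \<le> n" "n < b" for n
  proof -
    have "norm (g n) = 1 / (2 * sin (\<delta> n / 2))"
      unfolding g_def norm_inverse norm_cis_minus_one using s0[OF that] by (simp add: inverse_eq_divide)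
    also have "\<dots> \<le> 1 / (2 * (\<theta> / 4))"
      using s[OF that] assms(2) by (intro divide_left_mono) auto
    finally show ?thesis by simp
  qed
  have cotb: "\<bar>cot (\<delta> n / 2)\<bar> \<le> 4 / \<theta>" if "a \<le> n" "n < b" for n
  proof -
    have "\<bar>cot (\<delta> n / 2)\<bar> = \<bar>cos (\<delta> n / 2)\<bar> / sin (\<delta> n / 2)"
      using s0[OF that] by (simp add: cot_def abs_divide)
    also have "\<dots> \<le> 1 / (\<theta> / 4)"
      using s[OF that] assms(2) by (intro frac_le) auto
    finally show ?thesis by simp
  qed
  have cotm: "cot (\<delta> n / 2) \<ge> cot (\<delta> (Suc n) / 2)" if "a \<le> n" "Suc n < b" for n
  proof -
    have n1: "a \<le> n" "n < b" "a \<le> Suc n" using that by auto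
    have "\<delta> n \<le> \<delta> (Suc n)" using mono[OF that] by (simp add: \<delta>_def)
    moreover have "\<delta> (Suc n) \<le> 2 * pi - \<theta>" "\<delta> n \<ge> \<theta>"
      using hi[of "Suc n"] lo[of n] n1 that by (auto simp: \<delta>_def)
    ultimately have "sin (\<delta> (Suc n) / 2 - \<delta> n / 2) \<ge> 0"
      using assms(2) by (intro sin_ge_zero) auto
    then have "cot (\<delta> n / 2) - cot (\<delta> (Suc n) / 2) \<ge> 0"
      using s0[OF n1(1,2)] s0[OF n1(3) that(2)]
      by (subst cot_diff) auto
    then show ?thesis by simp
  qed
  have key: "\<exists>W. (\<Sum>n=a..<c. cis (\<phi> n)) = g (c - 1) * cis (\<phi> c) + W \<and>
          norm W \<le> norm (g a) + (cot (\<delta> a / 2) - cot (\<delta> (c - 1) / 2)) / 2"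
    if "Suc a \<le> c" "c \<le> b" for c
    using that
  proof (induction c rule: dec_induct)
    case base
    have nz: "cis (\<delta> a) - 1 \<noteq> 0"
      using s0[of a] base norm_cis_minus_one[of "\<delta> a"] by auto
    have "cis (\<phi> (Suc a)) = cis (\<phi> a) * cis (\<delta> a)"
      by (simp add: cis_mult \<delta>_def)
    then have "cis (\<phi> (Suc a)) - cis (\<phi> a) = cis (\<phi> a) * (cis (\<delta> a) - 1)" by (simp add: algebra_simps)
    then have "cis (\<phi> a) = g a * (cis (\<phi> (Suc a)) - cis (\<phi> a))"
      using nz by (simp add: g_def field_simps)
    then have "cis (\<phi> a) = g a * cis (\<phi> (Suc a)) + (- g a * cis (\<phi> a))"
      by (simp add: algebra_simps)
    then show ?case
      by (intro exI[of _ "- g a * cis (\<phi> a)"]) (simp add: norm_mult)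
  next
    case (step c)
    then obtain W where W: "(\<Sum>n=a..<c. cis (\<phi> n)) = g (c - 1) * cis (\<phi> c) + W"
      "norm W \<le> norm (g a) + (cot (\<delta> a / 2) - cot (\<delta> (c - 1) / 2)) / 2" by auto
    have ac: "a \<le> c" "c < b" "a \<le> c - 1" "c - 1 < b" "Suc (c - 1) = c" using step by auto
    have nz: "cis (\<delta> c) - 1 \<noteq> 0"
      using s0[of c] ac norm_cis_minus_one[of "\<delta> c"] by auto
    have "cis (\<phi> (Suc c)) = cis (\<phi> c) * cis (\<delta> c)"
      by (simp add: cis_mult \<delta>_def)
    then have "cis (\<phi> (Suc c)) - cis (\<phi> c) = cis (\<phi> c) * (cis (\<delta> c) - 1)" by (simp add: algebra_simps)
    then have z: "cis (\<phi> c) = g c * (cis (\<phi> (Suc c)) - cis (\<phi> c))"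
      using nz by (simp add: g_def field_simps)
    have gd: "g (c - 1) - g c = Complex 0 (- (cot (\<delta> (c-1) / 2) - cot (\<delta> c / 2)) / 2)"
    proof -
      have "g (c - 1) = Complex (-1/2) (- cot (\<delta> (c - 1) / 2) / 2)" "g c = Complex (-1/2) (- cot (\<delta> c / 2) / 2)"
        unfolding g_def using s0[OF ac(1,2)] s0[OF ac(3,4)] by (intro inverse_cis_minus_one; simp)+
      then show ?thesis by (simp add: complex_eq_iff field_simps)
    qed
    have "norm (g (c - 1) - g c) = \<bar>cot (\<delta> (c-1) / 2) - cot (\<delta> c / 2)\<bar> / 2"
      unfolding gd by (simp add: complex_norm)
    also have "\<dots> = (cot (\<delta> (c-1) / 2) - cot (\<delta> c / 2)) / 2"
      using cotm[of "c - 1"] ac by simp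
    finally have gdn: "norm (g (c - 1) - g c) = (cot (\<delta> (c-1) / 2) - cot (\<delta> c / 2)) / 2" .
    have "(\<Sum>n=a..<Suc c. cis (\<phi> n)) = g (c - 1) * cis (\<phi> c) + W + cis (\<phi> c)"
      using ac by (simp add: W)
    also have "\<dots> = g (c - 1) * cis (\<phi> c) + W + g c * (cis (\<phi> (Suc c)) - cis (\<phi> c))"
      using z by simp
    also have "\<dots> = g c * cis (\<phi> (Suc c)) + (W + (g (c - 1) - g c) * cis (\<phi> c))"
      by (simp add: algebra_simps)
    finally have e: "(\<Sum>n=a..<Suc c. cis (\<phi> n)) = g c * cis (\<phi> (Suc c)) + (W + (g (c - 1) - g c) * cis (\<phi> c))" .
    have "norm (W + (g (c - 1) - g c) * cis (\<phi> c)) \<le> norm W + norm (g (c - 1) - g c)"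
      by (metis norm_triangle_ineq norm_mult norm_cis mult.right_neutral)
    also have "\<dots> \<le> norm (g a) + (cot (\<delta> a / 2) - cot (\<delta> c / 2)) / 2"
      using W(2) gdn by (simp add: field_simps)
    finally show ?case using e by auto
  qed
  obtain W where W: "(\<Sum>n=a..<b. cis (\<phi> n)) = g (b - 1) * cis (\<phi> b) + W"
    "norm W \<le> norm (g a) + (cot (\<delta> a / 2) - cot (\<delta> (b - 1) / 2)) / 2"
    using key[of b] assms(1) by auto
  have "norm (\<Sum>n=a..<b. cis (\<phi> n)) \<le> norm (g (b - 1)) + norm W"
    unfolding W(1) by (metis norm_triangle_ineq norm_mult norm_cis mult.right_neutral)
  also have "\<dots> \<le> 2/\<theta> + (2/\<theta> + (4/\<theta> + 4/\<theta>) / 2)"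
  proof -
    have ab: "a \<le> b - 1" "b - 1 < b" using assms(1) by auto
    show ?thesis
      using W(2) gn[OF order_refl assms(1)] gn[OF ab]
        abs_le_D1[OF cotb[OF order_refl assms(1)]] abs_le_D2[OF cotb[OF ab]]
      by (intro add_mono order_trans[OF W(2)] divide_right_mono) auto
  qed
  also have "\<dots> = 8 / \<theta>" by (simp add: field_simps)
  finally show ?thesis .
qed

text \<open>Subtracting \<open>2 * pi * \<nu> * n\<close> from the phase changes no summand, hence the increments may lie between any two
consecutive multiples of \<open>2 * pi\<close>.\<close>

lemma Kusmin_Landau:
  fixes \<phi> :: "nat \<Rightarrow> real" and \<nu> :: int
  assumes "0 < \<theta>"
    and mono: "\<And>n. a \<le> n \<Longrightarrow> Suc n < b \<Longrightarrow> \<phi> (Suc n) - \<phi> n \<le> \<phi> (Suc (Suc n)) - \<phi> (Suc n)"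
    and lo: "\<And>n. a \<le> n \<Longrightarrow> n < b \<Longrightarrow> 2 * pi * \<nu> + \<theta> \<le> \<phi> (Suc n) - \<phi> n"
    and hi: "\<And>n. a \<le> n \<Longrightarrow> n < b \<Longrightarrow> \<phi> (Suc n) - \<phi> n \<le> 2 * pi * (\<nu> + 1) - \<theta>"
  shows "norm (\<Sum>n=a..<b. cis (\<phi> n)) \<le> 8 / \<theta>"
proof (cases "a < b")
  case True
  define \<psi> where "\<psi> n = \<phi> n - 2 * pi * (\<nu> * int n)" for n
  have "cis (\<psi> n) = cis (\<phi> n)" for n
  proof -
    have "cis (2 * pi * real_of_int (\<nu> * int n)) = 1" by (rule cis_multiple_2pi) (metis Ints_of_int)
    then show ?thesis by (simp add: \<psi>_def cis_divide [symmetric])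
  qed
  moreover have "norm (\<Sum>n=a..<b. cis (\<psi> n)) \<le> 8 / \<theta>"
  proof (rule Kusmin_Landau_aux[OF True assms(1)])
    fix n assume "a \<le> n" "Suc n < b"
    then show "\<psi> (Suc n) - \<psi> n \<le> \<psi> (Suc (Suc n)) - \<psi> (Suc n)"
      using mono[of n] by (simp add: \<psi>_def algebra_simps)
  next
    fix n assume "a \<le> n" "n < b"
    then show "\<theta> \<le> \<psi> (Suc n) - \<psi> n" "\<psi> (Suc n) - \<psi> n \<le> 2 * pi - \<theta>"
      using lo[of n] hi[of n] by (simp_all add: \<psi>_def algebra_simps)
  qed
  ultimately show ?thesis by simp
next
  case False
  then show ?thesis using assms(1) by simp
qed

lemma steep_card_le:
  fixes \<delta> :: "nat \<Rightarrow> real"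
  assumes "0 < lam" and inc: "\<And>n. Suc n < N \<Longrightarrow> \<delta> n + lam \<le> \<delta> (Suc n)"
    and I: "I \<subseteq> {..<N}" "\<And>n. n \<in> I \<Longrightarrow> x \<le> \<delta> n \<and> \<delta> n \<le> x + L" and L: "0 \<le> L"
  shows "real (card I) \<le> L / lam + 1"
proof (cases "I = {}")
  case True
  then show ?thesis using assms by simp
next
  case False
  have fin: "finite I" using I(1) finite_subset by blast
  define m M where "m = Min I" and "M = Max I"
  have mM: "m \<in> I" "M \<in> I" "m \<le> M" using False fin by (auto simp: m_def M_def)
  have "\<delta> m + lam * real (c - m) \<le> \<delta> c" if "m \<le> c" "c \<le> M" for c
    using that
  proof (induction c rule: dec_induct)
    case (step c)
    then have "Suc c < N" using mM(2) I(1) by auto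
    then have "\<delta> c + lam \<le> \<delta> (Suc c)" by (rule inc)
    then show ?case using step by (simp add: Suc_diff_le algebra_simps)
  qed auto
  from this[of M] have "lam * real (M - m) \<le> \<delta> M - \<delta> m" using mM by simp
  also have "\<dots> \<le> L" using I(2)[OF mM(1)] I(2)[OF mM(2)] by linarith
  finally have "real (M - m) \<le> L / lam" using assms(1) by (simp add: field_simps)
  moreover have "card I \<le> M - m + 1"
  proof -
    have "I \<subseteq> {m..M}" using fin by (auto simp: m_def M_def)
    then have "card I \<le> card {m..M}" by (intro card_mono) auto
    then show ?thesis using mM by simp
  qed
  ultimately show ?thesis by linarith
qed

text \<open>Group the \<open>n\<close> by the integer part \<open>\<nu> n\<close> of the first difference divided by \<open>2 * pi\<close>. In one group, the \<open>n\<close> whose difference is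
within \<open>\<theta> = sqrt lam\<close> of a multiple of \<open>2 * pi\<close> are at most about \<open>\<theta> / lam\<close> many since the differences grow
by at least \<open>lam\<close> in each step; the others form an interval to which \<open>Kusmin_Landau\<close> applies. The
choice of \<open>\<theta>\<close> balances \<open>\<theta> / lam\<close> against \<open>1 / \<theta>\<close>.\<close>

lemma second_difference_test:
  fixes \<phi> :: "nat \<Rightarrow> real"
  assumes lam: "0 < lam" and A: "1 \<le> A"
    and lo: "\<And>n. n < N \<Longrightarrow> lam \<le> \<phi> (Suc (Suc n)) - 2 * \<phi> (Suc n) + \<phi> n"
    and hi: "\<And>n. n < N \<Longrightarrow> \<phi> (Suc (Suc n)) - 2 * \<phi> (Suc n) + \<phi> n \<le> A * lam"
  shows "norm (\<Sum>n<N. cis (\<phi> n)) \<le> 24 * A * (real N * sqrt lam + 1 / sqrt lam)"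
proof (cases "sqrt lam < 1 \<and> N > 0")
  case False
  have "norm (\<Sum>n<N. cis (\<phi> n)) \<le> real N"
    using norm_sum[of "\<lambda>n. cis (\<phi> n)" "{..<N}"] by simp
  also have "\<dots> \<le> real N * sqrt lam" using False by (cases "N = 0") (auto simp: mult_le_cancel_left1)
  also have "\<dots> \<le> 1 * (real N * sqrt lam + 1 / sqrt lam)" using lam by simp
  also have "\<dots> \<le> 24 * A * (real N * sqrt lam + 1 / sqrt lam)"
    using A lam by (intro mult_right_mono) auto
  finally show ?thesis .
next
  case True
  define \<theta> where "\<theta> = sqrt lam"
  have th: "0 < \<theta>" "\<theta> < 1" "\<theta> * \<theta> = lam" "N > 0" using lam True by (auto simp: \<theta>_def)
  define \<delta> where "\<delta> n = \<phi> (Suc n) - \<phi> n" for n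
  have inc: "\<delta> n + lam \<le> \<delta> (Suc n)" "\<delta> (Suc n) \<le> \<delta> n + A * lam" if "n < N" for n
    using lo[OF that] hi[OF that] by (auto simp: \<delta>_def)
  have mono: "\<delta> m \<le> \<delta> n" if "m \<le> n" "n < N" for m n
    using that
  proof (induction n rule: dec_induct)
    case (step n)
    then show ?case using inc(1)[of n] lam by simp
  qed auto
  have tot: "\<delta> n \<le> \<delta> 0 + A * lam * real n" if "n < N" for n
    using that
  proof (induction n)
    case (Suc n)
    then show ?case using inc(2)[of n] by (simp add: algebra_simps)
  qed auto
  define \<nu> where "\<nu> n = \<lfloor>\<delta> n / (2 * pi)\<rfloor>" for n
  have nu: "2 * pi * \<nu> n \<le> \<delta> n" "\<delta> n < 2 * pi * (\<nu> n + 1)" for n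
  proof -
    have "real_of_int (\<nu> n) \<le> \<delta> n / (2 * pi)" "\<delta> n / (2 * pi) < real_of_int (\<nu> n) + 1"
      unfolding \<nu>_def by linarith+
    then show "2 * pi * \<nu> n \<le> \<delta> n" "\<delta> n < 2 * pi * (\<nu> n + 1)"
      by (simp_all add: field_simps)
  qed
  define V where "V = \<nu> ` {..<N}"
  have numono: "\<nu> m \<le> \<nu> n" if "m \<le> n" "n < N" for m n
    unfolding \<nu>_def using mono[OF that] by (intro floor_mono divide_right_mono) auto
  have cardV: "real (card V) \<le> A * lam * real N + 2"
  proof -
    have "V \<subseteq> {\<nu> 0..\<nu> (N - 1)}" using numono th(4) by (auto simp: V_def)
    then have "card V \<le> card {\<nu> 0..\<nu> (N - 1)}" by (intro card_mono) auto
    also have "\<dots> = nat (\<nu> (N - 1) + 1 - \<nu> 0)" by simp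
    finally have "real (card V) \<le> real_of_int (\<nu> (N - 1)) + 1 - real_of_int (\<nu> 0)"
      using numono[of 0 "N-1"] th(4) by auto
    also have "\<dots> \<le> \<delta> (N-1) / (2*pi) + 1 - (\<delta> 0 / (2 * pi) - 1)"
      unfolding \<nu>_def by linarith
    also have "\<dots> = (\<delta> (N-1) - \<delta> 0) / (2*pi) + 2" by (simp add: field_simps)
    also have "\<dots> \<le> (A * lam * real N) / (2 * pi) + 2"
    proof -
      have "\<delta> (N-1) \<le> \<delta> 0 + A * lam * real (N-1)" using tot[of "N-1"] th(4) by simp
      also have "\<dots> \<le> \<delta> 0 + A * lam * real N" using A lam by (intro add_left_mono mult_left_mono) auto
      finally show ?thesis by (intro add_right_mono divide_right_mono) auto
    qed
    also have "(A * lam * real N) / (2 * pi) \<le> (A * lam * real N) / 1"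
      using A lam pi_gt3 by (intro divide_left_mono) auto
    finally show ?thesis by simp
  qed
  have block: "norm (\<Sum>n\<in>{n\<in>{..<N}. \<nu> n = v}. cis (\<phi> n)) \<le> 12 / \<theta>" for v
  proof -
    define lo' where "lo' = {n. n < N \<and> \<nu> n = v \<and> \<delta> n < 2 * pi * v + \<theta>}"
    define hi' where "hi' = {n. n < N \<and> \<nu> n = v \<and> \<delta> n > 2 * pi * (v + 1) - \<theta>}"
    define mid where "mid = {n. n < N \<and> 2 * pi * v + \<theta> \<le> \<delta> n \<and> \<delta> n \<le> 2 * pi * (v + 1) - \<theta>}"
    have nuv: "\<nu> n = v" if "n \<in> mid" for n
    proof -
      have "of_int v \<le> \<delta> n / (2 * pi)" "\<delta> n / (2 * pi) < of_int v + 1"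
        using that th(1) by (auto simp: mid_def field_simps)
      then show ?thesis unfolding \<nu>_def by linarith
    qed
    have "\<theta> < pi" using th(2) pi_gt3 by linarith
    then have disj: "lo' \<inter> hi' = {}" "(lo' \<union> hi') \<inter> mid = {}" 
      by (auto simp: lo'_def hi'_def mid_def algebra_simps)
    have un: "{n\<in>{..<N}. \<nu> n = v} = (lo' \<union> hi') \<union> mid"
    proof (intro equalityI subsetI)
      fix n assume "n \<in> {n\<in>{..<N}. \<nu> n = v}"
      then have "n < N" "\<nu> n = v" by auto
      then show "n \<in> (lo' \<union> hi') \<union> mid"
        unfolding lo'_def hi'_def mid_def Un_iff mem_Collect_eq by linarith
    next
      fix n assume n: "n \<in> (lo' \<union> hi') \<union> mid"
      show "n \<in> {n\<in>{..<N}. \<nu> n = v}"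
      proof (cases "n \<in> mid")
        case True
        then show ?thesis using nuv[OF True] by (simp add: mid_def)
      next
        case False
        then have "n \<in> lo' \<or> n \<in> hi'" using n by blast
        then show ?thesis by (auto simp: lo'_def hi'_def)
      qed
    qed
    have fin: "finite lo'" "finite hi'" "finite mid" by (auto simp: lo'_def hi'_def mid_def)
    have c1: "real (card lo') \<le> \<theta> / lam + 1"
    proof (rule steep_card_le[OF lam, of N \<delta> _ "2 * pi * v"])
      show "x \<in> lo' \<Longrightarrow> 2 * pi * v \<le> \<delta> x \<and> \<delta> x \<le> 2 * pi * v + \<theta>" for x
        using nu[of x] by (auto simp: lo'_def)
    qed (use inc th in \<open>auto simp: lo'_def\<close>)
    have c2: "real (card hi') \<le> \<theta> / lam + 1"
    proof (rule steep_card_le[OF lam, of N \<delta> _ "2 * pi * (v + 1) - \<theta>"])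
      show "x \<in> hi' \<Longrightarrow> 2 * pi * (v+1) - \<theta> \<le> \<delta> x \<and> \<delta> x \<le> 2 * pi * (v+1) - \<theta> + \<theta>" for x
        using nu[of x] by (auto simp: hi'_def)
    qed (use inc th in \<open>auto simp: hi'_def\<close>)
    have c3: "norm (\<Sum>n\<in>mid. cis (\<phi> n)) \<le> 8 / \<theta>"
    proof (cases "mid = {}")
      case True
      then show ?thesis using th by simp
    next
      case False
      define a b where "a = Min mid" and "b = Suc (Max mid)"
      have am: "a \<in> mid" "Max mid \<in> mid" using False fin by (auto simp: a_def)
      have mideq: "mid = {a..<b}"
      proof (intro equalityI subsetI)
        fix n assume "n \<in> mid"
        then show "n \<in> {a..<b}" using fin by (auto simp: a_def b_def less_Suc_eq_le)
      next
        fix n assume n: "n \<in> {a..<b}"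
        then have le: "a \<le> n" "n \<le> Max mid" by (auto simp: b_def)
        have "Max mid < N" using am(2) by (simp add: mid_def)
        then have "\<delta> a \<le> \<delta> n" "\<delta> n \<le> \<delta> (Max mid)" "n < N" using le mono by auto
        then show "n \<in> mid" using am by (auto simp: mid_def)
      qed
      have bN: "n < N" if "n < b" for n using that am(2) by (auto simp: b_def mid_def)
      show ?thesis unfolding mideq
      proof (rule Kusmin_Landau[OF th(1)])
        fix n assume "a \<le> n" "Suc n < b"
        then show "\<phi> (Suc n) - \<phi> n \<le> \<phi> (Suc (Suc n)) - \<phi> (Suc n)"
          using inc(1)[of n] bN[of n] lam by (simp add: \<delta>_def)
      next
        fix n assume "a \<le> n" "n < b"
        then have "n \<in> mid" using mideq by auto
        then show "2 * pi * v + \<theta> \<le> \<phi> (Suc n) - \<phi> n" "\<phi> (Suc n) - \<phi> n \<le> 2 * pi * (v + 1) - \<theta>"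
          by (auto simp: mid_def \<delta>_def)
      qed
    qed
    have tl: "\<theta> / lam = 1 / \<theta>" using th by (metis divide_divide_eq_left divide_self_if less_irrefl)
    have "norm (\<Sum>n\<in>{n\<in>{..<N}. \<nu> n = v}. cis (\<phi> n))
        = norm ((\<Sum>n\<in>lo'. cis (\<phi> n)) + (\<Sum>n\<in>hi'. cis (\<phi> n)) + (\<Sum>n\<in>mid. cis (\<phi> n)))"
      unfolding un using fin disj by (simp add: sum.union_disjoint)
    also have "\<dots> \<le> norm (\<Sum>n\<in>lo'. cis (\<phi> n)) + norm (\<Sum>n\<in>hi'. cis (\<phi> n)) + norm (\<Sum>n\<in>mid. cis (\<phi> n))"
      by (meson norm_triangle_ineq order_trans add_mono order_refl)
    also have "\<dots> \<le> (\<theta> / lam + 1) + (\<theta> / lam + 1) + 8 / \<theta>"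
      using c1 c2 c3 norm_sum[of "\<lambda>n. cis (\<phi> n)" lo'] norm_sum[of "\<lambda>n. cis (\<phi> n)" hi'] by simp
    also have "\<dots> \<le> 12 / \<theta>" unfolding tl using th(1,2) by (simp add: field_simps)
    finally show ?thesis .
  qed
  have "(\<Sum>n<N. cis (\<phi> n)) = (\<Sum>v\<in>V. \<Sum>n\<in>{n\<in>{..<N}. \<nu> n = v}. cis (\<phi> n))"
    unfolding V_def by (rule sum.image_gen) simp
  also have "norm \<dots> \<le> (\<Sum>v\<in>V. 12 / \<theta>)"
    by (intro sum_norm_le block)
  also have "\<dots> = real (card V) * (12 / \<theta>)" by simp
  also have "\<dots> \<le> (A * lam * real N + 2) * (12 / \<theta>)"
    using cardV th by (intro mult_right_mono) auto
  also have "\<dots> = 12 * A * real N * \<theta> + 24 / \<theta>"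
    unfolding th(3)[symmetric] using th(1) by (simp add: field_simps)
  also have "\<dots> \<le> 24 * A * (real N * \<theta>) + 24 * A * (1 / \<theta>)"
    using A th by (intro add_mono) (auto simp: divide_right_mono field_simps)
  finally show ?thesis by (simp add: \<theta>_def algebra_simps)
qed

section \<open>Van der Corput differencing and the test for higher differences\<close>

definition fdiff :: "(nat \<Rightarrow> real) \<Rightarrow> nat \<Rightarrow> real" where
  "fdiff f n = f (Suc n) - f n"

lemma fdiff_pow_minus: "(fdiff ^^ m) (\<lambda>n. f n - g n) = (\<lambda>n. (fdiff ^^ m) f n - (fdiff ^^ m) g n)"
  by (induction m) (auto simp: fdiff_def fun_eq_iff)

lemma fdiff_pow_shift: "(fdiff ^^ m) (\<lambda>n. f (n + h)) = (\<lambda>n. (fdiff ^^ m) f (n + h))"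
  by (induction m) (auto simp: fdiff_def fun_eq_iff)

lemma fdiff_pow_cmult: "(fdiff ^^ m) (\<lambda>n. c * f n) = (\<lambda>n. c * (fdiff ^^ m) f n)"
  by (induction m) (auto simp: fdiff_def fun_eq_iff algebra_simps)

lemma fdiff_pow_shift_diff:
  "(fdiff ^^ m) (\<lambda>n. f (n + h) - f n) n = (\<Sum>j<h. (fdiff ^^ Suc m) f (n + j))"
proof -
  have "(fdiff ^^ m) (\<lambda>n. f (n + h) - f n) n = (fdiff ^^ m) f (n + h) - (fdiff ^^ m) f n"
    using fdiff_pow_minus[of m "\<lambda>n. f (n + h)" f] fdiff_pow_shift[of m f h] by simp
  also have "\<dots> = (\<Sum>j<h. (fdiff ^^ m) f (n + Suc j) - (fdiff ^^ m) f (n + j))"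
    using sum_lessThan_telescope[of "\<lambda>j. (fdiff ^^ m) f (n + j)" h] by simp
  also have "\<dots> = (\<Sum>j<h. (fdiff ^^ Suc m) f (n + j))"
    by (simp add: fdiff_def)
  finally show ?thesis .
qed

text \<open>Shifting the summation range by \<open>h < H\<close> changes nothing once \<open>z\<close> is extended by zero, so \<open>H\<close> times the sum is a
sum over \<open>N + H\<close> positions of windows of length \<open>H\<close>. Cauchy--Schwarz over the positions leaves
correlations \<open>z (n + h) * cnj (z n)\<close>.\<close>

lemma van_der_Corput_inequality:
  fixes z :: "nat \<Rightarrow> complex"
  assumes z: "\<And>n. norm (z n) \<le> 1" and H: "1 \<le> H" "H \<le> N"
    and C: "\<And>h. 1 \<le> h \<Longrightarrow> h < H \<Longrightarrow> norm (\<Sum>n<N-h. z (n + h) * cnj (z n)) \<le> C" and C0: "0 \<le> C"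
  shows "(norm (\<Sum>n<N. z n))\<^sup>2 \<le> 2 * real N ^ 2 / real H + 4 * real N * C"
proof -
  define w where "w i = (if 0 \<le> i \<and> i < int N then z (nat i) else 0)" for i :: int
  define S where "S = (\<Sum>n<N. z n)"
  have wsum: "(\<Sum>i\<in>{0..<int N}. w i) = S"
  proof -
    have "(\<Sum>i\<in>{0..<int N}. w i) = (\<Sum>i\<in>int ` {..<N}. w i)"
      by (intro sum.cong) (auto simp: image_int_atLeastLessThan lessThan_atLeast0)
    also have "\<dots> = (\<Sum>n<N. w (int n))" by (subst sum.reindex) auto
    also have "\<dots> = S" by (auto simp: S_def w_def intro!: sum.cong)
    finally show ?thesis .
  qed
  define M where "M = {0..<int N + int H}"
  have shift: "(\<Sum>m\<in>M. w (m - int h)) = S" if "h < H" for h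
  proof -
    have "(\<Sum>m\<in>M. w (m - int h)) = (\<Sum>m\<in>{int h..<int N + int h}. w (m - int h))"
      using that by (intro sum.mono_neutral_right) (auto simp: M_def w_def)
    also have "\<dots> = (\<Sum>i\<in>{0..<int N}. w i)"
      by (rule sum.reindex_bij_witness[of _ "\<lambda>i. i + int h" "\<lambda>m. m - int h"]) auto
    finally show ?thesis using wsum by simp
  qed
  have HS: "of_nat H * S = (\<Sum>m\<in>M. \<Sum>h<H. w (m - int h))"
  proof -
    have "(\<Sum>m\<in>M. \<Sum>h<H. w (m - int h)) = (\<Sum>h<H. \<Sum>m\<in>M. w (m - int h))"
      by (rule sum.swap)
    also have "\<dots> = (\<Sum>h<H. S)" using shift by (intro sum.cong) auto
    finally show ?thesis by simp
  qed
  have finM: "finite M" "card M = N + H" by (auto simp: M_def)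
  have "(real H * norm S)\<^sup>2 = (norm (\<Sum>m\<in>M. \<Sum>h<H. w (m - int h)))\<^sup>2"
    by (metis HS norm_mult norm_of_nat)
  also have "\<dots> \<le> (\<Sum>m\<in>M. norm (\<Sum>h<H. w (m - int h)))\<^sup>2"
    by (intro power_mono norm_sum) auto
  also have "\<dots> \<le> real (card M) * (\<Sum>m\<in>M. (norm (\<Sum>h<H. w (m - int h)))\<^sup>2)"
    using Cauchy_Schwarz_ineq_sum[of "\<lambda>_. 1" "\<lambda>m. norm (\<Sum>h<H. w (m - int h))" M] by simp
  finally have CS: "(real H * norm S)\<^sup>2 \<le> real (card M) * (\<Sum>m\<in>M. (norm (\<Sum>h<H. w (m - int h)))\<^sup>2)" .
  define c where "c h = (if h = 0 then real N else C)" for h :: nat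
  have corr: "norm (\<Sum>m\<in>M. w (m - int h1) * cnj (w (m - int h2))) \<le> c (h1 - h2)"
    if "h1 < H" "h2 < H" "h2 \<le> h1" for h1 h2
  proof -
    have "(\<Sum>m\<in>M. w (m - int h1) * cnj (w (m - int h2)))
        = (\<Sum>m\<in>{int h1..<int N + int h2}. w (m - int h1) * cnj (w (m - int h2)))"
      using that by (intro sum.mono_neutral_right) (auto simp: M_def w_def)
    also have "\<dots> = (\<Sum>n<N-(h1-h2). z n * cnj (z (n + (h1 - h2))))"
    proof (rule sum.reindex_bij_witness[of _ "\<lambda>n. int n + int h1" "\<lambda>m. nat (m - int h1)"])
      fix m assume m: "m \<in> {int h1..<int N + int h2}"
      then have "nat (m - int h2) = nat (m - int h1) + (h1 - h2)" using that by auto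
      then show "z (nat (m - int h1)) * cnj (z (nat (m - int h1) + (h1 - h2)))
         = w (m - int h1) * cnj (w (m - int h2))"
        using m that by (auto simp: w_def)
    qed (use that in auto)
    finally have e: "(\<Sum>m\<in>M. w (m - int h1) * cnj (w (m - int h2))) = (\<Sum>n<N-(h1-h2). z n * cnj (z (n + (h1 - h2))))" .
    show ?thesis
    proof (cases "h1 = h2")
      case True
      have "norm (\<Sum>n<N. z n * cnj (z n)) \<le> (\<Sum>n<N. 1)"
        using z by (intro sum_norm_le) (auto simp: norm_mult intro!: mult_le_one)
      then show ?thesis using True e by (simp add: c_def)
    next
      case False
      define d where "d = h1 - h2"
      have "(\<Sum>n<N-d. z n * cnj (z (n + d))) = cnj (\<Sum>n<N-d. z (n + d) * cnj (z n))"
        by (simp add: mult.commute)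
      then have "norm (\<Sum>n<N-d. z n * cnj (z (n + d))) \<le> C"
        using C[of d] False that by (simp only: complex_mod_cnj) (simp add: d_def)
      moreover have "d \<noteq> 0" using False that by (simp add: d_def)
      ultimately show ?thesis unfolding e d_def[symmetric] by (simp add: c_def)
    qed
  qed
  have corr': "norm (\<Sum>m\<in>M. w (m - int h1) * cnj (w (m - int h2))) \<le> (if h1 = h2 then real N else C)"
    if "h1 < H" "h2 < H" for h1 h2
  proof (cases "h2 \<le> h1")
    case True
    then show ?thesis using corr[OF that True] by (auto simp: c_def split: if_splits)
  next
    case False
    have "(\<Sum>m\<in>M. w (m - int h1) * cnj (w (m - int h2))) = cnj (\<Sum>m\<in>M. w (m - int h2) * cnj (w (m - int h1)))"
      by (simp add: mult.commute)
    then have "norm (\<Sum>m\<in>M. w (m - int h1) * cnj (w (m - int h2))) = norm (\<Sum>m\<in>M. w (m - int h2) * cnj (w (m - int h1)))"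
      by (simp only: complex_mod_cnj)
    then show ?thesis using corr[OF that(2,1)] False by (auto simp: c_def split: if_splits)
  qed
  have "of_real (\<Sum>m\<in>M. (norm (\<Sum>h<H. w (m - int h)))\<^sup>2)
      = (\<Sum>m\<in>M. (\<Sum>h1<H. w (m - int h1)) * cnj (\<Sum>h2<H. w (m - int h2)))"
    unfolding of_real_sum by (intro sum.cong refl complex_norm_square)
  also have "\<dots> = (\<Sum>m\<in>M. \<Sum>h1<H. \<Sum>h2<H. w (m - int h1) * cnj (w (m - int h2)))"
    by (simp add: sum_product)
  also have "\<dots> = (\<Sum>h1<H. \<Sum>h2<H. \<Sum>m\<in>M. w (m - int h1) * cnj (w (m - int h2)))"
    by (subst sum.swap, rule sum.cong[OF refl], rule sum.swap)
  finally have e: "complex_of_real (\<Sum>m\<in>M. (norm (\<Sum>h<H. w (m - int h)))\<^sup>2) = \<dots>" .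
  have "(\<Sum>m\<in>M. (norm (\<Sum>h<H. w (m - int h)))\<^sup>2) = norm (complex_of_real (\<Sum>m\<in>M. (norm (\<Sum>h<H. w (m - int h)))\<^sup>2))"
    by (simp add: sum_nonneg del: of_real_sum of_real_power)
  also have "\<dots> \<le> (\<Sum>h1<H. \<Sum>h2<H. if h1 = h2 then real N else C)"
    unfolding e by (intro sum_norm_le corr') auto
  also have "\<dots> \<le> (\<Sum>h1<H. real N + real H * C)"
  proof (intro sum_mono)
    fix h1 assume h1: "h1 \<in> {..<H}"
    have "(\<Sum>h2<H. if h1 = h2 then real N else C) \<le> (\<Sum>h2<H. (if h1 = h2 then real N else 0) + C)"
      using C0 by (intro sum_mono) auto
    also have "\<dots> = real N + real H * C" using h1 by (simp add: sum.distrib)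
    finally show "(\<Sum>h2<H. if h1 = h2 then real N else C) \<le> real N + real H * C" .
  qed
  also have "\<dots> = real H * (real N + real H * C)" by simp
  finally have "(real H * norm S)\<^sup>2 \<le> real (card M) * (real H * (real N + real H * C))"
    using CS by (meson mult_left_mono of_nat_0_le_iff order_trans)
  also have "\<dots> \<le> (2 * real N) * (real H * (real N + real H * C))"
    using H C0 finM by (intro mult_right_mono) auto
  finally have "(norm S)\<^sup>2 * (real H)\<^sup>2 \<le> (2 * real N) * (real H * (real N + real H * C))"
    by (simp add: power_mult_distrib mult.commute)
  then have "(norm S)\<^sup>2 \<le> (2 * real N) * (real H * (real N + real H * C)) / (real H)\<^sup>2"
    using H by (simp add: field_simps)
  also have "\<dots> = 2 * real N ^ 2 / real H + 2 * real N * C"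
    using H by (simp add: field_simps power2_eq_square)
  also have "\<dots> \<le> 2 * real N ^ 2 / real H + 4 * real N * C" using C0 by simp
  finally show ?thesis by (simp add: S_def)
qed

text \<open>A power saving in \<open>N\<close> for all phases whose \<open>m\<close>-th differences have a constant order of magnitude \<open>lam\<close>, uniformly in
the range \<open>N powr (-7/4) \<le> lam \<le> N powr (-\<sigma>)\<close>. The lower end keeps the term \<open>1 / sqrt lam\<close> of the second
difference test below \<open>N powr (7/8)\<close>. The bound is for all initial segments \<open>N' \<le> N\<close> in terms of the same
\<open>N\<close>, because differencing shortens the range.\<close>

definition difference_test :: "nat \<Rightarrow> bool" where
  "difference_test m \<longleftrightarrow> (\<forall>\<sigma>>0. \<sigma> \<le> 1 \<longrightarrow> (\<forall>A\<ge>1. \<exists>c>0. \<exists>C>0. \<forall>N\<ge>1. \<forall>N'\<le>N. \<forall>\<phi> lam.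
     real N powr (-7/4) \<le> lam \<longrightarrow> lam \<le> real N powr (-\<sigma>) \<longrightarrow>
     (\<forall>n<N'. lam \<le> (fdiff ^^ m) \<phi> n \<and> (fdiff ^^ m) \<phi> n \<le> A * lam) \<longrightarrow>
     norm (\<Sum>n<N'. cis (\<phi> n)) \<le> C * real N powr (1 - c)))"

lemma difference_testE:
  assumes "difference_test m" "0 < \<sigma>" "\<sigma> \<le> 1" "1 \<le> A"
  obtains c C where "c > 0" "C > 0" "\<And>N N' \<phi> lam. 1 \<le> N \<Longrightarrow> N' \<le> N \<Longrightarrow>
     real N powr (-7/4) \<le> lam \<Longrightarrow> lam \<le> real N powr (-\<sigma>) \<Longrightarrow>
     (\<And>n. n<N' \<Longrightarrow> lam \<le> (fdiff ^^ m) \<phi> n \<and> (fdiff ^^ m) \<phi> n \<le> A * lam) \<Longrightarrow>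
     norm (\<Sum>n<N'. cis (\<phi> n)) \<le> C * real N powr (1 - c)"
proof -
  have "\<exists>c>0. \<exists>C>0. \<forall>N\<ge>1. \<forall>N'\<le>N. \<forall>\<phi> lam.
     real N powr (-7/4) \<le> lam \<longrightarrow> lam \<le> real N powr (-\<sigma>) \<longrightarrow>
     (\<forall>n<N'. lam \<le> (fdiff ^^ m) \<phi> n \<and> (fdiff ^^ m) \<phi> n \<le> A * lam) \<longrightarrow>
     norm (\<Sum>n<N'. cis (\<phi> n)) \<le> C * real N powr (1 - c)"
    by (rule assms(1)[unfolded difference_test_def, rule_format]) (use assms in auto)
  then obtain c C where *: "c > 0" "C > 0" "\<forall>N\<ge>1. \<forall>N'\<le>N. \<forall>\<phi> lam.
     real N powr (-7/4) \<le> lam \<longrightarrow> lam \<le> real N powr (-\<sigma>) \<longrightarrow>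
     (\<forall>n<N'. lam \<le> (fdiff ^^ m) \<phi> n \<and> (fdiff ^^ m) \<phi> n \<le> A * lam) \<longrightarrow>
     norm (\<Sum>n<N'. cis (\<phi> n)) \<le> C * real N powr (1 - c)"
    by (elim exE conjE) 
  show thesis
    by (rule that[OF *(1,2)]) (use *(3) in \<open>simp\<close>)
qed

lemma difference_test_2: "difference_test 2"
  unfolding difference_test_def
proof (intro allI impI)
  fix \<sigma> A :: real assume \<sigma>: "0 < \<sigma>" "\<sigma> \<le> 1" and A: "1 \<le> A"
  define c where "c = min (\<sigma>/2) (1/8)"
  have c: "0 < c" "c \<le> \<sigma>/2" "c \<le> 1/8" using \<sigma> by (auto simp: c_def)
  show "\<exists>c>0. \<exists>C>0. \<forall>N\<ge>1. \<forall>N'\<le>N. \<forall>\<phi> lam.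
     real N powr (-7/4) \<le> lam \<longrightarrow> lam \<le> real N powr (-\<sigma>) \<longrightarrow>
     (\<forall>n<N'. lam \<le> (fdiff ^^ 2) \<phi> n \<and> (fdiff ^^ 2) \<phi> n \<le> A * lam) \<longrightarrow>
     norm (\<Sum>n<N'. cis (\<phi> n)) \<le> C * real N powr (1 - c)"
  proof (rule exI[of _ c], rule conjI[OF c(1)], rule exI[of _ "48 * A"], rule conjI, use A in simp, intro allI impI)
    fix N N' :: nat and \<phi> :: "nat \<Rightarrow> real" and lam :: real
    assume N: "1 \<le> N" "N' \<le> N" and lam: "real N powr (-7/4) \<le> lam" "lam \<le> real N powr (-\<sigma>)"
      and d: "\<forall>n<N'. lam \<le> (fdiff ^^ 2) \<phi> n \<and> (fdiff ^^ 2) \<phi> n \<le> A * lam"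
    have "0 < real N powr (-7/4)" using N by simp
    then have lam0: "lam > 0" using lam by linarith
    have d2: "(fdiff ^^ 2) \<phi> n = \<phi> (Suc (Suc n)) - 2 * \<phi> (Suc n) + \<phi> n" for n
      by (simp add: fdiff_def numeral_2_eq_2)
    have "norm (\<Sum>n<N'. cis (\<phi> n)) \<le> 24 * A * (real N' * sqrt lam + 1 / sqrt lam)"
      using d unfolding d2 by (intro second_difference_test lam0 A) auto
    also have "\<dots> \<le> 24 * A * (real N powr (1 - c) + real N powr (1 - c))"
    proof (intro mult_left_mono add_mono)
      have "real N' * sqrt lam \<le> real N * sqrt (real N powr (-\<sigma>))"
        using N lam lam0 by (intro mult_mono) auto
      also have "\<dots> = real N powr (1 - \<sigma>/2)"
      proof -
        have "sqrt (real N powr (-\<sigma>)) = real N powr (-\<sigma>/2)"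
          using powr_half_sqrt[of "real N powr (-\<sigma>)"] by (simp only: powr_powr) simp
        then show ?thesis using N powr_add[of "real N" 1 "-\<sigma>/2"] by simp
      qed
      also have "\<dots> \<le> real N powr (1 - c)" using N c by (intro powr_mono) auto
      finally show "real N' * sqrt lam \<le> real N powr (1 - c)" .
      have "1 / sqrt lam \<le> 1 / sqrt (real N powr (-7/4))"
        using N lam lam0 by (intro divide_left_mono) auto
      also have "\<dots> = real N powr (7/8)"
      proof -
        have "sqrt (real N powr (-7/4)) = real N powr (-7/8)"
          using powr_half_sqrt[of "real N powr (-7/4)"] by (simp only: powr_powr) simp
        then show ?thesis using powr_minus_divide[of "real N" "-7/8"] by simp
      qed
      also have "\<dots> \<le> real N powr (1 - c)" using N c by (intro powr_mono) auto
      finally show "1 / sqrt lam \<le> real N powr (1 - c)" .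
    qed (use A in auto)
    finally show "norm (\<Sum>n<N'. cis (\<phi> n)) \<le> 48 * A * real N powr (1 - c)" by simp
  qed
qed

text \<open>For \<open>h < H\<close> the differenced phase \<open>\<phi> (n + h) - \<phi> n\<close> has \<open>m\<close>-th differences of size \<open>h * lam\<close>. With
\<open>H = N powr (\<sigma> / 2)\<close> these stay below \<open>N powr (- \<sigma> / 2)\<close>, so the case \<open>m\<close> with \<open>\<sigma> / 2\<close> in place of \<open>\<sigma>\<close> applies.\<close>

lemma difference_test_Suc:
  assumes "difference_test m"
  shows "difference_test (Suc m)"
  unfolding difference_test_def
proof (intro allI impI)
  fix \<sigma> A :: real assume \<sigma>: "0 < \<sigma>" "\<sigma> \<le> 1" and A: "1 \<le> A"
  obtain c1 C1 where c1: "c1 > 0" "C1 > 0" and IH: "\<And>N N' \<phi> lam. 1 \<le> N \<Longrightarrow> N' \<le> N \<Longrightarrow>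
     real N powr (-7/4) \<le> lam \<Longrightarrow> lam \<le> real N powr (-(\<sigma>/2)) \<Longrightarrow>
     (\<And>n. n<N' \<Longrightarrow> lam \<le> (fdiff ^^ m) \<phi> n \<and> (fdiff ^^ m) \<phi> n \<le> A * lam) \<Longrightarrow>
     norm (\<Sum>n<N'. cis (\<phi> n)) \<le> C1 * real N powr (1 - c1)"
    using difference_testE[OF assms, of "\<sigma>/2" A] \<sigma> A by auto
  define e where "e = min (\<sigma>/2) c1"
  have e: "0 < e" "e \<le> \<sigma>/2" "e \<le> c1" using \<sigma> c1 by (auto simp: e_def)
  show "\<exists>c>0. \<exists>C>0. \<forall>N\<ge>1. \<forall>N'\<le>N. \<forall>\<phi> lam.
     real N powr (-7/4) \<le> lam \<longrightarrow> lam \<le> real N powr (-\<sigma>) \<longrightarrow>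
     (\<forall>n<N'. lam \<le> (fdiff ^^ Suc m) \<phi> n \<and> (fdiff ^^ Suc m) \<phi> n \<le> A * lam) \<longrightarrow>
     norm (\<Sum>n<N'. cis (\<phi> n)) \<le> C * real N powr (1 - c)"
  proof (rule exI[of _ "e/2"], rule conjI, use e in simp, rule exI[of _ "sqrt (4 + 4 * C1)"], rule conjI, use c1 in simp, intro allI impI)
    fix N N' :: nat and \<phi> :: "nat \<Rightarrow> real" and lam :: real
    assume N: "1 \<le> N" "N' \<le> N" and lam: "real N powr (-7/4) \<le> lam" "lam \<le> real N powr (-\<sigma>)"
      and d: "\<forall>n<N'. lam \<le> (fdiff ^^ Suc m) \<phi> n \<and> (fdiff ^^ Suc m) \<phi> n \<le> A * lam"
    have "0 < real N powr (-7/4)" using N by simp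
    then have lam0: "lam > 0" using lam by linarith
    define H where "H = nat \<lfloor>real N powr (\<sigma>/2)\<rfloor>"
    have pw: "real N powr (\<sigma>/2) \<ge> 1" using N \<sigma> by (intro ge_one_powr_ge_zero) auto
    have rH: "real H = of_int \<lfloor>real N powr (\<sigma>/2)\<rfloor>" using pw unfolding H_def by simp
    have fl: "of_int \<lfloor>real N powr (\<sigma>/2)\<rfloor> \<ge> (1::real)" using pw by simp
    have H: "1 \<le> H" "real H \<le> real N powr (\<sigma>/2)" "real N powr (\<sigma>/2) \<le> 2 * real H"
      using rH fl real_of_int_floor_add_one_gt[of "real N powr (\<sigma>/2)"] by linarith+
    show "norm (\<Sum>n<N'. cis (\<phi> n)) \<le> sqrt (4 + 4 * C1) * real N powr (1 - e/2)"
    proof (cases "H \<le> N'")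
      case False
      have "norm (\<Sum>n<N'. cis (\<phi> n)) \<le> real N'"
        using norm_sum[of "\<lambda>n. cis (\<phi> n)" "{..<N'}"] by simp
      also have "\<dots> \<le> real N powr (\<sigma>/2)" using False H by linarith
      also have "\<dots> \<le> real N powr (1 - e/2)" using N \<sigma> e by (intro powr_mono) auto
      also have "\<dots> \<le> sqrt (4 + 4 * C1) * real N powr (1 - e/2)"
        using c1 by (simp add: mult_le_cancel_right1)
      finally show ?thesis .
    next
      case True
      have "(norm (\<Sum>n<N'. cis (\<phi> n)))\<^sup>2 \<le> 2 * real N' ^ 2 / real H + 4 * real N' * (C1 * real N powr (1 - c1))"
      proof (rule van_der_Corput_inequality)
        fix h assume h: "1 \<le> h" "h < H"
        have "norm (\<Sum>n<N'-h. cis (\<phi> (n + h) - \<phi> n)) \<le> C1 * real N powr (1 - c1)"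
        proof (rule IH[where lam = "real h * lam"])
          have "real N powr (-7/4) \<le> lam" by fact
          also have "\<dots> \<le> real h * lam" using h lam0 by simp
          finally show "real N powr (-7/4) \<le> real h * lam" .
          have "real h * lam \<le> real N powr (\<sigma>/2) * real N powr (-\<sigma>)"
            using h H lam lam0 by (intro mult_mono) auto
          also have "\<dots> = real N powr (-(\<sigma>/2))" by (simp add: powr_add[symmetric])
          finally show "real h * lam \<le> real N powr (-(\<sigma>/2))" .
          fix n assume n: "n < N' - h"
          have "(\<Sum>j<h. lam) \<le> (\<Sum>j<h. (fdiff ^^ Suc m) \<phi> (n + j))"
            using d n by (intro sum_mono) auto
          moreover have "(\<Sum>j<h. (fdiff ^^ Suc m) \<phi> (n + j)) \<le> (\<Sum>j<h. A * lam)"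
            using d n by (intro sum_mono) auto
          ultimately show "real h * lam \<le> (fdiff ^^ m) (\<lambda>n. \<phi> (n + h) - \<phi> n) n \<and>
             (fdiff ^^ m) (\<lambda>n. \<phi> (n + h) - \<phi> n) n \<le> A * (real h * lam)"
            unfolding fdiff_pow_shift_diff by (simp add: mult_ac)
        qed (use N in auto)
        then show "norm (\<Sum>n<N'-h. cis (\<phi> (n + h)) * cnj (cis (\<phi> n))) \<le> C1 * real N powr (1 - c1)"
          by (simp add: cis_cnj cis_mult)
      qed (use True H c1 in auto)
      also have "\<dots> \<le> 2 * real N ^ 2 / (real N powr (\<sigma>/2) / 2) + 4 * real N * (C1 * real N powr (1 - c1))"
        using N H c1 pw by (intro add_mono frac_le mult_left_mono mult_right_mono power_mono) auto
      also have "\<dots> = 4 * real N powr (2 - \<sigma>/2) + 4 * C1 * real N powr (2 - c1)"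
      proof -
        have n2: "real N ^ 2 = real N powr 2" using N by (simp add: powr_numeral)
        have "real N * real N powr (1 - c1) = real N powr (2 - c1)"
          using powr_add[of "real N" 1 "1 - c1"] N by simp
        moreover have "real N ^ 2 / real N powr (\<sigma>/2) = real N powr (2 - \<sigma>/2)"
          unfolding n2 by (simp add: powr_diff)
        moreover have "2 * real N ^ 2 / (real N powr (\<sigma>/2) / 2) + 4 * real N * (C1 * real N powr (1 - c1))
           = 4 * (real N ^ 2 / real N powr (\<sigma>/2)) + 4 * C1 * (real N * real N powr (1 - c1))"
          by simp
        ultimately show ?thesis by (simp only:)
      qed
      also have "\<dots> \<le> 4 * real N powr (2 - e) + 4 * C1 * real N powr (2 - e)"
        using N e c1 by (intro add_mono mult_left_mono powr_mono) auto
      also have "\<dots> = (sqrt (4 + 4 * C1) * real N powr (1 - e/2))\<^sup>2"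
      proof -
        have "(real N powr (1 - e/2))\<^sup>2 = real N powr (2 - e)"
          by (simp add: power2_eq_square powr_add[symmetric])
        then show ?thesis using c1 by (simp add: power_mult_distrib algebra_simps)
      qed
      finally have sq: "(norm (\<Sum>n<N'. cis (\<phi> n)))\<^sup>2 \<le> (sqrt (4 + 4 * C1) * real N powr (1 - e/2))\<^sup>2" .
      show ?thesis
        by (rule power2_le_imp_le[OF sq]) (use c1 in simp)
    qed
  qed
qed

lemma difference_test: "2 \<le> m \<Longrightarrow> difference_test m"
  by (induction m rule: dec_induct) (simp_all add: difference_test_2 difference_test_Suc)

section \<open>Exponential sums with logarithmic phase\<close>

definition dir_sum :: "nat set \<Rightarrow> real \<Rightarrow> complex" where
  "dir_sum N t = (\<Sum>n\<in>N. cis (t * ln (real n)))"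

definition triple :: "real \<Rightarrow> nat set" where
  "triple U = {n. U < real n \<and> real n \<le> 3 * U}"

lemma dir_sum_uminus: "dir_sum N (- t) = cnj (dir_sum N t)"
  by (simp add: dir_sum_def cis_cnj)

lemma norm_dir_sum_uminus: "norm (dir_sum N (- t)) = norm (dir_sum N t)"
  by (simp add: dir_sum_uminus)

lemma norm_dir_sum_le_card: "norm (dir_sum N t) \<le> real (card N)"
  unfolding dir_sum_def using norm_sum[of "\<lambda>n. cis (t * ln (real n))" N] by simp

lemma triple_eq:
  assumes "U > 0"
  defines "a \<equiv> nat \<lfloor>U\<rfloor> + 1" and "b \<equiv> nat \<lfloor>3 * U\<rfloor> + 1"
  shows "triple U = {a..<b}" "real (b - a) \<le> 3 * U" "a \<le> b"
proof -
  have 1: "n \<ge> a \<longleftrightarrow> U < real n" for n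
    unfolding a_def using assms(1) by linarith
  have 2: "n < b \<longleftrightarrow> real n \<le> 3 * U" for n
    unfolding b_def using assms(1) by linarith
  show "triple U = {a..<b}"
    using 1 2 by (auto simp: triple_def)
  show "real (b - a) \<le> 3 * U" "a \<le> b"
    unfolding a_def b_def using assms(1) by linarith+
qed

lemma finite_triple [simp]: "finite (triple U)"
proof (cases "U > 0")
  case True
  then show ?thesis by (simp add: triple_eq(1))
next
  case False
  have "triple U \<subseteq> {0}"
  proof
    fix n assume "n \<in> triple U"
    then have "real n \<le> 3 * U" by (simp add: triple_def)
    then have "real n \<le> 0" using False by linarith
    then show "n \<in> {0}" by simp
  qed
  then show ?thesis by (rule finite_subset) simp
qed

lemma card_triple_le:
  assumes "U > 0"
  shows "real (card (triple U)) \<le> 3 * U"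
  using triple_eq(2)[OF assms] by (simp only: triple_eq(1)[OF assms] card_atLeastLessThan)

lemma ln_Suc_diff_bounds:
  fixes x :: real
  assumes "x > 0"
  shows "1 / (x + 1) \<le> ln (x + 1) - ln x" "ln (x + 1) - ln x \<le> 1 / x"
proof -
  have "ln (x + 1) - ln x = ln ((x + 1) / x)" using assms by (simp add: ln_div)
  also have "\<dots> \<le> (x + 1) / x - 1" using assms by (intro ln_le_minus_one) auto
  also have "\<dots> = 1 / x" using assms by (simp add: field_simps)
  finally show "ln (x + 1) - ln x \<le> 1 / x" .
  have "ln x - ln (x + 1) = ln (x / (x + 1))" using assms by (simp add: ln_div)
  also have "\<dots> \<le> x / (x + 1) - 1" using assms by (intro ln_le_minus_one) auto
  also have "\<dots> = - (1 / (x + 1))" using assms by (simp add: field_simps)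
  finally show "1 / (x + 1) \<le> ln (x + 1) - ln x" by simp
qed

lemma ln_second_diff_bounds:
  fixes x :: real
  assumes "x > 0"
  shows "1 / (x + 1)\<^sup>2 \<le> 2 * ln (x + 1) - ln x - ln (x + 2)"
        "2 * ln (x + 1) - ln x - ln (x + 2) \<le> 1 / x\<^sup>2"
proof -
  have e: "2 * ln (x + 1) - ln x - ln (x + 2) = ln (x * (x + 2) + 1) - ln (x * (x + 2))"
  proof -
    have "x * (x + 2) + 1 = (x + 1)\<^sup>2" by (simp add: power2_eq_square algebra_simps)
    then show ?thesis using assms by (simp add: ln_mult ln_realpow)
  qed
  have p: "x * (x + 2) > 0" using assms by simp
  have "1 / (x + 1)\<^sup>2 = 1 / (x * (x + 2) + 1)" by (simp add: power2_eq_square algebra_simps)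
  then show "1 / (x + 1)\<^sup>2 \<le> 2 * ln (x + 1) - ln x - ln (x + 2)"
    using ln_Suc_diff_bounds(1)[OF p] e by simp
  have "2 * ln (x + 1) - ln x - ln (x + 2) \<le> 1 / (x * (x + 2))"
    using ln_Suc_diff_bounds(2)[OF p] e by simp
  also have "\<dots> \<le> 1 / x\<^sup>2" using assms by (intro divide_left_mono) (auto simp: power2_eq_square)
  finally show "2 * ln (x + 1) - ln x - ln (x + 2) \<le> 1 / x\<^sup>2" .
qed

text \<open>The phase \<open>- t * ln n\<close> is convex. If \<open>t \<le> U\<close>, its increments lie between \<open>- 2 * pi\<close> and \<open>0\<close>, at distance
\<open>t / (4 * U)\<close> from both, and \<open>Kusmin_Landau\<close> gives \<open>U / t\<close>; if \<open>t > U\<close>, the second differences have order \<open>t / U\<^sup>2\<close> and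
\<open>second_difference_test\<close> gives \<open>sqrt t\<close>.\<close>

lemma dir_sum_triple_pos:
  assumes U: "U > 0" and t: "t \<ge> 1"
  shows "norm (dir_sum (triple U) (- t)) \<le> 2000 * (U / t + sqrt t)"
proof -
  have st: "sqrt t \<ge> 1" using t by simp
  show ?thesis
  proof (cases "U < 1")
    case True
    have "norm (dir_sum (triple U) (- t)) \<le> 3 * U"
      using norm_dir_sum_le_card card_triple_le[OF U] order_trans by blast
    also have "\<dots> \<le> 3 * 1" using True by simp
    also have "\<dots> \<le> 2000 * (0 + sqrt t)" using st by (intro mult_mono) auto
    also have "\<dots> \<le> 2000 * (U / t + sqrt t)" using U t by (intro mult_left_mono add_right_mono) auto
    finally show ?thesis .
  next
    case False
    then have U1: "U \<ge> 1" by simp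
    define a b where "a = nat \<lfloor>U\<rfloor> + 1" and "b = nat \<lfloor>3 * U\<rfloor> + 1"
    have ab: "triple U = {a..<b}" "real (b - a) \<le> 3 * U" "a \<le> b"
      unfolding a_def b_def by (fact triple_eq[OF U])+
    have mem: "U < real n \<and> real n \<le> 3 * U" if "a \<le> n" "n < b" for n
    proof -
      have "n \<in> triple U" unfolding ab(1) using that by simp
      then show ?thesis by (simp add: triple_def)
    qed
    define \<phi> where "\<phi> n = - t * ln (real n)" for n :: nat
    have phi: "\<phi> (Suc n) - \<phi> n = - t * (ln (real n + 1) - ln (real n))" for n
      by (simp add: \<phi>_def algebra_simps)
    have phi2: "\<phi> (Suc (Suc n)) - 2 * \<phi> (Suc n) + \<phi> n = t * (2 * ln (real n + 1) - ln (real n) - ln (real n + 2))" for n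
      by (simp add: \<phi>_def algebra_simps)
    have lo2: "t / (16 * U\<^sup>2) \<le> \<phi> (Suc (Suc n)) - 2 * \<phi> (Suc n) + \<phi> n"
      and hi2: "\<phi> (Suc (Suc n)) - 2 * \<phi> (Suc n) + \<phi> n \<le> t / U\<^sup>2" if "a \<le> n" "n < b" for n
    proof -
      have n: "U < real n" "real n \<le> 3 * U" using mem[OF that] by auto
      have "1 / (4 * U)\<^sup>2 \<le> 1 / (real n + 1)\<^sup>2"
        using n U1 by (intro divide_left_mono power_mono) auto
      also have "\<dots> \<le> 2 * ln (real n + 1) - ln (real n) - ln (real n + 2)"
        using n U by (intro ln_second_diff_bounds) auto
      finally have "t * (1 / (4 * U)\<^sup>2) \<le> \<phi> (Suc (Suc n)) - 2 * \<phi> (Suc n) + \<phi> n"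
        unfolding phi2 using t by (intro mult_left_mono) auto
      then show "t / (16 * U\<^sup>2) \<le> \<phi> (Suc (Suc n)) - 2 * \<phi> (Suc n) + \<phi> n"
        by (simp add: power_mult_distrib)
      have "2 * ln (real n + 1) - ln (real n) - ln (real n + 2) \<le> 1 / (real n)\<^sup>2"
        using n U by (intro ln_second_diff_bounds) auto
      also have "\<dots> \<le> 1 / U\<^sup>2"
        using n U by (intro divide_left_mono power_mono) auto
      finally have "\<phi> (Suc (Suc n)) - 2 * \<phi> (Suc n) + \<phi> n \<le> t * (1 / U\<^sup>2)"
        unfolding phi2 using t by (intro mult_left_mono) auto
      then show "\<phi> (Suc (Suc n)) - 2 * \<phi> (Suc n) + \<phi> n \<le> t / U\<^sup>2" by simp
    qed
    have eq: "dir_sum (triple U) (- t) = (\<Sum>n=a..<b. cis (\<phi> n))"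
      by (simp add: dir_sum_def ab \<phi>_def)
    show ?thesis
    proof (cases "t \<le> U")
      case True
      have "norm (\<Sum>n=a..<b. cis (\<phi> n)) \<le> 8 / (t / (4 * U))"
      proof (rule Kusmin_Landau[where \<nu> = "-1"])
        show "0 < t / (4 * U)" using t U by simp
      next
        fix n assume n: "a \<le> n" "Suc n < b"
        have "0 \<le> t / (16 * U\<^sup>2)" using t by simp
        then show "\<phi> (Suc n) - \<phi> n \<le> \<phi> (Suc (Suc n)) - \<phi> (Suc n)"
          using lo2[of n] n by simp
      next
        fix n assume n: "a \<le> n" "n < b"
        have m: "U < real n" "real n \<le> 3 * U" using mem[OF n] by auto
        have l: "1 / (real n + 1) \<le> ln (real n + 1) - ln (real n)" "ln (real n + 1) - ln (real n) \<le> 1 / real n"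
          using m U by (auto intro!: ln_Suc_diff_bounds)
        have "t * (ln (real n + 1) - ln (real n)) \<le> t * (1 / real n)"
          using l t by (intro mult_left_mono) auto
        also have "\<dots> \<le> 1" using m True U by (simp add: field_simps)
        finally have A: "t * (ln (real n + 1) - ln (real n)) \<le> 1" .
        have th: "t / (4 * U) \<le> 1" using True U by (simp add: field_simps)
        show "2 * pi * real_of_int (- 1) + t / (4 * U) \<le> \<phi> (Suc n) - \<phi> n"
          unfolding phi using A th pi_gt3 by simp
        have "t * (1 / (4 * U)) \<le> t * (1 / (real n + 1))"
          using m t U1 by (intro mult_left_mono divide_left_mono) auto
        also have "\<dots> \<le> t * (ln (real n + 1) - ln (real n))"
          using l t by (intro mult_left_mono) auto
        finally show "\<phi> (Suc n) - \<phi> n \<le> 2 * pi * real_of_int (- 1 + 1) - t / (4 * U)"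
          unfolding phi by simp
      qed
      also have "\<dots> = 32 * (U / t)" using t U by (simp add: field_simps)
      also have "\<dots> \<le> 2000 * (U / t + sqrt t)" using t U st
        by (intro mult_mono) auto
      finally show ?thesis unfolding eq .
    next
      case False
      define lam where "lam = t / (16 * U\<^sup>2)"
      have lam: "lam > 0" "16 * lam = t / U\<^sup>2" using t U by (auto simp: lam_def)
      have sl: "sqrt lam = sqrt t / (4 * U)"
        using U by (simp add: lam_def real_sqrt_divide real_sqrt_mult)
      have "(\<Sum>n=a..<b. cis (\<phi> n)) = (\<Sum>n<b-a. cis (\<phi> (a + n)))"
        using sum.shift_bounds_nat_ivl[of "\<lambda>n. cis (\<phi> n)" 0 a "b - a"] ab(3)
        by (simp add: lessThan_atLeast0 add.commute)
      also have "norm \<dots> \<le> 24 * 16 * (real (b - a) * sqrt lam + 1 / sqrt lam)"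
      proof (rule second_difference_test[OF lam(1)])
        fix n assume "n < b - a"
        then show "lam \<le> \<phi> (a + Suc (Suc n)) - 2 * \<phi> (a + Suc n) + \<phi> (a + n)"
          "\<phi> (a + Suc (Suc n)) - 2 * \<phi> (a + Suc n) + \<phi> (a + n) \<le> 16 * lam"
          using lo2[of "a + n"] hi2[of "a + n"] unfolding lam(2) by (simp_all add: lam_def)
      qed auto
      also have "\<dots> \<le> 24 * 16 * (3 * U * sqrt lam + 1 / sqrt lam)"
        using ab(2) lam by (intro mult_left_mono add_right_mono mult_right_mono) auto
      also have "\<dots> = 24 * 16 * (3 / 4 * sqrt t + 4 * (U / sqrt t))"
        unfolding sl using U by (simp add: field_simps)
      also have "\<dots> \<le> 24 * 16 * (3 / 4 * sqrt t + 4 * sqrt t)"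
      proof -
        have "U \<le> sqrt t * sqrt t" using False t by simp
        then have "U / sqrt t \<le> sqrt t" using st by (simp add: divide_le_eq)
        then show ?thesis by simp
      qed
      also have "\<dots> \<le> 2000 * (U / t + sqrt t)" using U t st by simp
      finally show ?thesis unfolding eq .
    qed
  qed
qed

lemma norm_dir_sum_triple:
  assumes "U > 0" "\<bar>t\<bar> \<ge> 1"
  shows "norm (dir_sum (triple U) t) \<le> 2000 * (U / \<bar>t\<bar> + sqrt \<bar>t\<bar>)"
proof (cases "t > 0")
  case True
  then show ?thesis using dir_sum_triple_pos[OF assms(1), of t] assms(2) by (simp add: norm_dir_sum_uminus)
next
  case False
  then show ?thesis using dir_sum_triple_pos[OF assms(1), of "- t"] assms(2) by simp
qed

subsection \<open>Higher differences of the logarithm\<close>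

definition rdiff :: "(real \<Rightarrow> real) \<Rightarrow> real \<Rightarrow> real" where
  "rdiff f x = f (x + 1) - f x"

text \<open>Differencing commutes with differentiation, and the differences of \<open>1 / x\<close> have a closed form.\<close>

lemma rdiff_pow_ln_deriv:
  assumes "x > 0"
  shows "((rdiff ^^ m) ln has_real_derivative ((-1) ^ m * fact m / (\<Prod>i\<le>m. x + real i))) (at x)"
  using assms
proof (induction m arbitrary: x)
  case 0
  then show ?case by (auto intro!: derivative_eq_intros)
next
  case (Suc m)
  define p where "p = (\<Prod>i\<le>Suc m. x + real i)"
  have p: "p > 0" unfolding p_def using Suc.prems by (intro prod_pos) auto
  have p1: "(\<Prod>i\<le>m. x + real i) * (x + real m + 1) = p"
    by (simp add: p_def algebra_simps)
  have p2: "(\<Prod>i\<le>m. x + 1 + real i) * x = p"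
    unfolding p_def by (subst prod.atMost_Suc_shift) (simp add: algebra_simps)
  have q1: "1 / (\<Prod>i\<le>m. x + real i) = (x + real m + 1) / p"
  proof -
    have "x + real m + 1 \<noteq> 0" using Suc.prems by simp
    then show ?thesis unfolding p1[symmetric] by simp
  qed
  have q2: "1 / (\<Prod>i\<le>m. x + 1 + real i) = x / p"
    unfolding p2[symmetric] using Suc.prems by simp
  have d1: "((rdiff ^^ m) ln has_real_derivative ((-1) ^ m * fact m / (\<Prod>i\<le>m. x + real i))) (at x)"
    using Suc by simp
  have "((rdiff ^^ m) ln has_real_derivative ((-1) ^ m * fact m / (\<Prod>i\<le>m. x + 1 + real i))) (at (x + 1))"
    using Suc by simp
  then have d2: "((\<lambda>x. (rdiff ^^ m) ln (x + 1)) has_real_derivative ((-1) ^ m * fact m / (\<Prod>i\<le>m. x + 1 + real i))) (at x)"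
    by (simp add: DERIV_shift)
  have "((\<lambda>x. (rdiff ^^ m) ln (x + 1) - (rdiff ^^ m) ln x) has_real_derivative
     ((-1) ^ m * fact m / (\<Prod>i\<le>m. x + 1 + real i) - (-1) ^ m * fact m / (\<Prod>i\<le>m. x + real i))) (at x)"
    by (rule DERIV_diff[OF d2 d1])
  moreover have "(-1) ^ m * fact m / (\<Prod>i\<le>m. x + 1 + real i) - (-1) ^ m * fact m / (\<Prod>i\<le>m. x + real i)
     = (-1) ^ m * fact m * (1 / (\<Prod>i\<le>m. x + 1 + real i) - 1 / (\<Prod>i\<le>m. x + real i))"
    by (simp add: algebra_simps)
  moreover have "\<dots> = (-1) ^ Suc m * fact (Suc m) / p"
    unfolding q1 q2 using p by (simp add: field_simps)
  ultimately show ?case unfolding p_def rdiff_def[abs_def] funpow.simps o_def by simp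
qed

lemma rdiff_pow_ln_bounds:
  assumes "x > 0"
  shows "fact m / (x + real (Suc m)) ^ Suc m \<le> (-1) ^ m * (rdiff ^^ Suc m) ln x"
        "(-1) ^ m * (rdiff ^^ Suc m) ln x \<le> fact m / x ^ Suc m"
proof -
  have "\<exists>z>x. z < x + 1 \<and> (rdiff ^^ m) ln (x + 1) - (rdiff ^^ m) ln x
       = (x + 1 - x) * ((-1) ^ m * fact m / (\<Prod>i\<le>m. z + real i))"
    using assms by (intro MVT2 rdiff_pow_ln_deriv) auto
  then obtain z where z: "z > x" "z < x + 1"
    "(rdiff ^^ Suc m) ln x = (-1) ^ m * fact m / (\<Prod>i\<le>m. z + real i)"
    by (auto simp: rdiff_def)
  have e: "(-1) ^ m * (rdiff ^^ Suc m) ln x = fact m / (\<Prod>i\<le>m. z + real i)"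
    unfolding z(3) by (simp add: power_add[symmetric] flip: mult.assoc)
  have "(\<Prod>i\<le>m. z + real i) \<le> (\<Prod>i\<le>m. x + real (Suc m))"
    using z assms by (intro prod_mono) auto
  then have up: "(\<Prod>i\<le>m. z + real i) \<le> (x + real (Suc m)) ^ Suc m" by simp
  have "(\<Prod>i\<le>m. x) \<le> (\<Prod>i\<le>m. z + real i)"
    using z assms by (intro prod_mono) auto
  then have lo: "x ^ Suc m \<le> (\<Prod>i\<le>m. z + real i)" by simp
  have pos: "(\<Prod>i\<le>m. z + real i) > 0" using z assms by (intro prod_pos) auto
  show "fact m / (x + real (Suc m)) ^ Suc m \<le> (-1) ^ m * (rdiff ^^ Suc m) ln x"
    unfolding e using up pos by (intro divide_left_mono mult_pos_pos) auto
  show "(-1) ^ m * (rdiff ^^ Suc m) ln x \<le> fact m / x ^ Suc m"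
    unfolding e using lo pos assms by (intro divide_left_mono mult_pos_pos) auto
qed

lemma fdiff_pow_ln: "(fdiff ^^ m) (\<lambda>n. ln (real (a + n))) n = (rdiff ^^ m) ln (real (a + n))"
  by (induction m arbitrary: n) (auto simp: fdiff_def rdiff_def add_ac)

text \<open>For \<open>n\<close> of order \<open>P\<close> the differences of order \<open>m + 1\<close> of \<open>t * ln n\<close> have size
\<open>\<bar>t\<bar> / P ^ (m + 1)\<close>, up to a constant. For the given \<open>t\<close> this is between \<open>P powr (-3/2)\<close> and \<open>P powr (-1/2)\<close>: inside the range of \<open>difference_test\<close>.\<close>

lemma dir_sum_range_order:
  assumes m: "m \<ge> 1"
  shows "\<exists>c>0. \<forall>\<^sub>F P in sequentially. \<forall>t. real P powr (real m - 1/2) \<le> \<bar>t\<bar> \<longrightarrow>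
     \<bar>t\<bar> \<le> real P powr (real m + 1/2) \<longrightarrow> norm (dir_sum {P<..9*P} t) \<le> real P powr (1 - c)"
proof -
  define A where "A = (10::real) ^ Suc m"
  have A: "A \<ge> 1" unfolding A_def by (rule one_le_power) simp
  have "difference_test (Suc m)" using m by (intro difference_test) simp
  then obtain c C where cC: "c > 0" "C > 0" and test: "\<And>N N' \<phi> lam. 1 \<le> N \<Longrightarrow> N' \<le> N \<Longrightarrow>
     real N powr (-7/4) \<le> lam \<Longrightarrow> lam \<le> real N powr (-(1/4)) \<Longrightarrow>
     (\<And>n. n<N' \<Longrightarrow> lam \<le> (fdiff ^^ Suc m) \<phi> n \<and> (fdiff ^^ Suc m) \<phi> n \<le> A * lam) \<Longrightarrow>
     norm (\<Sum>n<N'. cis (\<phi> n)) \<le> C * real N powr (1 - c)"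
    by (rule difference_testE[of "Suc m" "1/4" A]) (use A in auto)
  define B where "B = fact m / (10::real) ^ Suc m"
  have B: "B > 0" by (simp add: B_def)
  have ev1: "\<forall>\<^sub>F P::nat in sequentially. (8 * real P) powr (-7/4) \<le> B * real P powr (-3/2)"
    using B by real_asymp
  have ev2: "\<forall>\<^sub>F P::nat in sequentially. B * real P powr (-1/2) \<le> (8 * real P) powr (-(1/4))"
    using B by real_asymp
  have ev3: "\<forall>\<^sub>F P::nat in sequentially. C * (8 * real P) powr (1 - c) \<le> real P powr (1 - c/2)"
    using cC by real_asymp
  have ev4: "\<forall>\<^sub>F P::nat in sequentially. P \<ge> Suc m" by (rule eventually_ge_at_top)
  show ?thesis
  proof (rule exI[of _ "c/2"], rule conjI, use cC in simp)
    show "\<forall>\<^sub>F P in sequentially. \<forall>t. real P powr (real m - 1/2) \<le> \<bar>t\<bar> \<longrightarrow>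
     \<bar>t\<bar> \<le> real P powr (real m + 1/2) \<longrightarrow> norm (dir_sum {P<..9*P} t) \<le> real P powr (1 - c/2)"
      using ev1 ev2 ev3 ev4
    proof eventually_elim
      case (elim P)
      show ?case
      proof (intro allI impI)
        fix t assume t: "real P powr (real m - 1/2) \<le> \<bar>t\<bar>" "\<bar>t\<bar> \<le> real P powr (real m + 1/2)"
        have P: "P > 0" using elim(4) by simp
        \<comment> \<open>The sign for which the differences of the phase are positive; conjugation does not change the norm of the sum.\<close>
        define s where "s = (if (-1) ^ m * t \<ge> 0 then 1 else -1::real)"
        have s: "s = 1 \<or> s = -1" "s * t * (-1) ^ m = \<bar>t\<bar>"
          by (auto simp: s_def minus_one_power_iff split: if_splits)
        define \<phi> where "\<phi> n = s * t * ln (real (Suc P + n))" for n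
        define lam where "lam = \<bar>t\<bar> * fact m / (10 * real P) ^ Suc m"
        have Ppow: "real P ^ Suc m = real P powr (real m + 1)"
          using P powr_realpow[of "real P" "Suc m"] by (simp only: of_nat_Suc of_nat_0_less_iff add.commute)
        have lam_eq: "lam = B * (\<bar>t\<bar> / real P ^ Suc m)"
          by (simp add: lam_def B_def power_mult_distrib mult_ac)
        have "norm (\<Sum>n<8*P. cis (\<phi> n)) \<le> C * real (8*P) powr (1 - c)"
        proof (rule test[where lam = lam])
          have "real (8 * P) powr (-7/4) \<le> B * real P powr (-3/2)" using elim(1) by simp
          also have "real P powr (-3/2) = real P powr (real m - 1/2) / real P ^ Suc m"
            unfolding Ppow using P by (simp add: powr_diff[symmetric])
          also have "B * \<dots> \<le> lam" unfolding lam_eq using B t P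
            by (intro mult_left_mono divide_right_mono) auto
          finally show "real (8 * P) powr (-7/4) \<le> lam" .
          have "lam \<le> B * (real P powr (real m + 1/2) / real P ^ Suc m)"
            unfolding lam_eq using B t P by (intro mult_left_mono divide_right_mono) auto
          also have "real P powr (real m + 1/2) / real P ^ Suc m = real P powr (-1/2)"
            unfolding Ppow using P by (simp add: powr_diff[symmetric])
          also have "B * real P powr (-1/2) \<le> real (8 * P) powr (-(1/4))" using elim(2) by simp
          finally show "lam \<le> real (8 * P) powr (-(1/4))" .
        next
          fix n assume n: "n < 8 * P"
          define x where "x = real (Suc P + n)"
          have x: "x > 0" "real P \<le> x" "x + real (Suc m) \<le> 10 * real P"
            using n elim(4) by (auto simp: x_def)
          have "(fdiff ^^ Suc m) \<phi> n = s * t * (rdiff ^^ Suc m) ln x"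
            unfolding \<phi>_def[abs_def] by (simp only: fdiff_pow_cmult fdiff_pow_ln x_def)
          also have "\<dots> = s * t * (-1) ^ m * ((-1) ^ m * (rdiff ^^ Suc m) ln x)"
            by (simp add: power_add[symmetric] flip: mult.assoc power_mult_distrib)
          finally have e: "(fdiff ^^ Suc m) \<phi> n = \<bar>t\<bar> * ((-1) ^ m * (rdiff ^^ Suc m) ln x)"
            unfolding s(2) .
          have "lam = \<bar>t\<bar> * (fact m / (10 * real P) ^ Suc m)" by (simp add: lam_def)
          also have "\<dots> \<le> \<bar>t\<bar> * (fact m / (x + real (Suc m)) ^ Suc m)"
            using x P by (intro mult_left_mono divide_left_mono power_mono mult_pos_pos zero_less_power) auto
          also have "\<dots> \<le> (fdiff ^^ Suc m) \<phi> n"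
            unfolding e using rdiff_pow_ln_bounds(1)[OF x(1), of m] by (intro mult_left_mono) auto
          finally have lo: "lam \<le> (fdiff ^^ Suc m) \<phi> n" .
          have "(fdiff ^^ Suc m) \<phi> n \<le> \<bar>t\<bar> * (fact m / x ^ Suc m)"
            unfolding e using rdiff_pow_ln_bounds(2)[OF x(1), of m] by (intro mult_left_mono) auto
          also have "\<dots> \<le> \<bar>t\<bar> * (fact m / real P ^ Suc m)"
            using x P by (intro mult_left_mono divide_left_mono power_mono mult_pos_pos zero_less_power) auto
          also have "\<dots> = A * lam" by (simp add: lam_def A_def power_mult_distrib)
          finally show "lam \<le> (fdiff ^^ Suc m) \<phi> n \<and> (fdiff ^^ Suc m) \<phi> n \<le> A * lam" using lo by simp
        qed (use P in auto)
        also have "(\<Sum>n<8*P. cis (\<phi> n)) = dir_sum {P<..9*P} (s * t)"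
        proof -
          have "{P<..9*P} = {Suc P..<Suc P + 8 * P}" by auto
          then show ?thesis
            using sum.shift_bounds_nat_ivl[of "\<lambda>n. cis (s * t * ln (real n))" 0 "Suc P" "8 * P"]
            by (simp add: dir_sum_def \<phi>_def lessThan_atLeast0 add_ac)
        qed
        also have "norm (dir_sum {P<..9*P} (s * t)) = norm (dir_sum {P<..9*P} t)"
          using s(1) by (auto simp: norm_dir_sum_uminus)
        finally show "norm (dir_sum {P<..9*P} t) \<le> real P powr (1 - c/2)"
          using elim(3) by simp
      qed
    qed
  qed
qed

lemma dir_sum_long_range:
  "\<exists>c>0. c \<le> 1/4 \<and> (\<forall>\<^sub>F P in sequentially. \<forall>t. real P powr (1/2) \<le> \<bar>t\<bar> \<longrightarrow>
     \<bar>t\<bar> \<le> real P powr (real K + 1/2) \<longrightarrow> norm (dir_sum {P<..9*P} t) \<le> real P powr (1 - c))"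
proof (induction K)
  case 0
  have "\<forall>\<^sub>F P::nat in sequentially. 8 * real P powr (1/2) \<le> real P powr (1 - 1/4)" by real_asymp
  obtain c where c: "c > 0" and ev: "\<forall>\<^sub>F P in sequentially. \<forall>t. real P powr (real 1 - 1/2) \<le> \<bar>t\<bar> \<longrightarrow>
     \<bar>t\<bar> \<le> real P powr (real 1 + 1/2) \<longrightarrow> norm (dir_sum {P<..9*P} t) \<le> real P powr (1 - c)"
    using dir_sum_range_order[of 1] by auto
  show ?case
  proof (rule exI[of _ "min c (1/4)"], intro conjI)
    show "\<forall>\<^sub>F P in sequentially. \<forall>t. real P powr (1/2) \<le> \<bar>t\<bar> \<longrightarrow>
     \<bar>t\<bar> \<le> real P powr (real 0 + 1/2) \<longrightarrow> norm (dir_sum {P<..9*P} t) \<le> real P powr (1 - min c (1/4))"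
      using ev eventually_ge_at_top[of 1]
    proof eventually_elim
      case (elim P)
      show ?case
      proof (intro allI impI)
        fix t assume t: "real P powr (1/2) \<le> \<bar>t\<bar>" "\<bar>t\<bar> \<le> real P powr (real 0 + 1/2)"
        have "real P powr (1/2) \<le> real P powr (real 1 + 1/2)" using elim(2) by (intro powr_mono) auto
        then have "norm (dir_sum {P<..9*P} t) \<le> real P powr (1 - c)" using elim(1) t by auto
        also have "\<dots> \<le> real P powr (1 - min c (1/4))" using elim(2) by (intro powr_mono) auto
        finally show "norm (dir_sum {P<..9*P} t) \<le> real P powr (1 - min c (1/4))" .
      qed
    qed
  qed (use c in auto)
next
  case (Suc K)
  then obtain c1 where c1: "c1 > 0" "c1 \<le> 1/4" and ev1: "\<forall>\<^sub>F P in sequentially. \<forall>t. real P powr (1/2) \<le> \<bar>t\<bar> \<longrightarrow>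
     \<bar>t\<bar> \<le> real P powr (real K + 1/2) \<longrightarrow> norm (dir_sum {P<..9*P} t) \<le> real P powr (1 - c1)" by auto
  obtain c where c: "c > 0" and ev: "\<forall>\<^sub>F P in sequentially. \<forall>t. real P powr (real (Suc K) - 1/2) \<le> \<bar>t\<bar> \<longrightarrow>
     \<bar>t\<bar> \<le> real P powr (real (Suc K) + 1/2) \<longrightarrow> norm (dir_sum {P<..9*P} t) \<le> real P powr (1 - c)"
    using dir_sum_range_order[of "Suc K"] by auto
  show ?case
  proof (rule exI[of _ "min c c1"], intro conjI)
    show "\<forall>\<^sub>F P in sequentially. \<forall>t. real P powr (1/2) \<le> \<bar>t\<bar> \<longrightarrow>
     \<bar>t\<bar> \<le> real P powr (real (Suc K) + 1/2) \<longrightarrow> norm (dir_sum {P<..9*P} t) \<le> real P powr (1 - min c c1)"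
      using ev ev1 eventually_ge_at_top[of 1]
    proof eventually_elim
      case (elim P)
      show ?case
      proof (intro allI impI)
        fix t assume t: "real P powr (1/2) \<le> \<bar>t\<bar>" "\<bar>t\<bar> \<le> real P powr (real (Suc K) + 1/2)"
        have mono: "real P powr (1 - c) \<le> real P powr (1 - min c c1)" "real P powr (1 - c1) \<le> real P powr (1 - min c c1)"
          using elim(3) by (auto intro!: powr_mono)
        show "norm (dir_sum {P<..9*P} t) \<le> real P powr (1 - min c c1)"
        proof (cases "\<bar>t\<bar> \<le> real P powr (real K + 1/2)")
          case True
          then show ?thesis using elim(2) t mono by (meson order_trans)
        next
          case False
          moreover have "real (Suc K) - 1/2 = real K + 1/2" by simp
          ultimately have "real P powr (real (Suc K) - 1/2) \<le> \<bar>t\<bar>" by (simp only:)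
          then show ?thesis using elim(1) t mono by (meson order_trans)
        qed
      qed
    qed
  qed (use c c1 in auto)
qed

text \<open>The Dirichlet polynomial over \<open>P < p \<le> 9 * P\<close> minus the same sum with \<open>p\<close> running through the multiples of
\<open>1 / B\<close> in this range, weighted by \<open>1 / B\<close>. For fine grids the subtracted sum is close to the integral of \<open>x\<close> to the power \<open>\<i> * t\<close>, which
is what makes the polynomial large for small \<open>t\<close>.\<close>

definition balanced :: "nat \<Rightarrow> nat \<Rightarrow> real \<Rightarrow> complex" where
  "balanced P B t = dir_sum {P<..9*P} t - (\<Sum>b\<in>{B*P<..B*(9*P)}. cis (t * ln (real b / real B))) / of_nat B"

lemma norm_cis_diff_le: "norm (cis a - cis b) \<le> \<bar>a - b\<bar>"
proof -
  have "cis a - cis b = cis b * (cis (a - b) - 1)" by (simp add: algebra_simps cis_mult)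
  then have "norm (cis a - cis b) = 2 * \<bar>sin ((a - b)/2)\<bar>" by (simp add: norm_mult norm_cis_minus_one)
  also have "\<dots> \<le> 2 * \<bar>(a - b)/2\<bar>" by (intro mult_left_mono abs_sin_x_le_abs_x) auto
  finally show ?thesis by simp
qed

text \<open>Each \<open>b\<close> belongs to the block of length \<open>B\<close> that ends at the next multiple of \<open>B\<close>.\<close>

lemma sum_multiples_blocks:
  fixes f :: "nat \<Rightarrow> complex"
  assumes "B > 0"
  shows "(\<Sum>b\<in>{B*P<..B*Q}. f b) = (\<Sum>p\<in>{P<..Q}. \<Sum>i<B. f (B * p - i))"
proof -
  have "(\<Sum>p\<in>{P<..Q}. \<Sum>i<B. f (B * p - i)) = (\<Sum>x\<in>{P<..Q}\<times>{..<B}. f (B * fst x - snd x))"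
    by (simp add: sum.cartesian_product case_prod_beta)
  also have "\<dots> = (\<Sum>b\<in>{B*P<..B*Q}. f b)"
  proof (rule sum.reindex_bij_witness[of _ "\<lambda>b. ((b + B - 1) div B, B * ((b + B - 1) div B) - b)" "\<lambda>x. B * fst x - snd x"])
    fix x assume x: "x \<in> {P<..Q}\<times>{..<B}"
    then obtain p i where pi: "x = (p, i)" "P < p" "p \<le> Q" "i < B" by auto
    have "B * p \<ge> B * Suc P" using pi by (intro mult_le_mono2) auto
    then have ge: "B * p \<ge> B * P + B" by simp
    have "B * p - i + B - 1 = B * p + (B - 1 - i)" using pi ge by auto
    moreover have "(B * p + (B - 1 - i)) div B = p" using pi by (subst div_mult_self4) auto
    ultimately have "(B * p - i + B - 1) div B = p" by simp
    then show "((B * fst x - snd x + B - 1) div B, B * ((B * fst x - snd x + B - 1) div B) - (B * fst x - snd x)) = x"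
      using pi ge by auto
    have "B * p \<le> B * Q" using pi by simp
    then have "B * P < B * p - i" "B * p - i \<le> B * Q" using pi ge by linarith+
    then show "B * fst x - snd x \<in> {B*P<..B*Q}" using pi by (simp only: greaterThanAtMost_iff fst_conv snd_conv)
  next
    fix b assume b: "b \<in> {B*P<..B*Q}"
    define p where "p = (b + B - 1) div B"
    have d: "B * p + (b + B - 1) mod B = b + B - 1" unfolding p_def by simp
    have r: "(b + B - 1) mod B < B" using assms by simp
    have 1: "b \<le> B * p" "B * p < b + B" using d r by linarith+
    have b': "B * P < b" "b \<le> B * Q" using b by auto
    have "B * P < B * p" using b'(1) 1(1) by (rule less_le_trans)
    then have 2: "P < p" by simp
    have "B * p < B * Q + B" using 1(2) b'(2) by linarith
    then have "B * p < B * Suc Q" by (simp only: mult_Suc_right add.commute)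
    then have "0 < B \<and> p < Suc Q" by (simp only: mult_less_cancel1)
    then have 3: "p \<le> Q" by simp
    show "B * fst ((b + B - 1) div B, B * ((b + B - 1) div B) - b) - snd ((b + B - 1) div B, B * ((b + B - 1) div B) - b) = b"
      using 1 by (simp add: p_def)
    show "((b + B - 1) div B, B * ((b + B - 1) div B) - b) \<in> {P<..Q}\<times>{..<B}"
      using 1 2 3 unfolding p_def by auto
  qed simp
  finally show ?thesis by simp
qed

text \<open>Every \<open>p\<close> is compared with the average over the grid points in the interval of length \<open>1\<close> that ends at \<open>p\<close>; there \<open>t * ln x\<close> varies by at most
\<open>\<bar>t\<bar> / P\<close>.\<close>

lemma balanced_small_t:
  assumes P: "P > 0" and B: "B > 0"
  shows "norm (balanced P B t) \<le> 8 * \<bar>t\<bar>"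
proof -
  have "(\<Sum>b\<in>{B*P<..B*(9*P)}. cis (t * ln (real b / real B))) / of_nat B
     = (\<Sum>p\<in>{P<..9*P}. (\<Sum>i<B. cis (t * ln (real (B * p - i) / real B))) / of_nat B)"
    using sum_multiples_blocks[OF B, of "\<lambda>b. cis (t * ln (real b / real B))" P "9*P"]
    by (simp add: sum_divide_distrib)
  then have "balanced P B t = (\<Sum>p\<in>{P<..9*P}. cis (t * ln (real p)) - (\<Sum>i<B. cis (t * ln (real (B * p - i) / real B))) / of_nat B)"
    by (simp add: balanced_def dir_sum_def sum_subtractf)
  also have "norm \<dots> \<le> (\<Sum>p\<in>{P<..9*P}. \<bar>t\<bar> / real P)"
  proof (intro sum_norm_le)
    fix p assume p: "p \<in> {P<..9*P}"
    have "cis (t * ln (real p)) - (\<Sum>i<B. cis (t * ln (real (B * p - i) / real B))) / of_nat B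
       = (\<Sum>i<B. cis (t * ln (real p)) - cis (t * ln (real (B * p - i) / real B))) / of_nat B"
      using B by (simp add: sum_subtractf diff_divide_distrib)
    also have "norm \<dots> = norm (\<Sum>i<B. cis (t * ln (real p)) - cis (t * ln (real (B * p - i) / real B))) / real B"
      by (simp add: norm_divide)
    also have "\<dots> \<le> (\<Sum>i<B. \<bar>t\<bar> / real P) / real B"
    proof (intro divide_right_mono sum_norm_le)
      fix i assume i: "i \<in> {..<B}"
      have "B * 1 \<le> B * p" using p by (intro mult_le_mono2) auto
      then have ge: "i < B * p" using i by (simp only: lessThan_iff mult_1_right)
      have B0: "real B > 0" using B by simp
      define y where "y = real (B * p - i) / real B"
      have ye: "y = real p - real i / real B" using ge B0 by (simp add: y_def of_nat_diff diff_divide_distrib)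
      have ib: "real i / real B \<le> 1" using i B by simp
      have ib0: "0 \<le> real i / real B" by simp
      have p1: "real P + 1 \<le> real p" using p by auto
      have y: "y \<ge> real P" "y \<le> real p" "real p \<le> y + 1" using ib ib0 p1 unfolding ye by linarith+
      have y0: "y > 0" using y P by simp
      have "norm (cis (t * ln (real p)) - cis (t * ln y)) \<le> \<bar>t * ln (real p) - t * ln y\<bar>"
        by (rule norm_cis_diff_le)
      also have "\<dots> = \<bar>t\<bar> * \<bar>ln (real p) - ln y\<bar>" by (simp add: abs_mult flip: right_diff_distrib)
      also have "\<dots> \<le> \<bar>t\<bar> * (1 / real P)"
      proof (intro mult_left_mono)
        have "ln y \<le> ln (real p)" using y y0 by simp
        moreover have "ln (real p) \<le> ln (y + 1)" using y y0 by simp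
        moreover have "ln (y + 1) - ln y \<le> 1 / y" using y0 by (rule ln_Suc_diff_bounds)
        moreover have "1 / y \<le> 1 / real P" using y P by (intro divide_left_mono) auto
        ultimately show "\<bar>ln (real p) - ln y\<bar> \<le> 1 / real P" by linarith
      qed simp
      finally show "norm (cis (t * ln (real p)) - cis (t * ln (real (B * p - i) / real B))) \<le> \<bar>t\<bar> / real P"
        by (simp add: y_def)
    qed simp
    also have "\<dots> = \<bar>t\<bar> / real P" using B by simp
    finally show "norm (cis (t * ln (real p)) - (\<Sum>i<B. cis (t * ln (real (B * p - i) / real B))) / of_nat B) \<le> \<bar>t\<bar> / real P" .
  qed
  also have "\<dots> = 8 * \<bar>t\<bar>" using P by simp
  finally show ?thesis .
qed

text \<open>For \<open>\<bar>t\<bar> < P powr (1/2)\<close> the two sums almost cancel. For larger \<open>t\<close> both are small separately: the sum over \<open>p\<close> by the higher difference tests,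
and the grid sum, of length \<open>8 * B * P\<close> with \<open>\<bar>t\<bar> \<le> B\<close>, by \<open>norm_dir_sum_triple\<close>.\<close>

lemma balanced_bound:
  "\<exists>c>0. c \<le> 1/4 \<and> (\<forall>\<^sub>F P in sequentially. \<forall>B t. B > 0 \<longrightarrow> \<bar>t\<bar> \<le> real B \<longrightarrow>
     \<bar>t\<bar> \<le> real P powr real K \<longrightarrow> norm (balanced P B t) \<le> real P powr (1 - c))"
proof -
  obtain c where c: "c > 0" "c \<le> 1/4" and ev: "\<forall>\<^sub>F P in sequentially. \<forall>t. real P powr (1/2) \<le> \<bar>t\<bar> \<longrightarrow>
     \<bar>t\<bar> \<le> real P powr (real K + 1/2) \<longrightarrow> norm (dir_sum {P<..9*P} t) \<le> real P powr (1 - c)"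
    using dir_sum_long_range[of K] by auto
  have e1: "\<forall>\<^sub>F P::nat in sequentially. 8 * real P powr (1/2) \<le> real P powr (1 - c/2)"
    using c by real_asymp
  have e2: "\<forall>\<^sub>F P::nat in sequentially. real P powr (1 - c) + (8000 * real P powr (1/2) + 4000) \<le> real P powr (1 - c/2)"
    using c by real_asymp
  show ?thesis
  proof (rule exI[of _ "c/2"], intro conjI)
    show "\<forall>\<^sub>F P in sequentially. \<forall>B t. B > 0 \<longrightarrow> \<bar>t\<bar> \<le> real B \<longrightarrow>
     \<bar>t\<bar> \<le> real P powr real K \<longrightarrow> norm (balanced P B t) \<le> real P powr (1 - c/2)"
      using ev e1 e2 eventually_ge_at_top[of 1]
    proof eventually_elim
      case (elim P)
      show ?case
      proof (intro allI impI)
        fix B :: nat and t :: real assume B: "B > 0" and t: "\<bar>t\<bar> \<le> real B" "\<bar>t\<bar> \<le> real P powr real K"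
        show "norm (balanced P B t) \<le> real P powr (1 - c/2)"
        proof (cases "real P powr (1/2) \<le> \<bar>t\<bar>")
          case False
          then show ?thesis using balanced_small_t[of P B t] B elim(2,4) by simp
        next
          case True
          have P1: "real P powr (1/2) \<ge> 1" using elim(4) by (intro ge_one_powr_ge_zero) auto
          then have t1: "\<bar>t\<bar> \<ge> 1" using True by linarith
          have "real P powr real K \<le> real P powr (real K + 1/2)" using elim(4) by (intro powr_mono) auto
          then have A: "norm (dir_sum {P<..9*P} t) \<le> real P powr (1 - c)" using elim(1) True t by auto
          have split: "{B*P<..B*(9*P)} = triple (real (B*P)) \<union> triple (real (3*(B*P)))"
          proof (intro equalityI subsetI)
            fix n assume "n \<in> {B*P<..B*(9*P)}"
            then have "B * P < n" "n \<le> 9 * (B * P)" by auto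
            then have "real (B * P) < real n" "real n \<le> 3 * real (3 * (B*P))" by linarith+
            then show "n \<in> triple (real (B*P)) \<union> triple (real (3*(B*P)))"
              by (auto simp: triple_def)
          next
            fix n assume "n \<in> triple (real (B*P)) \<union> triple (real (3*(B*P)))"
            then have "real (B * P) < real n \<and> real n \<le> 9 * real (B * P)"
              by (auto simp: triple_def)
            then have "B * P < n \<and> n \<le> 9 * (B * P)" by linarith
            then show "n \<in> {B*P<..B*(9*P)}" by auto
          qed
          have disj: "triple (real (B*P)) \<inter> triple (real (3*(B*P))) = {}"
            by (auto simp: triple_def)
          have "(\<Sum>b\<in>{B*P<..B*(9*P)}. cis (t * ln (real b / real B)))
             = (\<Sum>b\<in>{B*P<..B*(9*P)}. cis (t * ln (real b)) * cis (- t * ln (real B)))"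
            using B by (intro sum.cong) (auto simp: ln_div cis_mult algebra_simps)
          also have "\<dots> = dir_sum {B*P<..B*(9*P)} t * cis (- t * ln (real B))"
            by (simp add: dir_sum_def sum_distrib_right)
          finally have "norm (\<Sum>b\<in>{B*P<..B*(9*P)}. cis (t * ln (real b / real B))) = norm (dir_sum {B*P<..B*(9*P)} t)"
            by (simp add: norm_mult)
          also have "\<dots> = norm (dir_sum (triple (real (B*P))) t + dir_sum (triple (real (3*(B*P)))) t)"
            unfolding split dir_sum_def using disj by (simp add: sum.union_disjoint)
          also have "\<dots> \<le> 2000 * (real (B*P) / \<bar>t\<bar> + sqrt \<bar>t\<bar>) + 2000 * (real (3*(B*P)) / \<bar>t\<bar> + sqrt \<bar>t\<bar>)"
            using B elim(4) t1 by (intro norm_triangle_mono norm_dir_sum_triple) auto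
          also have "\<dots> = 8000 * (real B * (real P / \<bar>t\<bar>)) + 4000 * sqrt \<bar>t\<bar>"
            by (simp add: field_simps)
          also have "\<dots> \<le> 8000 * (real B * real P powr (1/2)) + 4000 * real B"
          proof (intro add_mono mult_left_mono)
            have "real P / \<bar>t\<bar> \<le> real P / real P powr (1/2)"
              using True P1 t1 elim(4) by (intro divide_left_mono mult_pos_pos) auto
            also have "\<dots> = real P powr (1/2)"
              using powr_diff[of "real P" 1 "1/2"] elim(4) by simp
            finally show "real P / \<bar>t\<bar> \<le> real P powr (1/2)" .
            have "sqrt \<bar>t\<bar> * 1 \<le> sqrt \<bar>t\<bar> * sqrt \<bar>t\<bar>" using t1 by (intro mult_left_mono) auto
            then show "sqrt \<bar>t\<bar> \<le> real B" using t by simp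
          qed auto
          finally have "norm ((\<Sum>b\<in>{B*P<..B*(9*P)}. cis (t * ln (real b / real B))) / of_nat B) \<le> 8000 * real P powr (1/2) + 4000"
            using B by (simp add: norm_divide field_simps)
          then have "norm (balanced P B t) \<le> real P powr (1 - c) + (8000 * real P powr (1/2) + 4000)"
            unfolding balanced_def using A norm_triangle_ineq4 by (meson add_mono order_trans)
          then show ?thesis using elim(3) by linarith
        qed
      qed
    qed
  qed (use c in auto)
qed

section \<open>The large sieve with integer frequencies\<close>

lemma sum_inverse_le_ln: "L \<ge> 1 \<Longrightarrow> (\<Sum>n=1..L. 1 / real n) \<le> 1 + ln (real L)"
proof (induction L rule: dec_induct)
  case (step L)
  have "1 / (real L + 1) \<le> ln (real L + 1) - ln (real L)" using step by (intro ln_Suc_diff_bounds) auto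
  then show ?case using step by (simp add: add.commute)
qed auto

lemma sum_inverse_abs_int_le:
  assumes J: "finite J" "\<And>m. m \<in> J \<Longrightarrow> m \<noteq> 0 \<and> \<bar>m\<bar> \<le> int L" and L: "L \<ge> 1"
  shows "(\<Sum>m\<in>J. 1 / real_of_int \<bar>m\<bar>) \<le> 2 * (1 + ln (real L))"
proof -
  have h: "(\<Sum>m\<in>int ` {1..L}. 1 / real_of_int \<bar>m\<bar>) = (\<Sum>n=1..L. 1 / real n)"
    by (subst sum.reindex) auto
  have h': "(\<Sum>m\<in>(\<lambda>n. - int n) ` {1..L}. 1 / real_of_int \<bar>m\<bar>) = (\<Sum>n=1..L. 1 / real n)"
    by (subst sum.reindex) (auto simp: inj_on_def)
  have "J \<subseteq> int ` {1..L} \<union> (\<lambda>n. - int n) ` {1..L}"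
  proof
    fix m assume m: "m \<in> J"
    show "m \<in> int ` {1..L} \<union> (\<lambda>n. - int n) ` {1..L}"
    proof (cases "m > 0")
      case True
      then have "m = int (nat m)" "nat m \<in> {1..L}" using J(2)[OF m] by auto
      then show ?thesis by blast
    next
      case False
      then have "m = - int (nat (-m))" "nat (-m) \<in> {1..L}" using J(2)[OF m] by auto
      then show ?thesis by blast
    qed
  qed
  then have "(\<Sum>m\<in>J. 1 / real_of_int \<bar>m\<bar>) \<le> (\<Sum>m\<in>int ` {1..L} \<union> (\<lambda>n. - int n) ` {1..L}. 1 / real_of_int \<bar>m\<bar>)"
    by (intro sum_mono2) auto
  also have "\<dots> = (\<Sum>m\<in>int ` {1..L}. 1 / real_of_int \<bar>m\<bar>) + (\<Sum>m\<in>(\<lambda>n. - int n) ` {1..L}. 1 / real_of_int \<bar>m\<bar>)"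
    by (intro sum.union_disjoint) auto
  finally have "(\<Sum>m\<in>J. 1 / real_of_int \<bar>m\<bar>) \<le> 2 * (\<Sum>n=1..L. 1 / real n)" unfolding h h' by simp
  also have "\<dots> \<le> 2 * (1 + ln (real L))"
    using sum_inverse_le_ln[OF L] by (intro mult_left_mono) auto
  finally show ?thesis .
qed

text \<open>The restriction \<open>\<bar>\<phi>\<bar> \<le> 3\<close> keeps \<open>\<phi>\<close> away from \<open>2 * pi\<close>, the next point where the kernel is large. In all
applications below the points are logarithms of numbers of comparable size.\<close>

lemma Dirichlet_kernel_bound:
  assumes "0 < \<bar>\<phi>\<bar>" "\<bar>\<phi>\<bar> \<le> 3"
  shows "norm (\<Sum>t\<in>{-int M..int M}. cis (of_int t * \<phi>)) \<le> 4 / \<bar>\<phi>\<bar>"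
proof -
  have "\<bar>\<phi>\<bar> / 4 \<le> sin (\<bar>\<phi>\<bar> / 2)" using sin_ge_half[of "\<bar>\<phi>\<bar>/2"] assms by simp
  also have "\<dots> \<le> \<bar>sin (\<phi> / 2)\<bar>" by (cases "\<phi> \<ge> 0") auto
  finally have s: "\<bar>\<phi>\<bar> / 4 \<le> \<bar>sin (\<phi> / 2)\<bar>" .
  have n1: "norm (cis \<phi> - 1) = 2 * \<bar>sin (\<phi>/2)\<bar>" by (rule norm_cis_minus_one)
  have ne: "cis \<phi> \<noteq> 1" using n1 s assms by auto
  have "(\<Sum>t\<in>{-int M..int M}. cis (of_int t * \<phi>)) = (\<Sum>n<2*M+1. cis (real_of_int (int n - int M) * \<phi>))"
    by (rule sum.reindex_bij_witness[of _ "\<lambda>n. int n - int M" "\<lambda>t. nat (t + int M)"]) auto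
  also have "\<dots> = cis (- real M * \<phi>) * (\<Sum>n<2*M+1. cis \<phi> ^ n)"
    unfolding sum_distrib_left by (intro sum.cong) (auto simp: Complex.DeMoivre cis_mult algebra_simps)
  also have "\<dots> = cis (- real M * \<phi>) * ((cis \<phi> ^ (2*M+1) - 1) / (cis \<phi> - 1))"
    by (subst geometric_sum[OF ne]) simp
  finally have e: "(\<Sum>t\<in>{-int M..int M}. cis (of_int t * \<phi>)) = cis (- real M * \<phi>) * ((cis \<phi> ^ (2*M+1) - 1) / (cis \<phi> - 1))" .
  have "norm (\<Sum>t\<in>{-int M..int M}. cis (of_int t * \<phi>)) = norm (cis \<phi> ^ (2*M+1) - 1) / (2 * \<bar>sin (\<phi>/2)\<bar>)"
    unfolding e by (simp add: norm_mult norm_divide n1)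
  also have "\<dots> \<le> 2 / (2 * (\<bar>\<phi>\<bar> / 4))"
  proof (rule frac_le)
    have "norm (cis \<phi> ^ (2*M+1) - 1) \<le> norm (cis \<phi> ^ (2*M+1)) + norm (1::complex)" by (rule norm_triangle_ineq4)
    then show "norm (cis \<phi> ^ (2*M+1) - 1) \<le> 2" by (simp add: norm_mult norm_power)
  qed (use s assms in auto)
  finally show ?thesis by simp
qed

text \<open>The norm bound of the large sieve by the test of Schur: \<open>2 * M + 1\<close> from the diagonal, the rest from the off-diagonal entries, which
decay like \<open>1 / \<Delta>\<close>, \<open>1 / (2 * \<Delta>)\<close> and so on.\<close>

definition sieve_const :: "nat \<Rightarrow> real \<Rightarrow> real" where
  "sieve_const M \<Delta> = 2 * real M + 1 + 16 / \<Delta> * (1 + ln (1 + 3 / \<Delta>))"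

text \<open>Rounding the points to multiples of \<open>\<Delta>\<close> gives distinct integers, at the cost of a factor \<open>2\<close> in the distances;
then the sum is harmonic.\<close>

lemma spaced_inverse_sum_le:
  fixes \<theta> :: "'a \<Rightarrow> real"
  assumes I: "finite I" and D: "\<Delta> > 0" and j: "j \<in> I"
    and sep: "\<And>i j. i \<in> I \<Longrightarrow> j \<in> I \<Longrightarrow> i \<noteq> j \<Longrightarrow> \<Delta> \<le> \<bar>\<theta> i - \<theta> j\<bar>"
    and near: "\<And>i j. i \<in> I \<Longrightarrow> j \<in> I \<Longrightarrow> \<bar>\<theta> i - \<theta> j\<bar> \<le> 3"
  shows "(\<Sum>i\<in>I-{j}. 4 / \<bar>\<theta> i - \<theta> j\<bar>) \<le> 16 / \<Delta> * (1 + ln (1 + 3 / \<Delta>))"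
proof -
  define m where "m i = \<lfloor>\<theta> i / \<Delta>\<rfloor>" for i
  have fl: "of_int (m i) * \<Delta> \<le> \<theta> i" "\<theta> i < (of_int (m i) + 1) * \<Delta>" for i
  proof -
    have "of_int (m i) \<le> \<theta> i / \<Delta>" "\<theta> i / \<Delta> < of_int (m i) + 1" unfolding m_def by linarith+
    then show "of_int (m i) * \<Delta> \<le> \<theta> i" "\<theta> i < (of_int (m i) + 1) * \<Delta>"
      using D by (simp_all add: field_simps)
  qed
  have dist: "m i \<noteq> m k" if "i \<in> I" "k \<in> I" "i \<noteq> k" for i k
  proof
    assume "m i = m k"
    then have "\<bar>\<theta> i - \<theta> k\<bar> < \<Delta>" using fl[of i] fl[of k] by (simp add: algebra_simps)
    then show False using sep[OF that] by simp
  qed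
  have lower: "\<bar>\<theta> i - \<theta> j\<bar> \<ge> \<Delta> * of_int \<bar>m i - m j\<bar> / 2" if i: "i \<in> I - {j}" for i
  proof (cases "\<bar>m i - m j\<bar> \<le> 2")
    case True
    then have "real_of_int \<bar>m i - m j\<bar> \<le> 2" by linarith
    then have "\<Delta> * of_int \<bar>m i - m j\<bar> \<le> \<Delta> * 2" using D by (intro mult_left_mono) auto
    then show ?thesis using sep[of i j] i j by simp
  next
    case False
    have "\<bar>\<theta> i - \<theta> j\<bar> \<ge> \<Delta> * (of_int \<bar>m i - m j\<bar> - 1)"
      using fl[of i] fl[of j] D by (cases "m i \<ge> m j") (auto simp: algebra_simps)
    moreover have "\<Delta> * (of_int \<bar>m i - m j\<bar> - 1) \<ge> \<Delta> * (of_int \<bar>m i - m j\<bar> / 2)"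
    proof (rule mult_left_mono)
      have "\<bar>m i - m j\<bar> \<ge> 3" using False by linarith
      then have "real_of_int \<bar>m i - m j\<bar> \<ge> 3" by linarith
      moreover have "x / 2 \<le> x - 1" if "3 \<le> x" for x :: real using that by linarith
      ultimately show "real_of_int \<bar>m i - m j\<bar> / 2 \<le> real_of_int \<bar>m i - m j\<bar> - 1" by blast
    qed (use D in simp)
    ultimately show ?thesis by simp
  qed
  have upper: "\<bar>m i - m j\<bar> \<le> int (nat \<lfloor>1 + 3 / \<Delta>\<rfloor>)" if i: "i \<in> I - {j}" for i
  proof -
    have "real_of_int \<bar>m i - m j\<bar> \<le> \<bar>\<theta> i - \<theta> j\<bar> / \<Delta> + 1"
    proof -
      have "\<bar>\<theta> i / \<Delta> - \<theta> j / \<Delta>\<bar> = \<bar>\<theta> i - \<theta> j\<bar> / \<Delta>" using D by (simp add: diff_divide_distrib[symmetric] abs_divide)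
      then show ?thesis unfolding m_def by linarith
    qed
    also have "\<dots> \<le> 3 / \<Delta> + 1" using near[of i j] i j D by (intro add_right_mono divide_right_mono) auto
    finally have "\<bar>m i - m j\<bar> \<le> \<lfloor>1 + 3 / \<Delta>\<rfloor>" by linarith
    moreover have "0 \<le> \<lfloor>1 + 3 / \<Delta>\<rfloor>" using D by simp
    ultimately show ?thesis by simp
  qed
  define L where "L = nat \<lfloor>1 + 3 / \<Delta>\<rfloor>"
  have d3: "3 / \<Delta> > 0" using D by simp
  have L: "L \<ge> 1" "real L \<le> 1 + 3 / \<Delta>" unfolding L_def using d3 by linarith+
  have "(\<Sum>i\<in>I-{j}. 4 / \<bar>\<theta> i - \<theta> j\<bar>) \<le> (\<Sum>i\<in>I-{j}. 8 / \<Delta> * (1 / of_int \<bar>m i - m j\<bar>))"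
  proof (rule sum_mono)
    fix i assume i: "i \<in> I - {j}"
    have p: "real_of_int \<bar>m i - m j\<bar> > 0" using dist[of i j] i j by auto
    have "4 / \<bar>\<theta> i - \<theta> j\<bar> \<le> 4 / (\<Delta> * of_int \<bar>m i - m j\<bar> / 2)"
    proof -
      have q: "0 < \<Delta> * of_int \<bar>m i - m j\<bar> / 2" using p D by simp
      show ?thesis
        by (rule divide_left_mono[OF lower[OF i] _ mult_pos_pos[OF less_le_trans[OF q lower[OF i]] q]]) simp
    qed
    then show "4 / \<bar>\<theta> i - \<theta> j\<bar> \<le> 8 / \<Delta> * (1 / of_int \<bar>m i - m j\<bar>)" by (simp add: mult.commute)
  qed
  also have "\<dots> = 8 / \<Delta> * (\<Sum>i\<in>I-{j}. 1 / of_int \<bar>m i - m j\<bar>)"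
    by (simp add: sum_distrib_left)
  also have "\<dots> \<le> 8 / \<Delta> * (2 * (1 + ln (1 + 3 / \<Delta>)))"
  proof (rule mult_left_mono)
    have "(\<Sum>i\<in>I-{j}. 1 / real_of_int \<bar>m i - m j\<bar>) = (\<Sum>n\<in>(\<lambda>i. m i - m j) ` (I - {j}). 1 / of_int \<bar>n\<bar>)"
    proof (subst sum.reindex)
      show "inj_on (\<lambda>i. m i - m j) (I - {j})" using dist by (auto simp: inj_on_def)
    qed (simp add: o_def)
    also have "\<dots> \<le> 2 * (1 + ln (real L))"
      using I upper dist j L(1) by (intro sum_inverse_abs_int_le) (auto simp: L_def)
    also have "\<dots> \<le> 2 * (1 + ln (1 + 3 / \<Delta>))"
      using L by simp
    finally show "(\<Sum>i\<in>I-{j}. 1 / real_of_int \<bar>m i - m j\<bar>) \<le> 2 * (1 + ln (1 + 3 / \<Delta>))" .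
  qed (use D in simp)
  finally show ?thesis by simp
qed

lemma Schur_bound:
  fixes K :: "'a \<Rightarrow> 'a \<Rightarrow> complex"
  assumes "finite I" and sym: "\<And>i j. norm (K i j) = norm (K j i)"
    and row: "\<And>j. j \<in> I \<Longrightarrow> (\<Sum>i\<in>I. norm (K i j)) \<le> B"
  shows "norm (\<Sum>i\<in>I. \<Sum>j\<in>I. a i * cnj (a j) * K i j) \<le> B * (\<Sum>i\<in>I. (norm (a i))\<^sup>2)"
proof -
  have "norm (\<Sum>i\<in>I. \<Sum>j\<in>I. a i * cnj (a j) * K i j) \<le> (\<Sum>i\<in>I. \<Sum>j\<in>I. ((norm (a i))\<^sup>2 + (norm (a j))\<^sup>2) / 2 * norm (K i j))"
  proof (intro sum_norm_le)
    fix i j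
    have "norm (a i * cnj (a j) * K i j) = norm (a i) * norm (a j) * norm (K i j)" by (simp add: norm_mult)
    also have "\<dots> \<le> ((norm (a i))\<^sup>2 + (norm (a j))\<^sup>2) / 2 * norm (K i j)"
    proof (intro mult_right_mono)
      have "0 \<le> (norm (a i) - norm (a j))\<^sup>2" by simp
      then show "norm (a i) * norm (a j) \<le> ((norm (a i))\<^sup>2 + (norm (a j))\<^sup>2) / 2" by (simp add: power2_eq_square algebra_simps)
    qed simp
    finally show "norm (a i * cnj (a j) * K i j) \<le> ((norm (a i))\<^sup>2 + (norm (a j))\<^sup>2) / 2 * norm (K i j)" .
  qed
  also have "\<dots> = (\<Sum>i\<in>I. \<Sum>j\<in>I. (norm (a i))\<^sup>2 * norm (K i j)) / 2 + (\<Sum>i\<in>I. \<Sum>j\<in>I. (norm (a j))\<^sup>2 * norm (K i j)) / 2"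
    by (simp add: sum.distrib[symmetric] sum_divide_distrib add_divide_distrib algebra_simps)
  also have "(\<Sum>i\<in>I. \<Sum>j\<in>I. (norm (a j))\<^sup>2 * norm (K i j)) = (\<Sum>i\<in>I. \<Sum>j\<in>I. (norm (a i))\<^sup>2 * norm (K i j))"
    by (subst sum.swap) (simp add: sym[of _ _])
  also have "(\<Sum>i\<in>I. \<Sum>j\<in>I. (norm (a i))\<^sup>2 * norm (K i j)) / 2 + (\<Sum>i\<in>I. \<Sum>j\<in>I. (norm (a i))\<^sup>2 * norm (K i j)) / 2
     = (\<Sum>i\<in>I. (norm (a i))\<^sup>2 * (\<Sum>j\<in>I. norm (K j i)))"
    by (simp add: sum_distrib_left sym[of _ _])
  also have "\<dots> \<le> (\<Sum>i\<in>I. (norm (a i))\<^sup>2 * B)"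
    using row by (intro sum_mono mult_left_mono) auto
  also have "\<dots> = B * (\<Sum>i\<in>I. (norm (a i))\<^sup>2)" by (simp add: sum_distrib_left mult.commute)
  finally show ?thesis .
qed

lemma norm_square_sum_expand:
  fixes a :: "'a \<Rightarrow> complex" and \<theta> :: "'a \<Rightarrow> real"
  shows "complex_of_real ((norm (\<Sum>i\<in>I. a i * cis (s * \<theta> i)))\<^sup>2)
    = (\<Sum>i\<in>I. \<Sum>j\<in>I. a i * cnj (a j) * cis (s * (\<theta> i - \<theta> j)))"
proof -
  have "complex_of_real ((norm (\<Sum>i\<in>I. a i * cis (s * \<theta> i)))\<^sup>2)
     = (\<Sum>i\<in>I. a i * cis (s * \<theta> i)) * cnj (\<Sum>i\<in>I. a i * cis (s * \<theta> i))"
    by (rule complex_norm_square)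
  also have "\<dots> = (\<Sum>i\<in>I. \<Sum>j\<in>I. (a i * cis (s * \<theta> i)) * cnj (a j * cis (s * \<theta> j)))"
    unfolding cnj_sum by (rule sum_product)
  also have "\<dots> = (\<Sum>i\<in>I. \<Sum>j\<in>I. a i * cnj (a j) * cis (s * (\<theta> i - \<theta> j)))"
  proof (intro sum.cong refl)
    fix i j
    have "cis (s * (\<theta> i - \<theta> j)) = cis (s * \<theta> i) * cnj (cis (s * \<theta> j))"
      by (simp add: cis_cnj cis_mult algebra_simps)
    then show "(a i * cis (s * \<theta> i)) * cnj (a j * cis (s * \<theta> j)) = a i * cnj (a j) * cis (s * (\<theta> i - \<theta> j))"
      by (simp add: mult_ac)
  qed
  finally show ?thesis .
qed

lemma large_sieve_frequencies:
  fixes \<theta> :: "'a \<Rightarrow> real" and a :: "'a \<Rightarrow> complex"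
  assumes I: "finite I" and D: "\<Delta> > 0"
    and sep: "\<And>i j. i \<in> I \<Longrightarrow> j \<in> I \<Longrightarrow> i \<noteq> j \<Longrightarrow> \<Delta> \<le> \<bar>\<theta> i - \<theta> j\<bar>"
    and near: "\<And>i j. i \<in> I \<Longrightarrow> j \<in> I \<Longrightarrow> \<bar>\<theta> i - \<theta> j\<bar> \<le> 3"
  shows "(\<Sum>t\<in>{-int M..int M}. (norm (\<Sum>i\<in>I. a i * cis (of_int t * \<theta> i)))\<^sup>2)
     \<le> sieve_const M \<Delta> * (\<Sum>i\<in>I. (norm (a i))\<^sup>2)"
proof -
  define K where "K i j = (\<Sum>t\<in>{-int M..int M}. cis (of_int t * (\<theta> i - \<theta> j)))" for i j
  have sym: "norm (K i j) = norm (K j i)" for i j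
  proof -
    have "K i j = cnj (K j i)" by (simp add: K_def cis_cnj algebra_simps)
    then show ?thesis by simp
  qed
  have row: "(\<Sum>i\<in>I. norm (K i j)) \<le> sieve_const M \<Delta>" if j: "j \<in> I" for j
  proof -
    have "(\<Sum>i\<in>I. norm (K i j)) = norm (K j j) + (\<Sum>i\<in>I-{j}. norm (K i j))"
      using I j by (simp add: sum.remove)
    also have "norm (K j j) = 2 * real M + 1"
    proof -
      have "K j j = of_nat (card {-int M..int M})" by (simp add: K_def)
      also have "card {-int M..int M} = 2 * M + 1" by simp
      finally have "norm (K j j) = norm (of_nat (2 * M + 1) :: complex)" by (simp only:)
      also have "\<dots> = real (2 * M + 1)" by (rule norm_of_nat)
      finally show ?thesis by simp
    qed
    also have "(\<Sum>i\<in>I-{j}. norm (K i j)) \<le> (\<Sum>i\<in>I-{j}. 4 / \<bar>\<theta> i - \<theta> j\<bar>)"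
    proof (intro sum_mono)
      fix i assume i: "i \<in> I - {j}"
      then have "0 < \<bar>\<theta> i - \<theta> j\<bar>" using sep[of i j] j D by fastforce
      then show "norm (K i j) \<le> 4 / \<bar>\<theta> i - \<theta> j\<bar>"
        unfolding K_def using near[of i j] i j by (intro Dirichlet_kernel_bound) auto
    qed
    also have "\<dots> \<le> 16 / \<Delta> * (1 + ln (1 + 3 / \<Delta>))"
      by (rule spaced_inverse_sum_le[OF I D j sep near]) 
    finally show ?thesis by (simp add: sieve_const_def)
  qed
  have "complex_of_real (\<Sum>t\<in>{-int M..int M}. (norm (\<Sum>i\<in>I. a i * cis (of_int t * \<theta> i)))\<^sup>2)
     = (\<Sum>t\<in>{-int M..int M}. \<Sum>i\<in>I. \<Sum>j\<in>I. a i * cnj (a j) * cis (of_int t * (\<theta> i - \<theta> j)))"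
    unfolding of_real_sum by (intro sum.cong refl norm_square_sum_expand)
  also have "\<dots> = (\<Sum>i\<in>I. \<Sum>j\<in>I. a i * cnj (a j) * K i j)"
    unfolding K_def sum_distrib_left
    by (subst sum.swap, rule sum.cong[OF refl], rule sum.swap)
  finally have e: "complex_of_real (\<Sum>t\<in>{-int M..int M}. (norm (\<Sum>i\<in>I. a i * cis (of_int t * \<theta> i)))\<^sup>2) = \<dots>" .
  have "(\<Sum>t\<in>{-int M..int M}. (norm (\<Sum>i\<in>I. a i * cis (of_int t * \<theta> i)))\<^sup>2)
     = norm (complex_of_real (\<Sum>t\<in>{-int M..int M}. (norm (\<Sum>i\<in>I. a i * cis (of_int t * \<theta> i)))\<^sup>2))"
    by (simp add: sum_nonneg del: of_real_sum of_real_power)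
  also have "\<dots> \<le> sieve_const M \<Delta> * (\<Sum>i\<in>I. (norm (a i))\<^sup>2)"
    unfolding e by (rule Schur_bound[OF I sym row])
  finally show ?thesis .
qed

text \<open>A matrix and its transpose have the same norm: the sum on the left is \<open>V\<close>, it equals the pairing of \<open>b\<close> with the image of the vector
\<open>cnj (B i)\<close> of squared norm \<open>V\<close>, and Cauchy--Schwarz gives \<open>V\<^sup>2 \<le> K * V * \<dots>\<close>.\<close>

lemma finite_duality:
  fixes c :: "'i \<Rightarrow> 't \<Rightarrow> complex"
  assumes fin: "finite I" "finite S" and K: "0 \<le> K"
    and bound: "\<And>a. (\<Sum>t\<in>S. (norm (\<Sum>i\<in>I. a i * c i t))\<^sup>2) \<le> K * (\<Sum>i\<in>I. (norm (a i))\<^sup>2)"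
  shows "(\<Sum>i\<in>I. (norm (\<Sum>t\<in>S. b t * c i t))\<^sup>2) \<le> K * (\<Sum>t\<in>S. (norm (b t))\<^sup>2)"
proof -
  define B where "B i = (\<Sum>t\<in>S. b t * c i t)" for i
  define V where "V = (\<Sum>i\<in>I. (norm (B i))\<^sup>2)"
  have V0: "V \<ge> 0" by (simp add: V_def sum_nonneg)
  have "complex_of_real V = (\<Sum>i\<in>I. B i * cnj (B i))"
    unfolding V_def of_real_sum by (intro sum.cong refl complex_norm_square)
  also have "\<dots> = (\<Sum>i\<in>I. \<Sum>t\<in>S. b t * (cnj (B i) * c i t))"
    by (simp add: B_def sum_distrib_right mult_ac)
  also have "\<dots> = (\<Sum>t\<in>S. b t * (\<Sum>i\<in>I. cnj (B i) * c i t))"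
    by (subst sum.swap) (simp add: sum_distrib_left)
  finally have e: "complex_of_real V = (\<Sum>t\<in>S. b t * (\<Sum>i\<in>I. cnj (B i) * c i t))" .
  have "V = norm (complex_of_real V)" using V0 by simp
  also have "\<dots> \<le> (\<Sum>t\<in>S. norm (b t) * norm (\<Sum>i\<in>I. cnj (B i) * c i t))"
    unfolding e by (intro sum_norm_le) (simp add: norm_mult)
  finally have "V\<^sup>2 \<le> (\<Sum>t\<in>S. norm (b t) * norm (\<Sum>i\<in>I. cnj (B i) * c i t))\<^sup>2"
    using V0 by (intro power_mono) auto
  also have "\<dots> \<le> (\<Sum>t\<in>S. (norm (b t))\<^sup>2) * (\<Sum>t\<in>S. (norm (\<Sum>i\<in>I. cnj (B i) * c i t))\<^sup>2)"
    by (rule Cauchy_Schwarz_ineq_sum)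
  also have "\<dots> \<le> (\<Sum>t\<in>S. (norm (b t))\<^sup>2) * (K * V)"
    using bound[of "\<lambda>i. cnj (B i)"] by (intro mult_left_mono sum_nonneg) (auto simp: V_def)
  finally have "V * V \<le> (K * (\<Sum>t\<in>S. (norm (b t))\<^sup>2)) * V" by (simp add: power2_eq_square mult_ac)
  moreover have "0 \<le> K * (\<Sum>t\<in>S. (norm (b t))\<^sup>2)" using K by (simp add: sum_nonneg)
  ultimately have "V \<le> K * (\<Sum>t\<in>S. (norm (b t))\<^sup>2)"
    using V0 by (cases "V = 0") (auto simp: mult_le_cancel_right)
  then show ?thesis by (simp add: V_def B_def)
qed

lemma sieve_const_nonneg: "\<Delta> > 0 \<Longrightarrow> 0 \<le> sieve_const M \<Delta>"
  unfolding sieve_const_def by (intro add_nonneg_nonneg mult_nonneg_nonneg) auto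

lemma large_sieve_points:
  fixes \<theta> :: "'a \<Rightarrow> real" and b :: "int \<Rightarrow> complex"
  assumes I: "finite I" and D: "\<Delta> > 0"
    and sep: "\<And>i j. i \<in> I \<Longrightarrow> j \<in> I \<Longrightarrow> i \<noteq> j \<Longrightarrow> \<Delta> \<le> \<bar>\<theta> i - \<theta> j\<bar>"
    and near: "\<And>i j. i \<in> I \<Longrightarrow> j \<in> I \<Longrightarrow> \<bar>\<theta> i - \<theta> j\<bar> \<le> 3"
  shows "(\<Sum>i\<in>I. (norm (\<Sum>t\<in>{-int M..int M}. b t * cis (of_int t * \<theta> i)))\<^sup>2)
     \<le> sieve_const M \<Delta> * (\<Sum>t\<in>{-int M..int M}. (norm (b t))\<^sup>2)"
  by (rule finite_duality[OF I _ sieve_const_nonneg[OF D]]) (auto intro!: large_sieve_frequencies[OF I D sep near])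

section \<open>Divisors and representations as products\<close>

lemma card_divisors_mult_le:
  assumes "a > 0" "b > (0::nat)"
  shows "card {d. d dvd a * b} \<le> card {d. d dvd a} * card {d. d dvd b}"
proof -
  have fin: "finite {d. d dvd a}" "finite {d. d dvd b}" using assms by auto
  have "{d. d dvd a * b} \<subseteq> (\<lambda>(x, y). x * y) ` ({d. d dvd a} \<times> {d. d dvd b})"
  proof
    fix d assume "d \<in> {d. d dvd a * b}"
    then obtain x y where "d = x * y" "x dvd a" "y dvd b" using division_decomp[of d a b] by auto
    then show "d \<in> (\<lambda>(x, y). x * y) ` ({d. d dvd a} \<times> {d. d dvd b})" by force
  qed
  then have "card {d. d dvd a * b} \<le> card ((\<lambda>(x, y). x * y) ` ({d. d dvd a} \<times> {d. d dvd b}))"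
    using fin by (intro card_mono) auto
  also have "\<dots> \<le> card ({d. d dvd a} \<times> {d. d dvd b})" using fin by (intro card_image_le) auto
  finally show ?thesis by (simp add: card_cartesian_product)
qed

lemma card_divisors_prime_power_le:
  assumes "prime (p::nat)"
  shows "card {d. d dvd p ^ e} \<le> e + 1"
proof -
  have "{d. d dvd p ^ e} \<subseteq> (\<lambda>i. p ^ i) ` {..e}"
    using divides_primepow_nat[OF assms] by auto
  then have "card {d. d dvd p ^ e} \<le> card ((\<lambda>i. p ^ i) ` {..e})" by (intro card_mono) auto
  also have "\<dots> \<le> card {..e}" by (intro card_image_le) auto
  finally show ?thesis by simp
qed

text \<open>By multiplicativity it is enough to compare \<open>e + 1\<close> with \<open>(p powr \<eta>) ^ e\<close>. Primes above \<open>2 powr (1 / \<eta>)\<close> lose nothing,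
and each of the finitely many smaller ones loses at most a constant factor.\<close>

lemma divisor_bound:
  assumes "\<eta> > (0::real)"
  shows "\<exists>C\<ge>1. \<forall>n>0. real (card {d. d dvd n}) \<le> C * real n powr \<eta>"
proof -
  define C1 where "C1 = max 1 (1 / (\<eta> * ln 2))"
  define B where "B = nat \<lceil>2 powr (1/\<eta>)\<rceil>"
  have C1: "C1 \<ge> 1" "C1 * (\<eta> * ln 2) \<ge> 1"
  proof -
    have "1 / (\<eta> * ln 2) * (\<eta> * ln 2) \<le> C1 * (\<eta> * ln 2)"
      using assms by (intro mult_right_mono) (auto simp: C1_def)
    then show "C1 * (\<eta> * ln 2) \<ge> 1" using assms by simp
  qed (simp add: C1_def)
  have small: "real e + 1 \<le> C1 * (real p powr \<eta>) ^ e" if "p \<ge> 2" for p e :: nat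
  proof -
    have "real e + 1 \<le> (C1 * (\<eta> * ln 2)) * real e + C1"
      using C1 by (intro add_mono) (auto simp: mult_le_cancel_right1)
    also have "\<dots> = C1 * (1 + real e * (\<eta> * ln 2))" by (simp add: algebra_simps)
    also have "\<dots> \<le> C1 * exp (real e * (\<eta> * ln 2))" using C1 by (intro mult_left_mono exp_ge_add_one_self) auto
    also have "exp (real e * (\<eta> * ln 2)) = (2 powr \<eta>) ^ e" by (simp add: powr_def exp_of_nat_mult)
    also have "C1 * (2 powr \<eta>) ^ e \<le> C1 * (real p powr \<eta>) ^ e"
      using that C1 assms by (intro mult_left_mono power_mono powr_mono2) auto
    finally show ?thesis .
  qed
  have large: "real e + 1 \<le> (real p powr \<eta>) ^ e" if "p > B" for p e :: nat
  proof -
    have "2 powr (1/\<eta>) \<le> real p" using that unfolding B_def by linarith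
    then have "(2 powr (1/\<eta>)) powr \<eta> \<le> real p powr \<eta>" using assms by (intro powr_mono2) auto
    then have "2 \<le> real p powr \<eta>" using assms by (simp add: powr_powr)
    then have "2 ^ e \<le> (real p powr \<eta>) ^ e" by (intro power_mono) auto
    moreover have "real e + 1 \<le> 2 ^ e"
      by (induction e) auto
    ultimately show ?thesis by linarith
  qed
  have main: "real (card {d. d dvd n}) \<le> C1 ^ card {p. prime p \<and> p \<le> B \<and> p dvd n} * real n powr \<eta>" if "n > 0" for n
    using that
  proof (induction n rule: less_induct)
    case (less n)
    show ?case
    proof (cases "n = 1")
      case True
      have "1 \<le> C1 ^ card {p. prime p \<and> p \<le> B \<and> p dvd n}" using C1(1) by (rule one_le_power)
      then show ?thesis using True by simp
    next
      case False
      then obtain p where p: "prime p" "p dvd n" using prime_factor_nat by blast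
      obtain m where m: "n = p ^ multiplicity p n * m" "\<not> p dvd m"
        using multiplicity_decompose'[of n p] p less.prems by (metis not_prime_unit not_gr_zero)
      define e where "e = multiplicity p n"
      have e: "e > 0" unfolding e_def using p less.prems by (simp add: prime_multiplicity_gt_zero_iff)
      have m0: "m > 0" using m less.prems by (metis gr0I mult_0_right)
      have nm: "n = p ^ e * m" using m e_def by simp
      have p2: "p \<ge> 2" using p by (simp add: prime_ge_2_nat)
      have "1 < p ^ e" using p2 e by (intro one_less_power) auto
      then have mn: "m < n" using nm m0 by simp
      have IH: "real (card {d. d dvd m}) \<le> C1 ^ card {p. prime p \<and> p \<le> B \<and> p dvd m} * real m powr \<eta>"
        using less.IH[OF mn m0] .
      have nn: "real n powr \<eta> = (real p powr \<eta>) ^ e * real m powr \<eta>"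
        using p2 by (simp add: nm powr_mult powr_realpow[symmetric] powr_powr mult.commute)
      have finn: "finite {q. prime q \<and> q \<le> B \<and> q dvd n}" by simp
      have bnd: "real e + 1 \<le> C1 ^ (if p \<le> B then 1 else 0) * (real p powr \<eta>) ^ e"
        using small[OF p2, of e] large[of p e] by auto
      have cardeq: "(if p \<le> B then 1 else 0) + card {q. prime q \<and> q \<le> B \<and> q dvd m} \<le> card {q. prime q \<and> q \<le> B \<and> q dvd n}"
      proof (cases "p \<le> B")
        case True
        have "insert p {q. prime q \<and> q \<le> B \<and> q dvd m} \<subseteq> {q. prime q \<and> q \<le> B \<and> q dvd n}"
          using True p nm by auto
        then have "card (insert p {q. prime q \<and> q \<le> B \<and> q dvd m}) \<le> card {q. prime q \<and> q \<le> B \<and> q dvd n}"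
          by (intro card_mono finn)
        then show ?thesis using True m(2) by simp
      next
        case False
        have "{q. prime q \<and> q \<le> B \<and> q dvd m} \<subseteq> {q. prime q \<and> q \<le> B \<and> q dvd n}"
          using nm by auto
        then show ?thesis using False by (simp add: card_mono finn)
      qed
      have "card {d. d dvd n} \<le> card {d. d dvd p ^ e} * card {d. d dvd m}"
        unfolding nm using p2 m0 by (intro card_divisors_mult_le) auto
      also have "\<dots> \<le> (e + 1) * card {d. d dvd m}"
        using card_divisors_prime_power_le[OF p(1)] by (intro mult_right_mono) auto
      finally have "real (card {d. d dvd n}) \<le> real ((e + 1) * card {d. d dvd m})" by (rule of_nat_mono)
      also have "\<dots> = (real e + 1) * real (card {d. d dvd m})" by (simp add: algebra_simps)
      also have "\<dots> \<le> (C1 ^ (if p \<le> B then 1 else 0) * (real p powr \<eta>) ^ e) * (C1 ^ card {p. prime p \<and> p \<le> B \<and> p dvd m} * real m powr \<eta>)"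
        using bnd IH C1 by (intro mult_mono) auto
      also have "\<dots> = C1 ^ ((if p \<le> B then 1 else 0) + card {q. prime q \<and> q \<le> B \<and> q dvd m}) * real n powr \<eta>"
        unfolding nn by (simp add: power_add)
      also have "\<dots> \<le> C1 ^ card {q. prime q \<and> q \<le> B \<and> q dvd n} * real n powr \<eta>"
        using cardeq C1(1) by (intro mult_right_mono power_increasing) auto
      finally show ?thesis .
    qed
  qed
  show ?thesis
  proof (intro exI[of _ "C1 ^ (B + 1)"] conjI allI impI)
    show "1 \<le> C1 ^ (B + 1)" using C1 by (intro one_le_power)
    fix n :: nat assume n: "n > 0"
    have "card {p. prime p \<and> p \<le> B \<and> p dvd n} \<le> card {..B}" by (intro card_mono) auto
    then have "C1 ^ card {p. prime p \<and> p \<le> B \<and> p dvd n} \<le> C1 ^ (B + 1)" using C1 by (intro power_increasing) auto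
    then have "C1 ^ card {p. prime p \<and> p \<le> B \<and> p dvd n} * real n powr \<eta> \<le> C1 ^ (B + 1) * real n powr \<eta>"
      by (intro mult_right_mono) auto
    then show "real (card {d. d dvd n}) \<le> C1 ^ (B + 1) * real n powr \<eta>" using main[OF n] by linarith
  qed
qed

text \<open>The number of ordered representations of \<open>n\<close> as a product of \<open>j\<close> elements of \<open>A\<close>, that is, the coefficients
of the \<open>j\<close>-th power of the Dirichlet polynomial over \<open>A\<close>.\<close>

fun rep :: "nat set \<Rightarrow> nat \<Rightarrow> nat \<Rightarrow> real" where
  "rep A 0 n = (if n = 1 then 1 else 0)"
| "rep A (Suc j) n = (\<Sum>a\<in>{a\<in>A. a dvd n}. rep A j (n div a))"

lemma rep_nonneg: "0 \<le> rep A j n"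
  by (induction j arbitrary: n) (auto intro!: sum_nonneg)

lemma rep_range:
  assumes A: "\<And>a. a \<in> A \<Longrightarrow> lo \<le> real a \<and> real a \<le> hi" and lo: "0 \<le> lo" and r: "rep A j n \<noteq> 0"
  shows "lo ^ j \<le> real n \<and> real n \<le> hi ^ j"
  using r
proof (induction j arbitrary: n)
  case (Suc j)
  then obtain a where a: "a \<in> A" "a dvd n" "rep A j (n div a) \<noteq> 0"
    by (auto elim!: sum.not_neutral_contains_not_neutral)
  have "lo ^ j \<le> real (n div a)" "real (n div a) \<le> hi ^ j" using Suc.IH[OF a(3)] by auto
  moreover have "lo \<le> real a" "real a \<le> hi" using A[OF a(1)] by auto
  moreover have "real n = real a * real (n div a)" using a(2) by (metis dvd_mult_div_cancel of_nat_mult)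
  ultimately show ?case using lo by (auto intro!: mult_mono)
qed (auto split: if_splits)

lemma rep_smooth:
  assumes A: "\<And>a. a \<in> A \<Longrightarrow> 0 < a \<and> real a \<le> hi" and r: "rep A j n \<noteq> 0"
  shows "smooth hi n"
  using r
proof (induction j arbitrary: n)
  case (Suc j)
  then obtain a where a: "a \<in> A" "a dvd n" "rep A j (n div a) \<noteq> 0"
    by (auto elim!: sum.not_neutral_contains_not_neutral)
  have n: "n = a * (n div a)" using a(2) by simp
  have s: "smooth hi (n div a)" by (rule Suc.IH[OF a(3)])
  have aa: "0 < a" "real a \<le> hi" using A[OF a(1)] by auto
  show ?case unfolding smooth_def
  proof (intro conjI allI impI)
    show "n > 0" using n s aa by (metis smooth_def nat_0_less_mult_iff)
    fix p assume p: "prime p \<and> p dvd n"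
    then have "p dvd a \<or> p dvd (n div a)" using n by (metis prime_dvd_mult_iff)
    then show "real p \<le> hi"
    proof
      assume "p dvd a"
      then have "p \<le> a" using aa by (intro dvd_imp_le) auto
      then show ?thesis using aa by linarith
    next
      assume "p dvd n div a"
      then show ?thesis using s p by (auto simp: smooth_def)
    qed
  qed
qed (auto simp: smooth_def split: if_splits)

text \<open>Each factor divides \<open>n\<close>, so there are at most \<open>D\<close> choices for it.\<close>

lemma rep_le:
  assumes "finite A" and D: "\<And>m. 0 < m \<Longrightarrow> real m \<le> L \<Longrightarrow> real (card {d. d dvd m}) \<le> D" and D1: "1 \<le> D"
    and n: "0 < n" "real n \<le> L"
  shows "rep A j n \<le> D ^ j"
  using n
proof (induction j arbitrary: n)
  case (Suc j)
  have "rep A (Suc j) n \<le> (\<Sum>a\<in>{a\<in>A. a dvd n}. D ^ j)"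
    unfolding rep.simps
  proof (intro sum_mono Suc.IH)
    fix a assume a: "a \<in> {a\<in>A. a dvd n}"
    then have "n = a * (n div a)" by simp
    then show "0 < n div a" using Suc.prems(1) by (metis gr0I mult_0_right)
    have "n div a \<le> n" by simp
    then show "real (n div a) \<le> L" using Suc.prems(2) by linarith
  qed
  also have "\<dots> = real (card {a\<in>A. a dvd n}) * D ^ j" by simp
  also have "\<dots> \<le> D * D ^ j"
  proof (intro mult_right_mono)
    have "card {a\<in>A. a dvd n} \<le> card {d. d dvd n}" using Suc.prems by (intro card_mono) auto
    then show "real (card {a\<in>A. a dvd n}) \<le> D" using D[OF Suc.prems] by linarith
  qed (use D1 in auto)
  finally show ?case by simp
qed auto

lemma dir_sum_power:
  assumes A: "finite A" "\<And>a. a \<in> A \<Longrightarrow> 0 < a \<and> a \<le> K" and K: "K \<ge> 1"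
  shows "dir_sum A t ^ j = (\<Sum>n\<in>{1..K^j}. of_real (rep A j n) * cis (t * ln (real n)))"
proof (induction j)
  case (Suc j)
  have supp: "rep A j n = 0" if "n > K ^ j" for n
  proof (rule ccontr)
    assume "rep A j n \<noteq> 0"
    then have "real n \<le> real K ^ j" using rep_range[of A 0 "real K" j n] A by auto
    then have "real n \<le> real (K ^ j)" by simp
    then show False using that by linarith
  qed
  have "(\<Sum>n\<in>{1..K^Suc j}. of_real (rep A (Suc j) n) * cis (t * ln (real n)))
     = (\<Sum>n\<in>{1..K^Suc j}. \<Sum>a\<in>{a\<in>A. a dvd n}. of_real (rep A j (n div a)) * cis (t * ln (real n)))"
    by (simp add: sum_distrib_right)
  also have "\<dots> = (\<Sum>n\<in>{1..K^Suc j}. \<Sum>a\<in>A. if a dvd n then of_real (rep A j (n div a)) * cis (t * ln (real n)) else 0)"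
    using A(1) by (intro sum.cong refl sum.inter_filter)
  also have "\<dots> = (\<Sum>a\<in>A. \<Sum>n\<in>{1..K^Suc j}. if a dvd n then of_real (rep A j (n div a)) * cis (t * ln (real n)) else 0)"
    by (rule sum.swap)
  also have "\<dots> = (\<Sum>a\<in>A. \<Sum>m\<in>{1..K^j}. of_real (rep A j m) * cis (t * ln (real (a * m))))"
  proof (rule sum.cong[OF refl])
    fix a assume a: "a \<in> A"
    then have a0: "0 < a" "a \<le> K" using A(2) by auto
    have "(\<Sum>n\<in>{1..K^Suc j}. if a dvd n then of_real (rep A j (n div a)) * cis (t * ln (real n)) else 0)
       = (\<Sum>n\<in>{n\<in>{1..K^Suc j}. a dvd n}. of_real (rep A j (n div a)) * cis (t * ln (real n)))"
      by (intro sum.inter_filter[symmetric]) simp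
    also have "\<dots> = (\<Sum>n\<in>(\<lambda>m. a * m) ` {1..K^j}. of_real (rep A j (n div a)) * cis (t * ln (real n)))"
    proof (rule sum.mono_neutral_right)
      show "(\<lambda>m. a * m) ` {1..K^j} \<subseteq> {n\<in>{1..K^Suc j}. a dvd n}"
        using a0 by (auto intro: mult_le_mono)
      show "\<forall>n\<in>{n\<in>{1..K^Suc j}. a dvd n} - (\<lambda>m. a * m) ` {1..K^j}. of_real (rep A j (n div a)) * cis (t * ln (real n)) = 0"
      proof
        fix n assume n: "n \<in> {n\<in>{1..K^Suc j}. a dvd n} - (\<lambda>m. a * m) ` {1..K^j}"
        then have "n = a * (n div a)" "n > 0" by auto
        then have "n div a \<notin> {1..K^j}" "n div a > 0" using n by (blast, metis gr0I mult_0_right less_irrefl)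
        then have "n div a > K ^ j" by auto
        then show "of_real (rep A j (n div a)) * cis (t * ln (real n)) = 0" using supp by simp
      qed
    qed auto
    also have "\<dots> = (\<Sum>m\<in>{1..K^j}. of_real (rep A j m) * cis (t * ln (real (a * m))))"
      using a0 by (subst sum.reindex) (auto simp: inj_on_def)
    finally show "(\<Sum>n\<in>{1..K^Suc j}. if a dvd n then of_real (rep A j (n div a)) * cis (t * ln (real n)) else 0)
      = (\<Sum>m\<in>{1..K^j}. of_real (rep A j m) * cis (t * ln (real (a * m))))" .
  qed
  also have "\<dots> = (\<Sum>a\<in>A. \<Sum>m\<in>{1..K^j}. cis (t * ln (real a)) * (of_real (rep A j m) * cis (t * ln (real m))))"
  proof (intro sum.cong refl)
    fix a m assume am: "a \<in> A" "m \<in> {1..K^j}"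
    then have "ln (real (a * m)) = ln (real a) + ln (real m)" using A(2)[of a] by (simp add: ln_mult)
    then have "cis (t * ln (real (a * m))) = cis (t * ln (real a)) * cis (t * ln (real m))"
      by (simp add: cis_mult distrib_left)
    then show "of_real (rep A j m) * cis (t * ln (real (a * m))) = cis (t * ln (real a)) * (of_real (rep A j m) * cis (t * ln (real m)))"
      by (simp add: mult_ac)
  qed
  also have "\<dots> = dir_sum A t * (\<Sum>m\<in>{1..K^j}. of_real (rep A j m) * cis (t * ln (real m)))"
    by (simp add: dir_sum_def sum_product)
  also have "\<dots> = dir_sum A t ^ Suc j" using Suc by simp
  finally show ?case by simp
qed auto

section \<open>Large values and additive energy\<close>

definition fsum :: "int set \<Rightarrow> real \<Rightarrow> complex" where
  "fsum S \<theta> = (\<Sum>t\<in>S. cis (of_int t * \<theta>))"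

definition tpoly :: "(nat \<Rightarrow> real) \<Rightarrow> real \<Rightarrow> real \<Rightarrow> complex" where
  "tpoly r U t = (\<Sum>n\<in>triple U. of_real (r n) * cis (t * ln (real n)))"

lemma norm_fsum_le: "norm (fsum S \<theta>) \<le> real (card S)"
  unfolding fsum_def using norm_sum[of "\<lambda>t. cis (of_int t * \<theta>)" S] by simp

lemma ln3_le: "ln (3::real) \<le> 3/2"
proof -
  have "ln (3::real) = ln (2 * (3/2))" by simp
  also have "\<dots> = ln 2 + ln (3/2)" by (rule ln_mult_pos) auto
  also have "ln 2 \<le> (1::real)" using ln_le_minus_one[of "2::real"] by simp
  also have "ln (3/2) \<le> (1/2::real)" using ln_le_minus_one[of "3/2::real"] by simp
  finally show ?thesis by simp
qed

lemma ln_nat_diff_ge: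
  assumes "0 < m" "m < n" "real n \<le> N"
  shows "1 / N \<le> ln (real n) - ln (real m)"
proof -
  have "1 / N \<le> 1 / (real m + 1)" using assms by (intro divide_left_mono) auto
  also have "\<dots> \<le> ln (real m + 1) - ln (real m)" using assms by (intro ln_Suc_diff_bounds) auto
  also have "ln (real m + 1) \<le> ln (real n)" using assms by simp
  finally show ?thesis by simp
qed

lemma triple_ln_spaced:
  assumes U: "U > 0" and mn: "m \<in> triple U" "n \<in> triple U"
  shows "m \<noteq> n \<Longrightarrow> 1 / (3 * U) \<le> \<bar>ln (real m) - ln (real n)\<bar>"
    and "\<bar>ln (real m) - ln (real n)\<bar> \<le> 3/2"
proof -
  have m: "U < real m" "real m \<le> 3 * U" "U < real n" "real n \<le> 3 * U"
    using mn by (auto simp: triple_def)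
  have pos: "0 < m" "0 < n" using m U by (auto intro!: Nat.gr0I)
  show "1 / (3 * U) \<le> \<bar>ln (real m) - ln (real n)\<bar>" if "m \<noteq> n"
  proof (cases "m < n")
    case True
    then show ?thesis using ln_nat_diff_ge[of m n "3 * U"] m pos by linarith
  next
    case False
    then have "n < m" using that by simp
    then show ?thesis using ln_nat_diff_ge[of n m "3 * U"] m pos by linarith
  qed
  have "ln (real k) - ln (real l) \<le> 3/2" if "0 < k" "0 < l" "real k \<le> 3 * U" "U < real l" for k l
  proof -
    have "ln (real k) \<le> ln (3 * real l)" using that by simp
    also have "\<dots> = ln 3 + ln (real l)" using that by (simp add: ln_mult_pos)
    finally show ?thesis using ln3_le by linarith
  qed
  from this[of m n] this[of n m] show "\<bar>ln (real m) - ln (real n)\<bar> \<le> 3/2"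
    using m pos by linarith
qed

text \<open>A mean value estimate: on \<open>S\<close> each summand is at least \<open>V\<^sup>2\<close>, and the logarithms of the integers up to
\<open>3 * U\<close> are \<open>1 / (3 * U)\<close>-separated frequencies for the large sieve.\<close>

lemma large_values_mean:
  assumes U: "U > 0" and S: "S \<subseteq> {-int T..int T}" and r: "\<And>n. n \<in> triple U \<Longrightarrow> \<bar>r n\<bar> \<le> M"
    and V: "0 \<le> V" "\<And>t. t \<in> S \<Longrightarrow> V \<le> norm (tpoly r U (of_int t))"
  shows "real (card S) * V\<^sup>2 \<le> sieve_const T (1 / (3 * U)) * (3 * U * M\<^sup>2)"
proof -
  have "real (card S) * V\<^sup>2 = (\<Sum>t\<in>S. V\<^sup>2)" by simp
  also have "\<dots> \<le> (\<Sum>t\<in>S. (norm (tpoly r U (of_int t)))\<^sup>2)"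
    using V by (intro sum_mono power_mono) auto
  also have "\<dots> \<le> (\<Sum>t\<in>{-int T..int T}. (norm (tpoly r U (of_int t)))\<^sup>2)"
    using S by (intro sum_mono2) auto
  also have "\<dots> \<le> sieve_const T (1 / (3 * U)) * (\<Sum>n\<in>triple U. (norm (complex_of_real (r n)))\<^sup>2)"
    unfolding tpoly_def
  proof (rule large_sieve_frequencies)
    show "\<bar>ln (real i) - ln (real j)\<bar> \<le> 3" if "i \<in> triple U" "j \<in> triple U" for i j
      using triple_ln_spaced(2)[OF U that] by linarith
  qed (use U triple_ln_spaced in auto)
  also have "\<dots> \<le> sieve_const T (1 / (3 * U)) * (3 * U * M\<^sup>2)"
  proof (intro mult_left_mono sieve_const_nonneg)
    have "(\<Sum>n\<in>triple U. (norm (complex_of_real (r n)))\<^sup>2) \<le> (\<Sum>n\<in>triple U. M\<^sup>2)"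
      using r by (intro sum_mono) (metis norm_of_real abs_ge_zero power_mono)
    also have "\<dots> = real (card (triple U)) * M\<^sup>2" by simp
    also have "\<dots> \<le> 3 * U * M\<^sup>2" using card_triple_le[OF U] by (intro mult_right_mono) auto
    finally show "(\<Sum>n\<in>triple U. (norm (complex_of_real (r n)))\<^sup>2) \<le> 3 * U * M\<^sup>2" .
  qed (use U in auto)
  finally show ?thesis .
qed

lemma diff_in_window:
  assumes "S \<subseteq> {-int T..int T}" "t \<in> S" "t' \<in> S"
  shows "\<bar>t - t'\<bar> \<le> 2 * int T"
proof -
  have "t \<in> {-int T..int T}" "t' \<in> {-int T..int T}" using assms by blast+
  then show ?thesis by auto
qed

lemma row_inverse_sum:
  assumes S: "S \<subseteq> {-int T..int T}" and t: "t \<in> S" and T: "T \<ge> 1"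
  shows "(\<Sum>t'\<in>S-{t}. 1 / real_of_int \<bar>t - t'\<bar>) \<le> 2 * (1 + ln (2 * real T))"
proof -
  have fin: "finite S" using S finite_subset by blast
  have "(\<Sum>t'\<in>S-{t}. 1 / real_of_int \<bar>t - t'\<bar>) = (\<Sum>m\<in>(\<lambda>t'. t - t') ` (S - {t}). 1 / real_of_int \<bar>m\<bar>)"
    by (subst sum.reindex) (auto simp: inj_on_def)
  also have "\<dots> \<le> 2 * (1 + ln (real (2 * T)))"
  proof (rule sum_inverse_abs_int_le)
    fix m assume "m \<in> (\<lambda>t'. t - t') ` (S - {t})"
    then obtain t' where "m = t - t'" "t' \<in> S" "t' \<noteq> t" by auto
    then show "m \<noteq> 0 \<and> \<bar>m\<bar> \<le> int (2 * T)" using diff_in_window[OF S t, of t'] by auto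
  qed (use fin T in auto)
  finally show ?thesis by simp
qed

lemma row_sum_dir_sum:
  assumes U: "U > 0" and S: "S \<subseteq> {-int T..int T}" and t: "t \<in> S" and T: "T \<ge> 1"
  shows "(\<Sum>t'\<in>S. norm (dir_sum (triple U) (of_int (t - t')))) \<le> 8000 * (U * (1 + ln (2 * real T)) + real (card S) * sqrt (real T))"
proof -
  have fin: "finite S" using S finite_subset by blast
  have l: "ln (2 * real T) \<ge> 0" using T by simp
  have "(\<Sum>t'\<in>S. norm (dir_sum (triple U) (of_int (t - t'))))
     = norm (dir_sum (triple U) 0) + (\<Sum>t'\<in>S-{t}. norm (dir_sum (triple U) (of_int (t - t'))))"
    using fin t by (simp add: sum.remove)
  also have "\<dots> \<le> 3 * U + (\<Sum>t'\<in>S-{t}. 2000 * U * (1 / real_of_int \<bar>t - t'\<bar>) + 4000 * sqrt (real T))"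
  proof (intro add_mono sum_mono)
    show "norm (dir_sum (triple U) 0) \<le> 3 * U"
      using norm_dir_sum_le_card card_triple_le[OF U] order_trans by blast
    fix t' assume t': "t' \<in> S - {t}"
    have b: "real_of_int \<bar>t - t'\<bar> \<le> 2 * real T" "\<bar>real_of_int (t - t')\<bar> \<ge> 1"
    proof -
      have "\<bar>t - t'\<bar> \<le> 2 * int T" using diff_in_window[OF S t, of t'] t' by auto
      then show "real_of_int \<bar>t - t'\<bar> \<le> 2 * real T" by linarith
      have "\<bar>t - t'\<bar> \<ge> 1" using t' by auto
      then show "\<bar>real_of_int (t - t')\<bar> \<ge> 1" by linarith
    qed
    have "sqrt (real_of_int \<bar>t - t'\<bar>) \<le> sqrt (4 * real T)" using b by (intro real_sqrt_le_mono) linarith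
    then have sq: "sqrt (real_of_int \<bar>t - t'\<bar>) \<le> 2 * sqrt (real T)" by (simp add: real_sqrt_mult)
    have "norm (dir_sum (triple U) (of_int (t - t'))) \<le> 2000 * (U / \<bar>real_of_int (t - t')\<bar> + sqrt \<bar>real_of_int (t - t')\<bar>)"
      using U b(2) by (rule norm_dir_sum_triple)
    also have "\<dots> = 2000 * U * (1 / real_of_int \<bar>t - t'\<bar>) + 2000 * sqrt (real_of_int \<bar>t - t'\<bar>)"
      by (simp add: algebra_simps)
    also have "\<dots> \<le> 2000 * U * (1 / real_of_int \<bar>t - t'\<bar>) + 2000 * (2 * sqrt (real T))"
      using sq by (intro add_left_mono mult_left_mono) auto
    finally show "norm (dir_sum (triple U) (of_int (t - t'))) \<le> 2000 * U * (1 / real_of_int \<bar>t - t'\<bar>) + 4000 * sqrt (real T)"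
      by simp
  qed
  also have "\<dots> = 3 * U + 2000 * U * (\<Sum>t'\<in>S-{t}. 1 / real_of_int \<bar>t - t'\<bar>) + real (card (S - {t})) * (4000 * sqrt (real T))"
    by (simp add: sum.distrib sum_distrib_left)
  also have "\<dots> \<le> 3 * U + 2000 * U * (2 * (1 + ln (2 * real T))) + real (card S) * (4000 * sqrt (real T))"
    using U T fin by (intro add_mono mult_left_mono mult_right_mono row_inverse_sum[OF S t T]) (auto simp: card_mono)
  also have "\<dots> \<le> 8000 * (U * (1 + ln (2 * real T)) + real (card S) * sqrt (real T))"
  proof -
    have "0 \<le> U * ln (2 * real T)" "0 \<le> real (card S) * sqrt (real T)" using U l by auto
    then show ?thesis using U by (simp add: algebra_simps)
  qed
  finally show ?thesis .
qed

text \<open>The square of the bound \<open>U / \<bar>t\<bar> + sqrt \<bar>t\<bar>\<close> is summed over \<open>S\<close>; here \<open>1 / \<bar>t\<bar>\<^sup>2 \<le> 1 / \<bar>t\<bar>\<close> since \<open>t\<close> is an integer.\<close>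

lemma row_sum_dir_sum_square:
  assumes U: "U > 0" and S: "S \<subseteq> {-int T..int T}" and t: "t \<in> S" and T: "T \<ge> 1"
  shows "(\<Sum>t'\<in>S. (norm (dir_sum (triple U) (of_int (t - t'))))\<^sup>2) \<le> 40000000 * (U\<^sup>2 * (1 + ln (2 * real T)) + real (card S) * real T)"
proof -
  have fin: "finite S" using S finite_subset by blast
  have l: "ln (2 * real T) \<ge> 0" using T by simp
  have "(\<Sum>t'\<in>S. (norm (dir_sum (triple U) (of_int (t - t'))))\<^sup>2)
     = (norm (dir_sum (triple U) 0))\<^sup>2 + (\<Sum>t'\<in>S-{t}. (norm (dir_sum (triple U) (of_int (t - t'))))\<^sup>2)"
    using fin t by (simp add: sum.remove)
  also have "\<dots> \<le> (3 * U)\<^sup>2 + (\<Sum>t'\<in>S-{t}. 8000000 * U\<^sup>2 * (1 / real_of_int \<bar>t - t'\<bar>) + 16000000 * real T)"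
  proof (intro add_mono sum_mono)
    show "(norm (dir_sum (triple U) 0))\<^sup>2 \<le> (3 * U)\<^sup>2"
      using order_trans[OF norm_dir_sum_le_card[of "triple U" 0] card_triple_le[OF U]] by (intro power_mono) auto
    fix t' assume t': "t' \<in> S - {t}"
    define x where "x = real_of_int \<bar>t - t'\<bar>"
    have b: "x \<le> 2 * real T" "x \<ge> 1"
    proof -
      have "\<bar>t - t'\<bar> \<le> 2 * int T" using diff_in_window[OF S t, of t'] t' by auto
      then show "x \<le> 2 * real T" unfolding x_def by linarith
      have "\<bar>t - t'\<bar> \<ge> 1" using t' by auto
      then show "x \<ge> 1" unfolding x_def by linarith
    qed
    have xx: "\<bar>real_of_int (t - t')\<bar> = x" by (simp add: x_def)
    have "norm (dir_sum (triple U) (of_int (t - t'))) \<le> 2000 * (U / x + sqrt x)"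
      using norm_dir_sum_triple[OF U, of "of_int (t - t')"] b unfolding xx by simp
    then have "(norm (dir_sum (triple U) (of_int (t - t'))))\<^sup>2 \<le> (2000 * (U / x + sqrt x))\<^sup>2"
      by (intro power_mono) auto
    also have "\<dots> \<le> 4000000 * (2 * ((U / x)\<^sup>2 + (sqrt x)\<^sup>2))"
    proof -
      have "0 \<le> (U / x - sqrt x)\<^sup>2" by simp
      then have "(U / x + sqrt x)\<^sup>2 \<le> 2 * ((U / x)\<^sup>2 + (sqrt x)\<^sup>2)" unfolding power2_sum power2_diff by simp
      then show ?thesis unfolding power_mult_distrib by simp
    qed
    also have "\<dots> = 8000000 * U\<^sup>2 * (1 / x\<^sup>2) + 8000000 * x"
      using b by (simp add: power_divide algebra_simps)
    also have "\<dots> \<le> 8000000 * U\<^sup>2 * (1 / x) + 8000000 * (2 * real T)"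
    proof (intro add_mono mult_left_mono)
      show "1 / x\<^sup>2 \<le> 1 / x" using b by (intro divide_left_mono) (auto simp: power2_eq_square)
    qed (use b in auto)
    finally show "(norm (dir_sum (triple U) (of_int (t - t'))))\<^sup>2 \<le> 8000000 * U\<^sup>2 * (1 / real_of_int \<bar>t - t'\<bar>) + 16000000 * real T"
      by (simp add: x_def)
  qed
  also have "\<dots> = 9 * U\<^sup>2 + 8000000 * U\<^sup>2 * (\<Sum>t'\<in>S-{t}. 1 / real_of_int \<bar>t - t'\<bar>) + real (card (S - {t})) * (16000000 * real T)"
    by (simp add: sum.distrib sum_distrib_left power_mult_distrib)
  also have "\<dots> \<le> 9 * U\<^sup>2 + 8000000 * U\<^sup>2 * (2 * (1 + ln (2 * real T))) + real (card S) * (16000000 * real T)"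
    using U T fin by (intro add_mono mult_left_mono mult_right_mono row_inverse_sum[OF S t T]) (auto simp: card_mono)
  also have "\<dots> \<le> 40000000 * (U\<^sup>2 * (1 + ln (2 * real T)) + real (card S) * real T)"
  proof -
    have "0 \<le> U\<^sup>2 * ln (2 * real T)" "0 \<le> real (card S) * real T" "0 \<le> U\<^sup>2" using U l by auto
    then show ?thesis by (simp add: algebra_simps)
  qed
  finally show ?thesis .
qed

lemma fsum_square_triple:
  assumes fin: "finite S" and c: "\<And>t. t \<in> S \<Longrightarrow> norm (c t) \<le> 1"
  shows "(\<Sum>n\<in>triple U. (norm (\<Sum>t\<in>S. c t * cis (of_int t * ln (real n))))\<^sup>2)
     \<le> (\<Sum>t\<in>S. \<Sum>t'\<in>S. norm (dir_sum (triple U) (of_int (t - t'))))"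
proof -
  have "complex_of_real (\<Sum>n\<in>triple U. (norm (\<Sum>t\<in>S. c t * cis (of_int t * ln (real n))))\<^sup>2)
     = (\<Sum>n\<in>triple U. \<Sum>t\<in>S. \<Sum>t'\<in>S. c t * cnj (c t') * cis (of_int (t - t') * ln (real n)))"
    unfolding of_real_sum
  proof (rule sum.cong[OF refl])
    fix n
    show "complex_of_real ((norm (\<Sum>t\<in>S. c t * cis (of_int t * ln (real n))))\<^sup>2)
      = (\<Sum>t\<in>S. \<Sum>t'\<in>S. c t * cnj (c t') * cis (of_int (t - t') * ln (real n)))"
      using norm_square_sum_expand[of c "ln (real n)" "of_int" S] by (simp add: mult.commute)
  qed
  also have "\<dots> = (\<Sum>t\<in>S. \<Sum>t'\<in>S. c t * cnj (c t') * dir_sum (triple U) (of_int (t - t')))"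
    unfolding dir_sum_def sum_distrib_left
    by (subst sum.swap, rule sum.cong[OF refl], rule sum.swap)
  finally have e: "complex_of_real (\<Sum>n\<in>triple U. (norm (\<Sum>t\<in>S. c t * cis (of_int t * ln (real n))))\<^sup>2) = \<dots>" .
  have "(\<Sum>n\<in>triple U. (norm (\<Sum>t\<in>S. c t * cis (of_int t * ln (real n))))\<^sup>2)
     = norm (complex_of_real (\<Sum>n\<in>triple U. (norm (\<Sum>t\<in>S. c t * cis (of_int t * ln (real n))))\<^sup>2))"
    by (simp add: sum_nonneg del: of_real_sum of_real_power)
  also have "\<dots> \<le> (\<Sum>t\<in>S. \<Sum>t'\<in>S. norm (dir_sum (triple U) (of_int (t - t'))))"
    unfolding e
  proof (intro sum_norm_le)
    fix t t' assume tt: "t \<in> S" "t' \<in> S"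
    have "norm (c t) * norm (c t') \<le> 1 * 1" using c[OF tt(1)] c[OF tt(2)] by (intro mult_mono) auto
    then have "norm (c t) * norm (c t') * norm (dir_sum (triple U) (of_int (t - t'))) \<le> 1 * norm (dir_sum (triple U) (of_int (t - t')))"
      by (intro mult_right_mono) auto
    then show "norm (c t * cnj (c t') * dir_sum (triple U) (of_int (t - t'))) \<le> norm (dir_sum (triple U) (of_int (t - t')))"
      by (simp add: norm_mult)
  qed
  finally show ?thesis .
qed

text \<open>The unimodular weights that turn a sum of norms into the norm of a sum, so that duality applies.\<close>

lemma aligned_phases:
  fixes f :: "'a \<Rightarrow> complex"
  obtains c where "\<And>t. norm (c t) \<le> 1" "\<And>t. c t * f t = of_real (norm (f t))"
proof
  fix t
  show "norm (cnj (sgn (f t))) \<le> 1" by (simp add: norm_sgn)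
  show "cnj (sgn (f t)) * f t = of_real (norm (f t))"
  proof (cases "f t = 0")
    case False
    have "cnj (sgn (f t)) * f t = f t * cnj (f t) / of_real (norm (f t))"
      by (simp add: sgn_div_norm scaleR_conv_of_real divide_inverse mult_ac)
    also have "\<dots> = of_real ((norm (f t))\<^sup>2) / of_real (norm (f t))"
      by (simp only: complex_norm_square)
    also have "\<dots> = of_real (norm (f t))" using False by (simp add: power2_eq_square)
    finally show ?thesis .
  qed simp
qed

text \<open>The method of Halasz. After alignment of the phases and Cauchy--Schwarz over \<open>n\<close>, the differences \<open>t - t'\<close> of
elements of \<open>S\<close> enter through a Dirichlet polynomial with coefficients \<open>1\<close>, which is small off the diagonal. Compared with
\<open>large_values_mean\<close>, the length \<open>T\<close> of the range is replaced by \<open>card S * sqrt T\<close>.\<close>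

lemma Halasz_large_values:
  assumes U: "U > 0" and S: "S \<subseteq> {-int T..int T}" and T: "T \<ge> 1"
    and r: "\<And>n. n \<in> triple U \<Longrightarrow> \<bar>r n\<bar> \<le> M"
    and V: "0 \<le> V" "\<And>t. t \<in> S \<Longrightarrow> V \<le> norm (tpoly r U (of_int t))"
  shows "real (card S) * V\<^sup>2 \<le> 24000 * M\<^sup>2 * U * (U * (1 + ln (2 * real T)) + real (card S) * sqrt (real T))"
proof (cases "S = {}")
  case True
  have "ln (2 * real T) \<ge> 0" using T by simp
  then show ?thesis using U True by simp
next
  case False
  have fin: "finite S" using S finite_subset by blast
  have D0: "real (card S) > 0" using False fin by (simp add: card_gt_0_iff)
  obtain c where c: "\<And>t. norm (c t) \<le> 1" "\<And>t. c t * tpoly r U (of_int t) = of_real (norm (tpoly r U (of_int t)))"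
    using aligned_phases[of "\<lambda>t::int. tpoly r U (of_int t)"] by blast
  define s where "s n = (\<Sum>t\<in>S. c t * cis (of_int t * ln (real n)))" for n
  have "real (card S) * V = (\<Sum>t\<in>S. V)" by simp
  also have "\<dots> \<le> (\<Sum>t\<in>S. norm (tpoly r U (of_int t)))" using V by (intro sum_mono) auto
  also have "\<dots> = norm (complex_of_real (\<Sum>t\<in>S. norm (tpoly r U (of_int t))))" by (simp add: sum_nonneg del: of_real_sum)
  also have "complex_of_real (\<Sum>t\<in>S. norm (tpoly r U (of_int t))) = (\<Sum>t\<in>S. c t * tpoly r U (of_int t))"
    by (simp add: c(2))
  also have "\<dots> = (\<Sum>n\<in>triple U. of_real (r n) * s n)"
    unfolding tpoly_def s_def sum_distrib_left by (subst sum.swap) (simp add: mult_ac)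
  also have "norm \<dots> \<le> (\<Sum>n\<in>triple U. M * norm (s n))"
  proof (intro sum_norm_le)
    fix n assume n: "n \<in> triple U"
    then show "norm (of_real (r n) * s n) \<le> M * norm (s n)"
      using r[OF n] by (simp add: norm_mult mult_right_mono)
  qed
  finally have "(real (card S) * V)\<^sup>2 \<le> (\<Sum>n\<in>triple U. M * norm (s n))\<^sup>2"
    using V by (intro power_mono) auto
  also have "\<dots> \<le> (\<Sum>n\<in>triple U. M\<^sup>2) * (\<Sum>n\<in>triple U. (norm (s n))\<^sup>2)"
    by (rule Cauchy_Schwarz_ineq_sum)
  also have "\<dots> \<le> (3 * U * M\<^sup>2) * (real (card S) * (8000 * (U * (1 + ln (2 * real T)) + real (card S) * sqrt (real T))))"
  proof (intro mult_mono)
    show "(\<Sum>n\<in>triple U. M\<^sup>2) \<le> 3 * U * M\<^sup>2" using card_triple_le[OF U] by (simp add: mult_right_mono)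
    have "(\<Sum>n\<in>triple U. (norm (s n))\<^sup>2) \<le> (\<Sum>t\<in>S. \<Sum>t'\<in>S. norm (dir_sum (triple U) (of_int (t - t'))))"
      unfolding s_def using c(1) by (intro fsum_square_triple fin) auto
    also have "\<dots> \<le> (\<Sum>t\<in>S. 8000 * (U * (1 + ln (2 * real T)) + real (card S) * sqrt (real T)))"
      by (intro sum_mono row_sum_dir_sum U S T)
    finally show "(\<Sum>n\<in>triple U. (norm (s n))\<^sup>2) \<le> real (card S) * (8000 * (U * (1 + ln (2 * real T)) + real (card S) * sqrt (real T)))"
      by simp
  qed (use U in \<open>auto intro!: sum_nonneg\<close>)
  finally have "real (card S) * (real (card S) * V\<^sup>2) \<le> real (card S) * (24000 * M\<^sup>2 * U * (U * (1 + ln (2 * real T)) + real (card S) * sqrt (real T)))"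
    by (simp add: power_mult_distrib power2_eq_square mult_ac)
  then show ?thesis using D0 by (simp only: mult_le_cancel_left_pos)
qed

subsection \<open>Additive energy\<close>

definition reps :: "int set \<Rightarrow> int \<Rightarrow> real" where
  "reps S \<tau> = real (card {a\<in>S. \<tau> - a \<in> S})"

text \<open>The additive energy, the number of quadruples in \<open>S\<close> with \<open>a + b = d + d'\<close>.\<close>

definition energy :: "int set \<Rightarrow> real" where
  "energy S = (\<Sum>a\<in>S. \<Sum>b\<in>S. reps S (a + b))"

lemma energy_eq:
  assumes S: "S \<subseteq> {-int T..int T}"
  shows "(\<Sum>\<tau>\<in>{-int (2*T)..int (2*T)}. (reps S \<tau>)\<^sup>2) = energy S"
proof -
  have fin: "finite S" using S finite_subset by blast
  have "(\<Sum>\<tau>\<in>{-int (2*T)..int (2*T)}. (reps S \<tau>)\<^sup>2)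
     = (\<Sum>\<tau>\<in>{-int (2*T)..int (2*T)}. \<Sum>a\<in>S. if \<tau> - a \<in> S then reps S \<tau> else 0)"
  proof (rule sum.cong[OF refl])
    fix \<tau>
    have "(\<Sum>a\<in>S. if \<tau> - a \<in> S then reps S \<tau> else 0) = (\<Sum>a\<in>{a\<in>S. \<tau> - a \<in> S}. reps S \<tau>)"
      by (rule sum.inter_filter[OF fin, symmetric])
    then show "(reps S \<tau>)\<^sup>2 = (\<Sum>a\<in>S. if \<tau> - a \<in> S then reps S \<tau> else 0)"
      by (simp add: reps_def power2_eq_square)
  qed
  also have "\<dots> = (\<Sum>a\<in>S. \<Sum>\<tau>\<in>{-int (2*T)..int (2*T)}. if \<tau> - a \<in> S then reps S \<tau> else 0)"
    by (rule sum.swap)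
  also have "\<dots> = (\<Sum>a\<in>S. \<Sum>b\<in>S. reps S (a + b))"
  proof (rule sum.cong[OF refl])
    fix a assume a: "a \<in> S"
    have "(\<Sum>\<tau>\<in>{-int (2*T)..int (2*T)}. if \<tau> - a \<in> S then reps S \<tau> else 0)
       = (\<Sum>\<tau>\<in>{\<tau>\<in>{-int (2*T)..int (2*T)}. \<tau> - a \<in> S}. reps S \<tau>)"
      by (rule sum.inter_filter[symmetric]) simp
    also have "\<dots> = (\<Sum>b\<in>S. reps S (a + b))"
    proof (rule sum.reindex_bij_witness[of _ "\<lambda>b. a + b" "\<lambda>\<tau>. \<tau> - a"])
      fix b assume b: "b \<in> S"
      have "a \<in> {-int T..int T}" "b \<in> {-int T..int T}" using a b S by auto
      then show "a + b \<in> {\<tau>\<in>{-int (2*T)..int (2*T)}. \<tau> - a \<in> S}" using b by auto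
    qed auto
    finally show "(\<Sum>\<tau>\<in>{-int (2*T)..int (2*T)}. if \<tau> - a \<in> S then reps S \<tau> else 0) = (\<Sum>b\<in>S. reps S (a + b))" .
  qed
  finally show ?thesis by (simp add: energy_def)
qed

lemma energy_nonneg: "0 \<le> energy S"
  by (auto simp: energy_def reps_def intro!: sum_nonneg)

lemma square_as_sum_over_sums:
  assumes S: "S \<subseteq> {-int T..int T}"
  shows "(\<Sum>t\<in>S. c t * cis (of_int t * \<theta>))\<^sup>2
    = (\<Sum>\<tau>\<in>{-int (2*T)..int (2*T)}. (\<Sum>a\<in>{a\<in>S. \<tau> - a \<in> S}. c a * c (\<tau> - a)) * cis (of_int \<tau> * \<theta>))"
proof -
  have fin: "finite S" using S finite_subset by blast
  have "(\<Sum>\<tau>\<in>{-int (2*T)..int (2*T)}. (\<Sum>a\<in>{a\<in>S. \<tau> - a \<in> S}. c a * c (\<tau> - a)) * cis (of_int \<tau> * \<theta>))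
     = (\<Sum>\<tau>\<in>{-int (2*T)..int (2*T)}. \<Sum>a\<in>S. if \<tau> - a \<in> S then c a * c (\<tau> - a) * cis (of_int \<tau> * \<theta>) else 0)"
    using fin by (simp add: sum.inter_filter[symmetric] sum_distrib_right)
  also have "\<dots> = (\<Sum>a\<in>S. \<Sum>\<tau>\<in>{-int (2*T)..int (2*T)}. if \<tau> - a \<in> S then c a * c (\<tau> - a) * cis (of_int \<tau> * \<theta>) else 0)"
    by (rule sum.swap)
  also have "\<dots> = (\<Sum>a\<in>S. \<Sum>b\<in>S. (c a * cis (of_int a * \<theta>)) * (c b * cis (of_int b * \<theta>)))"
  proof (rule sum.cong[OF refl])
    fix a assume a: "a \<in> S"
    have "(\<Sum>\<tau>\<in>{-int (2*T)..int (2*T)}. if \<tau> - a \<in> S then c a * c (\<tau> - a) * cis (of_int \<tau> * \<theta>) else 0)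
       = (\<Sum>\<tau>\<in>{\<tau>\<in>{-int (2*T)..int (2*T)}. \<tau> - a \<in> S}. c a * c (\<tau> - a) * cis (of_int \<tau> * \<theta>))"
      by (rule sum.inter_filter[symmetric]) simp
    also have "\<dots> = (\<Sum>b\<in>S. (c a * cis (of_int a * \<theta>)) * (c b * cis (of_int b * \<theta>)))"
    proof (rule sum.reindex_bij_witness[of _ "\<lambda>b. a + b" "\<lambda>\<tau>. \<tau> - a"])
      fix b assume b: "b \<in> S"
      have "a \<in> {-int T..int T}" "b \<in> {-int T..int T}" using a b S by auto
      then show "a + b \<in> {\<tau>\<in>{-int (2*T)..int (2*T)}. \<tau> - a \<in> S}" using b by auto
    next
      fix \<tau>
      have "cis (of_int \<tau> * \<theta>) = cis (of_int a * \<theta>) * cis (of_int (\<tau> - a) * \<theta>)"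
        by (simp add: cis_mult algebra_simps)
      then show "(c a * cis (of_int a * \<theta>)) * (c (\<tau> - a) * cis (of_int (\<tau> - a) * \<theta>)) = c a * c (\<tau> - a) * cis (of_int \<tau> * \<theta>)"
        by (simp add: mult_ac)
    qed auto
    finally show "(\<Sum>\<tau>\<in>{-int (2*T)..int (2*T)}. if \<tau> - a \<in> S then c a * c (\<tau> - a) * cis (of_int \<tau> * \<theta>) else 0)
      = (\<Sum>b\<in>S. (c a * cis (of_int a * \<theta>)) * (c b * cis (of_int b * \<theta>)))" .
  qed
  also have "\<dots> = (\<Sum>t\<in>S. c t * cis (of_int t * \<theta>))\<^sup>2"
    by (simp add: power2_eq_square sum_product)
  finally show ?thesis by simp
qed

text \<open>The fourth power is the square of a trigonometric polynomial with frequencies \<open>a + b\<close>, whose coefficients are bounded by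
the numbers of representations; the sum of their squares is the energy.\<close>

lemma fourth_moment_points:
  fixes \<theta> :: "'a \<Rightarrow> real"
  assumes S: "S \<subseteq> {-int T..int T}" and c: "\<And>t. norm (c t) \<le> 1"
    and I: "finite I" and D: "\<Delta> > 0"
    and sep: "\<And>i j. i \<in> I \<Longrightarrow> j \<in> I \<Longrightarrow> i \<noteq> j \<Longrightarrow> \<Delta> \<le> \<bar>\<theta> i - \<theta> j\<bar>"
    and near: "\<And>i j. i \<in> I \<Longrightarrow> j \<in> I \<Longrightarrow> \<bar>\<theta> i - \<theta> j\<bar> \<le> 3"
  shows "(\<Sum>i\<in>I. (norm (\<Sum>t\<in>S. c t * cis (of_int t * \<theta> i))) ^ 4) \<le> sieve_const (2 * T) \<Delta> * energy S"
proof -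
  define b where "b \<tau> = (\<Sum>a\<in>{a\<in>S. \<tau> - a \<in> S}. c a * c (\<tau> - a))" for \<tau>
  have "(\<Sum>i\<in>I. (norm (\<Sum>t\<in>S. c t * cis (of_int t * \<theta> i))) ^ 4)
     = (\<Sum>i\<in>I. (norm ((\<Sum>t\<in>S. c t * cis (of_int t * \<theta> i))\<^sup>2))\<^sup>2)"
    by (simp add: norm_power power_mult[symmetric])
  also have "\<dots> = (\<Sum>i\<in>I. (norm (\<Sum>\<tau>\<in>{-int (2*T)..int (2*T)}. b \<tau> * cis (of_int \<tau> * \<theta> i)))\<^sup>2)"
    by (simp only: square_as_sum_over_sums[OF S] b_def)
  also have "\<dots> \<le> sieve_const (2 * T) \<Delta> * (\<Sum>\<tau>\<in>{-int (2*T)..int (2*T)}. (norm (b \<tau>))\<^sup>2)"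
    by (rule large_sieve_points[OF I D sep near])
  also have "\<dots> \<le> sieve_const (2 * T) \<Delta> * energy S"
  proof (intro mult_left_mono sieve_const_nonneg D)
    have "norm (b \<tau>) \<le> reps S \<tau>" for \<tau>
    proof -
      have "norm (b \<tau>) \<le> (\<Sum>a\<in>{a\<in>S. \<tau> - a \<in> S}. 1)"
        unfolding b_def
      proof (intro sum_norm_le)
        fix a
        have "norm (c a) * norm (c (\<tau> - a)) \<le> 1 * 1" using c by (intro mult_mono) auto
        then show "norm (c a * c (\<tau> - a)) \<le> 1" by (simp add: norm_mult)
      qed
      then show ?thesis by (simp add: reps_def)
    qed
    then have "(\<Sum>\<tau>\<in>{-int (2*T)..int (2*T)}. (norm (b \<tau>))\<^sup>2) \<le> (\<Sum>\<tau>\<in>{-int (2*T)..int (2*T)}. (reps S \<tau>)\<^sup>2)"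
      by (intro sum_mono power_mono) auto
    then show "(\<Sum>\<tau>\<in>{-int (2*T)..int (2*T)}. (norm (b \<tau>))\<^sup>2) \<le> energy S"
      by (simp only: energy_eq[OF S])
  qed
  finally show ?thesis .
qed

text \<open>For each quadruple \<open>a + b = d + d'\<close> in \<open>S\<close> the polynomial is at least \<open>V\<close> at \<open>d' = a + b - d\<close>. Weight the quadruple
by the square of this value and then drop the condition \<open>d' \<in> S\<close>: the sum over \<open>a\<close>, \<open>b\<close>, \<open>d\<close> becomes free,
and for each pair \<open>(m, n)\<close> of integers it is a product of three exponential sums over \<open>S\<close> at the same point \<open>ln (m / n)\<close>.\<close>

lemma energy_le_cubic_sum:
  assumes S: "S \<subseteq> {-int T..int T}" and r: "\<And>n. n \<in> triple U \<Longrightarrow> \<bar>r n\<bar> \<le> M"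
    and V: "0 \<le> V" "\<And>t. t \<in> S \<Longrightarrow> V \<le> norm (tpoly r U (of_int t))"
  shows "energy S * V\<^sup>2 \<le> M\<^sup>2 * (\<Sum>m\<in>triple U. \<Sum>n\<in>triple U. (norm (fsum S (ln (real m) - ln (real n)))) ^ 3)"
proof -
  have fin: "finite S" using S finite_subset by blast
  define f where "f t = tpoly r U (of_int t)" for t :: int
  have "energy S * V\<^sup>2 = (\<Sum>a\<in>S. \<Sum>b\<in>S. \<Sum>d\<in>{d\<in>S. a + b - d \<in> S}. V\<^sup>2)"
    by (simp add: energy_def reps_def sum_distrib_right)
  also have "\<dots> \<le> (\<Sum>a\<in>S. \<Sum>b\<in>S. \<Sum>d\<in>{d\<in>S. a + b - d \<in> S}. (norm (f (a + b - d)))\<^sup>2)"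
  proof (intro sum_mono power_mono V(1))
    fix a b d assume "d \<in> {d\<in>S. a + b - d \<in> S}"
    then have "a + b - d \<in> S" by simp
    then show "V \<le> norm (f (a + b - d))" unfolding f_def by (rule V(2))
  qed
  also have "\<dots> \<le> (\<Sum>a\<in>S. \<Sum>b\<in>S. \<Sum>d\<in>S. (norm (f (a + b - d)))\<^sup>2)"
    using fin by (intro sum_mono sum_mono2) auto
  finally have 1: "energy S * V\<^sup>2 \<le> (\<Sum>a\<in>S. \<Sum>b\<in>S. \<Sum>d\<in>S. (norm (f (a + b - d)))\<^sup>2)" .
  have sq: "complex_of_real ((norm (f t))\<^sup>2) = (\<Sum>m\<in>triple U. \<Sum>n\<in>triple U. of_real (r m * r n) * cis (of_int t * (ln (real m) - ln (real n))))" for t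
    unfolding f_def tpoly_def
    by (subst norm_square_sum_expand) simp
  have "complex_of_real (\<Sum>a\<in>S. \<Sum>b\<in>S. \<Sum>d\<in>S. (norm (f (a + b - d)))\<^sup>2)
     = (\<Sum>a\<in>S. \<Sum>b\<in>S. \<Sum>d\<in>S. \<Sum>m\<in>triple U. \<Sum>n\<in>triple U. of_real (r m * r n) * cis (of_int (a + b - d) * (ln (real m) - ln (real n))))"
    by (simp only: of_real_sum sq)
  also have "\<dots> = (\<Sum>m\<in>triple U. \<Sum>n\<in>triple U. \<Sum>a\<in>S. \<Sum>b\<in>S. \<Sum>d\<in>S. of_real (r m * r n) * cis (of_int (a + b - d) * (ln (real m) - ln (real n))))"
    by (simp only: sum.swap[of _ "triple U" S])
  also have "\<dots> = (\<Sum>m\<in>triple U. \<Sum>n\<in>triple U. of_real (r m * r n) *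
      ((fsum S (ln (real m) - ln (real n)))\<^sup>2 * cnj (fsum S (ln (real m) - ln (real n)))))"
  proof (intro sum.cong refl)
    fix m n
    define \<theta> where "\<theta> = ln (real m) - ln (real n)"
    have "cis (of_int (a + b - d) * \<theta>) = cis (of_int a * \<theta>) * cis (of_int b * \<theta>) * cnj (cis (of_int d * \<theta>))" for a b d
      by (simp add: cis_mult cis_cnj algebra_simps)
    then have "(\<Sum>a\<in>S. \<Sum>b\<in>S. \<Sum>d\<in>S. of_real (r m * r n) * cis (of_int (a + b - d) * \<theta>))
       = (\<Sum>a\<in>S. \<Sum>b\<in>S. \<Sum>d\<in>S. of_real (r m * r n) * (cis (of_int a * \<theta>) * cis (of_int b * \<theta>) * cnj (cis (of_int d * \<theta>))))"
      by simp
    also have "\<dots> = of_real (r m * r n) * ((\<Sum>a\<in>S. \<Sum>b\<in>S. cis (of_int a * \<theta>) * cis (of_int b * \<theta>)) * cnj (fsum S \<theta>))"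
      by (simp only: fsum_def cnj_sum sum_distrib_left[symmetric] sum_distrib_right[symmetric])
    also have "(\<Sum>a\<in>S. \<Sum>b\<in>S. cis (of_int a * \<theta>) * cis (of_int b * \<theta>)) = (fsum S \<theta>)\<^sup>2"
      by (simp add: fsum_def power2_eq_square sum_product)
    finally show "(\<Sum>a\<in>S. \<Sum>b\<in>S. \<Sum>d\<in>S. of_real (r m * r n) * cis (of_int (a + b - d) * (ln (real m) - ln (real n))))
       = of_real (r m * r n) * ((fsum S (ln (real m) - ln (real n)))\<^sup>2 * cnj (fsum S (ln (real m) - ln (real n))))"
      unfolding \<theta>_def .
  qed
  finally have e: "complex_of_real (\<Sum>a\<in>S. \<Sum>b\<in>S. \<Sum>d\<in>S. (norm (f (a + b - d)))\<^sup>2) = \<dots>" .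
  have "(\<Sum>a\<in>S. \<Sum>b\<in>S. \<Sum>d\<in>S. (norm (f (a + b - d)))\<^sup>2) = norm (complex_of_real (\<Sum>a\<in>S. \<Sum>b\<in>S. \<Sum>d\<in>S. (norm (f (a + b - d)))\<^sup>2))"
    by (simp add: sum_nonneg del: of_real_sum of_real_power)
  also have "\<dots> \<le> (\<Sum>m\<in>triple U. \<Sum>n\<in>triple U. M\<^sup>2 * (norm (fsum S (ln (real m) - ln (real n)))) ^ 3)"
    unfolding e
  proof (intro sum_norm_le)
    fix m n assume mn: "m \<in> triple U" "n \<in> triple U"
    have "\<bar>r m\<bar> * \<bar>r n\<bar> \<le> M * M" using r[OF mn(1)] r[OF mn(2)] by (intro mult_mono) auto
    then have "\<bar>r m\<bar> * \<bar>r n\<bar> * norm (fsum S (ln (real m) - ln (real n))) ^ 3 \<le> M\<^sup>2 * (norm (fsum S (ln (real m) - ln (real n)))) ^ 3"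
      by (intro mult_right_mono) (auto simp: power2_eq_square)
    then show "norm (of_real (r m * r n) * ((fsum S (ln (real m) - ln (real n)))\<^sup>2 * cnj (fsum S (ln (real m) - ln (real n)))))
       \<le> M\<^sup>2 * (norm (fsum S (ln (real m) - ln (real n)))) ^ 3"
      by (simp add: norm_mult norm_power abs_mult power3_eq_cube power2_eq_square mult_ac)
  qed
  also have "\<dots> = M\<^sup>2 * (\<Sum>m\<in>triple U. \<Sum>n\<in>triple U. (norm (fsum S (ln (real m) - ln (real n)))) ^ 3)"
    by (simp add: sum_distrib_left)
  finally show ?thesis using 1 by linarith
qed

text \<open>Fractions in lowest terms, indexed by their numerators and denominators.\<close>

definition coprime_pairs :: "real \<Rightarrow> (nat \<times> nat) set" where
  "coprime_pairs W = {(a, b). a \<in> triple W \<and> b \<in> triple W \<and> coprime a b}"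

lemma finite_coprime_pairs [simp]: "finite (coprime_pairs W)"
  by (rule finite_subset[of _ "triple W \<times> triple W"]) (auto simp: coprime_pairs_def)

lemma triple_scale:
  assumes "g > 0" "n = g * a"
  shows "n \<in> triple U \<longleftrightarrow> a \<in> triple (U / real g)"
  using assms by (auto simp: triple_def field_simps)

text \<open>The function depends on \<open>m / n\<close> only, so the pairs with greatest common divisor \<open>g\<close> may be reduced by \<open>g\<close>.\<close>

lemma sum_by_gcd:
  fixes h :: "real \<Rightarrow> real"
  assumes U: "U > 0"
  shows "(\<Sum>m\<in>triple U. \<Sum>n\<in>triple U. h (ln (real m) - ln (real n)))
     = (\<Sum>g\<in>{1..nat \<lfloor>3 * U\<rfloor>}. \<Sum>(a, b)\<in>coprime_pairs (U / real g). h (ln (real a) - ln (real b)))"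
proof -
  have pos: "0 < n" "n \<le> nat \<lfloor>3 * U\<rfloor>" if "n \<in> triple U" for n
  proof -
    have n: "U < real n" "real n \<le> 3 * U" using that by (auto simp: triple_def)
    then show "0 < n" using U by (intro Nat.gr0I) auto
    show "n \<le> nat \<lfloor>3 * U\<rfloor>" using n by linarith
  qed
  have "(\<Sum>m\<in>triple U. \<Sum>n\<in>triple U. h (ln (real m) - ln (real n)))
     = (\<Sum>x\<in>triple U \<times> triple U. h (ln (real (fst x)) - ln (real (snd x))))"
    by (simp add: sum.cartesian_product case_prod_beta)
  also have "\<dots> = (\<Sum>g\<in>{1..nat \<lfloor>3 * U\<rfloor>}. \<Sum>x\<in>{x\<in>triple U \<times> triple U. gcd (fst x) (snd x) = g}. h (ln (real (fst x)) - ln (real (snd x))))"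
  proof (rule sum.group[symmetric])
    show "(\<lambda>x. gcd (fst x) (snd x)) ` (triple U \<times> triple U) \<subseteq> {1..nat \<lfloor>3 * U\<rfloor>}"
    proof clarify
      fix a b assume ab: "a \<in> triple U" "b \<in> triple U"
      have "gcd a b \<le> a" using pos[OF ab(1)] by (intro gcd_le1_nat) auto
      moreover have "gcd a b > 0" using pos[OF ab(1)] by simp
      ultimately have "1 \<le> gcd a b" "gcd a b \<le> nat \<lfloor>3 * U\<rfloor>" using pos[OF ab(1)] by linarith+
      then show "gcd (fst (a, b)) (snd (a, b)) \<in> {1..nat \<lfloor>3 * U\<rfloor>}" by (simp only: fst_conv snd_conv atLeastAtMost_iff)
    qed
  qed auto
  also have "\<dots> = (\<Sum>g\<in>{1..nat \<lfloor>3 * U\<rfloor>}. \<Sum>(a, b)\<in>coprime_pairs (U / real g). h (ln (real a) - ln (real b)))"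
  proof (rule sum.cong[OF refl])
    fix g assume "g \<in> {1..nat \<lfloor>3 * U\<rfloor>}"
    then have g: "g > 0" by simp
    show "(\<Sum>x\<in>{x\<in>triple U \<times> triple U. gcd (fst x) (snd x) = g}. h (ln (real (fst x)) - ln (real (snd x))))
       = (\<Sum>(a, b)\<in>coprime_pairs (U / real g). h (ln (real a) - ln (real b)))"
    proof (rule sum.reindex_bij_witness[of _ "\<lambda>(a, b). (g * a, g * b)" "\<lambda>(m, n). (m div g, n div g)"])
      fix x assume x: "x \<in> {x\<in>triple U \<times> triple U. gcd (fst x) (snd x) = g}"
      obtain m n where mn: "x = (m, n)" "m \<in> triple U" "n \<in> triple U" "gcd m n = g" using x by auto
      have d: "m = g * (m div g)" "n = g * (n div g)" using mn(4) by auto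
      show "(case case x of (m, n) \<Rightarrow> (m div g, n div g) of (a, b) \<Rightarrow> (g * a, g * b)) = x"
        using mn d by simp
      have "coprime (m div g) (n div g)" using mn(4) g by (metis div_gcd_coprime gcd_eq_0_iff less_irrefl)
      then show "(case x of (m, n) \<Rightarrow> (m div g, n div g)) \<in> coprime_pairs (U / real g)"
        using mn triple_scale[OF g d(1)] triple_scale[OF g d(2)] by (auto simp: coprime_pairs_def)
      have pm: "0 < m div g" "0 < n div g" using pos[OF mn(2)] pos[OF mn(3)] d by (metis gr0I mult_0_right less_irrefl)+
      have "ln (real m) = ln (real g) + ln (real (m div g))" "ln (real n) = ln (real g) + ln (real (n div g))"
        using d g pm by (metis ln_mult_pos of_nat_0_less_iff of_nat_mult)+
      then show "(case case x of (m, n) \<Rightarrow> (m div g, n div g) of (a, b) \<Rightarrow> h (ln (real a) - ln (real b))) = h (ln (real (fst x)) - ln (real (snd x)))"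
        using mn by simp
    next
      fix y assume y: "y \<in> coprime_pairs (U / real g)"
      obtain a b where ab: "y = (a, b)" "a \<in> triple (U / real g)" "b \<in> triple (U / real g)" "coprime a b"
        using y by (auto simp: coprime_pairs_def)
      show "(case case y of (a, b) \<Rightarrow> (g * a, g * b) of (m, n) \<Rightarrow> (m div g, n div g)) = y" using ab g by simp
      have "gcd (g * a) (g * b) = g" using ab(4) by (simp add: gcd_mult_distrib_nat[symmetric] coprime_iff_gcd_eq_1)
      then show "(case y of (a, b) \<Rightarrow> (g * a, g * b)) \<in> {x\<in>triple U \<times> triple U. gcd (fst x) (snd x) = g}"
        using ab triple_scale[OF g refl] by auto
    qed
  qed
  finally show ?thesis .
qed

text \<open>Distinct reduced fractions \<open>a / b\<close> and \<open>c / d\<close> have \<open>a * d \<noteq> c * b\<close>, integers up to \<open>9 * W\<^sup>2\<close>.\<close>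

lemma coprime_pairs_spaced:
  assumes W: "W > 0" and x: "x \<in> coprime_pairs W" "y \<in> coprime_pairs W"
  defines "\<theta> \<equiv> \<lambda>x. ln (real (fst x)) - ln (real (snd x))"
  shows "x \<noteq> y \<Longrightarrow> 1 / (9 * W\<^sup>2) \<le> \<bar>\<theta> x - \<theta> y\<bar>" and "\<bar>\<theta> x - \<theta> y\<bar> \<le> 3"
proof -
  obtain a b c d where abcd: "x = (a, b)" "y = (c, d)" by (cases x, cases y) auto
  have t: "a \<in> triple W" "b \<in> triple W" "c \<in> triple W" "d \<in> triple W" "coprime a b" "coprime c d"
    using x abcd by (auto simp: coprime_pairs_def)
  have b': "W < real n \<and> real n \<le> 3 * W \<and> 0 < n" if "n \<in> triple W" for n
    using that W by (auto simp: triple_def intro!: Nat.gr0I)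
  have e: "\<theta> x - \<theta> y = ln (real (a * d)) - ln (real (c * b))"
    using b'[OF t(1)] b'[OF t(2)] b'[OF t(3)] b'[OF t(4)] by (simp add: \<theta>_def abcd ln_mult_pos)
  have prod: "real (p * q) \<le> 9 * W\<^sup>2" "0 < p * q" if "p \<in> triple W" "q \<in> triple W" for p q
  proof -
    have "real p * real q \<le> (3 * W) * (3 * W)" using b'[OF that(1)] b'[OF that(2)] W by (intro mult_mono) auto
    then show "real (p * q) \<le> 9 * W\<^sup>2" by (simp add: power2_eq_square)
    show "0 < p * q" using b'[OF that(1)] b'[OF that(2)] by simp
  qed
  show "1 / (9 * W\<^sup>2) \<le> \<bar>\<theta> x - \<theta> y\<bar>" if "x \<noteq> y"
  proof -
    have ne: "a * d \<noteq> c * b" using coprime_crossproduct_nat[OF t(5,6)] that abcd by auto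
    show ?thesis
    proof (cases "a * d < c * b")
      case True
      then show ?thesis using ln_nat_diff_ge[of "a * d" "c * b" "9 * W\<^sup>2"] prod[OF t(1,4)] prod[OF t(3,2)] e by linarith
    next
      case False
      then have "c * b < a * d" using ne by simp
      then show ?thesis using ln_nat_diff_ge[of "c * b" "a * d" "9 * W\<^sup>2"] prod[OF t(1,4)] prod[OF t(3,2)] e by linarith
    qed
  qed
  have "\<bar>ln (real a) - ln (real b)\<bar> \<le> 3/2" "\<bar>ln (real c) - ln (real d)\<bar> \<le> 3/2"
    by (rule triple_ln_spaced(2)[OF W t(1,2)], rule triple_ln_spaced(2)[OF W t(3,4)])
  then show "\<bar>\<theta> x - \<theta> y\<bar> \<le> 3" unfolding \<theta>_def abcd fst_conv snd_conv by linarith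
qed

text \<open>Expanding the square over \<open>S\<close> and exchanging the roles of the variables gives the squares of Dirichlet
polynomials at the differences \<open>t - t'\<close>.\<close>

lemma second_moment_ratios:
  assumes W: "W > 0" and S: "S \<subseteq> {-int T..int T}" and T: "T \<ge> 1"
  shows "(\<Sum>a\<in>triple W. \<Sum>b\<in>triple W. (norm (fsum S (ln (real a) - ln (real b))))\<^sup>2)
     \<le> real (card S) * (40000000 * (W\<^sup>2 * (1 + ln (2 * real T)) + real (card S) * real T))"
proof -
  have sq: "complex_of_real ((norm (fsum S \<theta>))\<^sup>2) = (\<Sum>t\<in>S. \<Sum>t'\<in>S. cis (of_int (t - t') * \<theta>))" for \<theta>
    using norm_square_sum_expand[of "\<lambda>_. 1" \<theta> "of_int" S] by (simp add: fsum_def mult.commute)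
  have "complex_of_real (\<Sum>a\<in>triple W. \<Sum>b\<in>triple W. (norm (fsum S (ln (real a) - ln (real b))))\<^sup>2)
     = (\<Sum>a\<in>triple W. \<Sum>b\<in>triple W. \<Sum>t\<in>S. \<Sum>t'\<in>S. cis (of_int (t - t') * (ln (real a) - ln (real b))))"
    by (simp only: of_real_sum sq)
  also have "\<dots> = (\<Sum>t\<in>S. \<Sum>t'\<in>S. \<Sum>a\<in>triple W. \<Sum>b\<in>triple W. cis (of_int (t - t') * (ln (real a) - ln (real b))))"
    by (simp only: sum.swap[of _ S "triple W"])
  also have "\<dots> = (\<Sum>t\<in>S. \<Sum>t'\<in>S. of_real ((norm (dir_sum (triple W) (of_int (t - t'))))\<^sup>2))"
    unfolding dir_sum_def
    using norm_square_sum_expand[of "\<lambda>_. 1" _ "\<lambda>n. ln (real n)" "triple W"] by simp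
  finally have e: "complex_of_real (\<Sum>a\<in>triple W. \<Sum>b\<in>triple W. (norm (fsum S (ln (real a) - ln (real b))))\<^sup>2)
     = complex_of_real (\<Sum>t\<in>S. \<Sum>t'\<in>S. (norm (dir_sum (triple W) (of_int (t - t'))))\<^sup>2)" by (simp only: of_real_sum)
  have "(\<Sum>a\<in>triple W. \<Sum>b\<in>triple W. (norm (fsum S (ln (real a) - ln (real b))))\<^sup>2)
     = (\<Sum>t\<in>S. \<Sum>t'\<in>S. (norm (dir_sum (triple W) (of_int (t - t'))))\<^sup>2)"
    using e by (simp only: of_real_eq_iff)
  also have "\<dots> \<le> (\<Sum>t\<in>S. 40000000 * (W\<^sup>2 * (1 + ln (2 * real T)) + real (card S) * real T))"
    by (intro sum_mono row_sum_dir_sum_square W S T)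
  finally show ?thesis by simp
qed

text \<open>By Cauchy--Schwarz the cubes are controlled by second and fourth powers. The points are \<open>1 / (9 * W\<^sup>2)\<close>-separated,
so the fourth powers sum to about \<open>(T + W\<^sup>2) * energy S\<close>. If \<open>W\<^sup>2 \<ge> T\<close>, this is combined with \<open>second_moment_ratios\<close>,
otherwise with the trivial bound \<open>9 * W\<^sup>2 * (card S)\<^sup>2\<close> for the second powers; the product has the factor \<open>W\<^sup>2\<close> in either case.
After the square root, a bound linear in \<open>W\<close> remains, which is what makes the sum over \<open>W = U / g\<close> cost a logarithm only.\<close>

lemma cubic_sum_coprime:
  assumes W: "W > 0" "W \<le> U" and S: "S \<subseteq> {-int T..int T}" and T: "T \<ge> 1"
  defines "l \<equiv> 1 + ln (2 * real T) + ln (1 + 27 * U\<^sup>2)"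
  shows "(\<Sum>(a, b)\<in>coprime_pairs W. (norm (fsum S (ln (real a) - ln (real b)))) ^ 3)
     \<le> 200000 * l * W * sqrt (energy S * (real (card S) * U\<^sup>2 + (real (card S))\<^sup>2 * real T))"
proof -
  define D where "D = real (card S)"
  define E where "E = energy S"
  define Q where "Q = D * U\<^sup>2 + D\<^sup>2 * real T"
  define \<theta> where "\<theta> x = ln (real (fst x)) - ln (real (snd x))" for x :: "nat \<times> nat"
  define x where "x p = norm (fsum S (\<theta> p))" for p
  have D0: "0 \<le> D" and E0: "0 \<le> E" by (simp_all add: D_def E_def energy_nonneg)
  have U: "U > 0" using W by simp
  have lT: "ln (2 * real T) \<ge> 0" using T by simp
  have lU: "ln (1 + 27 * U\<^sup>2) \<ge> 0" by simp
  have l1: "l \<ge> 1" using lT lU by (simp add: l_def)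
  have WU: "W\<^sup>2 \<le> U\<^sup>2" using W by (intro power_mono) auto
  have c2a: "(\<Sum>p\<in>coprime_pairs W. (x p)\<^sup>2) \<le> 40000000 * l * (D * W\<^sup>2 + D\<^sup>2 * real T)"
  proof -
    have "(\<Sum>p\<in>coprime_pairs W. (x p)\<^sup>2) \<le> (\<Sum>p\<in>triple W \<times> triple W. (x p)\<^sup>2)"
      by (intro sum_mono2) (auto simp: coprime_pairs_def)
    also have "\<dots> = (\<Sum>a\<in>triple W. \<Sum>b\<in>triple W. (norm (fsum S (ln (real a) - ln (real b))))\<^sup>2)"
      by (simp add: sum.cartesian_product case_prod_beta x_def \<theta>_def)
    also have "\<dots> \<le> D * (40000000 * (W\<^sup>2 * (1 + ln (2 * real T)) + D * real T))"
      using second_moment_ratios[OF W(1) S T] by (simp add: D_def)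
    also have "\<dots> \<le> D * (40000000 * (W\<^sup>2 * l + D * real T * l))"
    proof -
      have "W\<^sup>2 * (1 + ln (2 * real T)) \<le> W\<^sup>2 * l" using lU by (intro mult_left_mono) (auto simp: l_def)
      moreover have "D * real T * 1 \<le> D * real T * l" using D0 l1 by (intro mult_left_mono) auto
      ultimately show ?thesis using D0 by (intro mult_left_mono) auto
    qed
    also have "\<dots> = 40000000 * l * (D * W\<^sup>2 + D\<^sup>2 * real T)" by (simp add: algebra_simps power2_eq_square)
    finally show ?thesis .
  qed
  have c2b: "(\<Sum>p\<in>coprime_pairs W. (x p)\<^sup>2) \<le> 9 * W\<^sup>2 * D\<^sup>2"
  proof -
    have "(\<Sum>p\<in>coprime_pairs W. (x p)\<^sup>2) \<le> (\<Sum>p\<in>triple W \<times> triple W. (x p)\<^sup>2)"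
      by (intro sum_mono2) (auto simp: coprime_pairs_def)
    also have "\<dots> \<le> (\<Sum>p\<in>triple W \<times> triple W. D\<^sup>2)"
      using norm_fsum_le by (intro sum_mono power_mono) (auto simp: x_def D_def)
    also have "\<dots> = real (card (triple W)) * real (card (triple W)) * D\<^sup>2" by (simp add: card_cartesian_product)
    also have "\<dots> \<le> (3 * W) * (3 * W) * D\<^sup>2"
      using card_triple_le[OF W(1)] W by (intro mult_mono) auto
    finally show ?thesis by (simp add: power2_eq_square)
  qed
  have c4: "(\<Sum>p\<in>coprime_pairs W. (x p) ^ 4) \<le> 149 * (real T + W\<^sup>2) * l * E"
  proof -
    have "(\<Sum>p\<in>coprime_pairs W. (x p) ^ 4) = (\<Sum>p\<in>coprime_pairs W. (norm (\<Sum>t\<in>S. (\<lambda>_. 1) t * cis (of_int t * \<theta> p))) ^ 4)"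
      by (simp add: x_def fsum_def)
    also have "\<dots> \<le> sieve_const (2 * T) (1 / (9 * W\<^sup>2)) * energy S"
      using W(1) coprime_pairs_spaced[OF W(1)] by (intro fourth_moment_points S) (auto simp: \<theta>_def)
    also have "\<dots> \<le> (149 * (real T + W\<^sup>2) * l) * energy S"
    proof (intro mult_right_mono energy_nonneg)
      have "ln (1 + 27 * W\<^sup>2) \<le> ln (1 + 27 * U\<^sup>2)" using WU W by (intro ln_mono) (auto intro: add_pos_nonneg)
      then have a: "144 * W\<^sup>2 * (1 + ln (1 + 27 * W\<^sup>2)) \<le> 144 * W\<^sup>2 * l"
        using lT by (intro mult_left_mono) (auto simp: l_def)
      have b: "4 * real T + 1 \<le> 5 * real T * l"
      proof -
        have "4 * real T + 1 \<le> 5 * real T * 1" using T by simp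
        also have "\<dots> \<le> 5 * real T * l" using l1 by (intro mult_left_mono) auto
        finally show ?thesis .
      qed
      have "sieve_const (2 * T) (1 / (9 * W\<^sup>2)) = (4 * real T + 1) + 144 * W\<^sup>2 * (1 + ln (1 + 27 * W\<^sup>2))"
        by (simp add: sieve_const_def)
      also have "\<dots> \<le> 5 * real T * l + 144 * W\<^sup>2 * l" by (rule add_mono[OF b a])
      also have "\<dots> \<le> 149 * (real T + W\<^sup>2) * l"
      proof -
        have "0 \<le> real T * l" "0 \<le> W\<^sup>2 * l" using l1 by auto
        then show ?thesis by (simp add: algebra_simps)
      qed
      finally show "sieve_const (2 * T) (1 / (9 * W\<^sup>2)) \<le> 149 * (real T + W\<^sup>2) * l" .
    qed
    finally show ?thesis by (simp add: E_def)
  qed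
  have CS: "(\<Sum>p\<in>coprime_pairs W. (x p) ^ 3)\<^sup>2 \<le> (\<Sum>p\<in>coprime_pairs W. (x p)\<^sup>2) * (\<Sum>p\<in>coprime_pairs W. (x p) ^ 4)"
    using Cauchy_Schwarz_ineq_sum[of x "\<lambda>p. (x p)\<^sup>2" "coprime_pairs W"]
    by (simp add: power3_eq_cube power2_eq_square power4_eq_xxxx mult_ac)
  have Q0: "Q \<ge> 0" using D0 by (simp add: Q_def)
  have X4: "0 \<le> (\<Sum>p\<in>coprime_pairs W. (x p) ^ 4)" by (simp add: sum_nonneg x_def)
  have "(\<Sum>p\<in>coprime_pairs W. (x p)\<^sup>2) * (\<Sum>p\<in>coprime_pairs W. (x p) ^ 4) \<le> (200000 * l * W)\<^sup>2 * (E * Q)"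
  proof (cases "real T \<le> W\<^sup>2")
    case True
    have "(\<Sum>p\<in>coprime_pairs W. (x p)\<^sup>2) * (\<Sum>p\<in>coprime_pairs W. (x p) ^ 4)
       \<le> (40000000 * l * (D * W\<^sup>2 + D\<^sup>2 * real T)) * (149 * (real T + W\<^sup>2) * l * E)"
      using c2a c4 X4 l1 D0 by (intro mult_mono) auto
    also have "\<dots> \<le> (40000000 * l * Q) * (149 * (2 * W\<^sup>2) * l * E)"
      using True WU D0 l1 E0 by (intro mult_mono mult_left_mono mult_right_mono) (auto simp: Q_def intro!: mult_left_mono)
    also have "\<dots> = 11920000000 * ((l * W)\<^sup>2 * (E * Q))" by (simp add: power2_eq_square)
    also have "\<dots> \<le> 40000000000 * ((l * W)\<^sup>2 * (E * Q))" using E0 Q0 by (intro mult_right_mono) auto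
    also have "\<dots> = (200000 * l * W)\<^sup>2 * (E * Q)" by (simp add: power2_eq_square)
    finally show ?thesis .
  next
    case False
    have "(\<Sum>p\<in>coprime_pairs W. (x p)\<^sup>2) * (\<Sum>p\<in>coprime_pairs W. (x p) ^ 4)
       \<le> (9 * W\<^sup>2 * D\<^sup>2) * (149 * (real T + W\<^sup>2) * l * E)"
      using c2b c4 X4 D0 by (intro mult_mono) auto
    also have "\<dots> \<le> (9 * W\<^sup>2 * D\<^sup>2) * (149 * (2 * real T) * (l * l) * E)"
    proof -
      have "(real T + W\<^sup>2) * l \<le> (2 * real T) * (l * l)"
        using False l1 by (intro mult_mono) (auto simp: mult_le_cancel_right1)
      then have "149 * ((real T + W\<^sup>2) * l) * E \<le> 149 * ((2 * real T) * (l * l)) * E"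
        using E0 by (intro mult_right_mono mult_left_mono) auto
      then have "149 * (real T + W\<^sup>2) * l * E \<le> 149 * (2 * real T) * (l * l) * E" by (simp add: mult_ac)
      then show ?thesis by (intro mult_left_mono) auto
    qed
    also have "\<dots> = 2682 * ((l * W)\<^sup>2 * (E * (D\<^sup>2 * real T)))" by (simp add: power2_eq_square)
    also have "\<dots> \<le> 40000000000 * ((l * W)\<^sup>2 * (E * Q))"
      using E0 D0 by (intro mult_mono mult_left_mono) (auto simp: Q_def)
    also have "\<dots> = (200000 * l * W)\<^sup>2 * (E * Q)" by (simp add: power2_eq_square)
    finally show ?thesis .
  qed
  also have "\<dots> = (200000 * l * W * sqrt (E * Q))\<^sup>2"
    using E0 Q0 by (simp add: power_mult_distrib)
  finally have "(\<Sum>p\<in>coprime_pairs W. (x p) ^ 3)\<^sup>2 \<le> (200000 * l * W * sqrt (E * Q))\<^sup>2"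
    using CS by linarith
  then have "(\<Sum>p\<in>coprime_pairs W. (x p) ^ 3) \<le> 200000 * l * W * sqrt (E * Q)"
    by (rule power2_le_imp_le) (use l1 W E0 Q0 in auto)
  then show ?thesis
    by (simp add: x_def \<theta>_def E_def Q_def D_def case_prod_beta)
qed

lemma cubic_sum_bound:
  assumes U: "U > 0" and S: "S \<subseteq> {-int T..int T}" and T: "T \<ge> 1"
  defines "l \<equiv> 1 + ln (2 * real T) + ln (1 + 27 * U\<^sup>2)"
  shows "(\<Sum>m\<in>triple U. \<Sum>n\<in>triple U. (norm (fsum S (ln (real m) - ln (real n)))) ^ 3)
     \<le> 200000 * l\<^sup>2 * U * sqrt (energy S * (real (card S) * U\<^sup>2 + (real (card S))\<^sup>2 * real T))"
proof -
  define R where "R = sqrt (energy S * (real (card S) * U\<^sup>2 + (real (card S))\<^sup>2 * real T))"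
  have R0: "R \<ge> 0" by (simp add: R_def energy_nonneg)
  have lT: "ln (2 * real T) \<ge> 0" using T by simp
  have lU: "ln (1 + 27 * U\<^sup>2) \<ge> 0" by simp
  have l1: "l \<ge> 1" using lT lU by (simp add: l_def)
  define L where "L = nat \<lfloor>3 * U\<rfloor>"
  have "(\<Sum>m\<in>triple U. \<Sum>n\<in>triple U. (norm (fsum S (ln (real m) - ln (real n)))) ^ 3)
     = (\<Sum>g\<in>{1..L}. \<Sum>(a, b)\<in>coprime_pairs (U / real g). (norm (fsum S (ln (real a) - ln (real b)))) ^ 3)"
    unfolding L_def by (rule sum_by_gcd[OF U])
  also have "\<dots> \<le> (\<Sum>g\<in>{1..L}. 200000 * l * (U / real g) * R)"
    unfolding l_def R_def
    using U by (intro sum_mono cubic_sum_coprime S T) (auto simp: divide_le_eq mult_le_cancel_left1)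
  also have "\<dots> = (\<Sum>g=1..L. 200000 * l * U * R * (1 / real g))"
    by (simp add: mult_ac)
  also have "\<dots> = 200000 * l * U * R * (\<Sum>g=1..L. 1 / real g)"
    by (rule sum_distrib_left[symmetric])
  also have "\<dots> \<le> 200000 * l * U * R * l"
  proof (rule mult_left_mono)
    show "(\<Sum>g=1..L. 1 / real g) \<le> l"
    proof (cases "L \<ge> 1")
      case True
      have "real L \<le> 3 * U" using U by (simp add: L_def)
      also have "\<dots> \<le> 1 + 27 * U\<^sup>2"
      proof -
        have "0 \<le> (6 * U - 1)\<^sup>2" by simp
        then have "12 * U \<le> 36 * U\<^sup>2 + 1" by (simp add: power2_eq_square algebra_simps)
        then have "3 * U \<le> 9 * U\<^sup>2 + 1/4" by simp
        moreover have "0 \<le> U\<^sup>2" by simp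
        ultimately show ?thesis by linarith
      qed
      finally have "ln (real L) \<le> ln (1 + 27 * U\<^sup>2)" using True by (intro ln_mono) auto
      then show ?thesis using sum_inverse_le_ln[OF True] lT by (simp add: l_def)
    next
      case False
      then show ?thesis using l1 by simp
    qed
  qed (use l1 U R0 in auto)
  finally show ?thesis by (simp add: R_def power2_eq_square mult_ac)
qed

text \<open>The bound of the cubic sum contains the square root of the energy, so the inequality of \<open>energy_le_cubic_sum\<close> can be solved
for the energy.\<close>

lemma energy_large_values:
  assumes U: "U > 0" and S: "S \<subseteq> {-int T..int T}" and T: "T \<ge> 1"
    and r: "\<And>n. n \<in> triple U \<Longrightarrow> \<bar>r n\<bar> \<le> M"
    and V: "0 \<le> V" "\<And>t. t \<in> S \<Longrightarrow> V \<le> norm (tpoly r U (of_int t))"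
  defines "l \<equiv> 1 + ln (2 * real T) + ln (1 + 27 * U\<^sup>2)"
  shows "energy S * V ^ 4 \<le> 40000000000 * M ^ 4 * l ^ 4 * U\<^sup>2 * (real (card S) * U\<^sup>2 + (real (card S))\<^sup>2 * real T)"
proof (cases "energy S = 0")
  case True
  then show ?thesis by (simp add: zero_le_even_power)
next
  case False
  define E where "E = energy S"
  define Q where "Q = real (card S) * U\<^sup>2 + (real (card S))\<^sup>2 * real T"
  have E: "E > 0" using False energy_nonneg[of S] by (simp add: E_def)
  have Q: "Q \<ge> 0" by (simp add: Q_def)
  have "E * V\<^sup>2 \<le> M\<^sup>2 * (\<Sum>m\<in>triple U. \<Sum>n\<in>triple U. (norm (fsum S (ln (real m) - ln (real n)))) ^ 3)"
    unfolding E_def by (rule energy_le_cubic_sum[OF S r V])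
  also have "\<dots> \<le> M\<^sup>2 * (200000 * l\<^sup>2 * U * sqrt (E * Q))"
    unfolding E_def Q_def l_def by (intro mult_left_mono cubic_sum_bound U S T) auto
  finally have "(E * V\<^sup>2)\<^sup>2 \<le> (M\<^sup>2 * (200000 * l\<^sup>2 * U * sqrt (E * Q)))\<^sup>2"
    using E by (intro power_mono) auto
  also have "\<dots> = E * (40000000000 * M ^ 4 * l ^ 4 * U\<^sup>2 * Q)"
    using E Q by (simp add: power_mult_distrib power_mult[symmetric] mult_ac)
  also have "(E * V\<^sup>2)\<^sup>2 = E * (E * V ^ 4)"
    by (simp add: power2_eq_square power4_eq_xxxx mult_ac)
  finally have "E * V ^ 4 \<le> 40000000000 * M ^ 4 * l ^ 4 * U\<^sup>2 * Q"
    using E by (simp only: mult_le_cancel_left_pos)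
  then show ?thesis by (simp add: E_def Q_def)
qed

subsection \<open>Exponential sums over separated points\<close>

lemma point_sum_second:
  fixes \<theta> :: "'a \<Rightarrow> real"
  assumes S: "S \<subseteq> {-int T..int T}" and I: "finite I" and D: "\<Delta> > 0"
    and sep: "\<And>i j. i \<in> I \<Longrightarrow> j \<in> I \<Longrightarrow> i \<noteq> j \<Longrightarrow> \<Delta> \<le> \<bar>\<theta> i - \<theta> j\<bar>"
    and near: "\<And>i j. i \<in> I \<Longrightarrow> j \<in> I \<Longrightarrow> \<bar>\<theta> i - \<theta> j\<bar> \<le> 3"
  shows "(\<Sum>t\<in>S. norm (\<Sum>i\<in>I. cis (of_int t * \<theta> i)))\<^sup>2 \<le> real (card S) * sieve_const T \<Delta> * real (card I)"
proof -
  have "(\<Sum>t\<in>S. norm (\<Sum>i\<in>I. cis (of_int t * \<theta> i)))\<^sup>2 \<le> (\<Sum>t\<in>S. 1\<^sup>2) * (\<Sum>t\<in>S. (norm (\<Sum>i\<in>I. cis (of_int t * \<theta> i)))\<^sup>2)"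
    using Cauchy_Schwarz_ineq_sum[of "\<lambda>_. 1" "\<lambda>t. norm (\<Sum>i\<in>I. cis (of_int t * \<theta> i))" S] by simp
  also have "\<dots> \<le> real (card S) * (sieve_const T \<Delta> * real (card I))"
  proof (intro mult_mono)
    have "(\<Sum>t\<in>S. (norm (\<Sum>i\<in>I. cis (of_int t * \<theta> i)))\<^sup>2) \<le> (\<Sum>t\<in>{-int T..int T}. (norm (\<Sum>i\<in>I. 1 * cis (of_int t * \<theta> i)))\<^sup>2)"
      using S by (simp add: sum_mono2)
    also have "\<dots> \<le> sieve_const T \<Delta> * (\<Sum>i\<in>I. (norm (1::complex))\<^sup>2)"
      by (rule large_sieve_frequencies[OF I D sep near])
    finally show "(\<Sum>t\<in>S. (norm (\<Sum>i\<in>I. cis (of_int t * \<theta> i)))\<^sup>2) \<le> sieve_const T \<Delta> * real (card I)" by simp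
  qed (auto intro!: sum_nonneg)
  finally show ?thesis by (simp add: mult_ac)
qed

text \<open>Duality with aligned phases moves the fourth power from the frequencies to the points, where \<open>fourth_moment_points\<close> applies.\<close>

lemma point_sum_fourth:
  fixes \<theta> :: "'a \<Rightarrow> real"
  assumes S: "S \<subseteq> {-int T..int T}" and I: "finite I" and D: "\<Delta> > 0"
    and sep: "\<And>i j. i \<in> I \<Longrightarrow> j \<in> I \<Longrightarrow> i \<noteq> j \<Longrightarrow> \<Delta> \<le> \<bar>\<theta> i - \<theta> j\<bar>"
    and near: "\<And>i j. i \<in> I \<Longrightarrow> j \<in> I \<Longrightarrow> \<bar>\<theta> i - \<theta> j\<bar> \<le> 3"
  shows "(\<Sum>t\<in>S. norm (\<Sum>i\<in>I. cis (of_int t * \<theta> i))) ^ 4 \<le> (real (card I)) ^ 3 * sieve_const (2 * T) \<Delta> * energy S"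
proof -
  define Y where "Y t = (\<Sum>i\<in>I. cis (of_int t * \<theta> i))" for t :: int
  obtain c where c: "\<And>t. norm (c t) \<le> 1" "\<And>t. c t * Y t = of_real (norm (Y t))"
    using aligned_phases[of Y] by blast
  define s where "s i = norm (\<Sum>t\<in>S. c t * cis (of_int t * \<theta> i))" for i
  have "(\<Sum>t\<in>S. norm (Y t)) = norm (complex_of_real (\<Sum>t\<in>S. norm (Y t)))" by (simp add: sum_nonneg del: of_real_sum)
  also have "complex_of_real (\<Sum>t\<in>S. norm (Y t)) = (\<Sum>t\<in>S. c t * Y t)" by (simp add: c(2))
  also have "\<dots> = (\<Sum>i\<in>I. \<Sum>t\<in>S. c t * cis (of_int t * \<theta> i))"
    unfolding Y_def sum_distrib_left by (rule sum.swap)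
  also have "norm \<dots> \<le> (\<Sum>i\<in>I. s i)" unfolding s_def by (rule norm_sum)
  finally have 1: "(\<Sum>t\<in>S. norm (Y t)) \<le> (\<Sum>i\<in>I. s i)" .
  have "(\<Sum>t\<in>S. norm (Y t)) ^ 4 \<le> (\<Sum>i\<in>I. s i) ^ 4"
    using 1 by (intro power_mono) (auto intro!: sum_nonneg)
  also have "\<dots> = ((\<Sum>i\<in>I. s i)\<^sup>2)\<^sup>2" by (simp add: power_mult[symmetric])
  also have "\<dots> \<le> (real (card I) * (\<Sum>i\<in>I. (s i)\<^sup>2))\<^sup>2"
    using Cauchy_Schwarz_ineq_sum[of "\<lambda>_. 1" s I] by (intro power_mono) auto
  also have "\<dots> = (real (card I))\<^sup>2 * (\<Sum>i\<in>I. (s i)\<^sup>2)\<^sup>2" by (simp add: power_mult_distrib)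
  also have "\<dots> \<le> (real (card I))\<^sup>2 * (real (card I) * (\<Sum>i\<in>I. (s i) ^ 4))"
    using Cauchy_Schwarz_ineq_sum[of "\<lambda>_. 1" "\<lambda>i. (s i)\<^sup>2" I] by (intro mult_left_mono) (auto simp: power_mult[symmetric])
  also have "\<dots> \<le> (real (card I))\<^sup>2 * (real (card I) * (sieve_const (2 * T) \<Delta> * energy S))"
    unfolding s_def by (intro mult_left_mono fourth_moment_points[OF S c(1) I D sep near]) auto
  also have "\<dots> = (real (card I)) ^ 3 * sieve_const (2 * T) \<Delta> * energy S"
    by (simp add: power2_eq_square power3_eq_cube mult_ac)
  finally show ?thesis by (simp add: Y_def)
qed

section \<open>Detecting products near a point\<close>

text \<open>The Fejer kernel, normalised to have the value \<open>1\<close> at \<open>0\<close>. It is at least \<open>1/4\<close> for \<open>\<bar>v\<bar> \<le> 1 / M\<close> and decays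
quadratically on the scale \<open>1 / M\<close>; its powers decay as fast as desired and keep integer frequencies.\<close>

definition kern :: "nat \<Rightarrow> real \<Rightarrow> real" where
  "kern M v = (norm (\<Sum>s<M. cis (real s * v)) / real M)\<^sup>2"

lemma kern_nonneg: "0 \<le> kern M v"
  by (simp add: kern_def)

lemma kern_expand:
  assumes "M \<ge> 1"
  shows "complex_of_real (kern M v) = (\<Sum>a<M. \<Sum>b<M. cis (of_int (int a - int b) * v)) / of_nat (M * M)"
proof -
  have "complex_of_real ((norm (\<Sum>s<M. 1 * cis (v * real s)))\<^sup>2) = (\<Sum>a<M. \<Sum>b<M. 1 * cnj 1 * cis (v * (real a - real b)))"
    by (rule norm_square_sum_expand)
  then have "complex_of_real ((norm (\<Sum>s<M. cis (real s * v)))\<^sup>2) = (\<Sum>a<M. \<Sum>b<M. cis (of_int (int a - int b) * v))"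
    by (simp add: mult.commute)
  then show ?thesis by (simp add: kern_def power_divide power2_eq_square)
qed

text \<open>Multiplication by the kernel averages the coefficients over windows of length \<open>M\<close>. The bound for the sum over a window
is carried through the induction because it holds for \<open>j = 0\<close>, where the single coefficient \<open>1\<close> is too large for the pointwise bound.\<close>

lemma kern_power_coeffs:
  assumes M: "M \<ge> 1"
  shows "\<exists>\<kappa>::int \<Rightarrow> real. (\<forall>t. 0 \<le> \<kappa> t) \<and> (\<forall>t. (\<Sum>b<M. \<kappa> (t + int b)) \<le> 1) \<and>
     (\<forall>t. \<bar>t\<bar> > int (j * M) \<longrightarrow> \<kappa> t = 0) \<and> (j \<ge> 1 \<longrightarrow> (\<forall>t. \<kappa> t \<le> 1 / real M)) \<and>
     (\<forall>v. complex_of_real (kern M v ^ j) = (\<Sum>t\<in>{-int (j*M)..int (j*M)}. of_real (\<kappa> t) * cis (of_int t * v)))"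
proof (induction j)
  case 0
  define \<kappa> where "\<kappa> t = (if t = 0 then 1 else 0 :: real)" for t :: int
  have "(\<Sum>b<M. \<kappa> (t + int b)) \<le> 1" for t
  proof -
    have "(\<Sum>b<M. \<kappa> (t + int b)) = (\<Sum>b\<in>{b\<in>{..<M}. t + int b = 0}. 1)"
      unfolding \<kappa>_def by (rule sum.inter_filter[symmetric]) simp
    also have "\<dots> = real (card {b\<in>{..<M}. t + int b = 0})" by simp
    also have "card {b\<in>{..<M}. t + int b = 0} \<le> card {nat (-t)}" by (intro card_mono) auto
    finally show ?thesis by simp
  qed
  then show ?case by (intro exI[of _ \<kappa>]) (auto simp: \<kappa>_def)
next
  case (Suc j)
  then obtain \<kappa> where k: "\<And>t. 0 \<le> \<kappa> t" "\<And>t. (\<Sum>b<M. \<kappa> (t + int b)) \<le> 1" "\<And>t. \<bar>t\<bar> > int (j * M) \<Longrightarrow> \<kappa> t = 0"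
    and ke: "\<And>v. complex_of_real (kern M v ^ j) = (\<Sum>t\<in>{-int (j*M)..int (j*M)}. of_real (\<kappa> t) * cis (of_int t * v))"
    by auto
  define \<kappa>' where "\<kappa>' t = (\<Sum>a<M. \<Sum>b<M. \<kappa> (t - int a + int b)) / real (M * M)" for t
  have nn: "0 \<le> \<kappa>' t" for t unfolding \<kappa>'_def by (intro divide_nonneg_nonneg sum_nonneg k) auto
  have up: "\<kappa>' t \<le> 1 / real M" for t
  proof -
    have "(\<Sum>a<M. \<Sum>b<M. \<kappa> (t - int a + int b)) \<le> (\<Sum>a<M. 1)" by (intro sum_mono k)
    then have "\<kappa>' t \<le> real M / real (M * M)" unfolding \<kappa>'_def by (intro divide_right_mono) auto
    also have "\<dots> = 1 / real M" using M by simp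
    finally show ?thesis .
  qed
  have win: "(\<Sum>b<M. \<kappa>' (t + int b)) \<le> 1" for t
  proof -
    have "(\<Sum>b<M. \<kappa>' (t + int b)) \<le> (\<Sum>b<M. 1 / real M)" by (intro sum_mono up)
    also have "\<dots> = 1" using M by simp
    finally show ?thesis .
  qed
  have supp: "\<kappa>' t = 0" if "\<bar>t\<bar> > int (Suc j * M)" for t
  proof -
    have "\<kappa> (t - int a + int b) = 0" if "a < M" "b < M" for a b
    proof (rule k(3))
      have "\<bar>t\<bar> > int (j * M) + int M" using \<open>\<bar>t\<bar> > int (Suc j * M)\<close> by simp
      then show "\<bar>t - int a + int b\<bar> > int (j * M)" using that by linarith
    qed
    then show ?thesis by (simp add: \<kappa>'_def)
  qed
  define L where "L = int (Suc j * M)"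
  have LL: "L = int (j * M) + int M" by (simp add: L_def)
  have ex: "complex_of_real (kern M v ^ Suc j) = (\<Sum>t\<in>{-L..L}. of_real (\<kappa>' t) * cis (of_int t * v))" for v
  proof -
    have inner: "(\<Sum>t\<in>{-L..L}. of_real (\<kappa> (t - int a + int b)) * cis (of_int t * v))
        = cis (of_int (int a - int b) * v) * complex_of_real (kern M v ^ j)" if ab: "a < M" "b < M" for a b
    proof -
      have "(\<Sum>t\<in>{-L..L}. of_real (\<kappa> (t - int a + int b)) * cis (of_int t * v))
         = (\<Sum>t\<in>{- int (j*M) + int a - int b..int (j*M) + int a - int b}. of_real (\<kappa> (t - int a + int b)) * cis (of_int t * v))"
      proof (rule sum.mono_neutral_right)
        show "{- int (j*M) + int a - int b..int (j*M) + int a - int b} \<subseteq> {-L..L}" using ab LL by auto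
        show "\<forall>t\<in>{-L..L} - {- int (j*M) + int a - int b..int (j*M) + int a - int b}. of_real (\<kappa> (t - int a + int b)) * cis (of_int t * v) = 0"
        proof
          fix t assume "t \<in> {-L..L} - {- int (j*M) + int a - int b..int (j*M) + int a - int b}"
          then have "\<bar>t - int a + int b\<bar> > int (j * M)" by auto
          then show "of_real (\<kappa> (t - int a + int b)) * cis (of_int t * v) = 0" using k(3) by simp
        qed
      qed auto
      also have "\<dots> = (\<Sum>t\<in>{-int (j*M)..int (j*M)}. cis (of_int (int a - int b) * v) * (of_real (\<kappa> t) * cis (of_int t * v)))"
        by (rule sum.reindex_bij_witness[of _ "\<lambda>t. t + int a - int b" "\<lambda>t. t - int a + int b"])
           (auto simp: cis_mult algebra_simps)
      finally show ?thesis by (simp only: ke sum_distrib_left)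
    qed
    have "complex_of_real (kern M v ^ Suc j) = complex_of_real (kern M v) * complex_of_real (kern M v ^ j)" by simp
    also have "\<dots> = (\<Sum>a<M. \<Sum>b<M. cis (of_int (int a - int b) * v) * complex_of_real (kern M v ^ j)) / of_nat (M * M)"
      by (simp add: kern_expand[OF M] sum_distrib_right)
    also have "\<dots> = (\<Sum>a<M. \<Sum>b<M. \<Sum>t\<in>{-L..L}. of_real (\<kappa> (t - int a + int b)) * cis (of_int t * v)) / of_nat (M * M)"
      using inner by simp
    also have "(\<Sum>a<M. \<Sum>b<M. \<Sum>t\<in>{-L..L}. complex_of_real (\<kappa> (t - int a + int b)) * cis (of_int t * v))
        = (\<Sum>t\<in>{-L..L}. (\<Sum>a<M. \<Sum>b<M. of_real (\<kappa> (t - int a + int b))) * cis (of_int t * v))"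
      by (simp only: sum.swap[of _ "{-L..L}" "{..<M}"] sum_distrib_right)
    also have "\<dots> / of_nat (M * M) = (\<Sum>t\<in>{-L..L}. of_real (\<kappa>' t) * cis (of_int t * v))"
      unfolding sum_divide_distrib[of _ "{-L..L}"] by (intro sum.cong refl) (simp add: \<kappa>'_def)
    finally show ?thesis .
  qed
  show ?case
    using nn up win supp ex by (intro exI[of _ \<kappa>']) (auto simp: L_def)
qed

lemma kern_le:
  assumes M: "M \<ge> 1" and v: "0 < \<bar>v\<bar>" "\<bar>v\<bar> \<le> 3"
  shows "kern M v \<le> (4 / (real M * \<bar>v\<bar>))\<^sup>2"
proof -
  have "\<bar>v\<bar> / 4 \<le> sin (\<bar>v\<bar> / 2)" using sin_ge_half[of "\<bar>v\<bar>/2"] v by simp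
  also have "\<dots> \<le> \<bar>sin (v / 2)\<bar>" by (cases "v \<ge> 0") auto
  finally have s: "\<bar>v\<bar> / 4 \<le> \<bar>sin (v / 2)\<bar>" .
  have n1: "norm (cis v - 1) = 2 * \<bar>sin (v/2)\<bar>" by (rule norm_cis_minus_one)
  have ne: "cis v \<noteq> 1" using n1 s v by auto
  have "(\<Sum>s<M. cis (real s * v)) = (\<Sum>s<M. cis v ^ s)" by (simp add: Complex.DeMoivre)
  also have "\<dots> = (cis v ^ M - 1) / (cis v - 1)" by (rule geometric_sum[OF ne])
  finally have "norm (\<Sum>s<M. cis (real s * v)) = norm (cis v ^ M - 1) / (2 * \<bar>sin (v/2)\<bar>)"
    by (simp add: norm_divide n1)
  also have "\<dots> \<le> 2 / (2 * (\<bar>v\<bar> / 4))"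
  proof (rule frac_le)
    have "norm (cis v ^ M - 1) \<le> norm (cis v ^ M) + norm (1::complex)" by (rule norm_triangle_ineq4)
    then show "norm (cis v ^ M - 1) \<le> 2" by (simp add: norm_power)
  qed (use s v in auto)
  finally have "norm (\<Sum>s<M. cis (real s * v)) / real M \<le> 4 / (real M * \<bar>v\<bar>)"
    using M v by (simp add: field_simps)
  then show ?thesis unfolding kern_def by (intro power_mono) auto
qed

lemma kern_ge:
  assumes M: "M \<ge> 1" and v: "\<bar>v\<bar> \<le> 1 / real M"
  shows "kern M v \<ge> 1/4"
proof -
  have c: "cos (real s * v) \<ge> 1/2" if "s < M" for s
  proof -
    have "\<bar>real s * v\<bar> \<le> real M * (1 / real M)" unfolding abs_mult using that v by (intro mult_mono) auto
    then have x: "\<bar>real s * v\<bar> \<le> 1" using M by simp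
    define x where "x = real s * v"
    have "cos x = 1 - 2 * (sin (x/2))\<^sup>2" using cos_double_sin[of "x/2"] by simp
    moreover have "(sin (x/2))\<^sup>2 \<le> (1/2)\<^sup>2"
    proof -
      have "\<bar>sin (x/2)\<bar> \<le> \<bar>x/2\<bar>" by (rule abs_sin_x_le_abs_x)
      then have "\<bar>sin (x/2)\<bar> \<le> \<bar>1/2\<bar>" using x by (simp add: x_def)
      then show ?thesis by (rule abs_le_square_iff[THEN iffD1])
    qed
    ultimately show ?thesis by (simp add: x_def power2_eq_square)
  qed
  have "real M / 2 = (\<Sum>s<M. 1/2)" by simp
  also have "\<dots> \<le> (\<Sum>s<M. cos (real s * v))" using c by (intro sum_mono) auto
  also have "\<dots> = Re (\<Sum>s<M. cis (real s * v))" by simp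
  also have "\<dots> \<le> norm (\<Sum>s<M. cis (real s * v))" by (rule complex_Re_le_cmod)
  finally have "1/2 \<le> norm (\<Sum>s<M. cis (real s * v)) / real M" using M by (simp add: field_simps)
  then have "(1/2)\<^sup>2 \<le> kern M v" unfolding kern_def by (intro power_mono) auto
  then show ?thesis by (simp add: power2_eq_square)
qed

lemma ln2_le_1: "ln (2::real) \<le> 1"
  using ln_le_minus_one[of "2::real"] by simp

lemma ln_ratio_le_3:
  fixes x y Z :: real
  assumes Z: "Z > 0" and x: "Z \<le> x" "x \<le> 27 * Z" and y: "3 * Z \<le> y" "y \<le> 8 * Z"
  shows "\<bar>ln x - ln y\<bar> \<le> 3"
proof -
  have "ln x \<le> ln (9 * y)" using assms by simp
  also have "\<dots> = ln (3 * 3) + ln y" using assms by (subst ln_mult_pos) auto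
  also have "ln (3 * 3 :: real) = ln 3 + ln 3" by (rule ln_mult_pos) auto
  finally have 1: "ln x - ln y \<le> 3" using ln3_le by linarith
  have "ln (8::real) = 3 * ln 2" using ln_realpow[of 2 3] by simp
  moreover have "ln y \<le> ln (8 * x)" using assms by simp
  moreover have "ln (8 * x) = ln 8 + ln x" using assms by (intro ln_mult_pos) auto
  ultimately have "ln y - ln x \<le> 3" using ln2_le_1 by linarith
  with 1 show ?thesis by linarith
qed

lemma exp_power_le_3:
  assumes "k \<ge> 1"
  shows "(1 + 1 / real k) ^ k \<le> 3"
proof -
  have "(1 + 1 / real k) ^ k \<le> exp (1 / real k) ^ k" by (intro power_mono exp_ge_add_one_self) auto
  also have "\<dots> = exp 1" using assms by (simp add: exp_of_nat_mult[symmetric])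
  also have "\<dots> \<le> 3" by (rule exp_le)
  finally show ?thesis .
qed

text \<open>Factors from so short an interval that products of up to \<open>k\<close> of them are determined up to a factor
\<open>(1 + 1 / k) ^ k \<le> 3\<close>.\<close>

locale smooth_factors =
  fixes A :: "nat set" and P k :: nat
  assumes k1: "k \<ge> 1" and P1: "P \<ge> 1"
    and A_fin: "finite A"
    and A_lo: "\<And>a. a \<in> A \<Longrightarrow> P < a"
    and A_hi: "\<And>a. a \<in> A \<Longrightarrow> real a \<le> (1 + 1 / real k) * real P"
begin

lemma rep_support:
  assumes "rep A j n \<noteq> 0" "j \<le> k"
  shows "(real P) ^ j \<le> real n" "real n \<le> 3 * (real P) ^ j" "j \<ge> 1 \<Longrightarrow> (real P) ^ j < real n" "n > 0"
proof -
  have "real (P + 1) ^ j \<le> real n \<and> real n \<le> ((1 + 1 / real k) * real P) ^ j"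
  proof (rule rep_range[OF _ _ assms(1)])
    fix a assume "a \<in> A"
    then show "real (P + 1) \<le> real a \<and> real a \<le> (1 + 1 / real k) * real P" using A_lo A_hi by fastforce
  qed simp
  then have r: "real (P + 1) ^ j \<le> real n" "real n \<le> (1 + 1 / real k) ^ j * (real P) ^ j"
    by (auto simp: power_mult_distrib)
  have "(real P) ^ j \<le> real (P + 1) ^ j" by (intro power_mono) auto
  then show "(real P) ^ j \<le> real n" using r(1) by linarith
  then show "n > 0" using P1 by (metis less_le_trans of_nat_0_less_iff zero_less_power zero_less_one)
  have "(1 + 1 / real k) ^ j \<le> (1 + 1 / real k) ^ k" using assms(2) k1 by (intro power_increasing) auto
  also have "\<dots> \<le> 3" by (rule exp_power_le_3[OF k1])
  finally have "(1 + 1 / real k) ^ j * (real P) ^ j \<le> 3 * (real P) ^ j" by (intro mult_right_mono) auto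
  then show "real n \<le> 3 * (real P) ^ j" using r(2) by linarith
  show "(real P) ^ j < real n" if "j \<ge> 1"
  proof -
    have "(real P) ^ j < real (P + 1) ^ j" using that by (intro power_strict_mono) auto
    then show ?thesis using r(1) by linarith
  qed
qed

lemma dir_sum_power_support:
  assumes "j \<le> k"
  shows "dir_sum A t ^ j = (\<Sum>n\<in>{n. rep A j n \<noteq> 0}. of_real (rep A j n) * cis (t * ln (real n)))"
proof -
  define K where "K = Max (insert 1 A)"
  have K: "K \<ge> 1" "\<And>a. a \<in> A \<Longrightarrow> 0 < a \<and> a \<le> K" using A_fin A_lo by (auto simp: K_def intro: le_less_trans)
  have K': "0 < a \<and> a \<le> K" if "a \<in> A" for a using K(2)[OF that] .
  have "dir_sum A t ^ j = (\<Sum>n\<in>{1..K^j}. of_real (rep A j n) * cis (t * ln (real n)))"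
    by (rule dir_sum_power[OF A_fin K' K(1)])
  also have "\<dots> = (\<Sum>n\<in>{n. rep A j n \<noteq> 0}. of_real (rep A j n) * cis (t * ln (real n)))"
  proof (rule sum.mono_neutral_right)
    show "{n. rep A j n \<noteq> 0} \<subseteq> {1..K ^ j}"
    proof
      fix n assume n: "n \<in> {n. rep A j n \<noteq> 0}"
      then have "real n \<le> real K ^ j" using rep_range[of A 0 "real K" j n] K by auto
      then have "real n \<le> real (K ^ j)" by simp
      then have "n \<le> K ^ j" by (simp only: of_nat_le_iff)
      then show "n \<in> {1..K ^ j}" using rep_support(4)[of j n] n assms by simp
    qed
  qed auto
  finally show ?thesis .
qed

lemma dir_sum_power_tpoly:
  assumes "1 \<le> j" "j \<le> k"
  shows "dir_sum A t ^ j = tpoly (rep A j) (real P ^ j) t"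
  unfolding tpoly_def dir_sum_power_support[OF assms(2)]
proof (rule sum.mono_neutral_left)
  show "{n. rep A j n \<noteq> 0} \<subseteq> triple (real P ^ j)"
    using rep_support[of j] assms by (auto simp: triple_def)
qed auto

lemma sum_rep: "(\<Sum>n\<in>{n. rep A j n \<noteq> 0}. rep A j n) = real (card A) ^ j" if "j \<le> k"
proof -
  have "complex_of_real (real (card A) ^ j) = dir_sum A 0 ^ j" by (simp add: dir_sum_def)
  also have "\<dots> = of_real (\<Sum>n\<in>{n. rep A j n \<noteq> 0}. rep A j n)"
    by (simp add: dir_sum_power_support[OF that])
  finally show ?thesis by (simp only: of_real_eq_iff)
qed

text \<open>Let \<open>W\<close> be the \<open>j\<close>-th power of the kernel, and compare for fixed \<open>y\<close> and \<open>q\<close> the sum of \<open>W (ln (q * p) - ln y)\<close> over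
\<open>P < p \<le> 9 * P\<close> with the corresponding average over the grid points \<open>b / B\<close>. The first is negligible because every \<open>q * p\<close> is at
logarithmic distance at least \<open>1 / T\<close> from \<open>y\<close>, where \<open>W\<close> has decayed. The second is not: the grid is fine enough to contain about \<open>B * P / M\<close> points close to \<open>y / q\<close>,
which lies in the range since \<open>y\<close> is between \<open>3 * P ^ (k + 1)\<close> and \<open>8 * P ^ (k + 1)\<close>. So the difference \<open>G\<close> is negative and bounded away from
\<open>0\<close>; summation over \<open>q\<close> with the weights \<open>rep A k q\<close> and over \<open>y\<close>, and the Fourier expansion of \<open>W\<close>, give the claim.\<close>

lemma detection:
  fixes I :: "real set" and T :: real
  assumes j: "j \<ge> 1" and M: "M \<ge> 8" and B: "B \<ge> 1" "B * P \<ge> 2 * M" and T: "T > 0"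
    and small: "32 * real M * 4 ^ j * (4 * T / real M) ^ (2 * j) \<le> 1"
    and I: "finite I" "\<And>y. y \<in> I \<Longrightarrow> 3 * real P ^ (k + 1) \<le> y \<and> y \<le> 8 * real P ^ (k + 1)"
    and gap: "\<And>y q p. y \<in> I \<Longrightarrow> rep A k q \<noteq> 0 \<Longrightarrow> P < p \<Longrightarrow> p \<le> 9 * P \<Longrightarrow> 1 / T \<le> \<bar>ln (real (q * p)) - ln y\<bar>"
  shows "real (card I) * (real P * real (card A) ^ k)
     \<le> 4 ^ (j + 1) * (\<Sum>t\<in>{-int (j*M)..int (j*M)}. norm (dir_sum A (of_int t)) ^ k * norm (balanced P B (of_int t)) * norm (\<Sum>y\<in>I. cis (of_int t * ln y)))"
proof -
  obtain \<kappa> where kn: "\<And>t. 0 \<le> \<kappa> t" and ku: "\<And>t. \<kappa> t \<le> 1 / real M"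
    and ke: "\<And>v. complex_of_real (kern M v ^ j) = (\<Sum>t\<in>{-int (j*M)..int (j*M)}. of_real (\<kappa> t) * cis (of_int t * v))"
    using kern_power_coeffs[of M j] M j by auto
  define N where "N = {n. rep A k n \<noteq> 0}"
  define X where "X = {-int (j*M)..int (j*M)}"
  define Bs where "Bs = {B*P<..B*(9*P)}"
  define W where "W v = kern M v ^ j" for v
  have W0: "0 \<le> W v" for v by (simp add: W_def kern_nonneg)
  define G where "G y q = (\<Sum>p\<in>{P<..9*P}. W (ln (real q) + ln (real p) - ln y)) - (\<Sum>b\<in>Bs. W (ln (real q) + ln (real b / real B) - ln y)) / real B" for y q
  have expand: "(\<Sum>t\<in>X. of_real (\<kappa> t) * (dir_sum A (of_int t) ^ k * balanced P B (of_int t) * cis (- of_int t * ln y)))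
     = of_real (\<Sum>q\<in>N. rep A k q * G y q)" for y
  proof -
    have c3: "cis (of_int t * (a + b - c)) = cis (of_int t * a) * cis (of_int t * b) * cis (- of_int t * c)" for t :: int and a b c
      by (simp add: cis_mult algebra_simps)
    have Wt: "complex_of_real (W (a + b - c)) = (\<Sum>t\<in>X. of_real (\<kappa> t) * (cis (of_int t * a) * cis (of_int t * b) * cis (- of_int t * c)))" for a b c
      unfolding W_def ke X_def by (simp only: c3)
    have G1: "of_real (G y q) = (\<Sum>t\<in>X. of_real (\<kappa> t) * (cis (of_int t * ln (real q)) * balanced P B (of_int t) * cis (- of_int t * ln y)))" for q
    proof -
      have "complex_of_real (\<Sum>p\<in>{P<..9*P}. W (ln (real q) + ln (real p) - ln y))
        = (\<Sum>t\<in>X. of_real (\<kappa> t) * (cis (of_int t * ln (real q)) * dir_sum {P<..9*P} (of_int t) * cis (- of_int t * ln y)))"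
        unfolding of_real_sum Wt dir_sum_def
        by (subst sum.swap) (simp only: sum_distrib_left sum_distrib_right)
      moreover have "complex_of_real (\<Sum>b\<in>Bs. W (ln (real q) + ln (real b / real B) - ln y))
        = (\<Sum>t\<in>X. of_real (\<kappa> t) * (cis (of_int t * ln (real q)) * (\<Sum>b\<in>Bs. cis (of_int t * ln (real b / real B))) * cis (- of_int t * ln y)))"
        unfolding of_real_sum Wt
        by (subst sum.swap) (simp only: sum_distrib_left sum_distrib_right)
      ultimately have "of_real (G y q) = (\<Sum>t\<in>X. of_real (\<kappa> t) * (cis (of_int t * ln (real q)) * dir_sum {P<..9*P} (of_int t) * cis (- of_int t * ln y)))
         - (\<Sum>t\<in>X. of_real (\<kappa> t) * (cis (of_int t * ln (real q)) * (\<Sum>b\<in>Bs. cis (of_int t * ln (real b / real B))) * cis (- of_int t * ln y))) / of_nat B"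
        unfolding G_def of_real_diff of_real_divide by simp
      also have "\<dots> = (\<Sum>t\<in>X. of_real (\<kappa> t) * (cis (of_int t * ln (real q)) * balanced P B (of_int t) * cis (- of_int t * ln y)))"
      proof -
        have alg: "k * (c * d * s) - k * (c * w * s) / b = k * (c * (d - w / b) * s)" for k c d s w b :: complex
          by (simp add: algebra_simps)
        show ?thesis
          unfolding sum_divide_distrib[of _ X] sum_subtractf[symmetric] balanced_def Bs_def
          by (intro sum.cong refl alg)
      qed
      finally show ?thesis .
    qed
    have "complex_of_real (\<Sum>q\<in>N. rep A k q * G y q)
      = (\<Sum>q\<in>N. of_real (rep A k q) * (\<Sum>t\<in>X. of_real (\<kappa> t) * (cis (of_int t * ln (real q)) * balanced P B (of_int t) * cis (- of_int t * ln y))))"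
      by (simp add: G1)
    also have "\<dots> = (\<Sum>t\<in>X. \<Sum>q\<in>N. of_real (rep A k q) * (of_real (\<kappa> t) * (cis (of_int t * ln (real q)) * balanced P B (of_int t) * cis (- of_int t * ln y))))"
      unfolding sum_distrib_left by (rule sum.swap)
    also have "\<dots> = (\<Sum>t\<in>X. of_real (\<kappa> t) * (dir_sum A (of_int t) ^ k * balanced P B (of_int t) * cis (- of_int t * ln y)))"
      unfolding dir_sum_power_support[OF order_refl] N_def sum_distrib_left sum_distrib_right
      by (intro sum.cong refl) (simp only: mult_ac)
    finally show ?thesis by simp
  qed
  have Gle: "G y q \<le> - (real P / (4 * real M * 4 ^ j))" if y: "y \<in> I" and q: "q \<in> N" for y q
  proof -
    have q': "rep A k q \<noteq> 0" using q by (simp add: N_def)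
    have qr: "real P ^ k \<le> real q" "real q \<le> 3 * real P ^ k" "q > 0" using rep_support[OF q'] by auto
    have yr: "3 * real P ^ (k + 1) \<le> y" "y \<le> 8 * real P ^ (k + 1)" using I(2)[OF y] by auto
    have Z: "real P ^ (k + 1) > 0" using P1 by simp
    have y0: "y > 0" using yr Z by linarith
    have M0: "real M > 0" using M by simp
    have B0: "real B > 0" using B by simp
    have s1: "(\<Sum>p\<in>{P<..9*P}. W (ln (real q) + ln (real p) - ln y)) \<le> 8 * real P * (4 * T / real M) ^ (2 * j)"
    proof -
      have "(\<Sum>p\<in>{P<..9*P}. W (ln (real q) + ln (real p) - ln y)) \<le> (\<Sum>p\<in>{P<..9*P}. (4 * T / real M) ^ (2 * j))"
      proof (rule sum_mono)
        fix p assume "p \<in> {P<..9*P}"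
        then have p: "P < p" "p \<le> 9 * P" by auto
        define v where "v = ln (real q) + ln (real p) - ln y"
        have ve: "v = ln (real (q * p)) - ln y" using qr p by (simp add: v_def ln_mult_pos)
        have g: "1 / T \<le> \<bar>v\<bar>" unfolding ve by (rule gap[OF y q' p])
        have v0: "0 < \<bar>v\<bar>" using g T by (meson less_le_trans zero_less_divide_1_iff)
        have v3: "\<bar>v\<bar> \<le> 3" unfolding ve
        proof (rule ln_ratio_le_3[OF Z _ _ yr])
          have "real P ^ k * real P \<le> real q * real p" using qr p by (intro mult_mono) auto
          then show "real P ^ (k + 1) \<le> real (q * p)" by (simp add: mult_ac)
          have "real q * real p \<le> (3 * real P ^ k) * (9 * real P)" using qr p by (intro mult_mono) auto
          then show "real (q * p) \<le> 27 * real P ^ (k + 1)" by (simp add: mult_ac)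
        qed
        have "kern M v \<le> (4 / (real M * \<bar>v\<bar>))\<^sup>2" using M by (intro kern_le v0 v3) auto
        also have "\<dots> \<le> (4 * T / real M)\<^sup>2"
        proof (intro power_mono)
          have "1 / \<bar>v\<bar> \<le> T" using g v0 T by (simp add: field_simps)
          then have "4 / real M * (1 / \<bar>v\<bar>) \<le> 4 / real M * T" using M0 by (intro mult_left_mono) auto
          then show "4 / (real M * \<bar>v\<bar>) \<le> 4 * T / real M" by simp
        qed auto
        finally have "W v \<le> ((4 * T / real M)\<^sup>2) ^ j" unfolding W_def by (intro power_mono kern_nonneg)
        then show "W (ln (real q) + ln (real p) - ln y) \<le> (4 * T / real M) ^ (2 * j)" by (simp add: v_def power_mult)
      qed
      then show ?thesis by simp
    qed
    have s2: "(\<Sum>b\<in>Bs. W (ln (real q) + ln (real b / real B) - ln y)) \<ge> (1/4) ^ j * (real B * real P / (2 * real M))"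
    proof -
      define x where "x = y / real q"
      have x: "real P \<le> x" "x \<le> 8 * real P"
      proof -
        have "real P * real q \<le> real P * (3 * real P ^ k)" using qr by (intro mult_left_mono) auto
        then have "real P * real q \<le> y" using yr by (simp add: mult_ac)
        then show "real P \<le> x" using qr by (simp add: x_def le_divide_eq)
        have "8 * real P * real P ^ k \<le> 8 * real P * real q" using qr by (intro mult_left_mono) auto
        then have "y \<le> 8 * real P * real q" using yr by (simp add: mult_ac)
        then show "x \<le> 8 * real P" using qr by (simp add: x_def divide_le_eq)
      qed
      have x0: "x > 0" using x P1 by linarith
      define lo where "lo = real B * x"
      define hi where "hi = real B * x * (1 + 1 / real M)"
      define b0 where "b0 = nat \<lfloor>lo\<rfloor>"
      define b1 where "b1 = nat \<lfloor>hi\<rfloor>"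
      have lo0: "lo > 0" using x0 B0 by (simp add: lo_def)
      have hilo: "hi = lo + real B * x / real M" by (simp add: hi_def lo_def algebra_simps)
      have "0 < real B * x / real M" using x0 B0 M0 by simp
      then have hi0: "hi > 0" using lo0 unfolding hilo by linarith
      have bb: "real b0 \<le> lo" "lo < real b0 + 1" "real b1 \<le> hi" "hi < real b1 + 1"
        unfolding b0_def b1_def using lo0 hi0 by linarith+
      have len: "real B * real P / real M \<le> hi - lo" unfolding hilo using x B0 M0 by (simp add: divide_right_mono)
      have two: "2 \<le> real B * real P / real M"
      proof -
        have "real (2 * M) \<le> real (B * P)" using B(2) by (simp only: of_nat_le_iff)
        then show ?thesis using M0 by (simp add: le_divide_eq)
      qed
      have cnt: "real (b1 - b0) \<ge> real B * real P / (2 * real M)"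
      proof -
        have "real b1 - real b0 \<ge> real B * real P / real M - 1" using bb len by linarith
        moreover have "w - 1 \<ge> w / 2" if "2 \<le> w" for w :: real using that by linarith
        then have "real B * real P / real M - 1 \<ge> real B * real P / real M / 2" using two by blast
        ultimately have "real b1 - real b0 \<ge> real B * real P / (2 * real M)" by (simp add: mult.commute)
        moreover have "real b1 - real b0 \<le> real (b1 - b0)" by linarith
        ultimately show ?thesis by linarith
      qed
      \<comment> \<open>The grid points in \<open>(b0, b1]\<close> are those with \<open>b / B\<close> between \<open>y / q\<close> and \<open>(1 + 1 / M) * y / q\<close>.\<close>
      have sub: "{b0<..b1} \<subseteq> Bs"
      proof
        fix b assume b: "b \<in> {b0<..b1}"
        then have b': "lo < real b" "real b \<le> hi" using bb by auto
        have "real B * real P \<le> lo" unfolding lo_def using x B0 by (intro mult_left_mono) auto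
        then have "real (B * P) < real b" using b' by simp
        moreover have "hi \<le> real B * (8 * real P) * (9/8)"
        proof -
          have "1 / real M \<le> 1/8" using M by (intro divide_left_mono) auto
          then show ?thesis unfolding hi_def using x x0 B0 M0 by (intro mult_mono) auto
        qed
        then have "real b \<le> real (B * (9 * P))" using b' by simp
        ultimately show "b \<in> Bs" unfolding Bs_def by (simp only: of_nat_less_iff of_nat_le_iff greaterThanAtMost_iff)
      qed
      have each: "W (ln (real q) + ln (real b / real B) - ln y) \<ge> (1/4) ^ j" if b: "b \<in> {b0<..b1}" for b
      proof -
        have b': "lo < real b" "real b \<le> hi" using bb b by auto
        have bp: "real b > 0" using b' lo0 by linarith
        define v where "v = ln (real q) + ln (real b / real B) - ln y"
        have "ln x = ln y - ln (real q)" using y0 qr by (simp add: x_def ln_div)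
        then have v: "v = ln (real b / real B) - ln x" by (simp add: v_def)
        have 1: "x \<le> real b / real B" using b' B0 by (simp add: lo_def le_divide_eq mult.commute)
        have 2: "real b / real B \<le> x * (1 + 1 / real M)" using b' B0 by (simp add: hi_def divide_le_eq mult_ac)
        have "ln (real b / real B) \<le> ln (x * (1 + 1 / real M))" using 2 bp B0 by (intro ln_mono) auto
        also have "\<dots> = ln x + ln (1 + 1 / real M)" using x0 M0 by (intro ln_mult_pos) (auto intro: add_pos_pos)
        also have "ln (1 + 1 / real M) \<le> 1 / real M" using M0 by (intro ln_add_one_self_le_self) auto
        finally have "v \<le> 1 / real M" by (simp add: v)
        moreover have "v \<ge> 0" using 1 x0 by (simp add: v)
        ultimately have "kern M v \<ge> 1/4" using M by (intro kern_ge) auto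
        then show ?thesis unfolding W_def v_def[symmetric] by (intro power_mono) auto
      qed
      have "(1/4) ^ j * (real B * real P / (2 * real M)) \<le> (1/4) ^ j * real (b1 - b0)"
        using cnt by (intro mult_left_mono) auto
      also have "\<dots> = (\<Sum>b\<in>{b0<..b1}. (1/4) ^ j)" by simp
      also have "\<dots> \<le> (\<Sum>b\<in>{b0<..b1}. W (ln (real q) + ln (real b / real B) - ln y))" using each by (intro sum_mono) auto
      also have "\<dots> \<le> (\<Sum>b\<in>Bs. W (ln (real q) + ln (real b / real B) - ln y))"
        using sub W0 by (intro sum_mono2) (auto simp: Bs_def)
      finally show ?thesis .
    qed
    have "G y q \<le> 8 * real P * (4 * T / real M) ^ (2 * j) - (1/4) ^ j * (real B * real P / (2 * real M)) / real B"
      unfolding G_def using s1 s2 B0 by (intro diff_mono divide_right_mono) auto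
    also have "(1/4) ^ j * (real B * real P / (2 * real M)) / real B = 2 * (real P / (4 * real M * 4 ^ j))"
      using B0 by (simp add: power_divide)
    also have "8 * real P * (4 * T / real M) ^ (2 * j) \<le> real P / (4 * real M * 4 ^ j)"
    proof -
      have "real P * (32 * real M * 4 ^ j * (4 * T / real M) ^ (2 * j)) \<le> real P * 1"
        by (rule mult_left_mono[OF small]) simp
      then have "8 * real P * (4 * T / real M) ^ (2 * j) * (4 * real M * 4 ^ j) \<le> real P" by (simp add: mult_ac)
      moreover have "4 * real M * 4 ^ j > 0" using M0 by simp
      ultimately show ?thesis by (simp only: le_divide_eq if_True)
    qed
    finally show ?thesis by simp
  qed
  define Y where "Y t = (\<Sum>y\<in>I. cis (- of_int t * ln y))" for t :: int
  have normY: "norm (Y t) = norm (\<Sum>y\<in>I. cis (of_int t * ln y))" for t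
  proof -
    have "Y t = cnj (\<Sum>y\<in>I. cis (of_int t * ln y))" by (simp add: Y_def cis_cnj)
    then show ?thesis by (simp only: complex_mod_cnj)
  qed
  have total: "(\<Sum>t\<in>X. of_real (\<kappa> t) * (dir_sum A (of_int t) ^ k * balanced P B (of_int t) * Y t))
     = of_real (\<Sum>y\<in>I. \<Sum>q\<in>N. rep A k q * G y q)"
  proof -
    have "complex_of_real (\<Sum>y\<in>I. \<Sum>q\<in>N. rep A k q * G y q)
      = (\<Sum>y\<in>I. \<Sum>t\<in>X. of_real (\<kappa> t) * (dir_sum A (of_int t) ^ k * balanced P B (of_int t) * cis (- of_int t * ln y)))"
      by (simp only: of_real_sum[of _ I] expand)
    also have "\<dots> = (\<Sum>t\<in>X. of_real (\<kappa> t) * (dir_sum A (of_int t) ^ k * balanced P B (of_int t) * Y t))"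
      unfolding Y_def sum_distrib_left by (rule sum.swap)
    finally show ?thesis by simp
  qed
  have low: "(\<Sum>y\<in>I. \<Sum>q\<in>N. rep A k q * G y q) \<le> - (real (card I) * (real (card A) ^ k * (real P / (4 * real M * 4 ^ j))))"
  proof -
    have "(\<Sum>y\<in>I. \<Sum>q\<in>N. rep A k q * G y q) \<le> (\<Sum>y\<in>I. \<Sum>q\<in>N. rep A k q * - (real P / (4 * real M * 4 ^ j)))"
      by (intro sum_mono mult_left_mono Gle rep_nonneg)
    also have "\<dots> = (\<Sum>y\<in>I. - (real (card A) ^ k * (real P / (4 * real M * 4 ^ j))))"
      using sum_rep[OF order_refl] by (simp add: N_def sum_distrib_right[symmetric] sum_negf sum_divide_distrib[symmetric])
    finally show ?thesis by simp
  qed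
  have "real (card I) * (real (card A) ^ k * (real P / (4 * real M * 4 ^ j))) \<le> norm (complex_of_real (\<Sum>y\<in>I. \<Sum>q\<in>N. rep A k q * G y q))"
    using low by (simp only: norm_of_real)
  also have "\<dots> \<le> (\<Sum>t\<in>X. 1 / real M * (norm (dir_sum A (of_int t)) ^ k * norm (balanced P B (of_int t)) * norm (Y t)))"
    unfolding total[symmetric]
  proof (intro sum_norm_le)
    fix t
    have "norm (of_real (\<kappa> t) * (dir_sum A (of_int t) ^ k * balanced P B (of_int t) * Y t))
       = \<kappa> t * (norm (dir_sum A (of_int t)) ^ k * norm (balanced P B (of_int t)) * norm (Y t))"
      using kn[of t] by (simp add: norm_mult norm_power)
    also have "\<dots> \<le> 1 / real M * (norm (dir_sum A (of_int t)) ^ k * norm (balanced P B (of_int t)) * norm (Y t))"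
      by (intro mult_right_mono ku) auto
    finally show "norm (of_real (\<kappa> t) * (dir_sum A (of_int t) ^ k * balanced P B (of_int t) * Y t))
      \<le> 1 / real M * (norm (dir_sum A (of_int t)) ^ k * norm (balanced P B (of_int t)) * norm (Y t))" .
  qed
  also have "\<dots> = 1 / real M * (\<Sum>t\<in>X. norm (dir_sum A (of_int t)) ^ k * norm (balanced P B (of_int t)) * norm (Y t))"
    by (rule sum_distrib_left[symmetric])
  finally have "real (card I) * (real (card A) ^ k * real P) / (4 * real M * 4 ^ j) \<le> (\<Sum>t\<in>X. norm (dir_sum A (of_int t)) ^ k * norm (balanced P B (of_int t)) * norm (Y t)) / real M"
    by simp
  then have "(4 * real M * 4 ^ j) * (real (card I) * (real (card A) ^ k * real P) / (4 * real M * 4 ^ j)) \<le> (4 * real M * 4 ^ j) * ((\<Sum>t\<in>X. norm (dir_sum A (of_int t)) ^ k * norm (balanced P B (of_int t)) * norm (Y t)) / real M)"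
    by (rule mult_left_mono) simp
  then have "real (card I) * (real (card A) ^ k * real P) \<le> 4 * 4 ^ j * (\<Sum>t\<in>X. norm (dir_sum A (of_int t)) ^ k * norm (balanced P B (of_int t)) * norm (Y t))"
    using M by simp
  then show ?thesis unfolding normY X_def by (simp add: mult_ac)
qed

end

section \<open>The exponents\<close>

text \<open>All exponents are relative to \<open>P ^ k\<close>: \<open>T\<close>, \<open>R\<close> and \<open>card S\<close> have the exponents \<open>\<tau>\<close>, \<open>\<rho>\<close> and \<open>d\<close>, the \<open>k\<close>-th power of
the polynomial, divided by its value at \<open>0\<close>, has exponent \<open>- v / 2\<close> on the level set, and \<open>h\<close> collects errors of size \<open>1 / k\<close>. The mean value bound for \<open>d\<close> in the
second and fourth moment inequalities gives the upper bound \<open>a\<close> and the lower bound \<open>b\<close> for multiples of \<open>\<tau>\<close>. Eliminating \<open>\<tau>\<close> leaves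
\<open>- (v * (v - 1/2) * (v - 1/3))\<close>, which is not positive, minus a positive multiple of \<open>e\<close>.\<close>

lemma exponent_contradiction_large:
  fixes v \<tau> \<rho> d e h :: real
  assumes v: "1/2 \<le> v" "v \<le> 1" and h: "0 \<le> h" and e: "30 * h \<le> e" "0 < e" and \<tau>: "0 \<le> \<tau>"
    and second: "\<rho> + v \<le> d + \<tau> + h" and lower: "2 * \<tau> - 5/6 + e \<le> \<rho> + h"
    and mean: "d \<le> v * \<tau> + h"
    and fourth: "v < 1 \<Longrightarrow> \<rho> + 2 * v \<le> (1 + v) * (\<tau> + d) + 2 * h"
  shows False
proof -
  have a: "\<tau> * (1 - v) \<le> 5/6 - v - e + 3 * h"
    using second lower mean by (simp add: algebra_simps)
  show False
  proof (cases "v < 1")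
    case False
    then have "v = 1" using v by simp
    then show False using a e h by simp
  next
    case True
    have "(1 + v) * (\<tau> + d) \<le> (1 + v) * (\<tau> + (v * \<tau> + h))"
      using mean v by (intro mult_left_mono) auto
    also have "\<dots> = \<tau> * (v\<^sup>2 + 2 * v + 1) + (1 + v) * h" by (simp add: power2_eq_square algebra_simps)
    also have "(1 + v) * h \<le> 2 * h" using v h by (intro mult_right_mono) auto
    finally have f: "\<rho> + 2 * v \<le> \<tau> * (v\<^sup>2 + 2 * v + 1) + 4 * h" using fourth[OF True] by simp
    have b: "2 * v - 5/6 + e - 5 * h \<le> \<tau> * (v\<^sup>2 + 2 * v - 1)"
      using f lower by (simp add: algebra_simps)
    have c0: "v\<^sup>2 + 2 * v - 1 \<ge> 0"
    proof -
      have "v\<^sup>2 \<ge> 0" by simp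
      then show ?thesis using v by linarith
    qed
    have v2: "v\<^sup>2 \<le> 1" using v by (simp add: power_le_one)
    have "(2 * v - 5/6 + e - 5 * h) * (1 - v) \<le> \<tau> * (v\<^sup>2 + 2 * v - 1) * (1 - v)"
      using b v by (intro mult_right_mono) auto
    also have "\<dots> = (\<tau> * (1 - v)) * (v\<^sup>2 + 2 * v - 1)" by (simp add: mult_ac)
    also have "\<dots> \<le> (5/6 - v - e + 3 * h) * (v\<^sup>2 + 2 * v - 1)"
      using a c0 by (intro mult_right_mono) auto
    finally have m: "(2 * v - 5/6 + e - 5 * h) * (1 - v) \<le> (5/6 - v - e + 3 * h) * (v\<^sup>2 + 2 * v - 1)" .
    have id: "(5/6 - v - e + 3 * h) * (v\<^sup>2 + 2 * v - 1) - (2 * v - 5/6 + e - 5 * h) * (1 - v)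
       = - (v * (v - 1/2) * (v - 1/3)) - e * (v\<^sup>2 + v) + h * (3 * v\<^sup>2 + v + 2)"
      by (simp add: power2_eq_square field_simps)
    have p1: "v * (v - 1/2) * (v - 1/3) \<ge> 0" using v by (intro mult_nonneg_nonneg) auto
    have p2: "e * (v\<^sup>2 + v) \<ge> e * (1/2)" using v e by (intro mult_left_mono) (auto intro: add_increasing)
    have p3: "h * (3 * v\<^sup>2 + v + 2) \<le> h * 6" using v v2 h by (intro mult_left_mono) auto
    show False using m id p1 p2 p3 e h by linarith
  qed
qed

text \<open>As \<open>exponent_contradiction_large\<close>, but for \<open>v < 1/2\<close> the bound of Halasz for \<open>d\<close> is the better one. The elimination of
\<open>\<tau>\<close> now leaves \<open>v * (v - 1/2) * (v + 2/3)\<close>. If the coefficient \<open>b\<close> of \<open>\<tau>\<close> in the fourth moment inequality is not positive, the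
lower bound \<open>1 - v\<close> for \<open>\<tau>\<close> decides instead, by \<open>(v - 1/2)\<^sup>2 \<ge> 0\<close>.\<close>

lemma exponent_contradiction_small:
  fixes v \<tau> \<rho> d e h :: real
  assumes v: "0 < v" "v < 1/2" and h: "0 \<le> h" and e: "30 * h \<le> e" "0 < e" "e \<le> 1" and \<tau>: "0 \<le> \<tau>"
    and second: "\<rho> + v \<le> d + \<tau> + h" and lower: "2 * \<tau> - 5/6 + e \<le> \<rho> + h"
    and Halasz: "d \<le> v * \<tau> / (2 * (1 - v)) + h" and trivial: "1 - v \<le> \<tau> + h"
    and fourth: "\<rho> + 2 * v \<le> (1 + v) * (\<tau> + d) + 2 * h"
  shows False
proof -
  define w where "w = 1 - v"
  have w: "w > 1/2" "w < 1" using v by (auto simp: w_def)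
  define z where "z = v * \<tau> / (2 * w)"
  have z: "2 * w * z = v * \<tau>" using w by (simp add: z_def)
  have dz: "d \<le> z + h" using Halasz by (simp add: z_def w_def)
  have "\<tau> - z \<le> 5/6 - v - e + 3 * h" using second lower dz by linarith
  then have "2 * w * (\<tau> - z) \<le> 2 * w * (5/6 - v - e + 3 * h)" using w by (intro mult_left_mono) auto
  moreover have "2 * w * (\<tau> - z) = \<tau> * (2 - 3 * v)" using z by (simp add: algebra_simps w_def)
  ultimately have a: "\<tau> * (2 - 3 * v) \<le> 2 * w * (5/6 - v - e + 3 * h)" by simp
  have tw: "w - h \<le> \<tau>" using trivial by (simp add: w_def)
  have s: "2 - 3 * v > 1/2" using v by linarith
  have "(w - h) * (2 - 3 * v) \<le> 2 * w * (5/6 - v - e + 3 * h)"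
    using mult_right_mono[OF tw, of "2 - 3 * v"] s a by linarith
  moreover have "h * (2 - 3 * v) \<le> w * (4 * h)"
  proof -
    have "h * (2 - 3 * v) \<le> h * 2" using v h by (intro mult_left_mono) auto
    also have "h * 2 \<le> w * (4 * h)" using mult_right_mono[of "1/2" w "4 * h"] w h by simp
    finally show ?thesis .
  qed
  ultimately have "w * (2 - 3 * v) \<le> w * (2 * (5/6 - v - e + 3 * h) + 4 * h)" by (simp add: algebra_simps)
  then have "2 - 3 * v \<le> 2 * (5/6 - v - e + 3 * h) + 4 * h" using w by (simp only: mult_le_cancel_left_pos)
  then have "1/3 + 2 * e \<le> v + 10 * h" by (simp add: algebra_simps)
  then have v3: "v \<ge> 1/3" using e h by linarith
  define b where "b = 5 * v - 2 - v\<^sup>2"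
  have b': "2 * w * (2 * v - 5/6 + e - 5 * h) \<le> \<tau> * b"
  proof -
    have "(1 + v) * (\<tau> + d) \<le> (1 + v) * (\<tau> + z + h)" using dz v by (intro mult_left_mono) auto
    also have "\<dots> \<le> (1 + v) * (\<tau> + z) + 2 * h" using mult_right_mono[of "1 + v" 2 h] v h by (simp add: distrib_left)
    finally have "2 * v - 5/6 + e - 5 * h \<le> (1 + v) * (\<tau> + z) - 2 * \<tau>" using fourth lower by linarith
    then have "2 * w * (2 * v - 5/6 + e - 5 * h) \<le> 2 * w * ((1 + v) * (\<tau> + z) - 2 * \<tau>)"
      using w by (intro mult_left_mono) auto
    also have "\<dots> = (1 + v) * (2 * w * \<tau> + 2 * w * z) - 4 * w * \<tau>" by (simp add: algebra_simps)
    also have "\<dots> = \<tau> * b" unfolding z by (simp add: b_def w_def power2_eq_square algebra_simps)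
    finally show ?thesis .
  qed
  have v2: "v\<^sup>2 \<le> (1/2)\<^sup>2" using v by (intro power_mono) auto
  show False
  proof (cases "b \<le> 0")
    case True
    have "\<tau> * b \<le> (w - h) * b" using tw True by (rule mult_right_mono_neg)
    moreover have "- (h * b) \<le> h * 2"
    proof -
      have "- b \<le> 2" using v v2 by (simp add: b_def power2_eq_square)
      then have "h * (- b) \<le> h * 2" using h by (intro mult_left_mono) auto
      then show ?thesis by simp
    qed
    moreover have "h * 2 \<le> w * (4 * h)" using mult_right_mono[of "1/2" w "4 * h"] w h by simp
    ultimately have "w * (2 * (2 * v - 5/6 + e - 5 * h)) \<le> w * (b + 4 * h)"
      using b' by (simp add: algebra_simps)
    then have "2 * (2 * v - 5/6 + e - 5 * h) \<le> b + 4 * h" using w by (simp only: mult_le_cancel_left_pos)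
    then have "4 * v - 5/3 + 2 * e - 10 * h \<le> b + 4 * h" by (simp add: algebra_simps)
    moreover have "0 \<le> (v - 1/2)\<^sup>2" by simp
    then have "v\<^sup>2 - v + 1/4 \<ge> 0" by (simp add: power2_eq_square algebra_simps)
    ultimately show False using e h unfolding b_def by linarith
  next
    case False
    have "2 * w * (2 * v - 5/6 + e - 5 * h) * (2 - 3 * v) \<le> \<tau> * b * (2 - 3 * v)"
      using b' s by (intro mult_right_mono) auto
    also have "\<dots> = \<tau> * (2 - 3 * v) * b" by (simp add: mult_ac)
    also have "\<dots> \<le> 2 * w * (5/6 - v - e + 3 * h) * b" using a False by (intro mult_right_mono) auto
    finally have "(2 * w) * ((2 * v - 5/6 + e - 5 * h) * (2 - 3 * v)) \<le> (2 * w) * ((5/6 - v - e + 3 * h) * b)"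
      by (simp only: mult.assoc)
    then have m: "(2 * v - 5/6 + e - 5 * h) * (2 - 3 * v) \<le> (5/6 - v - e + 3 * h) * b"
      using w by (simp only: mult_le_cancel_left_pos)
    have id: "(5/6 - v - e + 3 * h) * b - (2 * v - 5/6 + e - 5 * h) * (2 - 3 * v)
       = v * (v - 1/2) * (v + 2/3) - e * (2 * v - v\<^sup>2) + h * (4 - 3 * v\<^sup>2)"
      by (simp add: b_def power2_eq_square field_simps)
    have p1: "v * (v - 1/2) * (v + 2/3) \<le> 0"
      using v by (intro mult_nonpos_nonneg mult_nonneg_nonpos) auto
    have p2: "e * (1/3) \<le> e * (2 * v - v\<^sup>2)"
    proof (rule mult_left_mono)
      have "v\<^sup>2 \<le> v * 1" unfolding power2_eq_square using v by (intro mult_left_mono) auto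
      then show "1/3 \<le> 2 * v - v\<^sup>2" using v3 by linarith
    qed (use e in simp)
    have "0 \<le> v\<^sup>2" by simp
    then have "h * (4 - 3 * v\<^sup>2) \<le> h * 4" using h by (intro mult_left_mono) auto
    then show False using m id p1 p2 e h by linarith
  qed
qed

section \<open>Bounds for a level set in terms of exponents\<close>

text \<open>
Throughout, \<open>S\<close> consists of frequencies at which the polynomial over \<open>A\<close> is at least \<open>card A * P powr (- u)\<close>, and \<open>P powr \<kappa>\<close>
dominates the coefficients of its powers and all logarithms. The \<open>i\<close>-th power of the polynomial has length about \<open>U = P ^ i\<close> and is at least about
\<open>U powr (1 - u)\<close> on \<open>S\<close>. Each bound is the form that the
underlying estimate takes when the length \<open>U\<close> is large enough compared with the range \<open>T\<close>.
\<close>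

context smooth_factors
begin

context
  fixes S :: "int set" and T :: nat and \<kappa> u :: real
  assumes S: "S \<subseteq> {-int T..int T}" and T: "T \<ge> 1" and \<kappa>: "\<kappa> > 0" and P2: "P \<ge> 2" and u0: "0 \<le> u"
    and lev: "\<And>t. t \<in> S \<Longrightarrow> real (card A) * real P powr (- u) \<le> norm (dir_sum A (of_int t))"
    and cardA: "real P powr (1 - \<kappa> / real k) \<le> real (card A)"
    and repb: "\<And>i n. i \<le> k \<Longrightarrow> 0 < n \<Longrightarrow> real n \<le> 3 * real P ^ k \<Longrightarrow> rep A i n \<le> real P powr \<kappa>"
    and two: "9 \<le> real P powr \<kappa>"
    and log1: "144 * (1 + ln (1 + 9 * real P ^ k)) \<le> real P powr \<kappa>"
    and log2: "24000 * (1 + ln (2 * real T)) \<le> real P powr \<kappa>"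
    and log3: "40000000000 * (1 + ln (2 * real T) + ln (1 + 27 * (real P ^ k)\<^sup>2)) ^ 4 \<le> real P powr \<kappa>"
begin

lemma P_gt_1: "real P > 1" using P2 by simp

lemma level_tpoly:
  assumes i: "1 \<le> i" "i \<le> k" and t: "t \<in> S"
  shows "real P powr (real i * (1 - u) - \<kappa>) \<le> norm (tpoly (rep A i) (real P ^ i) (of_int t))"
proof -
  have "real P powr (1 - \<kappa> / real k) * real P powr (- u) \<le> norm (dir_sum A (of_int t))"
    using lev[OF t] mult_right_mono[OF cardA, of "real P powr (- u)"] by simp
  then have "real P powr (1 - \<kappa> / real k - u) \<le> norm (dir_sum A (of_int t))"
    by (simp add: powr_add[symmetric])
  then have "(real P powr (1 - \<kappa> / real k - u)) ^ i \<le> norm (dir_sum A (of_int t)) ^ i"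
    by (intro power_mono) auto
  also have "\<dots> = norm (tpoly (rep A i) (real P ^ i) (of_int t))"
    by (simp add: dir_sum_power_tpoly[OF i, symmetric] norm_power)
  also have "(real P powr (1 - \<kappa> / real k - u)) ^ i = real P powr (real i * (1 - \<kappa> / real k - u))"
    using P_gt_1 by (simp add: powr_realpow[symmetric] powr_powr mult.commute)
  finally have "real P powr (real i * (1 - \<kappa> / real k - u)) \<le> norm (tpoly (rep A i) (real P ^ i) (of_int t))" .
  moreover have "real i * (1 - u) - \<kappa> \<le> real i * (1 - \<kappa> / real k - u)"
  proof -
    have "real i * (\<kappa> / real k) \<le> real k * (\<kappa> / real k)" using i \<kappa> by (intro mult_right_mono) auto
    then have "real i * (\<kappa> / real k) \<le> \<kappa>" using k1 by simp
    then show ?thesis by (simp add: algebra_simps)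
  qed
  then have "real P powr (real i * (1 - u) - \<kappa>) \<le> real P powr (real i * (1 - \<kappa> / real k - u))"
    using P_gt_1 by (intro powr_mono) auto
  ultimately show ?thesis by linarith
qed

lemma level_rep_bound:
  assumes i: "1 \<le> i" "i \<le> k" and n: "n \<in> triple (real P ^ i)"
  shows "\<bar>rep A i n\<bar> \<le> real P powr \<kappa>"
proof -
  have n': "real P ^ i < real n" "real n \<le> 3 * real P ^ i" using n by (auto simp: triple_def)
  have "0 < real P ^ i" using P_gt_1 by simp
  then have "0 < n" using n' by (intro Nat.gr0I) auto
  moreover have "real P ^ i \<le> real P ^ k" using i P_gt_1 by (intro power_increasing) auto
  ultimately show ?thesis using repb[OF i(2), of n] n' rep_nonneg[of A i n] by auto
qed

lemma power_le_top: "i \<le> k \<Longrightarrow> real P ^ i \<le> real P ^ k"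
  using P_gt_1 by (intro power_increasing) auto

lemma powr_nat: "real P ^ i = real P powr real i"
  using P_gt_1 by (simp add: powr_realpow)

lemma level_mean_value:
  assumes i: "1 \<le> i" "i \<le> k" and TU: "real T \<le> real P ^ i"
  shows "real (card S) \<le> real P powr (2 * real i * u + 6 * \<kappa>)"
proof -
  define U where "U = real P ^ i"
  have U: "U \<ge> 1" using P_gt_1 by (simp add: U_def)
  have "real (card S) * (real P powr (real i * (1 - u) - \<kappa>))\<^sup>2 \<le> sieve_const T (1 / (3 * U)) * (3 * U * (real P powr \<kappa>)\<^sup>2)"
    using U P_gt_1 level_rep_bound[OF i] level_tpoly[OF i] unfolding U_def by (intro large_values_mean S) auto
  also have "sieve_const T (1 / (3 * U)) * (3 * U * (real P powr \<kappa>)\<^sup>2)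
     = (3 * (2 * real T + 1) + 144 * (1 + ln (1 + 9 * U)) * U) * (U * (real P powr \<kappa>)\<^sup>2)"
    by (simp add: sieve_const_def algebra_simps)
  also have "\<dots> \<le> (2 * real P powr \<kappa> * U) * (U * (real P powr \<kappa>)\<^sup>2)"
  proof (rule mult_right_mono)
    have "3 * (2 * real T + 1) \<le> 9 * real T" using T by simp
    also have "\<dots> \<le> real P powr \<kappa> * U" using two TU U by (intro mult_mono) (auto simp: U_def)
    finally have 1: "3 * (2 * real T + 1) \<le> real P powr \<kappa> * U" .
    have "ln (1 + 9 * U) \<le> ln (1 + 9 * real P ^ k)" using power_le_top[OF i(2)] U by (intro ln_mono) (auto simp: U_def)
    then have "144 * (1 + ln (1 + 9 * U)) \<le> real P powr \<kappa>" using log1 by simp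
    then have "144 * (1 + ln (1 + 9 * U)) * U \<le> real P powr \<kappa> * U" using U by (intro mult_right_mono) auto
    with 1 show "3 * (2 * real T + 1) + 144 * (1 + ln (1 + 9 * U)) * U \<le> 2 * real P powr \<kappa> * U" by simp
  qed (use U in auto)
  also have "\<dots> \<le> (real P powr \<kappa> * real P powr \<kappa> * U) * (U * (real P powr \<kappa>)\<^sup>2)"
    using two U by (intro mult_right_mono) auto
  also have "\<dots> = real P powr (2 * real i + 4 * \<kappa>)"
    unfolding U_def powr_nat power2_eq_square by (simp add: powr_add[symmetric])
  finally have "real (card S) * real P powr (2 * (real i * (1 - u) - \<kappa>)) \<le> real P powr (2 * real i + 4 * \<kappa>)"
    by (simp add: power2_eq_square powr_add[symmetric])
  then have "real (card S) \<le> real P powr (2 * real i + 4 * \<kappa>) / real P powr (2 * (real i * (1 - u) - \<kappa>))"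
    using P_gt_1 by (simp add: le_divide_eq)
  also have "\<dots> = real P powr (2 * real i * u + 6 * \<kappa>)"
    by (simp add: powr_diff[symmetric] algebra_simps)
  finally show ?thesis .
qed

lemma level_Halasz:
  assumes i: "1 \<le> i" "i \<le> k" and big: "real P powr (7 * \<kappa>) * sqrt (real T) \<le> real P powr (real i * (1 - 2 * u))"
  shows "real (card S) \<le> real P powr (2 * real i * u + 7 * \<kappa>)"
proof -
  define U where "U = real P ^ i"
  define D where "D = real (card S)"
  define V2 where "V2 = real P powr (2 * (real i * (1 - u) - \<kappa>))"
  have U: "U \<ge> 1" using P_gt_1 by (simp add: U_def)
  have V20: "V2 > 0" using P_gt_1 by (simp add: V2_def)
  have D0: "D \<ge> 0" by (simp add: D_def)
  have lg: "1 + ln (2 * real T) \<ge> 1" using T by simp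
  have "D * (real P powr (real i * (1 - u) - \<kappa>))\<^sup>2 \<le> 24000 * (real P powr \<kappa>)\<^sup>2 * U * (U * (1 + ln (2 * real T)) + D * sqrt (real T))"
    unfolding D_def U_def using P_gt_1 level_rep_bound[OF i] level_tpoly[OF i] T by (intro Halasz_large_values S) auto
  also have "(real P powr (real i * (1 - u) - \<kappa>))\<^sup>2 = V2"
    by (simp add: V2_def power2_eq_square powr_add[symmetric])
  also have "24000 * (real P powr \<kappa>)\<^sup>2 * U * (U * (1 + ln (2 * real T)) + D * sqrt (real T))
     \<le> 24000 * (real P powr \<kappa>)\<^sup>2 * U * ((1 + ln (2 * real T)) * (U + D * sqrt (real T)))"
  proof (rule mult_left_mono)
    have "1 * (D * sqrt (real T)) \<le> (1 + ln (2 * real T)) * (D * sqrt (real T))"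
      using lg D0 by (intro mult_right_mono) auto
    then show "U * (1 + ln (2 * real T)) + D * sqrt (real T) \<le> (1 + ln (2 * real T)) * (U + D * sqrt (real T))"
      by (simp add: algebra_simps)
  qed (use U in auto)
  also have "\<dots> = (24000 * (1 + ln (2 * real T))) * ((real P powr \<kappa>)\<^sup>2 * U * (U + D * sqrt (real T)))"
    by (simp add: mult_ac)
  also have "\<dots> \<le> real P powr \<kappa> * ((real P powr \<kappa>)\<^sup>2 * U * (U + D * sqrt (real T)))"
    using log2 U D0 by (intro mult_right_mono) auto
  also have "\<dots> = real P powr (3 * \<kappa>) * U * U + real P powr (3 * \<kappa>) * U * sqrt (real T) * D"
    by (simp add: power2_eq_square powr_add[symmetric] algebra_simps)
  finally have m: "D * V2 \<le> real P powr (3 * \<kappa>) * U * U + real P powr (3 * \<kappa>) * U * sqrt (real T) * D" .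
  have "2 * (real P powr (3 * \<kappa>) * U * sqrt (real T)) \<le> V2"
  proof -
    have "2 * (real P powr (3 * \<kappa>) * U * sqrt (real T)) \<le> real P powr (2 * \<kappa>) * (real P powr (3 * \<kappa>) * U * sqrt (real T))"
    proof (rule mult_right_mono)
      have "2 \<le> real P powr \<kappa>" using two by simp
      also have "\<dots> \<le> real P powr (2 * \<kappa>)" using P_gt_1 \<kappa> by (intro powr_mono) auto
      finally show "2 \<le> real P powr (2 * \<kappa>)" .
    qed (use U in auto)
    also have "\<dots> = U * real P powr (- 2 * \<kappa>) * (real P powr (7 * \<kappa>) * sqrt (real T))"
      by (simp add: powr_add[symmetric] mult_ac)
    also have "\<dots> \<le> U * real P powr (- 2 * \<kappa>) * real P powr (real i * (1 - 2 * u))"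
      using big U by (intro mult_left_mono) auto
    also have "\<dots> = V2" unfolding U_def V2_def powr_nat by (simp add: powr_add[symmetric] algebra_simps)
    finally show ?thesis .
  qed
  then have "D * (2 * (real P powr (3 * \<kappa>) * U * sqrt (real T))) \<le> D * V2" using D0 by (rule mult_left_mono)
  then have "D * V2 \<le> 2 * (real P powr (3 * \<kappa>) * U * U)" using m by (simp add: mult_ac)
  also have "\<dots> \<le> real P powr \<kappa> * (real P powr (3 * \<kappa>) * U * U)"
    using two U by (intro mult_right_mono) auto
  also have "\<dots> = real P powr (2 * real i + 4 * \<kappa>)" unfolding U_def powr_nat by (simp add: powr_add[symmetric] add.commute)
  finally have "D \<le> real P powr (2 * real i + 4 * \<kappa>) / V2" using V20 by (simp add: le_divide_eq)
  also have "\<dots> = real P powr (2 * real i * u + 6 * \<kappa>)"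
    unfolding V2_def by (simp add: powr_diff[symmetric] algebra_simps)
  also have "\<dots> \<le> real P powr (2 * real i * u + 7 * \<kappa>)" using P_gt_1 \<kappa> by (intro powr_mono) auto
  finally show ?thesis by (simp add: D_def)
qed

lemma level_energy:
  assumes i: "1 \<le> i" "i \<le> k" and DT: "real (card S) * real T \<le> (real P ^ i)\<^sup>2"
  shows "energy S \<le> real P powr (4 * real i * u + 10 * \<kappa>) * real (card S)"
proof -
  define U where "U = real P ^ i"
  define D where "D = real (card S)"
  define V where "V = real P powr (real i * (1 - u) - \<kappa>)"
  have U: "U \<ge> 1" using P_gt_1 by (simp add: U_def)
  have V0: "V > 0" using P_gt_1 by (simp add: V_def)
  have D0: "D \<ge> 0" by (simp add: D_def)
  define l where "l = 1 + ln (2 * real T) + ln (1 + 27 * U\<^sup>2)"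
  have lT: "ln (2 * real T) \<ge> 0" using T by simp
  have l0: "l \<ge> 0" using lT by (simp add: l_def add_nonneg_nonneg)
  have lb: "40000000000 * l ^ 4 \<le> real P powr \<kappa>"
  proof -
    have "U\<^sup>2 \<le> (real P ^ k)\<^sup>2" unfolding U_def using power_le_top[OF i(2)] by (intro power_mono) auto
    then have "ln (1 + 27 * U\<^sup>2) \<le> ln (1 + 27 * (real P ^ k)\<^sup>2)" by (intro ln_mono) (auto intro: add_pos_nonneg)
    then have "l ^ 4 \<le> (1 + ln (2 * real T) + ln (1 + 27 * (real P ^ k)\<^sup>2)) ^ 4"
      using l0 by (intro power_mono) (auto simp: l_def)
    then show ?thesis using log3 by linarith
  qed
  have "energy S * V ^ 4 \<le> 40000000000 * (real P powr \<kappa>) ^ 4 * l ^ 4 * U\<^sup>2 * (D * U\<^sup>2 + D\<^sup>2 * real T)"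
    unfolding D_def U_def V_def l_def using P_gt_1 level_rep_bound[OF i] level_tpoly[OF i] T
    by (intro energy_large_values S) auto
  also have "\<dots> \<le> 40000000000 * (real P powr \<kappa>) ^ 4 * l ^ 4 * U\<^sup>2 * (D * U\<^sup>2 + D * U\<^sup>2)"
  proof (rule mult_left_mono)
    have "D * (D * real T) \<le> D * U\<^sup>2" using DT D0 by (intro mult_left_mono) (auto simp: D_def U_def)
    then show "D * U\<^sup>2 + D\<^sup>2 * real T \<le> D * U\<^sup>2 + D * U\<^sup>2" by (simp add: power2_eq_square)
  qed (use l0 in auto)
  also have "\<dots> = (40000000000 * l ^ 4) * (2 * ((real P powr \<kappa>) ^ 4 * U ^ 4 * D))"
    by (simp add: power2_eq_square power4_eq_xxxx)
  also have "\<dots> \<le> real P powr \<kappa> * (real P powr \<kappa> * ((real P powr \<kappa>) ^ 4 * U ^ 4 * D))"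
    using lb two D0 U by (intro mult_mono) (auto intro!: mult_right_mono)
  also have "\<dots> = real P powr (4 * real i + 6 * \<kappa>) * D"
    unfolding U_def powr_nat power4_eq_xxxx by (simp add: powr_add[symmetric] add.commute)
  finally have "energy S \<le> real P powr (4 * real i + 6 * \<kappa>) * D / V ^ 4" using V0 by (simp add: le_divide_eq)
  also have "V ^ 4 = real P powr (4 * (real i * (1 - u) - \<kappa>))"
    unfolding V_def power4_eq_xxxx by (simp add: powr_add[symmetric])
  also have "real P powr (4 * real i + 6 * \<kappa>) * D / real P powr (4 * (real i * (1 - u) - \<kappa>))
    = (real P powr (4 * real i + 6 * \<kappa>) / real P powr (4 * (real i * (1 - u) - \<kappa>))) * D" by simp
  also have "real P powr (4 * real i + 6 * \<kappa>) / real P powr (4 * (real i * (1 - u) - \<kappa>)) = real P powr (4 * real i * u + 10 * \<kappa>)"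
    by (simp add: powr_diff[symmetric] algebra_simps)
  finally show ?thesis by (simp add: D_def)
qed

end

end

text \<open>Division by \<open>k\<close> reduces this to the two preceding contradictions with \<open>v = 2 * u\<close> and \<open>h = 10 / k\<close>. The constants such as \<open>1\<close>,
\<open>3\<close> and \<open>4 * u\<close> in the assumptions come from rounding \<open>i\<close> to an integer and from \<open>Y\<close> not being exactly \<open>P ^ k\<close>; the condition
\<open>k * e \<ge> 300\<close> makes them harmless. The lower bound for \<open>\<tau>\<close> needed for small \<open>u\<close> follows from \<open>first\<close>: the term \<open>c / 2\<close>
forbids that \<open>d\<close> is as small as the bound of Halasz makes it for small \<open>\<tau>\<close>.\<close>

lemma exponents_incompatible:
  fixes k \<tau> d \<rho> u e \<kappa> c :: real
  assumes k: "k \<ge> 30" "k * e \<ge> 300" and e: "0 < e" "e \<le> 1" and u: "0 < u" "u \<le> 1/2"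
    and \<kappa>: "0 < \<kappa>" "\<kappa> \<le> 1/400" and c: "100 * \<kappa> \<le> c" and \<tau>: "0 \<le> \<tau>"
    and first: "k * u + c / 2 \<le> d"
    and second: "\<rho> + 2 * k * u \<le> d + \<tau> + 2 * \<kappa>"
    and lower: "2 * \<tau> - 5/6 * k + e * k - 3 \<le> \<rho>"
    and fourth: "u < 1/2 \<Longrightarrow> \<rho> + 4 * k * u \<le> (1 + 2 * u) * (\<tau> + d) + 4 * u + 12 * \<kappa>"
    and mean: "d \<le> 2 * u * (\<tau> + 1) + 1"
    and Halasz: "u < 1/4 \<Longrightarrow> d \<le> 2 * u * ((\<tau> / 2 + 8 * \<kappa>) / (1 - 2 * u) + 1) + 7 * \<kappa>"
  shows False
proof -
  have k0: "k > 0" using k by simp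
  define h where "h = 10 / k"
  have h: "0 \<le> h" "30 * h \<le> e" using k k0 by (auto simp: h_def divide_le_eq mult.commute)
  define v where "v = 2 * u"
  have hk: "h * k = 10" using k0 by (simp add: h_def)
  have scale: "x \<le> y" if "k * x \<le> k * y" for x y using that k0 by (simp only: mult_le_cancel_left_pos)
  have s2: "\<rho> / k + v \<le> d / k + \<tau> / k + h"
    by (rule scale) (use second \<kappa> k0 hk in \<open>simp add: algebra_simps v_def\<close>)
  have s1: "2 * (\<tau> / k) - 5/6 + e \<le> \<rho> / k + h"
    by (rule scale) (use lower k0 hk in \<open>simp add: algebra_simps\<close>)
  have s4: "\<rho> / k + 2 * v \<le> (1 + v) * (\<tau> / k + d / k) + 2 * h" if "u < 1/2"
  proof (rule scale)
    have "k * ((1 + v) * (\<tau> / k + d / k) + 2 * h) = (1 + 2 * u) * (\<tau> + d) + 20"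
      using k0 hk by (simp add: v_def field_simps)
    moreover have "k * (\<rho> / k + 2 * v) = \<rho> + 4 * k * u" using k0 by (simp add: v_def algebra_simps)
    ultimately show "k * (\<rho> / k + 2 * v) \<le> k * ((1 + v) * (\<tau> / k + d / k) + 2 * h)"
      using fourth[OF that] u \<kappa> by linarith
  qed
  show False
  proof (cases "u < 1/4")
    case False
    have mn: "d / k \<le> v * (\<tau> / k) + h"
    proof (rule scale)
      have "k * (v * (\<tau> / k) + h) = 2 * u * \<tau> + 10" using k0 hk by (simp add: v_def algebra_simps)
      moreover have "2 * u * (\<tau> + 1) + 1 \<le> 2 * u * \<tau> + 10" using u by (simp add: algebra_simps)
      ultimately show "k * (d / k) \<le> k * (v * (\<tau> / k) + h)" using mean k0 by simp
    qed
    show False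
    proof (rule exponent_contradiction_large[OF _ _ h e(1) _ s2 s1 mn])
      show "v < 1 \<Longrightarrow> \<rho> / k + 2 * v \<le> (1 + v) * (\<tau> / k + d / k) + 2 * h" using s4 by (simp add: v_def)
    qed (use False u \<tau> k0 in \<open>auto simp: v_def\<close>)
  next
    case True
    define w where "w = 1 - 2 * u"
    have w: "w > 1/2" "w < 1" using True u by (auto simp: w_def)
    define q where "q = (\<tau> / 2 + 8 * \<kappa>) / w"
    have q: "q * w = \<tau> / 2 + 8 * \<kappa>" using w by (simp add: q_def)
    have dq: "d \<le> 2 * u * (q + 1) + 7 * \<kappa>" using Halasz[OF True] by (simp add: q_def w_def)
    have "k * u < 2 * u * (q + 1)" using first dq c \<kappa> by linarith
    then have "u * k < u * (2 * (q + 1))" by (simp add: mult_ac)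
    then have kq: "k < 2 * (q + 1)" using u by (simp only: mult_less_cancel_left_pos)
    then have "k * w < 2 * (q + 1) * w" using w by (intro mult_strict_right_mono) auto
    then have "k * w < \<tau> + 16 * \<kappa> + 2 * w" using q by (simp add: algebra_simps)
    then have triv: "k * w \<le> \<tau> + 10" using \<kappa> w by linarith
    have s5: "1 - v \<le> \<tau> / k + h"
      by (rule scale) (use triv k0 hk in \<open>simp add: algebra_simps v_def w_def\<close>)
    have s3: "d / k \<le> v * (\<tau> / k) / (2 * (1 - v)) + h"
    proof (rule scale)
      have vw: "1 - v = w" by (simp add: v_def w_def)
      have "k * (v * (\<tau> / k) / (2 * (1 - v)) + h) = 2 * u * (\<tau> / 2 / w) + 10"
        unfolding vw using k0 hk w by (simp add: v_def field_simps)
      moreover have "q = \<tau> / 2 / w + 8 * \<kappa> / w" by (simp add: q_def add_divide_distrib)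
      moreover have "8 * \<kappa> / w \<le> 1"
        using w \<kappa> by (simp add: divide_le_eq)
      then have "2 * u * (8 * \<kappa> / w + 1) \<le> 2 * (1/4) * (1 + 1)" using u True w \<kappa> by (intro mult_mono add_mono) auto
      ultimately have "d \<le> k * (v * (\<tau> / k) / (2 * (1 - v)) + h)"
        using dq \<kappa> by (simp add: algebra_simps)
      then show "k * (d / k) \<le> k * (v * (\<tau> / k) / (2 * (1 - v)) + h)" using k0 by simp
    qed
    show False
      by (rule exponent_contradiction_small[OF _ _ h e _ s2 s1 s3 s5 s4]) (use True u \<tau> k0 in \<open>auto simp: v_def\<close>)
  qed
qed

context smooth_factors
begin

text \<open>Translation of the bounds for a level set into inequalities between exponents to the base \<open>P\<close>. The power \<open>i\<close> is chosen
as the least integer that makes the respective bound effective: \<open>P ^ i \<ge> T\<close> for the mean value,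
\<open>P powr (i * (1 - 2 * u)) \<ge> sqrt T\<close> for the bound of Halasz, and \<open>(P ^ i)\<^sup>2 \<ge> card S * T\<close> for the energy.
For \<open>u = 1/2\<close> nothing is assumed on the size of the polynomial; then the trivial bound for \<open>card S\<close> replaces the mean value.\<close>

lemma level_set_impossible:
  fixes S :: "int set" and T :: nat and \<kappa> u c e R \<Sigma> :: real
  assumes S: "S \<subseteq> {-int T..int T}" and T: "T \<ge> 1" and \<kappa>: "\<kappa> > 0" "\<kappa> \<le> 1/400" "100 * \<kappa> \<le> c" and P2: "P \<ge> 3"
    and u: "0 < u" "u \<le> 1/2"
    and lev: "\<And>t. u < 1/2 \<Longrightarrow> t \<in> S \<Longrightarrow> real (card A) * real P powr (- u) \<le> norm (dir_sum A (of_int t))"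
    and cardA: "real P powr (1 - \<kappa> / real k) \<le> real (card A)"
    and repb: "\<And>i n. i \<le> k \<Longrightarrow> 0 < n \<Longrightarrow> real n \<le> 3 * real P ^ k \<Longrightarrow> rep A i n \<le> real P powr \<kappa>"
    and two: "9 \<le> real P powr \<kappa>"
    and log1: "144 * (1 + ln (1 + 9 * real P ^ k)) \<le> real P powr \<kappa>"
    and log2: "24000 * (1 + ln (2 * real T)) \<le> real P powr \<kappa>"
    and log3: "40000000000 * (1 + ln (2 * real T) + ln (1 + 27 * (real P ^ k)\<^sup>2)) ^ 4 \<le> real P powr \<kappa>"
    and ke: "k \<ge> 30" "real k * e \<ge> 300" "0 < e" "e \<le> 1" and R: "R > 0"
    and sum: "R * real P powr (real k * u + c / 2) \<le> \<Sigma>"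
    and first: "\<Sigma> \<le> real (card S) * R"
    and second: "\<Sigma>\<^sup>2 \<le> real (card S) * (real P powr (2 * \<kappa>) * real T) * R"
    and fourth: "\<Sigma> ^ 4 \<le> R ^ 3 * (real P powr (2 * \<kappa>) * real T) * energy S"
    and lower: "(real T)\<^sup>2 * real P powr (- 5/6 * real k + e * real k - 3) \<le> R"
    and upper: "real T \<le> real P powr (5/6 * real k + 3)"
  shows False
proof -
  define p where "p = real P"
  have p1: "p > 1" "p \<ge> 3" using P2 by (auto simp: p_def)
  have powr_inj: "x \<le> y" if "p powr x \<le> p powr y" for x y using that p1 by simp
  define D where "D = real (card S)"
  have c0: "c \<ge> 0" using \<kappa> by linarith
  have pk: "p powr (real k * u + c / 2) \<ge> 1" using p1 u c0 by (intro ge_one_powr_ge_zero) auto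
  have DR: "p powr (real k * u + c / 2) \<le> D"
  proof -
    have "R * p powr (real k * u + c / 2) \<le> R * D" using sum first by (simp add: p_def D_def mult.commute)
    then show ?thesis using R by (simp only: mult_le_cancel_left_pos)
  qed
  have D1: "D \<ge> 1" using DR pk by linarith
  define d where "d = log p D"
  define \<tau> where "\<tau> = log p (real T)"
  define \<rho> where "\<rho> = log p R"
  have De: "D = p powr d" and Te: "real T = p powr \<tau>" and Re: "R = p powr \<rho>"
    using p1 D1 T R by (auto simp: d_def \<tau>_def \<rho>_def)
  have tau0: "\<tau> \<ge> 0" using T p1 by (simp add: \<tau>_def)
  have tau_up: "\<tau> \<le> 5/6 * real k + 3" by (rule powr_inj) (use upper Te in \<open>simp add: p_def\<close>)
  have kk: "real k \<ge> 30" using ke by simp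
  have S1: "real k * u + c / 2 \<le> d" by (rule powr_inj) (use DR in \<open>simp add: De\<close>)
  have Ssq: "(R * p powr (real k * u)) \<le> \<Sigma>"
  proof -
    have "R * p powr (real k * u) \<le> R * p powr (real k * u + c / 2)"
      using R p1 c0 by (intro mult_left_mono powr_mono) auto
    then show ?thesis using sum by (simp add: p_def)
  qed
  have S2: "\<rho> + 2 * real k * u \<le> d + \<tau> + 2 * \<kappa>"
  proof (rule powr_inj)
    have "(R * p powr (real k * u))\<^sup>2 \<le> \<Sigma>\<^sup>2" using Ssq R by (intro power_mono) auto
    also have "\<dots> \<le> D * (p powr (2 * \<kappa>) * real T) * R" using second by (simp add: D_def p_def)
    finally have "p powr (\<rho> + \<rho> + 2 * real k * u) \<le> p powr (d + \<tau> + 2 * \<kappa> + \<rho>)"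
      unfolding De Te Re power2_eq_square by (simp add: powr_add[symmetric] algebra_simps)
    then have "\<rho> + \<rho> + 2 * real k * u \<le> d + \<tau> + 2 * \<kappa> + \<rho>" by (rule powr_inj)
    then show "p powr (\<rho> + 2 * real k * u) \<le> p powr (d + \<tau> + 2 * \<kappa>)" using p1 by simp
  qed
  have S3: "2 * \<tau> - 5/6 * real k + e * real k - 3 \<le> \<rho>"
  proof (rule powr_inj)
    have "p powr (2 * \<tau> - 5/6 * real k + e * real k - 3) = (real T)\<^sup>2 * p powr (- 5/6 * real k + e * real k - 3)"
      unfolding Te power2_eq_square by (simp add: powr_add[symmetric] algebra_simps)
    then show "p powr (2 * \<tau> - 5/6 * real k + e * real k - 3) \<le> p powr \<rho>" using lower unfolding Re[symmetric] by (simp only: p_def)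
  qed
  have dT: "d \<le> \<tau> + 1"
  proof (rule powr_inj)
    have "card S \<le> card {-int T..int T}" using S by (intro card_mono) auto
    then have "D \<le> real (2 * T + 1)" by (simp add: D_def)
    also have "\<dots> \<le> 3 * real T" using T by simp
    also have "\<dots> \<le> p * real T" using p1 by (intro mult_right_mono) auto
    also have "\<dots> = p powr (\<tau> + 1)" using p1 by (simp add: Te powr_add)
    finally show "p powr d \<le> p powr (\<tau> + 1)" by (simp add: De)
  qed
  have ceil_props: "x \<le> real (nat \<lceil>x\<rceil>)" "real (nat \<lceil>x\<rceil>) < x + 1" if "x \<ge> 0" for x :: real
    using that by linarith+
  have pnat: "p ^ i = p powr real i" for i using p1 by (simp add: powr_realpow)
  have P2': "P \<ge> 2" using P2 by simp
  have u0: "0 \<le> u" using u by simp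
  have T2: "\<tau> + 2 \<le> real k" using tau_up kk by linarith
  have S4: "d \<le> 2 * u * (\<tau> + 1) + 1"
  proof (cases "u < 1/2")
    case False
    then have uh: "u = 1/2" using u by simp
    show ?thesis unfolding uh using dT by simp
  next
    case True
    define i where "i = nat \<lceil>max 1 \<tau>\<rceil>"
    have i: "max 1 \<tau> \<le> real i" "real i < max 1 \<tau> + 1" unfolding i_def by (intro ceil_props; simp)+
    have i1: "1 \<le> i" "i \<le> k" using i T2 kk by (auto simp: max_def split: if_splits)
    show ?thesis
    proof (cases "\<tau> \<le> 1")
      case True
      then have "d \<le> 2" using dT by simp
      moreover have "real k * u \<le> d" using S1 c0 by linarith
      moreover have "30 * u \<le> real k * u" using kk u by (intro mult_right_mono) auto
      ultimately have "u \<le> 1/15" by linarith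
      then have u4: "u < 1/4" by simp
      have "real T \<le> p ^ 1" using Te True p1 powr_mono[of \<tau> 1 p] by simp
      then have "real (card S) \<le> real P powr (2 * real 1 * u + 6 * \<kappa>)"
        using ke by (intro level_mean_value[OF S T \<kappa>(1) P2' u0 lev[OF \<open>u < 1/2\<close>] cardA repb two log1 log2 log3]) (auto simp: p_def)
      then have "p powr d \<le> p powr (2 * u + 6 * \<kappa>)" unfolding De[symmetric] unfolding D_def p_def by simp
      then have "d \<le> 2 * u + 6 * \<kappa>" by (rule powr_inj)
      moreover have "0 \<le> u * \<tau>" using u tau0 by simp
      ultimately show ?thesis using \<kappa> by (simp add: algebra_simps)
    next
      case False
      have "real T \<le> p ^ i" unfolding pnat Te using i p1 by (intro powr_mono) auto
      then have "real (card S) \<le> real P powr (2 * real i * u + 6 * \<kappa>)"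
        by (intro level_mean_value[OF S T \<kappa>(1) P2' u0 lev[OF \<open>u < 1/2\<close>] cardA repb two log1 log2 log3 i1]) (auto simp: p_def)
      then have "p powr d \<le> p powr (2 * real i * u + 6 * \<kappa>)" unfolding De[symmetric] unfolding D_def p_def by simp
      then have "d \<le> 2 * real i * u + 6 * \<kappa>" by (rule powr_inj)
      also have "2 * real i * u \<le> 2 * (\<tau> + 1) * u" using i False u by (intro mult_right_mono) auto
      finally show ?thesis using \<kappa> by (simp add: mult_ac)
    qed
  qed
  have S5: "d \<le> 2 * u * ((\<tau> / 2 + 8 * \<kappa>) / (1 - 2 * u) + 1) + 7 * \<kappa>" if u4: "u < 1/4"
  proof -
    define x where "x = (\<tau> / 2 + 8 * \<kappa>) / (1 - 2 * u)"
    have w: "1 - 2 * u > 1/2" using u4 by simp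
    have x0: "x > 0" using w tau0 \<kappa> by (simp add: x_def divide_pos_pos add_nonneg_pos)
    define i where "i = nat \<lceil>x\<rceil>"
    have i: "x \<le> real i" "real i < x + 1" unfolding i_def using x0 by (intro ceil_props; simp)+
    have "x \<le> \<tau> + 16 * \<kappa>"
    proof -
      have "\<tau> / 2 + 8 * \<kappa> = (\<tau> + 16 * \<kappa>) * (1/2)" by simp
      also have "\<dots> \<le> (\<tau> + 16 * \<kappa>) * (1 - 2 * u)" using w tau0 \<kappa> by (intro mult_left_mono) auto
      finally show ?thesis using w by (simp add: x_def divide_le_eq)
    qed
    then have i1: "1 \<le> i" "i \<le> k" using i x0 T2 \<kappa> by linarith+
    have big: "real P powr (7 * \<kappa>) * sqrt (real T) \<le> real P powr (real i * (1 - 2 * u))"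
    proof -
      have "sqrt (real T) = p powr (\<tau> / 2)" unfolding Te using p1
        by (simp add: powr_half_sqrt[symmetric] powr_powr)
      then have "real P powr (7 * \<kappa>) * sqrt (real T) = p powr (7 * \<kappa> + \<tau> / 2)" by (simp add: p_def powr_add)
      also have "\<dots> \<le> p powr (real i * (1 - 2 * u))"
      proof (intro powr_mono)
        have "\<tau> / 2 + 8 * \<kappa> = x * (1 - 2 * u)" using w by (simp add: x_def)
        also have "\<dots> \<le> real i * (1 - 2 * u)" using i w by (intro mult_right_mono) auto
        finally show "7 * \<kappa> + \<tau> / 2 \<le> real i * (1 - 2 * u)" using \<kappa> by linarith
      qed (use p1 in simp)
      finally show ?thesis by (simp add: p_def)
    qed
    have "u < 1/2" using u4 by simp
    have "real (card S) \<le> real P powr (2 * real i * u + 7 * \<kappa>)"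
      by (rule level_Halasz[OF S T \<kappa>(1) P2' u0 lev[OF \<open>u < 1/2\<close>] cardA repb two log1 log2 log3 i1 big])
    then have "p powr d \<le> p powr (2 * real i * u + 7 * \<kappa>)" unfolding De[symmetric] unfolding D_def p_def by simp
    then have "d \<le> 2 * real i * u + 7 * \<kappa>" by (rule powr_inj)
    also have "2 * real i * u \<le> 2 * (x + 1) * u" using i u by (intro mult_right_mono) auto
    finally show ?thesis by (simp add: x_def mult_ac)
  qed
  have S6: "\<rho> + 4 * real k * u \<le> (1 + 2 * u) * (\<tau> + d) + 4 * u + 12 * \<kappa>" if u2: "u < 1/2"
  proof -
    define x where "x = (d + \<tau>) / 2"
    have "0 < real k * u" using kk u by simp
    then have "d > 0" using S1 c0 by linarith
    then have x0: "x > 0" using tau0 by (simp add: x_def)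
    define i where "i = nat \<lceil>x\<rceil>"
    have i: "x \<le> real i" "real i < x + 1" unfolding i_def using x0 by (intro ceil_props; simp)+
    have "x \<le> \<tau> + 1/2" using dT by (simp add: x_def)
    then have i1: "1 \<le> i" "i \<le> k" using i x0 T2 by linarith+
    have DT: "real (card S) * real T \<le> (real P ^ i)\<^sup>2"
    proof -
      have "D * real T = p powr (d + \<tau>)" by (simp add: De Te powr_add)
      also have "\<dots> \<le> p powr (2 * real i)" using i p1 unfolding x_def by (intro powr_mono) auto
      also have "\<dots> = (p ^ i)\<^sup>2" by (simp add: pnat power2_eq_square powr_add[symmetric])
      finally show ?thesis by (simp add: D_def p_def)
    qed
    have E: "energy S \<le> p powr (4 * real i * u + 10 * \<kappa>) * D"
      unfolding p_def D_def
      by (rule level_energy[OF S T \<kappa>(1) P2' u0 lev[OF u2] cardA repb two log1 log2 log3 i1 DT])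
    have "(R * p powr (real k * u)) ^ 4 \<le> \<Sigma> ^ 4" using Ssq R by (intro power_mono) auto
    also have "\<dots> \<le> R ^ 3 * (p powr (2 * \<kappa>) * real T) * energy S" using fourth by (simp add: p_def)
    also have "\<dots> \<le> R ^ 3 * (p powr (2 * \<kappa>) * real T) * (p powr (4 * real i * u + 10 * \<kappa>) * D)"
      using E R by (intro mult_left_mono) auto
    finally have "p powr (4 * \<rho> + 4 * (real k * u)) \<le> p powr (3 * \<rho> + 2 * \<kappa> + \<tau> + (4 * real i * u + 10 * \<kappa>) + d)"
      unfolding De Te Re power4_eq_xxxx power3_eq_cube by (simp add: powr_add[symmetric] algebra_simps)
    then have "4 * \<rho> + 4 * (real k * u) \<le> 3 * \<rho> + 2 * \<kappa> + \<tau> + (4 * real i * u + 10 * \<kappa>) + d" by (rule powr_inj)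
    moreover have "4 * real i * u \<le> 4 * (x + 1) * u" using i u by (intro mult_right_mono) auto
    ultimately have "\<rho> + 4 * real k * u \<le> \<tau> + d + 4 * (x + 1) * u + 12 * \<kappa>" by simp
    also have "\<dots> = (1 + 2 * u) * (\<tau> + d) + 4 * u + 12 * \<kappa>" by (simp add: x_def algebra_simps)
    finally show ?thesis .
  qed
  show False
    by (rule exponents_incompatible[OF kk ke(2,3,4) u \<kappa> tau0 S1 S2 S3 S6 S4 S5])
qed

end

section \<open>Counting separated gaps\<close>

lemma ln_diff_lower:
  fixes y z :: real
  assumes "0 < z" "z \<le> y"
  shows "(y - z) / y \<le> ln y - ln z"
proof -
  have "ln z - ln y = ln (z / y)" using assms by (simp add: ln_div)
  also have "\<dots> \<le> z / y - 1" using assms by (intro ln_le_minus_one) auto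
  also have "\<dots> = - ((y - z) / y)" using assms by (simp add: field_simps)
  finally show ?thesis by simp
qed

context smooth_factors
begin

text \<open>If the bound fails, the detection inequality holds with \<open>M\<close> slightly larger than \<open>T = 3 * Y / H\<close>. Its right-hand side is split into
\<open>L + 1\<close> level sets of \<open>\<bar>A(t)\<bar>\<close>, the last of which contains all frequencies where this is below \<open>card A * P powr (-1/2)\<close>. By \<open>level_set_impossible\<close> each level
contributes less than \<open>R * P powr (3/4 * c)\<close>, relative to \<open>card A ^ k\<close>, and the saving \<open>P powr (- c)\<close> from \<open>balanced\<close> exceeds the loss.\<close>

lemma gap_count_core:
  fixes \<kappa> c e Y H :: real and j L :: nat and I :: "real set"
  assumes \<kappa>: "\<kappa> > 0" "\<kappa> \<le> 1/400" "100 * \<kappa> \<le> c" and ke: "k \<ge> 30" "real k * e \<ge> 300" "0 < e" "e \<le> 1"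
    and P12: "P \<ge> 12" and j: "j \<ge> 1" and L: "L \<ge> 1" "2 * real k \<le> c * real L"
    and cardA: "real P powr (1 - \<kappa> / real k) \<le> real (card A)"
    and repb: "\<And>i n. i \<le> k \<Longrightarrow> 0 < n \<Longrightarrow> real n \<le> 3 * real P ^ k \<Longrightarrow> rep A i n \<le> real P powr \<kappa>"
    and two: "9 \<le> real P powr \<kappa>"
    and bal: "\<And>B t. B > 0 \<Longrightarrow> \<bar>t\<bar> \<le> real B \<Longrightarrow> \<bar>t\<bar> \<le> real P powr real (k + 3) \<Longrightarrow> norm (balanced P B t) \<le> real P powr (1 - c)"
    and log1: "144 * (1 + ln (1 + 9 * real P ^ k)) \<le> real P powr \<kappa>"
    and log2: "24000 * (1 + ln (2 * real P powr real (k + 3))) \<le> real P powr \<kappa>"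
    and log3: "40000000000 * (1 + ln (2 * real P powr real (k + 3)) + ln (1 + 27 * (real P ^ k)\<^sup>2)) ^ 4 \<le> real P powr \<kappa>"
    and log4: "16 * (1 + ln (1 + 3 * real P powr real (k + 3))) \<le> real P powr \<kappa>"
    and jj: "2 * real j \<le> real P powr \<kappa>"
    and small: "32 * 64 ^ j * real P powr (real k + 3) \<le> real P powr (2 * \<kappa> * real j)"
    and levels: "4 ^ (j + 1) * (real L + 1) \<le> real P powr (c / 4)"
    and Y: "3 * real P ^ (k + 1) \<le> Y" "Y \<le> 4 * real P ^ (k + 1)"
    and H: "Y powr (1/6) \<le> H" "H \<le> Y"
    and I: "finite I" "\<And>y. y \<in> I \<Longrightarrow> Y \<le> y \<and> y \<le> 2 * Y"
    and sep: "\<And>y z. y \<in> I \<Longrightarrow> z \<in> I \<Longrightarrow> y \<noteq> z \<Longrightarrow> H \<le> \<bar>y - z\<bar>"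
    and free: "\<And>y n. y \<in> I \<Longrightarrow> smooth (9 * real P) n \<Longrightarrow> H \<le> \<bar>real n - y\<bar>"
  shows "real (card I) * H\<^sup>2 \<le> Y powr (7/6 + e)"
proof (rule ccontr)
  assume neg: "\<not> real (card I) * H\<^sup>2 \<le> Y powr (7/6 + e)"
  define p where "p = real P"
  define R where "R = real (card I)"
  have p12: "p \<ge> 12" using P12 by (simp add: p_def)
  have p0: "p > 1" using p12 by simp
  have pnat: "p ^ i = p powr real i" for i using p0 by (simp add: powr_realpow)
  have pw1: "p powr x \<ge> 1" if "x \<ge> 0" for x using that p0 by (intro ge_one_powr_ge_zero) auto
  have pmono: "p powr x \<le> p powr y" if "x \<le> y" for x y using that p0 by (intro powr_mono) auto
  have Ylow: "p powr (real k + 1) \<le> Y"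
  proof -
    have "p ^ (k + 1) \<le> 3 * p ^ (k + 1)" using p0 by simp
    then have "p ^ (k + 1) \<le> Y" using Y(1) unfolding p_def by linarith
    then show ?thesis using pnat[of "k + 1"] by (simp add: add.commute)
  qed
  have Yup: "Y \<le> p powr (real k + 2)"
  proof -
    have "4 * p ^ (k + 1) \<le> p * p ^ (k + 1)" using p12 by (intro mult_right_mono) auto
    also have "\<dots> = p ^ (k + 2)" by simp
    finally have "Y \<le> p ^ (k + 2)" using Y(2) unfolding p_def by linarith
    then show ?thesis using pnat[of "k + 2"] by (simp add: add.commute)
  qed
  have Y1: "Y \<ge> 1" using Ylow pw1[of "real k + 1"] by linarith
  have H1: "H \<ge> 1" using H(1) ge_one_powr_ge_zero[OF Y1, of "1/6"] by linarith
  have R0: "R > 0"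
  proof -
    have "0 \<le> Y powr (7/6 + e)" by simp
    then have "0 < R * H\<^sup>2" using neg unfolding R_def by linarith
    then show ?thesis using H1 by (simp add: zero_less_mult_iff)
  qed
  have RH: "Y powr (7/6 + e) \<le> R * H\<^sup>2" using neg by (simp add: R_def)
  define T where "T = 3 * Y / H"
  have TH: "T * H = 3 * Y" using H1 by (simp add: T_def)
  have T3: "T \<ge> 3" using H H1 by (simp add: T_def le_divide_eq)
  have Tup: "T \<le> p powr (real k + 2)"
  proof -
    have "T \<le> 3 * Y" using H1 Y1 by (simp add: T_def divide_le_eq mult_le_cancel_left1)
    also have "\<dots> \<le> 12 * p ^ (k + 1)" using Y(2) by (simp add: p_def)
    also have "\<dots> \<le> p * p ^ (k + 1)" using p12 by (intro mult_right_mono) auto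
    also have "\<dots> = p ^ (k + 2)" by simp
    finally show ?thesis using pnat[of "k + 2"] by (simp add: add.commute)
  qed
  define M where "M = nat \<lceil>T * p powr \<kappa>\<rceil>"
  have Tk: "T * p powr \<kappa> \<ge> 27" using mult_mono[OF T3 two] T3 by (simp add: p_def)
  have M: "T * p powr \<kappa> \<le> real M" "real M \<le> 2 * (T * p powr \<kappa>)" "M \<ge> 8"
  proof -
    define W where "W = T * p powr \<kappa>"
    have W27: "W \<ge> 27" using Tk by (simp add: W_def)
    then have "0 \<le> \<lceil>W\<rceil>" by simp
    then have "real M = of_int \<lceil>W\<rceil>" by (simp add: M_def W_def)
    then have W: "W \<le> real M" "real M < W + 1" using conjunct1[OF ceiling_correct[of W]] conjunct2[OF ceiling_correct[of W]] by linarith+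
    have "real M \<ge> 8" using W W27 by linarith
    then show "M \<ge> 8" by simp
    show "T * p powr \<kappa> \<le> real M" "real M \<le> 2 * (T * p powr \<kappa>)"
      using W W27 unfolding W_def[symmetric] by linarith+
  qed
  define T1 where "T1 = j * M"
  have T1M: "real M \<le> real T1" using j by (simp add: T1_def mult_le_cancel_right1)
  have T1T: "T \<le> real T1"
  proof -
    have "T * 1 \<le> T * p powr \<kappa>" using T3 two by (intro mult_left_mono) (auto simp: p_def)
    then show ?thesis using M(1) T1M by linarith
  qed
  have T11: "T1 \<ge> 1" using T1T T3 by linarith
  have T1a: "real T1 \<le> T * p powr (2 * \<kappa>)"
  proof -
    have "real T1 \<le> real j * (2 * (T * p powr \<kappa>))" unfolding T1_def of_nat_mult using M by (intro mult_left_mono) auto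
    also have "\<dots> = 2 * real j * (T * p powr \<kappa>)" by simp
    also have "\<dots> \<le> p powr \<kappa> * (T * p powr \<kappa>)" using jj T3 by (intro mult_right_mono) (auto simp: p_def)
    also have "\<dots> = T * p powr (2 * \<kappa>)" by (simp add: powr_add[symmetric] mult_ac)
    finally show ?thesis .
  qed
  have T1k: "real T1 \<le> p powr real (k + 3)"
  proof -
    have "real T1 \<le> p powr (real k + 2) * p powr (2 * \<kappa>)" using T1a Tup by (meson mult_right_mono order_trans powr_ge_zero)
    also have "\<dots> = p powr (real k + 2 + 2 * \<kappa>)" by (simp add: powr_add)
    also have "\<dots> \<le> p powr real (k + 3)" using \<kappa> by (intro pmono) simp
    finally show ?thesis .
  qed
  have gap: "1 / T \<le> \<bar>ln (real (q * pp)) - ln y\<bar>" if y: "y \<in> I" and q: "rep A k q \<noteq> 0" and pp: "P < pp" "pp \<le> 9 * P" for y q pp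
  proof -
    have sq: "smooth ((1 + 1 / real k) * real P) q"
      using A_lo A_hi by (intro rep_smooth[OF _ q]) (auto intro: le_less_trans)
    have hi: "(1 + 1 / real k) * real P \<le> 9 * real P"
    proof (rule mult_right_mono)
      have "1 / real k \<le> 1" using k1 by simp
      then show "1 + 1 / real k \<le> 9" by linarith
    qed simp
    have sm: "smooth (9 * real P) (q * pp)"
      unfolding smooth_def
    proof (intro conjI allI impI)
      show "q * pp > 0" using sq pp by (simp add: smooth_def)
      fix r assume r: "prime r \<and> r dvd q * pp"
      then have "r dvd q \<or> r dvd pp" using prime_dvd_multD[of r q pp] by blast
      then show "real r \<le> 9 * real P"
      proof
        assume "r dvd q"
        then show ?thesis using sq r hi by (auto simp: smooth_def)
      next
        assume "r dvd pp"
        then have "r \<le> pp" using pp by (intro dvd_imp_le) auto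
        then show ?thesis using pp by linarith
      qed
    qed
    define n where "n = real (q * pp)"
    have n0: "n > 0" using sm unfolding n_def smooth_def by (simp only: of_nat_0_less_iff)
    have d: "H \<le> \<bar>n - y\<bar>" unfolding n_def by (rule free[OF y sm])
    have yb: "Y \<le> y" "y \<le> 2 * Y" using I(2)[OF y] by auto
    have T1': "1 / T = H / (3 * Y)" by (simp add: T_def)
    show ?thesis unfolding n_def[symmetric] T1'
    proof (cases "n \<ge> y")
      case True
      have "H / (3 * Y) \<le> H / (y + H)" using yb H H1 Y1 by (intro divide_left_mono) auto
      also have "\<dots> \<le> ln (y + H) - ln y" using ln_diff_lower[of y "y + H"] yb Y1 H1 by simp
      also have "\<dots> \<le> ln n - ln y" using True d yb Y1 H1 by simp
      finally show "H / (3 * Y) \<le> \<bar>ln n - ln y\<bar>" by linarith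
    next
      case False
      have "H / (3 * Y) \<le> (y - n) / y"
        using False d yb Y1 H1 by (intro frac_le) auto
      also have "\<dots> \<le> ln y - ln n" using ln_diff_lower[of n y] n0 False by simp
      finally show "H / (3 * Y) \<le> \<bar>ln n - ln y\<bar>" by linarith
    qed
  qed
  have lsep: "1 / T \<le> \<bar>ln y - ln z\<bar>" if "y \<in> I" "z \<in> I" "y \<noteq> z" for y z
  proof -
    have main: "1 / T \<le> ln b - ln a" if "a \<in> I" "b \<in> I" "a < b" for a b
    proof -
      have ab: "Y \<le> a" "b \<le> 2 * Y" "H \<le> b - a" using I(2) that sep[of a b] by auto
      have "1 / T = H / (3 * Y)" by (simp add: T_def)
      also have "\<dots> \<le> (b - a) / b" using ab Y1 H1 that by (intro frac_le) auto
      also have "\<dots> \<le> ln b - ln a" using ab Y1 that by (intro ln_diff_lower) auto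
      finally show ?thesis .
    qed
    show ?thesis
    proof (cases "y < z")
      case True
      then show ?thesis using main[of y z] that by linarith
    next
      case False
      then show ?thesis using main[of z y] that by linarith
    qed
  qed
  have lnear: "\<bar>ln y - ln z\<bar> \<le> 3" if "y \<in> I" "z \<in> I" for y z
  proof -
    have "ln a - ln b \<le> 3" if "a \<in> I" "b \<in> I" for a b
    proof -
      have "ln a \<le> ln (2 * b)" using I(2)[OF that(1)] I(2)[OF that(2)] Y1 by simp
      also have "\<dots> = ln 2 + ln b" using I(2)[OF that(2)] Y1 by (intro ln_mult_pos) auto
      finally show ?thesis using ln2_le_1 by linarith
    qed
    from this[OF that] this[OF that(2,1)] show ?thesis by linarith
  qed
  have Tinv: "1 / T > 0" using T3 by simp
  have sieve1: "16 / (1 / T) * (1 + ln (1 + 3 / (1 / T))) \<le> p powr \<kappa> * real T1"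
  proof -
    have "T \<le> p powr real (k + 3)" using T1T T1k by linarith
    then have "ln (1 + 3 * T) \<le> ln (1 + 3 * p powr real (k + 3))" using T3 by (intro ln_mono) auto
    then have "16 * (1 + ln (1 + 3 * T)) \<le> p powr \<kappa>" using log4 by (simp add: p_def)
    moreover have "0 \<le> ln (1 + 3 * T)" using T3 by simp
    ultimately have "(16 * (1 + ln (1 + 3 * T))) * T \<le> p powr \<kappa> * real T1"
      using T1T T3 by (intro mult_mono) auto
    then show ?thesis by (simp add: mult_ac)
  qed
  have nine: "9 * real T1 \<le> p powr \<kappa> * real T1" using two by (intro mult_right_mono) (auto simp: p_def)
  have twok: "2 * (p powr \<kappa> * real T1) \<le> p powr (2 * \<kappa>) * real T1"
  proof -
    have "2 * (p powr \<kappa> * real T1) \<le> p powr \<kappa> * (p powr \<kappa> * real T1)" using two by (intro mult_right_mono) (auto simp: p_def)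
    then show ?thesis by (simp add: powr_add[symmetric] flip: mult.assoc)
  qed
  have sv2: "sieve_const T1 (1 / T) \<le> p powr (2 * \<kappa>) * real T1"
  proof -
    have "real T1 \<ge> 1" using T11 by simp
    then show ?thesis unfolding sieve_const_def using sieve1 nine twok by linarith
  qed
  have sv4: "sieve_const (2 * T1) (1 / T) \<le> p powr (2 * \<kappa>) * real T1"
  proof -
    have "real T1 \<ge> 1" "real (2 * T1) = 2 * real T1" using T11 by simp_all
    then show ?thesis unfolding sieve_const_def using sieve1 nine twok by linarith
  qed
  have log2': "24000 * (1 + ln (2 * real T1)) \<le> real P powr \<kappa>"
  proof -
    have "ln (2 * real T1) \<le> ln (2 * p powr real (k + 3))" using T1k T11 by (intro ln_mono) auto
    then show ?thesis using log2 by (simp add: p_def)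
  qed
  have log3': "40000000000 * (1 + ln (2 * real T1) + ln (1 + 27 * (real P ^ k)\<^sup>2)) ^ 4 \<le> real P powr \<kappa>"
  proof -
    have "ln (2 * real T1) \<le> ln (2 * p powr real (k + 3))" using T1k T11 by (intro ln_mono) auto
    moreover have "0 \<le> ln (2 * real T1)" using T11 by simp
    moreover have "0 \<le> ln (1 + 27 * (real P ^ k)\<^sup>2)" by simp
    ultimately have "(1 + ln (2 * real T1) + ln (1 + 27 * (real P ^ k)\<^sup>2)) ^ 4 \<le> (1 + ln (2 * real P powr real (k + 3)) + ln (1 + 27 * (real P ^ k)\<^sup>2)) ^ 4"
      by (intro power_mono) (auto simp: p_def)
    then show ?thesis using log3 by linarith
  qed
  \<comment> \<open>\<open>R \<ge> Y powr (7/6 + e) / H\<^sup>2\<close> is \<open>T\<^sup>2 * Y powr (- 5/6 + e)\<close> up to a constant.\<close>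
  have lower: "(real T1)\<^sup>2 * real P powr (- 5/6 * real k + e * real k - 3) \<le> R"
  proof -
    have Ye: "Y powr (7/6 + e) = Y\<^sup>2 * (Y powr (-5/6) * Y powr e)"
      using Y1 by (simp add: powr_add[symmetric] powr_numeral[symmetric] del: powr_numeral)
    have y1: "p powr (-5/6 * real k - 5/3) \<le> Y powr (-5/6)"
    proof -
      have "(p powr (real k + 2)) powr (-5/6) \<le> Y powr (-5/6)"
        using Yup Y1 by (intro powr_mono2') auto
      moreover have "(p powr (real k + 2)) powr (-5/6) = p powr (-5/6 * real k - 5/3)"
        unfolding powr_powr by (rule arg_cong[where f = "\<lambda>x. p powr x"]) (simp add: algebra_simps)
      ultimately show ?thesis by simp
    qed
    have y2: "p powr (e * real k) \<le> Y powr e"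
    proof -
      have "p powr (real k) \<le> Y" using Ylow pmono[of "real k" "real k + 1"] by linarith
      then have "(p powr real k) powr e \<le> Y powr e" using ke by (intro powr_mono2) auto
      then show ?thesis by (simp add: powr_powr mult.commute)
    qed
    have "H\<^sup>2 * ((real T1)\<^sup>2 * p powr (- 5/6 * real k + e * real k - 3)) = (real T1 * H)\<^sup>2 * p powr (- 5/6 * real k + e * real k - 3)"
      by (simp add: power_mult_distrib mult_ac)
    also have "\<dots> \<le> (3 * Y * p powr (2 * \<kappa>))\<^sup>2 * p powr (- 5/6 * real k + e * real k - 3)"
    proof (intro mult_right_mono power_mono)
      have "real T1 * H \<le> T * p powr (2 * \<kappa>) * H" using T1a H1 by (intro mult_right_mono) auto
      also have "\<dots> = 3 * Y * p powr (2 * \<kappa>)" using TH by (simp add: mult_ac)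
      finally show "real T1 * H \<le> 3 * Y * p powr (2 * \<kappa>)" .
    qed (use H1 in auto)
    also have "\<dots> = Y\<^sup>2 * (9 * p powr (4 * \<kappa> - 5/6 * real k + e * real k - 3))"
      by (simp add: power2_eq_square powr_add[symmetric] algebra_simps)
    also have "\<dots> \<le> Y\<^sup>2 * (p powr \<kappa> * p powr (4 * \<kappa> - 5/6 * real k + e * real k - 3))"
      using two by (intro mult_left_mono mult_right_mono) (auto simp: p_def)
    also have "\<dots> \<le> Y\<^sup>2 * (p powr (-5/6 * real k - 5/3) * p powr (e * real k))"
    proof (rule mult_left_mono)
      have "\<kappa> + (4 * \<kappa> - 5/6 * real k + e * real k - 3) \<le> (-5/6 * real k - 5/3) + e * real k" using \<kappa> by simp
      then show "p powr \<kappa> * p powr (4 * \<kappa> - 5/6 * real k + e * real k - 3) \<le> p powr (-5/6 * real k - 5/3) * p powr (e * real k)"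
        unfolding powr_add[symmetric] by (rule pmono)
    qed simp
    also have "\<dots> \<le> Y powr (7/6 + e)" unfolding Ye using y1 y2 by (intro mult_left_mono mult_mono) auto
    also have "\<dots> \<le> H\<^sup>2 * R" using RH by (simp add: mult.commute)
    finally have "H\<^sup>2 * ((real T1)\<^sup>2 * p powr (- 5/6 * real k + e * real k - 3)) \<le> H\<^sup>2 * R" .
    moreover have "H\<^sup>2 > 0" using H1 by simp
    ultimately show ?thesis unfolding p_def by (simp only: mult_le_cancel_left_pos)
  qed
  have upper: "real T1 \<le> real P powr (5/6 * real k + 3)"
  proof -
    have "Y = Y powr (1/6) * Y powr (5/6)" using Y1 by (simp add: powr_add[symmetric])
    also have "\<dots> \<le> H * Y powr (5/6)" using H by (intro mult_right_mono) auto
    finally have "3 * Y \<le> H * (3 * Y powr (5/6))" by simp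
    then have "T \<le> 3 * Y powr (5/6)" using H1 by (simp add: T_def divide_le_eq mult.commute)
    also have "\<dots> \<le> p powr \<kappa> * (p powr (real k + 2)) powr (5/6)"
      using two Yup Y1 by (intro mult_mono powr_mono2) (auto simp: p_def)
    also have "\<dots> = p powr (\<kappa> + (real k + 2) * (5/6))" unfolding powr_powr by (rule powr_add[symmetric])
    finally have "T * p powr (2 * \<kappa>) \<le> p powr (\<kappa> + (real k + 2) * (5/6)) * p powr (2 * \<kappa>)"
      by (intro mult_right_mono) auto
    also have "\<dots> = p powr (\<kappa> + (real k + 2) * (5/6) + 2 * \<kappa>)" by (simp only: powr_add)
    also have "\<dots> \<le> p powr (5/6 * real k + 3)"
    proof (rule pmono)
      have "(real k + 2) * (5/6) = 5/6 * real k + 5/3" by (simp add: algebra_simps)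
      then show "\<kappa> + (real k + 2) * (5/6) + 2 * \<kappa> \<le> 5/6 * real k + 3" using \<kappa> by linarith
    qed
    finally show ?thesis using T1a by (simp add: p_def)
  qed
  define X where "X = {-int T1..int T1}"
  define \<alpha> where "\<alpha> = real (card A)"
  have alpha0: "\<alpha> > 0"
  proof -
    have "0 < real P powr (1 - \<kappa> / real k)" using P12 by simp
    then show ?thesis using cardA unfolding \<alpha>_def by linarith
  qed
  define a where "a t = norm (dir_sum A (of_int t))" for t :: int
  have a_le: "a t \<le> \<alpha>" for t unfolding a_def \<alpha>_def by (rule norm_dir_sum_le_card)
  define Ysum where "Ysum t = norm (\<Sum>y\<in>I. cis (of_int t * ln y))" for t :: int
  have Y_le: "Ysum t \<le> R" for t
    unfolding Ysum_def R_def using norm_sum[of "\<lambda>y. cis (of_int t * ln y)" I] by simp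
  have cL: "c * real L \<ge> 2 * real k" using L by simp
  \<comment> \<open>Level \<open>i\<close> consists of the \<open>t\<close> with \<open>a t\<close> between \<open>\<alpha> * p powr (- (i + 1) / (2 * L))\<close> and \<open>\<alpha> * p powr (- i / (2 * L))\<close>.\<close>
  define idx where "idx t = (LEAST i. i = L \<or> \<alpha> * p powr (- (real i + 1) / (2 * real L)) < a t)" for t
  have idxP: "idx t = L \<or> \<alpha> * p powr (- (real (idx t) + 1) / (2 * real L)) < a t" for t
    unfolding idx_def by (rule LeastI[of _ L]) simp
  have idxL: "idx t \<le> L" for t unfolding idx_def by (rule Least_le) simp
  have idxup: "a t \<le> \<alpha> * p powr (- real (idx t) / (2 * real L))" for t
  proof (cases "idx t")
    case 0
    then show ?thesis using a_le p0 by simp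
  next
    case (Suc i)
    then have "i < idx t" by simp
    then have "\<not> (i = L \<or> \<alpha> * p powr (- (real i + 1) / (2 * real L)) < a t)"
      unfolding idx_def by (rule not_less_Least)
    then show ?thesis using Suc by (simp add: add.commute)
  qed
  define Sset where "Sset i = {t\<in>X. idx t = i}" for i
  define \<Sigma> where "\<Sigma> i = (\<Sum>t\<in>Sset i. Ysum t)" for i
  have level: "\<Sigma> i * p powr (- real k * real i / (2 * real L)) < R * p powr (3/4 * c)" if i: "i \<le> L" for i
  proof -
    define u where "u = (if i = L then 1/2 else (real i + 1) / (2 * real L))"
    have L0: "real L > 0" using L by simp
    have u: "0 < u" "u \<le> 1/2" using i L0 by (auto simp: u_def divide_le_eq)
    have iL: "u < 1/2 \<Longrightarrow> i < L" using i by (auto simp: u_def split: if_splits)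
    have SX: "Sset i \<subseteq> {-int T1..int T1}" by (auto simp: Sset_def X_def)
    have "\<not> R * real P powr (real k * u + c / 2) \<le> \<Sigma> i"
    proof
      assume as: "R * real P powr (real k * u + c / 2) \<le> \<Sigma> i"
      have lv: "real (card A) * real P powr (- u) \<le> norm (dir_sum A (of_int t))" if "u < 1/2" "t \<in> Sset i" for t
      proof -
        have it: "i < L" "idx t = i" using iL that by (auto simp: Sset_def)
        have "- (real i + 1) / (2 * real L) = - u" using it(1) by (simp add: u_def minus_divide_left)
        then have "\<alpha> * p powr (- u) < a t" using idxP[of t] it by simp
        then show ?thesis by (simp add: \<alpha>_def a_def p_def)
      qed
      have f1: "\<Sigma> i \<le> real (card (Sset i)) * R"
        unfolding \<Sigma>_def using sum_bounded_above[of "Sset i" Ysum R] Y_le by simp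
      have "(\<Sigma> i)\<^sup>2 \<le> real (card (Sset i)) * sieve_const T1 (1 / T) * real (card I)"
        unfolding \<Sigma>_def Ysum_def by (rule point_sum_second[where \<theta> = ln, OF SX I(1) Tinv lsep lnear])
      also have "\<dots> \<le> real (card (Sset i)) * (p powr (2 * \<kappa>) * real T1) * real (card I)"
        using sv2 by (intro mult_right_mono mult_left_mono) auto
      finally have f2: "(\<Sigma> i)\<^sup>2 \<le> real (card (Sset i)) * (real P powr (2 * \<kappa>) * real T1) * R" by (simp add: R_def p_def)
      have "(\<Sigma> i) ^ 4 \<le> real (card I) ^ 3 * sieve_const (2 * T1) (1 / T) * energy (Sset i)"
        unfolding \<Sigma>_def Ysum_def by (rule point_sum_fourth[where \<theta> = ln, OF SX I(1) Tinv lsep lnear])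
      also have "\<dots> \<le> real (card I) ^ 3 * (p powr (2 * \<kappa>) * real T1) * energy (Sset i)"
        using sv4 energy_nonneg by (intro mult_right_mono mult_left_mono) auto
      finally have f4: "(\<Sigma> i) ^ 4 \<le> R ^ 3 * (real P powr (2 * \<kappa>) * real T1) * energy (Sset i)" by (simp add: R_def p_def)
      have P3: "P \<ge> 3" using P12 by simp
      show False
        using level_set_impossible[OF SX T11 \<kappa> P3 u lv cardA repb two log1 log2' log3' ke R0 as f1 f2 f4 lower upper] .
    qed
    then have "\<Sigma> i < R * p powr (real k * u + c / 2)" by (simp add: p_def)
    then have "\<Sigma> i * p powr (- real k * real i / (2 * real L)) < R * p powr (real k * u + c / 2) * p powr (- real k * real i / (2 * real L))"
      using p0 by (intro mult_strict_right_mono) auto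
    also have "\<dots> = R * p powr (real k * u + c / 2 - real k * real i / (2 * real L))"
      by (simp add: powr_add[symmetric])
    also have "\<dots> \<le> R * p powr (3/4 * c)"
    proof (intro mult_left_mono pmono)
      have kL: "real k / (2 * real L) \<le> c / 4" using cL L0 by (simp add: divide_le_eq)
      have "u \<le> (real i + 1) / (2 * real L)" using L0 by (auto simp: u_def field_simps)
      then have "real k * u \<le> real k * ((real i + 1) / (2 * real L))" by (intro mult_left_mono) auto
      also have "\<dots> = real k * real i / (2 * real L) + real k / (2 * real L)" by (simp add: add_divide_distrib distrib_left)
      finally show "real k * u + c / 2 - real k * real i / (2 * real L) \<le> 3/4 * c" using kL by linarith
    qed (use R0 in simp)
    finally show ?thesis .
  qed
  \<comment> \<open>The grid parameter \<open>2 * T1\<close> exceeds all frequencies, as the bound for \<open>balanced\<close> demands.\<close>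
  have detect: "R * (real P * \<alpha> ^ k)
     \<le> 4 ^ (j + 1) * (\<Sum>t\<in>X. a t ^ k * norm (balanced P (2 * T1) (of_int t)) * Ysum t)"
    unfolding R_def \<alpha>_def X_def T1_def a_def Ysum_def
  proof (rule detection[OF j, where T = T])
    show "M \<ge> 8" by (rule M(3))
    show "2 * (j * M) \<ge> 1" using T11 by (simp add: T1_def)
    have "M \<le> j * M" using j by simp
    then show "2 * M \<le> 2 * (j * M) * P" using P1 by (metis mult.assoc mult_le_mono2 mult_le_mono mult.right_neutral)
    show "T > 0" using T3 by simp
    show "32 * real M * 4 ^ j * (4 * T / real M) ^ (2 * j) \<le> 1"
    proof -
      have M0: "real M > 0" using M by simp
      have "4 * T / real M \<le> 4 * p powr (- \<kappa>)"
      proof -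
        have "T * p powr \<kappa> * p powr (- \<kappa>) \<le> real M * p powr (- \<kappa>)" using M(1) by (intro mult_right_mono) auto
        moreover have "T * p powr \<kappa> * p powr (- \<kappa>) = T" using p0 by (simp add: mult.assoc powr_add[symmetric])
        ultimately have "T \<le> real M * p powr (- \<kappa>)" by simp
        then show ?thesis using M0 by (simp add: divide_le_eq mult_ac)
      qed
      then have "(4 * T / real M) ^ (2 * j) \<le> (4 * p powr (- \<kappa>)) ^ (2 * j)" using T3 by (intro power_mono) auto
      also have "\<dots> = 16 ^ j * p powr (- (2 * \<kappa> * real j))"
      proof -
        have "(p powr (- \<kappa>)) ^ (2 * j) = p powr (- \<kappa> * real (2 * j))" using p0 by (simp add: powr_realpow[symmetric] powr_powr)
        moreover have "- \<kappa> * real (2 * j) = - (2 * \<kappa> * real j)" by simp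
        moreover have "(4::real) ^ (2 * j) = 16 ^ j" by (simp add: power_mult)
        ultimately show ?thesis by (simp only: power_mult_distrib)
      qed
      finally have "32 * real M * 4 ^ j * (4 * T / real M) ^ (2 * j) \<le> 32 * p powr (real k + 3) * 4 ^ j * (16 ^ j * p powr (- (2 * \<kappa> * real j)))"
        using T1M T1k by (intro mult_mono) (auto simp: add.commute)
      also have "\<dots> = (32 * 64 ^ j * p powr (real k + 3)) * p powr (- (2 * \<kappa> * real j))"
        by (simp add: power_mult_distrib[symmetric] mult_ac)
      also have "\<dots> \<le> p powr (2 * \<kappa> * real j) * p powr (- (2 * \<kappa> * real j))"
        using small by (intro mult_right_mono) (auto simp: p_def)
      also have "\<dots> = 1" using p0 by (simp add: powr_minus)
      finally show ?thesis .
    qed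
    show "finite I" by fact
    show "3 * real P ^ (k + 1) \<le> y \<and> y \<le> 8 * real P ^ (k + 1)" if "y \<in> I" for y
      using I(2)[OF that] Y by linarith
    show "1 / T \<le> \<bar>ln (real (q * pp)) - ln y\<bar>" if "y \<in> I" "rep A k q \<noteq> 0" "P < pp" "pp \<le> 9 * P" for y q pp
      by (rule gap[OF that])
  qed
  have "(\<Sum>t\<in>X. a t ^ k * norm (balanced P (2 * T1) (of_int t)) * Ysum t)
     = (\<Sum>i\<le>L. \<Sum>t\<in>Sset i. a t ^ k * norm (balanced P (2 * T1) (of_int t)) * Ysum t)"
    unfolding Sset_def using idxL by (intro sum.group[symmetric]) (auto simp: X_def)
  also have "\<dots> \<le> (\<Sum>i\<le>L. \<alpha> ^ k * p powr (1 - c) * (\<Sigma> i * p powr (- real k * real i / (2 * real L))))"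
  proof (rule sum_mono)
    fix i assume "i \<in> {..L}"
    have "(\<Sum>t\<in>Sset i. a t ^ k * norm (balanced P (2 * T1) (of_int t)) * Ysum t)
       \<le> (\<Sum>t\<in>Sset i. (\<alpha> ^ k * p powr (- real k * real i / (2 * real L))) * p powr (1 - c) * Ysum t)"
    proof (intro sum_mono mult_right_mono mult_mono)
      fix t assume t: "t \<in> Sset i"
      then have ti: "idx t = i" "\<bar>t\<bar> \<le> int T1" by (auto simp: Sset_def X_def)
      have "a t ^ k \<le> (\<alpha> * p powr (- real i / (2 * real L))) ^ k"
        using idxup[of t] ti by (intro power_mono) (auto simp: a_def)
      also have "\<dots> = \<alpha> ^ k * p powr (- real k * real i / (2 * real L))"
      proof -
        have "(p powr (- real i / (2 * real L))) ^ k = p powr (- real i / (2 * real L) * real k)"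
          using p0 by (simp add: powr_realpow[symmetric] powr_powr)
        then show ?thesis by (simp add: power_mult_distrib mult_ac)
      qed
      finally show "a t ^ k \<le> \<alpha> ^ k * p powr (- real k * real i / (2 * real L))" .
      have tr: "\<bar>real_of_int t\<bar> \<le> real T1" using ti(2) by linarith
      show "norm (balanced P (2 * T1) (of_int t)) \<le> p powr (1 - c)"
        unfolding p_def using tr T1k T11 by (intro bal) (auto simp: p_def)
    qed (use alpha0 in \<open>auto simp: Ysum_def\<close>)
    also have "\<dots> = \<alpha> ^ k * p powr (1 - c) * (\<Sigma> i * p powr (- real k * real i / (2 * real L)))"
      by (simp add: \<Sigma>_def sum_distrib_left sum_distrib_right mult_ac)
    finally show "(\<Sum>t\<in>Sset i. a t ^ k * norm (balanced P (2 * T1) (of_int t)) * Ysum t)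
      \<le> \<alpha> ^ k * p powr (1 - c) * (\<Sigma> i * p powr (- real k * real i / (2 * real L)))" .
  qed
  also have "\<dots> < (\<Sum>i\<le>L. \<alpha> ^ k * p powr (1 - c) * (R * p powr (3/4 * c)))"
    using level alpha0 p0 by (intro sum_strict_mono mult_strict_left_mono) auto
  also have "\<dots> = (real L + 1) * (\<alpha> ^ k * p powr (1 - c) * (R * p powr (3/4 * c)))" by (simp add: add.commute)
  finally have tot: "(\<Sum>t\<in>X. a t ^ k * norm (balanced P (2 * T1) (of_int t)) * Ysum t)
     < (real L + 1) * (\<alpha> ^ k * p powr (1 - c) * (R * p powr (3/4 * c)))" .
  have "R * (real P * \<alpha> ^ k) < 4 ^ (j + 1) * ((real L + 1) * (\<alpha> ^ k * p powr (1 - c) * (R * p powr (3/4 * c))))"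
    using detect tot by (meson le_less_trans mult_strict_left_mono zero_less_numeral zero_less_power)
  also have "\<dots> = (4 ^ (j + 1) * (real L + 1)) * (\<alpha> ^ k * R * (p powr (1 - c) * p powr (3/4 * c)))"
    by (simp add: mult_ac)
  also have "\<dots> \<le> p powr (c / 4) * (\<alpha> ^ k * R * (p powr (1 - c) * p powr (3/4 * c)))"
    using levels alpha0 R0 by (intro mult_right_mono) (auto simp: p_def)
  also have "\<dots> = \<alpha> ^ k * R * (p powr (c / 4) * (p powr (1 - c) * p powr (3/4 * c)))"
    by (simp only: mult_ac)
  also have "\<dots> = \<alpha> ^ k * R * p powr (c / 4 + (1 - c) + 3/4 * c)"
    by (simp only: powr_add mult.assoc)
  also have "c / 4 + (1 - c) + 3/4 * c = 1" by simp
  finally show False using p0 by (simp add: p_def mult_ac)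
qed

end

definition factor_range :: "nat \<Rightarrow> nat \<Rightarrow> nat set" where
  "factor_range k P = {P<..nat \<lfloor>(1 + 1 / real k) * real P\<rfloor>}"

lemma factor_range_props:
  assumes "k \<ge> 1" "P \<ge> 1"
  shows "smooth_factors (factor_range k P) P k"
    and "real P / real k - 1 \<le> real (card (factor_range k P))"
proof -
  have nn: "0 \<le> (1 + 1 / real k) * real P" by simp
  show "smooth_factors (factor_range k P) P k"
  proof
    fix a assume a: "a \<in> factor_range k P"
    then show "P < a" by (simp add: factor_range_def)
    have "a \<le> nat \<lfloor>(1 + 1 / real k) * real P\<rfloor>" using a by (simp add: factor_range_def)
    then show "real a \<le> (1 + 1 / real k) * real P" using nn by linarith
  qed (use assms in \<open>auto simp: factor_range_def\<close>)
  have "(1 + 1 / real k) * real P < real (nat \<lfloor>(1 + 1 / real k) * real P\<rfloor>) + 1" using nn by linarith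
  moreover have "(1 + 1 / real k) * real P = real P + real P / real k" by (simp add: algebra_simps)
  moreover have "real (nat \<lfloor>(1 + 1 / real k) * real P\<rfloor>) - real P \<le> real (card (factor_range k P))"
    unfolding factor_range_def card_greaterThanAtMost by linarith
  ultimately show "real P / real k - 1 \<le> real (card (factor_range k P))" by linarith
qed

text \<open>The parameters are chosen in this order: \<open>k\<close> from \<open>e\<close>, the saving \<open>c\<close> from \<open>k\<close>, a much smaller \<open>\<kappa>\<close> for all other losses, the power
\<open>j\<close> of the kernel and the number \<open>L\<close> of levels, and the exponent \<open>\<eta>\<close> of the divisor bound. All remaining conditions hold for large \<open>P\<close>.\<close>

lemma few_separated_gaps:
  fixes e :: real and k0 :: nat
  assumes e: "0 < e" "e \<le> 1"
  shows "\<exists>k\<ge>k0. \<forall>\<^sub>F P in sequentially. \<forall>Y H. \<forall>I::real set.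
     3 * real P ^ (k + 1) \<le> Y \<longrightarrow> Y \<le> 4 * real P ^ (k + 1) \<longrightarrow> Y powr (1/6) \<le> H \<longrightarrow> H \<le> Y \<longrightarrow> finite I \<longrightarrow>
     (\<forall>y\<in>I. Y \<le> y \<and> y \<le> 2 * Y) \<longrightarrow> (\<forall>y\<in>I. \<forall>z\<in>I. y \<noteq> z \<longrightarrow> H \<le> \<bar>y - z\<bar>) \<longrightarrow>
     (\<forall>y\<in>I. \<forall>n. smooth (9 * real P) n \<longrightarrow> H \<le> \<bar>real n - y\<bar>) \<longrightarrow>
     real (card I) * H\<^sup>2 \<le> Y powr (7/6 + e)"
proof -
  define k where "k = max k0 (max 30 (nat \<lceil>300 / e\<rceil>))"
  have k: "k \<ge> k0" "k \<ge> 30" by (auto simp: k_def)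
  have ke: "real k * e \<ge> 300"
  proof -
    have "300 / e \<le> real (nat \<lceil>300 / e\<rceil>)" by linarith
    also have "\<dots> \<le> real k" unfolding of_nat_le_iff k_def by (intro max.coboundedI2 order_refl)
    finally show ?thesis using e by (simp add: divide_le_eq)
  qed
  define K where "K = real k"
  have K: "K > 0" using k by (simp add: K_def)
  obtain c where c: "c > 0" "c \<le> 1/4" and balev: "\<forall>\<^sub>F P in sequentially. \<forall>B t. B > 0 \<longrightarrow> \<bar>t\<bar> \<le> real B \<longrightarrow>
     \<bar>t\<bar> \<le> real P powr real (k + 3) \<longrightarrow> norm (balanced P B t) \<le> real P powr (1 - c)"
    using balanced_bound[of "k + 3"] by blast
  define \<kappa> where "\<kappa> = c / 100"
  have \<kappa>: "\<kappa> > 0" "\<kappa> \<le> 1/400" "100 * \<kappa> \<le> c" using c by (auto simp: \<kappa>_def)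
  define j where "j = nat \<lceil>(real k + 5) / \<kappa>\<rceil>"
  have jk: "real k + 5 \<le> \<kappa> * real j"
  proof -
    have "(real k + 5) / \<kappa> \<le> real j" unfolding j_def by linarith
    then show ?thesis using \<kappa> by (simp add: divide_le_eq mult.commute)
  qed
  have j1: "j \<ge> 1"
  proof (rule ccontr)
    assume "\<not> j \<ge> 1"
    then have "j = 0" by simp
    then show False using jk by simp
  qed
  define L where "L = nat \<lceil>2 * real k / c\<rceil>"
  have Lk: "2 * real k \<le> c * real L"
  proof -
    have "2 * real k / c \<le> real L" unfolding L_def by linarith
    then show ?thesis using c by (simp add: divide_le_eq mult.commute)
  qed
  have L1: "L \<ge> 1"
  proof (rule ccontr)
    assume "\<not> L \<ge> 1"
    then have "L = 0" by simp
    then show False using Lk k by simp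
  qed
  define \<eta> where "\<eta> = \<kappa> / (2 * K * K)"
  have \<eta>: "\<eta> > 0" using \<kappa> K by (simp add: \<eta>_def)
  obtain Cd where Cd: "Cd \<ge> 1" and div: "\<And>n. n > 0 \<Longrightarrow> real (card {d. d dvd n}) \<le> Cd * real n powr \<eta>"
    using divisor_bound[OF \<eta>] by blast
  define Q where "Q = Cd ^ k * (3 powr \<eta>) ^ k"
  have Q: "Q > 0" using Cd by (simp add: Q_def)
  have kk: "\<kappa> / K > 0" using \<kappa> K by simp
  have ev1: "\<forall>\<^sub>F P::nat in sequentially. real P powr (1 - \<kappa> / K) \<le> real P / K - 1"
    using kk K by real_asymp
  have ev2: "\<forall>\<^sub>F P::nat in sequentially. Q * real P powr (\<kappa> / 2) \<le> real P powr \<kappa>"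
    using Q \<kappa>(1) by real_asymp
  have ev3: "\<forall>\<^sub>F P::nat in sequentially. 9 \<le> real P powr \<kappa>"
    using \<kappa>(1) by real_asymp
  have ev4: "\<forall>\<^sub>F P::nat in sequentially. 144 * (1 + ln (1 + 9 * real P powr K)) \<le> real P powr \<kappa>"
    using \<kappa>(1) K by real_asymp
  have ev5: "\<forall>\<^sub>F P::nat in sequentially. 24000 * (1 + ln (2 * real P powr (K + 3))) \<le> real P powr \<kappa>"
    using \<kappa>(1) K by real_asymp
  have ev6: "\<forall>\<^sub>F P::nat in sequentially. 40000000000 * (1 + ln (2 * real P powr (K + 3)) + ln (1 + 27 * (real P powr K)\<^sup>2)) ^ 4 \<le> real P powr \<kappa>"
    using \<kappa>(1) K by real_asymp
  have ev7: "\<forall>\<^sub>F P::nat in sequentially. 16 * (1 + ln (1 + 3 * real P powr (K + 3))) \<le> real P powr \<kappa>"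
    using \<kappa>(1) K by real_asymp
  have ev8: "\<forall>\<^sub>F P::nat in sequentially. 2 * real j \<le> real P powr \<kappa>"
    using \<kappa>(1) by real_asymp
  have ev9: "\<forall>\<^sub>F P::nat in sequentially. 32 * 64 ^ j \<le> real P powr 1"
    by real_asymp
  have ev10: "\<forall>\<^sub>F P::nat in sequentially. 4 ^ (j + 1) * (real L + 1) \<le> real P powr (c / 4)"
    using c(1) by real_asymp
  show ?thesis
  proof (intro exI[of _ k] conjI k(1))
    show "\<forall>\<^sub>F P in sequentially. \<forall>Y H. \<forall>I::real set.
     3 * real P ^ (k + 1) \<le> Y \<longrightarrow> Y \<le> 4 * real P ^ (k + 1) \<longrightarrow> Y powr (1/6) \<le> H \<longrightarrow> H \<le> Y \<longrightarrow> finite I \<longrightarrow>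
     (\<forall>y\<in>I. Y \<le> y \<and> y \<le> 2 * Y) \<longrightarrow> (\<forall>y\<in>I. \<forall>z\<in>I. y \<noteq> z \<longrightarrow> H \<le> \<bar>y - z\<bar>) \<longrightarrow>
     (\<forall>y\<in>I. \<forall>n. smooth (9 * real P) n \<longrightarrow> H \<le> \<bar>real n - y\<bar>) \<longrightarrow>
     real (card I) * H\<^sup>2 \<le> Y powr (7/6 + e)"
      using balev ev1 ev2 ev3 ev4 ev5 ev6 ev7 ev8 ev9 ev10 eventually_ge_at_top[of 12]
    proof eventually_elim
      case (elim P)
      have P: "P \<ge> 12" by (rule elim(12))
      then have p1: "real P > 1" by simp
      have PK: "real P ^ k = real P powr K" using p1 by (simp add: K_def powr_realpow)
      have K3: "real (k + 3) = K + 3" by (simp add: K_def)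
      have kk1: "k \<ge> 1" using k by simp
      have P1: "P \<ge> 1" using P by simp
      interpret smooth_factors "factor_range k P" P k
        by (rule factor_range_props(1)[OF kk1 P1])
      have cardA: "real P powr (1 - \<kappa> / real k) \<le> real (card (factor_range k P))"
        using elim(2) factor_range_props(2)[OF kk1 P1] by (simp add: K_def)
      have repb: "rep (factor_range k P) i n \<le> real P powr \<kappa>"
        if "i \<le> k" "0 < n" "real n \<le> 3 * real P ^ k" for i n
      proof -
        define D where "D = Cd * (3 * real P ^ k) powr \<eta>"
        have "1 \<le> real P ^ k" by (rule one_le_power) (use P1 in simp)
        then have "3 * real P ^ k \<ge> 1" by linarith
        then have "(3 * real P ^ k) powr \<eta> \<ge> 1" using \<eta> by (intro ge_one_powr_ge_zero) auto
        then have D1: "D \<ge> 1" unfolding D_def using Cd mult_mono[of 1 Cd 1 "(3 * real P ^ k) powr \<eta>"] by simp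
        have "rep (factor_range k P) i n \<le> D ^ i"
        proof (rule rep_le[OF A_fin _ D1 that(2,3)])
          fix m :: nat assume m: "0 < m" "real m \<le> 3 * real P ^ k"
          have "real (card {d. d dvd m}) \<le> Cd * real m powr \<eta>" by (rule div[OF m(1)])
          also have "\<dots> \<le> D" unfolding D_def using m \<eta> Cd by (intro mult_left_mono powr_mono2) auto
          finally show "real (card {d. d dvd m}) \<le> D" .
        qed
        also have "\<dots> \<le> D ^ k" by (rule power_increasing[OF that(1) D1])
        also have "D ^ k = Q * (real P powr (K * \<eta>)) ^ k"
          using p1 by (simp add: D_def Q_def PK powr_mult powr_powr power_mult_distrib)
        also have "(real P powr (K * \<eta>)) ^ k = real P powr (K * \<eta> * K)"
        proof -
          have "(real P powr (K * \<eta>)) ^ k = (real P powr (K * \<eta>)) powr K"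
            unfolding K_def by (rule powr_realpow[symmetric]) (use P in auto)
          then show ?thesis by (simp add: powr_powr)
        qed
        also have "K * \<eta> * K = \<kappa> / 2" using K by (simp add: \<eta>_def)
        also have "Q * real P powr (\<kappa> / 2) \<le> real P powr \<kappa>" by (rule elim(3))
        finally show ?thesis .
      qed
      have small: "32 * 64 ^ j * real P powr (real k + 3) \<le> real P powr (2 * \<kappa> * real j)"
      proof -
        have "32 * 64 ^ j * real P powr (real k + 3) \<le> real P powr 1 * real P powr (real k + 3)"
          using elim(10) by (intro mult_right_mono) auto
        also have "\<dots> = real P powr (real k + 4)" unfolding powr_add[symmetric] by (simp add: add.commute)
        also have "\<dots> \<le> real P powr (2 * \<kappa> * real j)"
        proof (rule powr_mono)
          have "0 \<le> \<kappa> * real j" using \<kappa> by simp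
          then show "real k + 4 \<le> 2 * \<kappa> * real j" using jk by simp
        qed (use P in simp)
        finally show ?thesis .
      qed
      show ?case
      proof (intro allI impI)
        fix Y H :: real and I :: "real set"
        assume h: "3 * real P ^ (k + 1) \<le> Y" "Y \<le> 4 * real P ^ (k + 1)" "Y powr (1/6) \<le> H" "H \<le> Y" "finite I"
          "\<forall>y\<in>I. Y \<le> y \<and> y \<le> 2 * Y" "\<forall>y\<in>I. \<forall>z\<in>I. y \<noteq> z \<longrightarrow> H \<le> \<bar>y - z\<bar>"
          "\<forall>y\<in>I. \<forall>n. smooth (9 * real P) n \<longrightarrow> H \<le> \<bar>real n - y\<bar>"
        show "real (card I) * H\<^sup>2 \<le> Y powr (7/6 + e)"
        proof (rule gap_count_core[where \<kappa> = \<kappa> and c = c and j = j and L = L])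
          show "144 * (1 + ln (1 + 9 * real P ^ k)) \<le> real P powr \<kappa>" using elim(5) by (simp only: PK)
          show "24000 * (1 + ln (2 * real P powr real (k + 3))) \<le> real P powr \<kappa>" using elim(6) by (simp only: K3)
          show "40000000000 * (1 + ln (2 * real P powr real (k + 3)) + ln (1 + 27 * (real P ^ k)\<^sup>2)) ^ 4 \<le> real P powr \<kappa>"
            using elim(7) by (simp only: K3 PK)
          show "16 * (1 + ln (1 + 3 * real P powr real (k + 3))) \<le> real P powr \<kappa>" using elim(8) by (simp only: K3)
          show "norm (balanced P B t) \<le> real P powr (1 - c)" if "B > 0" "\<bar>t\<bar> \<le> real B" "\<bar>t\<bar> \<le> real P powr real (k + 3)" for B t
            using elim(1) that by blast
          show "rep (factor_range k P) i n \<le> real P powr \<kappa>" if "i \<le> k" "0 < n" "real n \<le> 3 * real P ^ k" for i n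
            by (rule repb[OF that])
          show "Y \<le> y \<and> y \<le> 2 * Y" if "y \<in> I" for y using h(6) that by blast
          show "H \<le> \<bar>y - z\<bar>" if "y \<in> I" "z \<in> I" "y \<noteq> z" for y z using h(7) that by blast
          show "H \<le> \<bar>real n - y\<bar>" if "y \<in> I" "smooth (9 * real P) n" for y n using h(8) that by blast
        qed (fact \<kappa> k(2) ke e P j1 L1 Lk cardA elim(4) elim(9) small elim(11) h(1-5))+
      qed
    qed
  qed
qed

text \<open>The intervals from \<open>3 * P ^ (k + 1)\<close> to \<open>4 * P ^ (k + 1)\<close> for consecutive \<open>P\<close> overlap when \<open>P\<close> is large, hence cover all large \<open>Y\<close>; and \<open>9 * P \<le> P\<^sup>2 \<le> Y powr e\<close>
because \<open>(k + 1) * e \<ge> 2\<close>.\<close>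

lemma gap_count_bound:
  fixes e :: real
  assumes e: "0 < e" "e \<le> 1"
  shows "\<exists>Y0\<ge>1. \<forall>Y\<ge>Y0. \<forall>H. \<forall>I::real set. Y powr (1/6) \<le> H \<longrightarrow> H \<le> Y \<longrightarrow> finite I \<longrightarrow>
     (\<forall>y\<in>I. Y \<le> y \<and> y \<le> 2 * Y) \<longrightarrow> (\<forall>y\<in>I. \<forall>z\<in>I. y \<noteq> z \<longrightarrow> H \<le> \<bar>y - z\<bar>) \<longrightarrow>
     (\<forall>y\<in>I. \<forall>n. smooth (Y powr e) n \<longrightarrow> H \<le> \<bar>real n - y\<bar>) \<longrightarrow>
     real (card I) * H\<^sup>2 \<le> Y powr (7/6 + e)"
proof -
  obtain k where k: "k \<ge> nat \<lceil>2 / e\<rceil>" and ev: "\<forall>\<^sub>F P in sequentially. \<forall>Y H. \<forall>I::real set.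
     3 * real P ^ (k + 1) \<le> Y \<longrightarrow> Y \<le> 4 * real P ^ (k + 1) \<longrightarrow> Y powr (1/6) \<le> H \<longrightarrow> H \<le> Y \<longrightarrow> finite I \<longrightarrow>
     (\<forall>y\<in>I. Y \<le> y \<and> y \<le> 2 * Y) \<longrightarrow> (\<forall>y\<in>I. \<forall>z\<in>I. y \<noteq> z \<longrightarrow> H \<le> \<bar>y - z\<bar>) \<longrightarrow>
     (\<forall>y\<in>I. \<forall>n. smooth (9 * real P) n \<longrightarrow> H \<le> \<bar>real n - y\<bar>) \<longrightarrow>
     real (card I) * H\<^sup>2 \<le> Y powr (7/6 + e)"
    using few_separated_gaps[OF e, of "nat \<lceil>2 / e\<rceil>"] by blast
  define K where "K = real (k + 1)"
  have K: "K > 0" by (simp add: K_def)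
  have Ke: "2 \<le> K * e"
  proof -
    have "2 / e \<le> real (nat \<lceil>2 / e\<rceil>)" by linarith
    also have "\<dots> \<le> K" using k unfolding K_def of_nat_le_iff by simp
    finally show ?thesis using e by (simp add: divide_le_eq)
  qed
  have ev2: "\<forall>\<^sub>F P::nat in sequentially. (real P + 1) powr K \<le> 4/3 * real P powr K"
    using K by real_asymp
  obtain P0 where P0: "\<And>P. P \<ge> P0 \<Longrightarrow> (real P + 1) powr K \<le> 4/3 * real P powr K"
    using ev2 unfolding eventually_sequentially by blast
  from ev[unfolded eventually_sequentially] obtain P00 where main: "\<forall>P\<ge>P00. \<forall>Y H. \<forall>I::real set.
     3 * real P ^ (k + 1) \<le> Y \<longrightarrow> Y \<le> 4 * real P ^ (k + 1) \<longrightarrow> Y powr (1/6) \<le> H \<longrightarrow> H \<le> Y \<longrightarrow> finite I \<longrightarrow>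
     (\<forall>y\<in>I. Y \<le> y \<and> y \<le> 2 * Y) \<longrightarrow> (\<forall>y\<in>I. \<forall>z\<in>I. y \<noteq> z \<longrightarrow> H \<le> \<bar>y - z\<bar>) \<longrightarrow>
     (\<forall>y\<in>I. \<forall>n. smooth (9 * real P) n \<longrightarrow> H \<le> \<bar>real n - y\<bar>) \<longrightarrow>
     real (card I) * H\<^sup>2 \<le> Y powr (7/6 + e)" ..
  \<comment> \<open>\<open>P \<ge> 9\<close> gives \<open>9 * P \<le> P\<^sup>2\<close>.\<close>
  define P1 where "P1 = max (max P0 P00) 9"
  show ?thesis
  proof (intro exI[of _ "3 * real P1 powr K"] conjI allI impI)
    have "real P1 powr K \<ge> 1" using K by (intro ge_one_powr_ge_zero) (auto simp: P1_def)
    then show "1 \<le> 3 * real P1 powr K" by simp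
    fix Y H :: real and I :: "real set"
    assume Y: "3 * real P1 powr K \<le> Y" and h: "Y powr (1/6) \<le> H" "H \<le> Y" "finite I"
       "\<forall>y\<in>I. Y \<le> y \<and> y \<le> 2 * Y" "\<forall>y\<in>I. \<forall>z\<in>I. y \<noteq> z \<longrightarrow> H \<le> \<bar>y - z\<bar>"
       "\<forall>y\<in>I. \<forall>n. smooth (Y powr e) n \<longrightarrow> H \<le> \<bar>real n - y\<bar>"
    have Y3: "Y \<ge> 3" using Y \<open>real P1 powr K \<ge> 1\<close> by linarith
    define x where "x = (Y / 3) powr (1 / K)"
    have xK: "x powr K = Y / 3" using K Y3 by (simp add: x_def powr_powr)
    have x0: "x \<ge> 0" by (simp add: x_def)
    define P where "P = nat \<lfloor>x\<rfloor>"
    have P: "real P \<le> x" "x < real P + 1" unfolding P_def using x0 by linarith+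
    have "real P1 \<le> x"
    proof (rule ccontr)
      assume "\<not> real P1 \<le> x"
      then have "x powr K < real P1 powr K" using x0 K by (intro powr_less_mono2) auto
      then show False using Y xK by simp
    qed
    then have PP1: "P \<ge> P1" using P by linarith
    have PP0: "P \<ge> P0" "P \<ge> 9" "P \<ge> P00" using PP1 by (auto simp: P1_def)
    have pk: "real P ^ (k + 1) = real P powr K" using PP0 powr_realpow[of "real P" "k + 1"] by (simp add: K_def)
    have lo: "3 * real P ^ (k + 1) \<le> Y"
    proof -
      have "real P powr K \<le> x powr K" using P K by (intro powr_mono2) auto
      then show ?thesis unfolding pk using xK by simp
    qed
    have hi: "Y \<le> 4 * real P ^ (k + 1)"
    proof -
      have "x powr K \<le> (real P + 1) powr K" using P x0 K by (intro powr_mono2) auto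
      also have "\<dots> \<le> 4/3 * real P powr K" by (rule P0[OF PP0(1)])
      finally show ?thesis unfolding pk using xK by simp
    qed
    have "9 * real P \<le> Y powr e"
    proof -
      have "9 * real P \<le> real P * real P" using PP0 by (intro mult_right_mono) auto
      also have "\<dots> = real P powr 2" using PP0 by (simp add: powr_numeral power2_eq_square)
      also have "\<dots> \<le> real P powr (K * e)" using PP0 Ke by (intro powr_mono) auto
      also have "\<dots> = (real P powr K) powr e" by (simp add: powr_powr)
      also have "\<dots> \<le> Y powr e"
      proof (rule powr_mono2)
        have "0 \<le> real P powr K" by simp
        then show "real P powr K \<le> Y" using lo unfolding pk by linarith
      qed (use e in auto)
      finally show ?thesis .
    qed
    then have "\<forall>y\<in>I. \<forall>n. smooth (9 * real P) n \<longrightarrow> H \<le> \<bar>real n - y\<bar>"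
      using h(6) unfolding smooth_def by (meson order_trans)
    then show "real (card I) * H\<^sup>2 \<le> Y powr (7/6 + e)"
      using main[rule_format, OF PP0(3) lo hi h(1-3)] h(4,5) by blast
  qed
qed

section \<open>Summation over all gaps\<close>

lemma separated_card_le:
  fixes I :: "real set"
  assumes "finite I" "\<And>y. y \<in> I \<Longrightarrow> Y \<le> y \<and> y \<le> 2 * Y" "0 < H" "0 \<le> Y"
    and sep: "\<And>y z. y \<in> I \<Longrightarrow> z \<in> I \<Longrightarrow> y \<noteq> z \<Longrightarrow> H \<le> \<bar>y - z\<bar>"
  shows "real (card I) \<le> Y / H + 1"
proof -
  define m where "m y = nat \<lfloor>(y - Y) / H\<rfloor>" for y
  have inj: "inj_on m I"
  proof (rule inj_onI, rule ccontr)
    fix y z assume yz: "y \<in> I" "z \<in> I" "m y = m z" "y \<noteq> z"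
    have "0 \<le> (y - Y) / H" "0 \<le> (z - Y) / H" using assms yz by auto
    then have "\<lfloor>(y - Y) / H\<rfloor> = \<lfloor>(z - Y) / H\<rfloor>" using yz(3) by (simp add: m_def nat_eq_iff)
    then have "\<bar>(y - Y) / H - (z - Y) / H\<bar> < 1" by linarith
    moreover have "(y - Y) / H - (z - Y) / H = (y - z) / H" by (simp add: diff_divide_distrib)
    ultimately have "\<bar>y - z\<bar> < H" using assms(3) by (simp add: abs_divide divide_less_eq)
    then show False using sep[OF yz(1,2,4)] by simp
  qed
  have "m ` I \<subseteq> {..nat \<lfloor>Y / H\<rfloor>}"
  proof
    fix n assume "n \<in> m ` I"
    then obtain y where y: "y \<in> I" "n = m y" by blast
    have "(y - Y) / H \<le> Y / H" using assms(2)[OF y(1)] assms(3) by (intro divide_right_mono) auto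
    then show "n \<in> {..nat \<lfloor>Y / H\<rfloor>}" unfolding y(2) m_def by (auto intro!: nat_mono floor_mono)
  qed
  then have "card (m ` I) \<le> card {..nat \<lfloor>Y / H\<rfloor>}" by (intro card_mono) auto
  then have "card I \<le> nat \<lfloor>Y / H\<rfloor> + 1" using card_image[OF inj] by simp
  moreover have "0 \<le> Y / H" using assms by simp
  ultimately show ?thesis by linarith
qed

lemma smooth_power_2:
  assumes "y \<ge> 2"
  shows "smooth y (2 ^ n)"
  unfolding smooth_def
proof (intro conjI allI impI)
  fix p :: nat assume "prime p \<and> p dvd 2 ^ n"
  then have "p dvd 2" using prime_dvd_power by blast
  then have "p \<le> 2" by (rule dvd_imp_le) simp
  then show "real p \<le> y" using assms by linarith
qed simp

lemma infinite_smooth: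
  assumes "y \<ge> 2"
  shows "infinite {n. smooth y n}"
proof -
  have "range (\<lambda>n. 2 ^ n :: nat) \<subseteq> {n. smooth y n}" using smooth_power_2[OF assms] by auto
  moreover have "infinite (range (\<lambda>n. 2 ^ n :: nat))" by (intro range_inj_infinite) (auto simp: inj_on_def)
  ultimately show ?thesis by (rule infinite_super)
qed

lemma smooth_mult: "smooth y a \<Longrightarrow> smooth y b \<Longrightarrow> smooth y (a * b)"
  unfolding smooth_def by (auto dest: prime_dvd_multD)

context
  fixes y :: real
  assumes y2: "y \<ge> 2"
begin

lemma smooth_seq_smooth: "smooth y (smooth_seq y n)"
  using enumerate_in_set[OF infinite_smooth[OF y2]] by (auto simp: smooth_seq_def)

lemma smooth_seq_less: "m < n \<Longrightarrow> smooth_seq y m < smooth_seq y n"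
  using enumerate_mono[OF _ infinite_smooth[OF y2]] by (auto simp: smooth_seq_def)

lemma smooth_seq_gap: "smooth y s \<Longrightarrow> s \<le> smooth_seq y n \<or> smooth_seq y (Suc n) \<le> s"
proof -
  assume "smooth y s"
  then obtain i where i: "s = smooth_seq y i"
    using enumerate_Ex[OF infinite_smooth[OF y2], of s] by (auto simp: smooth_seq_def)
  show ?thesis
  proof (cases "i \<le> n")
    case True
    then show ?thesis using smooth_seq_less[of i n] i by (cases "i = n") auto
  next
    case False
    then show ?thesis using smooth_seq_less[of "Suc n" i] i by (cases "i = Suc n") auto
  qed
qed

lemma smooth_seq_ge: "n < smooth_seq y n"
proof (induction n)
  case 0
  then show ?case using smooth_seq_smooth[of 0] by (simp add: smooth_def)
next
  case (Suc n)
  then show ?case using smooth_seq_less[of n "Suc n"] by simp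
qed

text \<open>Twice a smooth number is smooth, so a gap is never longer than the number at which it starts.\<close>

lemma smooth_seq_Suc_le: "smooth_seq y (Suc n) \<le> 2 * smooth_seq y n"
proof -
  have "smooth y (2 * smooth_seq y n)" using smooth_mult[OF smooth_power_2[OF y2, of 1] smooth_seq_smooth] by simp
  then show ?thesis using smooth_seq_gap[of "2 * smooth_seq y n" n] smooth_seq_ge[of n] by auto
qed

end

lemma floor_log_bounds:
  fixes v :: real
  assumes "v \<ge> 1"
  shows "2 ^ nat \<lfloor>log 2 v\<rfloor> \<le> v" "v < 2 * 2 ^ nat \<lfloor>log 2 v\<rfloor>"
proof -
  have l0: "0 \<le> log 2 v" using assms by simp
  define n where "n = nat \<lfloor>log 2 v\<rfloor>"
  have n: "real n \<le> log 2 v" "log 2 v < real n + 1" unfolding n_def using l0 by linarith+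
  have vv: "2 powr (log 2 v) = v" using assms by simp
  have "2 powr real n \<le> 2 powr (log 2 v)" using n by simp
  then show "2 ^ nat \<lfloor>log 2 v\<rfloor> \<le> v" using assms by (simp only: powr_realpow n_def[symmetric] vv zero_less_numeral)
  have "2 powr (log 2 v) < 2 powr (real n + 1)" using n by simp
  then have "v < 2 powr real n * 2 powr 1" by (simp only: vv powr_add)
  then show "v < 2 * 2 ^ nat \<lfloor>log 2 v\<rfloor>" by (simp add: powr_realpow n_def[symmetric])
qed

text \<open>Gaps are sorted by the binary orders of magnitude of their midpoint \<open>m n\<close> and of their length \<open>g n\<close>. In one
class the midpoints are separated by at least the least length \<open>2 * H\<close>, and the distance from them to any smooth number is at
least \<open>H\<close>, so \<open>gap_count_bound\<close> applies with \<open>e \<le> \<epsilon> / 2\<close>. As \<open>Y \<le> 2 * x \<le> x\<^sup>2\<close>, numbers that are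
\<open>Y powr e\<close>-smooth are \<open>x powr \<epsilon>\<close>-smooth. Half of \<open>\<epsilon>\<close> is left for the number of classes, of order
\<open>(ln x)\<^sup>2\<close>, and for the constants. For lengths below \<open>Y powr (1/6)\<close> the number of separated points in an interval is bound enough.\<close>

theorem theorem3:
  fixes \<epsilon> :: real
  assumes "\<epsilon> > 0"
  shows "\<exists>C > 0. \<exists>x0 :: real. \<forall>x \<ge> x0.
    (\<Sum>n \<in> {n. real (smooth_seq (x powr \<epsilon>) n) \<le> x}.
        (real (smooth_seq (x powr \<epsilon>) (Suc n)) - real (smooth_seq (x powr \<epsilon>) n))\<^sup>2)
      \<le> C * x powr (7 / 6 + \<epsilon>)"
proof -
  define e where "e = min 1 \<epsilon> / 2"
  have e: "0 < e" "e \<le> 1" "e + e \<le> \<epsilon>" using assms by (auto simp: e_def)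
  obtain Y0 where Y0: "Y0 \<ge> 1" and main: "\<forall>Y\<ge>Y0. \<forall>H. \<forall>I::real set. Y powr (1/6) \<le> H \<longrightarrow> H \<le> Y \<longrightarrow> finite I \<longrightarrow>
     (\<forall>y\<in>I. Y \<le> y \<and> y \<le> 2 * Y) \<longrightarrow> (\<forall>y\<in>I. \<forall>z\<in>I. y \<noteq> z \<longrightarrow> H \<le> \<bar>y - z\<bar>) \<longrightarrow>
     (\<forall>y\<in>I. \<forall>n. smooth (Y powr e) n \<longrightarrow> H \<le> \<bar>real n - y\<bar>) \<longrightarrow>
     real (card I) * H\<^sup>2 \<le> Y powr (7/6 + e)"
    using gap_count_bound[OF e(1,2)] by (elim exE conjE)
  have ev1: "\<forall>\<^sub>F x::real in at_top. (log 2 (4 * x))\<^sup>2 * (32 * ((2 * x) powr (7/6 + e) + Y0\<^sup>2)) \<le> x powr (7/6 + (e + e))"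
    using e(1) Y0 by real_asymp
  have ev2: "\<forall>\<^sub>F x::real in at_top. x powr \<epsilon> \<ge> 2" using assms by real_asymp
  have ev3: "\<forall>\<^sub>F x::real in at_top. x \<ge> 2" by (rule eventually_ge_at_top)
  obtain x0 where x0: "\<And>x. x \<ge> x0 \<Longrightarrow> (log 2 (4 * x))\<^sup>2 * (32 * ((2 * x) powr (7/6 + e) + Y0\<^sup>2)) \<le> x powr (7/6 + (e + e)) \<and> x powr \<epsilon> \<ge> 2 \<and> x \<ge> 2"
    using eventually_conj[OF ev1 eventually_conj[OF ev2 ev3]] unfolding eventually_at_top_linorder by blast
  show ?thesis
  proof (rule exI[of _ 1], rule conjI, simp, rule exI[of _ x0], intro allI impI)
    fix x assume "x \<ge> x0"
    then have x: "(log 2 (4 * x))\<^sup>2 * (32 * ((2 * x) powr (7/6 + e) + Y0\<^sup>2)) \<le> x powr (7/6 + (e + e))" "x powr \<epsilon> \<ge> 2" "x \<ge> 2"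
      using x0 by auto
    define a where "a n = smooth_seq (x powr \<epsilon>) n" for n
    define g where "g n = real (a (Suc n)) - real (a n)" for n
    define m where "m n = (real (a n) + real (a (Suc n))) / 2" for n
    define G where "G = {n. real (a n) \<le> x}"
    have alt: "a i < a j" if "i < j" for i j unfolding a_def by (rule smooth_seq_less[OF x(2) that])
    have ale: "a i \<le> a j" if "i \<le> j" for i j using alt[of i j] that by (cases "i = j") auto
    have age: "n < a n" for n unfolding a_def by (rule smooth_seq_ge[OF x(2)])
    have asuc: "a (Suc n) \<le> 2 * a n" for n unfolding a_def by (rule smooth_seq_Suc_le[OF x(2)])
    have g1: "g n \<ge> 1" for n
    proof -
      have "a n + 1 \<le> a (Suc n)" using alt[of n "Suc n"] by simp
      then show ?thesis unfolding g_def by linarith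
    qed
    have ga: "g n \<le> real (a n)" for n
    proof -
      have "real (a (Suc n)) \<le> real (2 * a n)" using asuc by (simp only: of_nat_le_iff)
      then show ?thesis by (simp add: g_def)
    qed
    have mg: "m n = real (a n) + g n / 2" "m n = real (a (Suc n)) - g n / 2" for n
      by (simp_all add: m_def g_def field_simps)
    have m1: "m n \<ge> 1" for n using age[of n] g1[of n] unfolding mg(1) by linarith
    have finG: "finite G"
    proof (rule finite_subset)
      show "G \<subseteq> {..nat \<lfloor>x\<rfloor>}"
      proof
        fix n assume "n \<in> G"
        then have "real (a n) \<le> x" by (simp add: G_def)
        then have "real n \<le> x" using age[of n] by linarith
        then show "n \<in> {..nat \<lfloor>x\<rfloor>}" by (simp add: le_nat_floor)
      qed
    qed simp
    define N where "N = nat \<lfloor>log 2 (2 * x)\<rfloor>"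
    define cls where "cls n = (nat \<lfloor>log 2 (m n)\<rfloor>, nat \<lfloor>log 2 (g n)\<rfloor>)" for n
    have cls_in: "cls ` G \<subseteq> {..N} \<times> {..N}"
    proof (rule image_subsetI)
      fix n assume n: "n \<in> G"
      have an: "real (a n) \<le> x" using n by (simp add: G_def)
      have "g n \<le> 2 * x" "m n \<le> 2 * x" using ga[of n] an x(3) g1[of n] unfolding mg(1) by linarith+
      then have "log 2 (g n) \<le> log 2 (2 * x)" "log 2 (m n) \<le> log 2 (2 * x)" using g1[of n] m1[of n] x(3) by auto
      then show "cls n \<in> {..N} \<times> {..N}" unfolding cls_def N_def by (auto intro!: nat_mono floor_mono)
    qed
    have class_bound: "(\<Sum>n\<in>{n\<in>G. cls n = (i, h)}. (g n)\<^sup>2) \<le> 32 * ((2 * x) powr (7/6 + e) + Y0\<^sup>2)" for i h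
    proof (cases "{n\<in>G. cls n = (i, h)} = {}")
      case True
      show ?thesis unfolding True by simp
    next
      case False
      define F where "F = {n\<in>G. cls n = (i, h)}"
      define Y where "Y = (2::real) ^ i"
      define H where "H = (2::real) ^ h / 2"
      have finF: "finite F" using finG by (simp add: F_def)
      have Fm: "Y \<le> m n" "m n \<le> 2 * Y" "2 * H \<le> g n" "g n \<le> 4 * H" "real (a n) \<le> x" if "n \<in> F" for n
      proof -
        have c: "nat \<lfloor>log 2 (m n)\<rfloor> = i" "nat \<lfloor>log 2 (g n)\<rfloor> = h" using that by (auto simp: F_def cls_def)
        show "Y \<le> m n" "m n \<le> 2 * Y" using floor_log_bounds[OF m1[of n]] unfolding c Y_def by auto
        show "2 * H \<le> g n" "g n \<le> 4 * H" using floor_log_bounds[OF g1[of n]] unfolding c H_def by auto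
        show "real (a n) \<le> x" using that by (simp add: F_def G_def)
      qed
      have H0: "H > 0" "H \<ge> 1/2" by (simp_all add: H_def)
      have Y1: "Y \<ge> 1" by (simp add: Y_def)
      obtain n0 where n0: "n0 \<in> F" using False by (auto simp: F_def)
      have HY: "H \<le> Y"
      proof -
        have "2 * H \<le> real (a n0)" using Fm(3)[OF n0] ga[of n0] by linarith
        also have "\<dots> \<le> m n0" using g1[of n0] unfolding mg(1) by linarith
        also have "\<dots> \<le> 2 * Y" by (rule Fm(2)[OF n0])
        finally show ?thesis by simp
      qed
      have Yx: "Y \<le> 2 * x"
      proof -
        have "Y \<le> m n0" by (rule Fm(1)[OF n0])
        also have "\<dots> \<le> 2 * x" using ga[of n0] Fm(5)[OF n0] x(3) unfolding mg(1) by linarith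
        finally show ?thesis .
      qed
      have sepm: "2 * H \<le> m n' - m n" if "n \<in> F" "n' \<in> F" "n < n'" for n n'
      proof -
        have "real (a (Suc n)) \<le> real (a n')" using ale[of "Suc n" n'] that by simp
        then have "m n + g n / 2 + g n' / 2 \<le> m n'" using mg(2)[of n] mg(1)[of n'] by linarith
        then show ?thesis using Fm(3)[OF that(1)] Fm(3)[OF that(2)] by linarith
      qed
      have injm: "inj_on m F"
      proof (rule inj_onI, rule ccontr)
        fix n n' assume "n \<in> F" "n' \<in> F" "m n = m n'" "n \<noteq> n'"
        then show False using sepm[of n n'] sepm[of n' n] H0 by (cases "n < n'") auto
      qed
      define I where "I = m ` F"
      have I: "finite I" "card I = card F" using finF card_image[OF injm] by (auto simp: I_def)
      have Irange: "\<forall>y\<in>I. Y \<le> y \<and> y \<le> 2 * Y" using Fm by (auto simp: I_def)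
      have Isep: "\<forall>y\<in>I. \<forall>z\<in>I. y \<noteq> z \<longrightarrow> H \<le> \<bar>y - z\<bar>"
      proof (intro ballI impI)
        fix y z assume yz: "y \<in> I" "z \<in> I" "y \<noteq> z"
        then obtain n n' where n: "n \<in> F" "n' \<in> F" "y = m n" "z = m n'" by (auto simp: I_def)
        then have "n \<noteq> n'" using yz by auto
        then consider "n < n'" | "n' < n" by linarith
        then show "H \<le> \<bar>y - z\<bar>"
        proof cases
          case 1
          then show ?thesis using sepm[OF n(1,2)] n H0 by linarith
        next
          case 2
          then show ?thesis using sepm[OF n(2,1)] n H0 by linarith
        qed
      qed
      have Ifree: "\<forall>y\<in>I. \<forall>s. smooth (Y powr e) s \<longrightarrow> H \<le> \<bar>real s - y\<bar>"
      proof (intro ballI allI impI)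
        fix y s assume y: "y \<in> I" and s: "smooth (Y powr e) s"
        obtain n where n: "n \<in> F" "y = m n" using y by (auto simp: I_def)
        have "Y powr e \<le> x powr \<epsilon>"
        proof -
          have "Y \<le> x * x" using Yx x(3) mult_right_mono[of 2 x x] by linarith
          then have "Y powr e \<le> (x * x) powr e" using Y1 e by (intro powr_mono2) auto
          also have "\<dots> = x powr e * x powr e" using x(3) by (simp add: powr_mult)
          also have "\<dots> = x powr (e + e)" by (simp only: powr_add)
          also have "\<dots> \<le> x powr \<epsilon>" using x(3) e by (intro powr_mono) auto
          finally show ?thesis .
        qed
        then have "smooth (x powr \<epsilon>) s" using s by (auto simp: smooth_def intro: order_trans)
        then have "s \<le> a n \<or> a (Suc n) \<le> s" unfolding a_def by (rule smooth_seq_gap[OF x(2)])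
        then have "real s \<le> real (a n) \<or> real (a (Suc n)) \<le> real s" by (simp only: of_nat_le_iff)
        then have "g n / 2 \<le> \<bar>real s - y\<bar>" using mg(1)[of n] mg(2)[of n] n(2) by linarith
        then show "H \<le> \<bar>real s - y\<bar>" using Fm(3)[OF n(1)] by linarith
      qed
      have trivial: "real (card I) * H\<^sup>2 \<le> 2 * (Y * H)"
      proof -
        have "real (card I) \<le> Y / H + 1"
          using Irange Isep I(1) H0 Y1 by (intro separated_card_le) auto
        then have "real (card I) * H\<^sup>2 \<le> (Y / H + 1) * H\<^sup>2" by (intro mult_right_mono) auto
        also have "\<dots> = Y * H + H * H" using H0 by (simp add: power2_eq_square distrib_right)
        also have "\<dots> \<le> Y * H + Y * H" using HY H0 by (intro add_left_mono mult_right_mono) auto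
        finally show ?thesis by linarith
      qed
      have bound: "real (card I) * H\<^sup>2 \<le> 2 * ((2 * x) powr (7/6 + e) + Y0\<^sup>2)"
      proof -
        have big: "Y powr (7/6 + e) \<le> (2 * x) powr (7/6 + e)" using Yx Y1 e by (intro powr_mono2) auto
        define S where "S = (2 * x) powr (7/6 + e) + Y0\<^sup>2"
        have nn: "Y0\<^sup>2 \<le> S" "(2 * x) powr (7/6 + e) \<le> S" "0 \<le> S" by (auto simp: S_def)
        have "real (card I) * H\<^sup>2 \<le> 2 * S"
        proof -
          have triv: ?thesis if "Y * H \<le> S"
            using order_trans[OF trivial, of "2 * S"] that by linarith
          consider "Y < Y0" | "Y \<ge> Y0" "Y powr (1/6) \<le> H" | "Y \<ge> Y0" "H < Y powr (1/6)" by linarith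
          then show ?thesis
          proof cases
            case 1
            have "Y * H \<le> Y0 * Y0" using 1 HY H0 Y1 by (intro mult_mono) auto
            then have "Y * H \<le> S" using nn(1) unfolding power2_eq_square by linarith
            then show ?thesis by (rule triv)
          next
            case 2
            have "real (card I) * H\<^sup>2 \<le> Y powr (7/6 + e)"
              using main 2 HY I(1) Irange Isep Ifree by blast
            then show ?thesis using big nn by linarith
          next
            case 3
            have "Y * H \<le> Y * Y powr (1/6)" using 3 Y1 by (intro mult_left_mono) auto
            also have "\<dots> = Y powr (1 + 1/6)" using Y1 powr_add[of Y 1 "1/6"] by simp
            also have "\<dots> \<le> Y powr (7/6 + e)" using Y1 e by (intro powr_mono) auto
            also have "\<dots> \<le> S" using big nn(2) by linarith
            finally show ?thesis by (rule triv)
          qed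
        qed
        then show ?thesis by (simp only: S_def)
      qed
      have "(\<Sum>n\<in>F. (g n)\<^sup>2) \<le> (\<Sum>n\<in>F. (4 * H)\<^sup>2)"
      proof (intro sum_mono power_mono)
        fix n assume n: "n \<in> F"
        show "g n \<le> 4 * H" by (rule Fm(4)[OF n])
        show "0 \<le> g n" using g1[of n] by linarith
      qed
      also have "\<dots> = 16 * (real (card I) * H\<^sup>2)" by (simp add: I(2) power_mult_distrib)
      also have "\<dots> \<le> 16 * (2 * ((2 * x) powr (7/6 + e) + Y0\<^sup>2))" using bound by (intro mult_left_mono) auto
      finally show ?thesis by (simp add: F_def)
    qed
    have "(\<Sum>n\<in>G. (g n)\<^sup>2) = (\<Sum>ih\<in>{..N} \<times> {..N}. \<Sum>n\<in>{n\<in>G. cls n = ih}. (g n)\<^sup>2)"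
      using finG cls_in by (intro sum.group[symmetric]) auto
    also have "\<dots> \<le> (\<Sum>ih\<in>{..N} \<times> {..N}. 32 * ((2 * x) powr (7/6 + e) + Y0\<^sup>2))"
    proof (rule sum_mono)
      fix ih :: "nat \<times> nat"
      obtain i h where "ih = (i, h)" by fastforce
      then show "(\<Sum>n\<in>{n\<in>G. cls n = ih}. (g n)\<^sup>2) \<le> 32 * ((2 * x) powr (7/6 + e) + Y0\<^sup>2)" using class_bound by simp
    qed
    also have "\<dots> = (real (N + 1))\<^sup>2 * (32 * ((2 * x) powr (7/6 + e) + Y0\<^sup>2))"
      unfolding sum_constant card_cartesian_product card_atMost by (simp only: of_nat_mult power2_eq_square Suc_eq_plus1)
    also have "\<dots> \<le> (log 2 (4 * x))\<^sup>2 * (32 * ((2 * x) powr (7/6 + e) + Y0\<^sup>2))"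
    proof (intro mult_right_mono power_mono)
      have "0 \<le> log 2 (2 * x)" using x(3) by simp
      then have "real N \<le> log 2 (2 * x)" unfolding N_def by linarith
      moreover have "log 2 (4 * x) = 1 + log 2 (2 * x)"
      proof -
        have "log 2 (4 * x) = log 2 (2 * (2 * x))" by simp
        also have "\<dots> = log 2 2 + log 2 (2 * x)" using x(3) by (intro log_mult_pos) auto
        finally show ?thesis by simp
      qed
      ultimately show "real (N + 1) \<le> log 2 (4 * x)" by simp
    qed auto
    also have "\<dots> \<le> x powr (7/6 + (e + e))" by (rule x(1))
    also have "\<dots> \<le> x powr (7/6 + \<epsilon>)" using x(3) e by (intro powr_mono) auto
    finally show "(\<Sum>n \<in> {n. real (smooth_seq (x powr \<epsilon>) n) \<le> x}.
        (real (smooth_seq (x powr \<epsilon>) (Suc n)) - real (smooth_seq (x powr \<epsilon>) n))\<^sup>2)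
      \<le> 1 * x powr (7 / 6 + \<epsilon>)"
      by (simp add: G_def g_def a_def)
  qed
qed

end
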